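(* Let $t$ be a coherent totally symmetric strict infinitesimal 2-braiding on a symmetric strict monoidal cochain 2-category $(\mathbf C,\otimes,\gamma)$. Let $\sigma=\gamma e^{i\pi t}$, $\alpha=\Phi(t_{12},t_{23})$, and let $\mathcal H^R$, $\mathcal H^L$ be the hexagonator series defined in the context from the right pre-hexagonator series $\mathbf R$. Then the Breen polytope axiom holds: for all objects $U,V,W$ of $\mathbf C$, $$\begin{aligned}&\mathcal H^L_{UWV}\,\alpha^{-1}_{UWV}(1_U\otimes\sigma_{VW})\alpha_{UVW}+\alpha_{WVU}\,\sigma_{1_U\boxtimes\sigma_{VW}}\,\alpha_{UVW}-\alpha_{WVU}(\sigma_{VW}\otimes1_U)\alpha^{-1}_{VWU}\,\mathcal H^L_{UVW}\\&\quad=(1_W\otimes\sigma_{UV})\alpha_{WUV}\,\mathcal H^R_{UVW}\,\alpha_{UVW}-\sigma_{\sigma_{UV}\boxtimes1_W}-\alpha_{WVU}\,\mathcal H^R_{VUW}\,\alpha_{VUW}(\sigma_{UV}\otimes1_W).\end{aligned}$$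
   Context: **2-categorical setting.** $R$ is a commutative associative unital $\mathbb C$-algebra. A cochain 2-category $\mathbf C$ is a category enriched in cochain complexes of $R$-modules concentrated in degrees $-1,0$ (tensor products truncated, so two degree $-1$ elements compose to $0$ and $(\partial k')k=k'(\partial k)$); $\mathbf C[U,U']$ is the hom-complex with differential $\partial$. Functors are enriched functors; $\mathbf C\boxtimes\mathbf C$ has pairs of objects and (truncated) tensor products of hom-complexes. A pseudonatural transformation $\xi:F\Rightarrow G:\mathbf C\to\mathbf D$ consists of $\xi_U\in\mathbf D[FU,GU]^0$ and $R$-linear maps $\xi_{(-)}:\mathbf C[U,U']^0\to\mathbf D[FU,GU']^{-1}$ with $G(f)\xi_U-\xi_{U'}F(f)=\partial\xi_f$ for $f$ of degree $0$, $G(k)\xi_U-\xi_{U'}F(k)=\xi_{\partial k}$ for $k$ of degree $-1$, and $\xi_{f'f}=\xi_{f'}F(f)+G(f')\xi_f$. Vertical composite: $(\theta\xi)_U=\theta_U\xi_U$, $(\theta\xi)_f=\theta_f\xi_U+\theta_{U'}\xi_f$. A modification $\Xi:\xi\Rrightarrow\xi'$ is a family $\Xi_U\in\mathbf D[FU,GU]^{-1}$ with $\partial\Xi_U=\xi_U-\xi'_U$ and $\Xi_{U'}F(f)+\xi_f=\xi'_f+G(f)\Xi_U$. Sums and scalar multiples are componentwise; whiskering is $(\theta\Xi)_U=\theta_U\Xi_U$, $(\Xi\theta)_U=\Xi_U\theta_U$. A symmetric strict monoidal cochain 2-category has a strictly associative and unital enriched functor $\otimes:\mathbf C\boxtimes\mathbf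 C\to\mathbf C$ and a strictly natural symmetry $\gamma_{UV}:U\otimes V\to V\otimes U$ (zero homotopy components), $\gamma_{VU}\gamma_{UV}=1$, satisfying the hexagon axiom. An infinitesimal 2-braiding is a pseudonatural transformation $t:\otimes\Rightarrow\otimes$. On $\otimes^2:\mathbf C^{\boxtimes3}\to\mathbf C$, $(U,V,W)\mapsto U\otimes V\otimes W$, it induces pseudonatural endomorphisms with components $t_{12}=t_{UV}\otimes1_W$, $t_{23}=1_U\otimes t_{VW}$, $t_{(12)3}=t_{U\otimes V,W}$, $t_{1(23)}=t_{U,V\otimes W}$, $t_{13}=(\gamma_{VU}\otimes1_W)(1_V\otimes t_{UW})(\gamma_{UV}\otimes1_W)$ (with the evident homotopy components). $t$ is strict if $t_{1(23)}=t_{12}+t_{13}$ and $t_{(12)3}=t_{23}+t_{13}$ as pseudonatural transformations; symmetric if $t_{UV}=\gamma_{VU}t_{VU}\gamma_{UV}$ as pseudonatural transformations (then put $t_{ji}=t_{ij}$); totally symmetric if symmetric and $t_{\gamma_{UV}\boxtimes1_W}=0$ for all $U,V,W$. The 4-term relationators are the modifications $\mathcal L:[t_{12},t_{(12)3}]\Rrightarrow0$ and $\mathcal R:[t_{23},t_{1(23)}]\Rrightarrow0$ with components $\mathcal L_{UVW}=t_{t_{UV}\boxtimes1_W}$, $\mathcal R_{UVW}=t_{1_U\boxtimes t_{VW}}$. $t$ is coherent if $-\mathcal R_{213}=\mathcal L+\mathcal R=-\mathcal L_{132}$, where $(\mathcal R_{213})_{UVW}=(\gamma_{VU}\otimes1_W)\mathcal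 R_{VUW}(\gamma_{UV}\otimes1_W)$ and $(\mathcal L_{132})_{UVW}=(1_U\otimes\gamma_{WV})\mathcal L_{UWV}(1_U\otimes\gamma_{VW})$. **Formal setting.** Everything is extended to formal power series in $\hbar$; $t,t_{ij},t_{(12)3},\dots$ stand for $\hbar t,\hbar t_{ij},\hbar t_{(12)3},\dots$ and $\mathcal L,\mathcal R$ for $\hbar^2\mathcal L,\hbar^2\mathcal R$. Put $\Lambda=t_{12}+t_{23}+t_{13}$ and $\varepsilon^X=\exp(\ln(\varepsilon)X)$. Limits are taken coefficientwise in $\hbar$: each coefficient is a finite linear combination, with $\varepsilon$-dependent complex scalars, of fixed words in the $t$'s, $\mathcal L$, $\mathcal R$. **2-connection and 2-holonomy.** On $(\mathbb C\setminus\{0,1\})\times\mathbb C^\times$ with coordinates $(z,v)$ take $\nabla=\big(\frac{t_{12}}z+\frac{t_{23}}{z-1}\big)dz+\frac{\Lambda}{v}dv$ and $\Delta=2\big(\frac{\mathcal L}{zv}+\frac{\mathcal R}{(z-1)v}\big)dz\wedge dv$, with $(dz\wedge dv)[X,Y]=\frac12(dz(X)dv(Y)-dz(Y)dv(X))$, so $\Delta[X,Y]=\frac1v\big(\frac{\mathcal L}z+\frac{\mathcal R}{z-1}\big)(dz(X)dv(Y)-dz(Y)dv(X))$. For a continuous piecewise smooth path $p$, $W^p_{rr'}$ solves $\partial_rW^p_{rr'}=\nabla[p'(r)]W^p_{rr'}$, $W^p_{r'r'}=1$, and $W^p:=W^p_{10}$. $qp$ means first $p$, then $q$. For a path $c$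 in $\mathbb C\setminus\{0,1\}$, ${}^{\Gamma(A,B)}W^c$ is the parallel transport of $\Gamma(A,B)=\big(\frac Az+\frac B{z-1}\big)dz$, and $W^c:={}^{\Gamma(t_{12},t_{23})}W^c$. A 2-path $\mathcal P:p\Rightarrow p'$ is a continuous piecewise smooth map $\mathcal P(s,r)$ on $[0,1]^2$ with $\mathcal P(0,\cdot)=p$, $\mathcal P(1,\cdot)=p'$ and $\mathcal P(\cdot,0),\mathcal P(\cdot,1)$ constant; $\mathcal P^s=\mathcal P(s,\cdot)$. Its 2-holonomy is $W^{\mathcal P}=\int_0^1\int_0^1W^{\mathcal P^s}_{1r}\Delta[\partial_s\mathcal P,\partial_r\mathcal P]W^{\mathcal P^s}_{r0}\,dr\,ds:W^p\Rrightarrow W^{p'}$. **Associator and braiding.** $c_{\mathbf I}(s)=\varepsilon+s(1-2\varepsilon)$; $\Phi^\varepsilon(A,B)=\varepsilon^{-B}\,{}^{\Gamma(A,B)}W^{c_{\mathbf I}}\,\varepsilon^{A}$, $\Phi(A,B)=\lim_{\varepsilon\to0}\Phi^\varepsilon(A,B)$ (Drinfeld's KZ series), $\Phi^{\varepsilon}_{ijk}=\Phi^{\varepsilon}(t_{ij},t_{jk})$, $\Phi_{ijk}=\Phi(t_{ij},t_{jk})$. $\alpha_{UVW}$ is the component of $\Phi(t_{12},t_{23})$ at $(U,V,W)$. $\sigma=\gamma e^{i\pi t}$ has components $\sigma_{UV}=\gamma_{UV}e^{i\pi t_{UV}}$ and, for a degree-0 morphism $f$ of $\mathbf C\boxtimes\mathbf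 C$, homotopy components $\sigma_f=\gamma\,(e^{i\pi t})_f$ with $\gamma$ at the target of $f$, where $(e^{i\pi t})_f=\sum_{m\ge1}\frac{(i\pi)^m}{m!}\sum_{j=0}^{m-1}t^{j}\,t_f\,t^{m-1-j}$ (the $t$'s on the left at the target of $f$, those on the right at the source). **Paths** ($0<\varepsilon\le\frac14$, $a\in\mathbb C^\times$ a free parameter, e.g. $a=1$). Put $c_{\mathbf{II}}(r)=\frac{2-\varepsilon-\varepsilon e^{i\pi r}}{2-\varepsilon+\varepsilon e^{i\pi r}}$, $c_{\mathbf{III}}(r)=\frac1{1-c_{\mathbf I}(r)}$, $c_{\mathbf{IV}}(r)=\frac12+(\frac1\varepsilon-\frac12)e^{-i\pi r}$, $z_{\mathbf V}(r)=\frac{c_{\mathbf I}(r)}{c_{\mathbf I}(r)-1}$, $z_{\mathbf{VI}}(r)=\frac{2\varepsilon}{\varepsilon+(2-\varepsilon)e^{i\pi r}}$, $\lambda(r)=\frac{1-c_{\mathbf I}(r)}{1-\varepsilon}$. Then $p_{\mathbf I}(r)=(c_{\mathbf I}(1-r),a)$, $p_{\mathbf{II}}=(c_{\mathbf{II}},a)$, $p_{\mathbf{III}}=(c_{\mathbf{III}},\lambda a)$, $p_{\mathbf{IV}}=(c_{\mathbf{IV}},\frac{a\varepsilon}{1-\varepsilon})$, $p_{\mathbf V}=(z_{\mathbf V},\lambda a)$, $p_{\mathbf{VI}}=(z_{\mathbf{VI}},a)$, $q_{\mathbf{IV}}=(c_{\mathbf{IV}},\frac a{c_{\mathbf{IV}}-1})$,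 $q_{\mathbf V}=(z_{\mathbf V},(c_{\mathbf I}-1)a)$, $q_{\mathbf{VI}}=(z_{\mathbf{VI}},\frac{a\varepsilon}{z_{\mathbf{VI}}})$, $q^\downarrow_1(r)=(1-\frac1\varepsilon,\frac{a}{c_{\mathbf{IV}}(r)-1})$. **2-paths.** - $\mathcal P_{\mathbf V}(s,r)$: $(z_{\mathbf V}(2r),a)$ for $r\le\frac s2$; $(z_{\mathbf V}(s),\lambda(2r-s)a)$ for $\frac s2\le r\le s$; $p_{\mathbf V}(r)$ for $r\ge s$. - $\mathcal P_{\mathbf{III}}(s,r)$: $(c_{\mathbf{III}}(2r),a)$ for $r\le\frac s2$; $(c_{\mathbf{III}}(s),\lambda(2r-s)a)$ for $\frac s2\le r\le s$; $p_{\mathbf{III}}(r)$ for $r\ge s$. - $\mathcal P_{\mathbf{IV}}(s,r)$: $(c_{\mathbf{IV}}(2r),a)$ for $r\le\frac s2$; $(c_{\mathbf{IV}}(s),\lambda(2r-s)a)$ for $\frac s2\le r\le\frac{1+s}2$; $p_{\mathbf{IV}}(2r-1)$ for $r\ge\frac{1+s}2$. - $\mathcal Q_{\mathbf{VI}}(s,r)$: $p_{\mathbf{VI}}(2r)$ for $r\le\frac s2$; $(z_{\mathbf{VI}}(s),\frac{a\varepsilon}{z_{\mathbf{VI}}(2r-s)})$ for $\frac s2\le r\le s$; $q_{\mathbf{VI}}(r)$ for $r\ge s$. - $\mathcal Q_{\mathbf V}(s,r)$: $p_{\mathbf V}(2r)$ for $r\le\frac s2$; $(z_{\mathbf V}(s),\frac{a\varepsilon\lambda(s)}{z_{\mathbf{VI}}(2r-s)})$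 for $\frac s2\le r\le\frac{1+s}2$; $q_{\mathbf V}(2r-1)$ for $r\ge\frac{1+s}2$. - $\mathcal Q_{\mathbf{IV}}(s,r)$: $p_{\mathbf{IV}}(2r)$ for $r\le\frac s2$; $(c_{\mathbf{IV}}(s),\frac a{c_{\mathbf{IV}}(2r-s)-1})$ for $\frac s2\le r\le s$; $q_{\mathbf{IV}}(r)$ for $r\ge s$. Concatenating these (and their reverses) with a 2-path contained in $\{v=a\}$ and one contained in $\{z=1-\frac1\varepsilon\}$ (both with zero 2-holonomy) gives a 2-path $\mathcal Q:q_{\mathbf V}q_{\mathbf{VI}}p_{\mathbf I}\Rightarrow q_{\mathbf{IV}}p_{\mathbf{III}}p_{\mathbf{II}}$ whose 2-holonomy is $$W^{\mathcal Q}=W^{q_{\mathbf V}}W^{\mathcal Q_{\mathbf{VI}}}W^{p_{\mathbf I}}+W^{\mathcal Q_{\mathbf V}}W^{p_{\mathbf{VI}}}W^{p_{\mathbf I}}+W^{q^\downarrow_1}W^{\mathcal P}-W^{\mathcal Q_{\mathbf{IV}}}W^{p_{\mathbf{III}}}W^{p_{\mathbf{II}}},$$ $$W^{\mathcal P}=W^{\mathcal P_{\mathbf V}}W^{p_{\mathbf{VI}}}W^{p_{\mathbf I}}-W^{\mathcal P_{\mathbf{IV}}}W^{c_{\mathbf{III}}}W^{p_{\mathbf{II}}}-W^{p_{\mathbf{IV}}}W^{\mathcal P_{\mathbf{III}}}W^{p_{\mathbf{II}}}.$$ **Hexagonators.** Put $$t_\varepsilon^{t_{12}}=\sum_{m,n\ge1}\frac{(-\ln\varepsilon)^n(i\pi)^m}{n!\,m!}\sum_{\substack{0\le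 j\le m-1\\0\le k\le n-1}}t_{(12)3}^{\,j}t_{12}^{\,k}\mathcal L\,t_{12}^{\,n-1-k}t_{(12)3}^{\,m-1-j}\,\varepsilon^{t_{12}},\qquad K_\varepsilon=\varepsilon^{-t_{12}}W^{q_{\mathbf{VI}}}e^{-i\pi t_{(12)3}}\varepsilon^{t_{12}},$$ $$\mathbf R=\lim_{\varepsilon\to0}\Big(\varepsilon^{-t_{13}}W^{\mathcal Q}\varepsilon^{t_{23}}-\Phi^\varepsilon_{213}\,K_\varepsilon\,t_\varepsilon^{t_{12}}\,\Phi^\varepsilon_{321}\Big):\Phi_{213}e^{i\pi t_{(12)3}}\Phi_{321}\Rrightarrow e^{i\pi t_{13}}\Phi_{231}e^{i\pi t_{23}}.$$ The left pre-hexagonator is $\mathbf L:=\mathbf R_{321}:\Phi_{231}e^{i\pi t_{1(23)}}\Phi_{123}\Rrightarrow e^{i\pi t_{13}}\Phi_{213}e^{i\pi t_{12}}$, i.e. $\mathbf L_{UVW}=\pi_{UVW}^{-1}\,\mathbf R_{WVU}\,\pi_{UVW}$ where $\pi_{UVW}=(\gamma_{VW}\otimes1_U)\gamma_{U,V\otimes W}:U\otimes V\otimes W\to W\otimes V\otimes U$. The hexagonators are $\mathcal H^R_{UVW}=\gamma_{U\otimes V,W}\mathbf R_{UVW}$ and $\mathcal H^L_{UVW}=\gamma_{U,V\otimes W}\mathbf L_{UVW}$. *)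

theory Defs
  imports "HOL-Analysis.Analysis" "HOL-Computational_Algebra.Formal_Power_Series"
begin

section \<open>Cochain 2-categories\<close>

text \<open>
  \<open>R\<close> is the type \<open>'r\<close>, made a complex algebra by the ring homomorphism \<open>cunit\<close>.
  The hom-complexes are graded \<open>R\<close>-submodules \<open>Hom C n U V\<close> of one ambient \<open>R\<close>-module \<open>'m\<close>; any
  family of hom-complexes has this form (take for \<open>'m\<close> the direct sum of all of them, and extend
  the operations bilinearly). All operations are only constrained on the hom-modules.
\<close>

record ('r, 'o, 'm) smc2cat =
  rscale :: "'r \<Rightarrow> 'm \<Rightarrow> 'm"
  cunit :: "complex \<Rightarrow> 'r"
  Hom :: "int \<Rightarrow> 'o \<Rightarrow> 'o \<Rightarrow> 'm set"
  idm :: "'o \<Rightarrow> 'm"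
  mcomp :: "'m \<Rightarrow> 'm \<Rightarrow> 'm" (infixl "\<cdot>\<index>" 70)
  diff :: "'m \<Rightarrow> 'm" ("\<partial>\<index>")
  tob :: "'o \<Rightarrow> 'o \<Rightarrow> 'o" (infixr "\<otimes>\<index>" 75)
  tunit :: 'o
  tmor :: "'m \<Rightarrow> 'm \<Rightarrow> 'm" (infixr "\<boxtimes>\<index>" 75)
  symm :: "'o \<Rightarrow> 'o \<Rightarrow> 'm" ("\<gamma>\<index>")

context
  fixes C :: "('r::comm_ring_1, 'o, 'm::ab_group_add) smc2cat" (structure)
begin

definition linear_on :: "'m set \<Rightarrow> ('m \<Rightarrow> 'm) \<Rightarrow> bool" where
  "linear_on A F \<longleftrightarrow>
     (\<forall>x\<in>A. \<forall>y\<in>A. F (x + y) = F x + F y) \<and> (\<forall>r. \<forall>x\<in>A. F (rscale C r x) = rscale C r (F x))"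

definition bilinear_on :: "'m set \<Rightarrow> 'm set \<Rightarrow> ('m \<Rightarrow> 'm \<Rightarrow> 'm) \<Rightarrow> bool" where
  "bilinear_on A B F \<longleftrightarrow>
     (\<forall>y\<in>B. linear_on A (\<lambda>x. F x y)) \<and> (\<forall>x\<in>A. linear_on B (F x))"

text \<open>
  Because \<open>Hom C n U V\<close> vanishes for \<open>n \<notin> {-1, 0}\<close>, the degree conditions below contain the
  truncation: two elements of degree \<open>-1\<close> have zero composite and zero tensor product, and the
  Leibniz rules give \<open>(\<partial>k')k = k'(\<partial>k)\<close> and \<open>\<partial>k' \<otimes> k = k' \<otimes> \<partial>k\<close>.
\<close>

definition cochain_2category :: bool where
  "cochain_2category \<longleftrightarrow>
     module (rscale C) \<and>
     cunit C 1 = 1 \<and>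
     (\<forall>x y. cunit C (x + y) = cunit C x + cunit C y) \<and>
     (\<forall>x y. cunit C (x * y) = cunit C x * cunit C y) \<and>
     (\<forall>n U V. module.subspace (rscale C) (Hom C n U V)) \<and>
     (\<forall>n U V. n \<notin> {-1, 0} \<longrightarrow> Hom C n U V = {0}) \<and>
     (\<forall>n U V. linear_on (Hom C n U V) (\<partial>) \<and> (\<forall>f\<in>Hom C n U V. \<partial> f \<in> Hom C (n + 1) U V)) \<and>
     (\<forall>U. idm C U \<in> Hom C 0 U U) \<and>
     (\<forall>m n U V W. bilinear_on (Hom C m V W) (Hom C n U V) (\<cdot>)) \<and>
     (\<forall>m n U V W. \<forall>g\<in>Hom C m V W. \<forall>f\<in>Hom C n U V.
        g \<cdot> f \<in> Hom C (m + n) U W \<and>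
        \<partial> (g \<cdot> f) = \<partial> g \<cdot> f + (if even m then g \<cdot> \<partial> f else - (g \<cdot> \<partial> f))) \<and>
     (\<forall>n U V. \<forall>f\<in>Hom C n U V. idm C V \<cdot> f = f \<and> f \<cdot> idm C U = f) \<and>
     (\<forall>l m n U V W X. \<forall>h\<in>Hom C l W X. \<forall>g\<in>Hom C m V W. \<forall>f\<in>Hom C n U V.
        (h \<cdot> g) \<cdot> f = h \<cdot> (g \<cdot> f))"

text \<open>
  An enriched functor on the tensor product of \<open>C\<close> with itself is given on pairs \<open>(f, g)\<close>,
  bilinearly (universal property of the tensor product). The Koszul signs of the interchange law
  and of the naturality of \<open>\<gamma>\<close> are omitted: they are \<open>-1\<close> only where both sides have degree at
  most \<open>-2\<close> and therefore vanish.
\<close>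

definition symmetric_strict_monoidal :: bool where
  "symmetric_strict_monoidal \<longleftrightarrow>
     cochain_2category \<and>
     (\<forall>U V W. (U \<otimes> V) \<otimes> W = U \<otimes> (V \<otimes> W)) \<and>
     (\<forall>U. U \<otimes> tunit C = U \<and> tunit C \<otimes> U = U) \<and>
     (\<forall>m n U U' V V'. bilinear_on (Hom C m U U') (Hom C n V V') (\<boxtimes>)) \<and>
     (\<forall>m n U U' V V'. \<forall>f\<in>Hom C m U U'. \<forall>g\<in>Hom C n V V'.
        f \<boxtimes> g \<in> Hom C (m + n) (U \<otimes> V) (U' \<otimes> V') \<and>
        \<partial> (f \<boxtimes> g) = \<partial> f \<boxtimes> g + (if even m then f \<boxtimes> \<partial> g else - (f \<boxtimes> \<partial> g))) \<and>
     (\<forall>U V. idm C U \<boxtimes> idm C V = idm C (U \<otimes> V)) \<and>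
     (\<forall>m n m' n' U U' U'' V V' V''.
        \<forall>f\<in>Hom C m U U'. \<forall>g\<in>Hom C n V V'. \<forall>f'\<in>Hom C m' U' U''. \<forall>g'\<in>Hom C n' V' V''.
        (f' \<boxtimes> g') \<cdot> (f \<boxtimes> g) = (f' \<cdot> f) \<boxtimes> (g' \<cdot> g)) \<and>
     (\<forall>l m n U U' V V' W W'. \<forall>f\<in>Hom C l U U'. \<forall>g\<in>Hom C m V V'. \<forall>h\<in>Hom C n W W'.
        (f \<boxtimes> g) \<boxtimes> h = f \<boxtimes> (g \<boxtimes> h)) \<and>
     (\<forall>n U V. \<forall>f\<in>Hom C n U V. f \<boxtimes> idm C (tunit C) = f \<and> idm C (tunit C) \<boxtimes> f = f) \<and>
     (\<forall>U V. \<gamma> U V \<in> Hom C 0 (U \<otimes> V) (V \<otimes> U)) \<and>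
     (\<forall>m n U U' V V'. \<forall>f\<in>Hom C m U U'. \<forall>g\<in>Hom C n V V'.
        \<gamma> U' V' \<cdot> (f \<boxtimes> g) = (g \<boxtimes> f) \<cdot> \<gamma> U V) \<and>
     (\<forall>U V. \<gamma> V U \<cdot> \<gamma> U V = idm C (U \<otimes> V)) \<and>
     (\<forall>U V W. \<gamma> U (V \<otimes> W) = (idm C V \<boxtimes> \<gamma> U W) \<cdot> (\<gamma> U V \<boxtimes> idm C W))"

end


section \<open>Infinitesimal 2-braidings\<close>

text \<open>
  Transformations between functors on the tensor square (cube) of \<open>C\<close>: \<open>'x\<close> is the type of pairs
  (triples) of objects, \<open>'a\<close> that of pairs (triples) of morphisms of \<open>C\<close>, standing for pure tensors.
  An \<open>R\<close>-linear map out of a tensor product is given by a multilinear map on pure tensors;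
  \<open>hty \<xi> x x' f\<close> is the homotopy component of \<open>\<xi>\<close> at \<open>f : x \<rightarrow> x'\<close>.
\<close>

record ('x, 'a, 'm) trans =
  cmp :: "'x \<Rightarrow> 'm"
  hty :: "'x \<Rightarrow> 'x \<Rightarrow> 'a \<Rightarrow> 'm"

type_synonym ('o, 'm) trans2 = "('o \<times> 'o, 'm \<times> 'm, 'm) trans"
type_synonym ('o, 'm) trans3 = "('o \<times> 'o \<times> 'o, 'm \<times> 'm \<times> 'm, 'm) trans"

context
  fixes C :: "('r::comm_ring_1, 'o, 'm::ab_group_add) smc2cat" (structure)
begin

text \<open>
  The degree \<open>-1\<close> part of the truncated tensor product is generated by the tensors of an element
  of degree \<open>-1\<close> with one of degree \<open>0\<close>, in either order; whence two conditions for
  \<open>G(k)\<xi> - \<xi>F(k) = \<xi>(\<partial>k)\<close>.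
\<close>

definition infinitesimal_2braiding :: "('o, 'm) trans2 \<Rightarrow> bool" where
  "infinitesimal_2braiding t \<longleftrightarrow>
     (\<forall>U V. cmp t (U, V) \<in> Hom C 0 (U \<otimes> V) (U \<otimes> V)) \<and>
     (\<forall>U V U' V'. bilinear_on C (Hom C 0 U U') (Hom C 0 V V')
        (\<lambda>f g. hty t (U, V) (U', V') (f, g))) \<and>
     (\<forall>U V U' V'. \<forall>f\<in>Hom C 0 U U'. \<forall>g\<in>Hom C 0 V V'.
        hty t (U, V) (U', V') (f, g) \<in> Hom C (-1) (U \<otimes> V) (U' \<otimes> V') \<and>
        (f \<boxtimes> g) \<cdot> cmp t (U, V) - cmp t (U', V') \<cdot> (f \<boxtimes> g) = \<partial> (hty t (U, V) (U', V') (f, g))) \<and>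
     (\<forall>U V U' V'. \<forall>k\<in>Hom C (-1) U U'. \<forall>g\<in>Hom C 0 V V'.
        (k \<boxtimes> g) \<cdot> cmp t (U, V) - cmp t (U', V') \<cdot> (k \<boxtimes> g) = hty t (U, V) (U', V') (\<partial> k, g)) \<and>
     (\<forall>U V U' V'. \<forall>f\<in>Hom C 0 U U'. \<forall>k\<in>Hom C (-1) V V'.
        (f \<boxtimes> k) \<cdot> cmp t (U, V) - cmp t (U', V') \<cdot> (f \<boxtimes> k) = hty t (U, V) (U', V') (f, \<partial> k)) \<and>
     (\<forall>U V U' V' U'' V''.
        \<forall>f\<in>Hom C 0 U U'. \<forall>g\<in>Hom C 0 V V'. \<forall>f'\<in>Hom C 0 U' U''. \<forall>g'\<in>Hom C 0 V' V''.
        hty t (U, V) (U'', V'') (f' \<cdot> f, g' \<cdot> g)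
          = hty t (U', V') (U'', V'') (f', g') \<cdot> (f \<boxtimes> g)
            + (f' \<boxtimes> g') \<cdot> hty t (U, V) (U', V') (f, g))"

definition trans2_eq :: "('o, 'm) trans2 \<Rightarrow> ('o, 'm) trans2 \<Rightarrow> bool" where
  "trans2_eq \<xi> \<zeta> \<longleftrightarrow>
     (\<forall>U V. cmp \<xi> (U, V) = cmp \<zeta> (U, V)) \<and>
     (\<forall>U V U' V'. \<forall>f\<in>Hom C 0 U U'. \<forall>g\<in>Hom C 0 V V'.
        hty \<xi> (U, V) (U', V') (f, g) = hty \<zeta> (U, V) (U', V') (f, g))"

definition trans3_eq :: "('o, 'm) trans3 \<Rightarrow> ('o, 'm) trans3 \<Rightarrow> bool" where
  "trans3_eq \<xi> \<zeta> \<longleftrightarrow>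
     (\<forall>U V W. cmp \<xi> (U, V, W) = cmp \<zeta> (U, V, W)) \<and>
     (\<forall>U V W U' V' W'. \<forall>f\<in>Hom C 0 U U'. \<forall>g\<in>Hom C 0 V V'. \<forall>h\<in>Hom C 0 W W'.
        hty \<xi> (U, V, W) (U', V', W') (f, g, h) = hty \<zeta> (U, V, W) (U', V', W') (f, g, h))"

definition trans_add :: "('x, 'a, 'm) trans \<Rightarrow> ('x, 'a, 'm) trans \<Rightarrow> ('x, 'a, 'm) trans" where
  "trans_add \<xi> \<zeta> =
     \<lparr>cmp = \<lambda>x. cmp \<xi> x + cmp \<zeta> x, hty = \<lambda>x x' f. hty \<xi> x x' f + hty \<zeta> x x' f\<rparr>"

definition t12 :: "('o, 'm) trans2 \<Rightarrow> ('o, 'm) trans3" where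
  "t12 t =
     \<lparr>cmp = \<lambda>(U, V, W). cmp t (U, V) \<boxtimes> idm C W,
      hty = \<lambda>(U, V, W) (U', V', W') (f, g, h). hty t (U, V) (U', V') (f, g) \<boxtimes> h\<rparr>"

definition t23 :: "('o, 'm) trans2 \<Rightarrow> ('o, 'm) trans3" where
  "t23 t =
     \<lparr>cmp = \<lambda>(U, V, W). idm C U \<boxtimes> cmp t (V, W),
      hty = \<lambda>(U, V, W) (U', V', W') (f, g, h). f \<boxtimes> hty t (V, W) (V', W') (g, h)\<rparr>"

definition t13 :: "('o, 'm) trans2 \<Rightarrow> ('o, 'm) trans3" where
  "t13 t =
     \<lparr>cmp = \<lambda>(U, V, W).
        (\<gamma> V U \<boxtimes> idm C W) \<cdot> (idm C V \<boxtimes> cmp t (U, W)) \<cdot> (\<gamma> U V \<boxtimes> idm C W),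
      hty = \<lambda>(U, V, W) (U', V', W') (f, g, h).
        (\<gamma> V' U' \<boxtimes> idm C W') \<cdot> (g \<boxtimes> hty t (U, W) (U', W') (f, h)) \<cdot> (\<gamma> U V \<boxtimes> idm C W)\<rparr>"

definition t12_3 :: "('o, 'm) trans2 \<Rightarrow> ('o, 'm) trans3" where
  "t12_3 t =
     \<lparr>cmp = \<lambda>(U, V, W). cmp t (U \<otimes> V, W),
      hty = \<lambda>(U, V, W) (U', V', W') (f, g, h). hty t (U \<otimes> V, W) (U' \<otimes> V', W') (f \<boxtimes> g, h)\<rparr>"

definition t1_23 :: "('o, 'm) trans2 \<Rightarrow> ('o, 'm) trans3" where
  "t1_23 t =
     \<lparr>cmp = \<lambda>(U, V, W). cmp t (U, V \<otimes> W),
      hty = \<lambda>(U, V, W) (U', V', W') (f, g, h). hty t (U, V \<otimes> W) (U', V' \<otimes> W') (f, g \<boxtimes> h)\<rparr>"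

definition swapped :: "('o, 'm) trans2 \<Rightarrow> ('o, 'm) trans2" where
  "swapped t =
     \<lparr>cmp = \<lambda>(U, V). \<gamma> V U \<cdot> cmp t (V, U) \<cdot> \<gamma> U V,
      hty = \<lambda>(U, V) (U', V') (f, g). \<gamma> V' U' \<cdot> hty t (V, U) (V', U') (g, f) \<cdot> \<gamma> U V\<rparr>"

definition strict :: "('o, 'm) trans2 \<Rightarrow> bool" where
  "strict t \<longleftrightarrow> trans3_eq (t1_23 t) (trans_add (t12 t) (t13 t)) \<and>
                trans3_eq (t12_3 t) (trans_add (t23 t) (t13 t))"

definition symmetric :: "('o, 'm) trans2 \<Rightarrow> bool" where
  "symmetric t \<longleftrightarrow> trans2_eq t (swapped t)"

definition totally_symmetric :: "('o, 'm) trans2 \<Rightarrow> bool" where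
  "totally_symmetric t \<longleftrightarrow> symmetric t \<and>
     (\<forall>U V W. hty t (U \<otimes> V, W) (V \<otimes> U, W) (\<gamma> U V, idm C W) = 0)"

definition relL :: "('o, 'm) trans2 \<Rightarrow> 'o \<Rightarrow> 'o \<Rightarrow> 'o \<Rightarrow> 'm" where
  "relL t U V W = hty t (U \<otimes> V, W) (U \<otimes> V, W) (cmp t (U, V), idm C W)"

definition relR :: "('o, 'm) trans2 \<Rightarrow> 'o \<Rightarrow> 'o \<Rightarrow> 'o \<Rightarrow> 'm" where
  "relR t U V W = hty t (U, V \<otimes> W) (U, V \<otimes> W) (idm C U, cmp t (V, W))"

definition coherent :: "('o, 'm) trans2 \<Rightarrow> bool" where
  "coherent t \<longleftrightarrow> (\<forall>U V W.
     - ((\<gamma> V U \<boxtimes> idm C W) \<cdot> relR t V U W \<cdot> (\<gamma> U V \<boxtimes> idm C W)) = relL t U V W + relR t U V W \<and>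
     relL t U V W + relR t U V W =
       - ((idm C U \<boxtimes> \<gamma> W V) \<cdot> relL t U W V \<cdot> (idm C U \<boxtimes> \<gamma> V W)))"

end


section \<open>Formal power series of morphisms\<close>

text \<open>
  A formal power series in \<open>\<hbar>\<close> of morphisms is an element of \<open>'m fps\<close>; only the additive structure
  of that type is used, products being formed with the composition of \<open>C\<close>.
\<close>

definition hpow :: "nat \<Rightarrow> 'm::zero \<Rightarrow> 'm fps" where
  "hpow n x = Abs_fps (\<lambda>m. if m = n then x else 0)"

text \<open>\<open>ssum F\<close> is \<open>F 0 + F 1 + ...\<close>, for a sequence such that \<open>F m\<close> is divisible by \<open>\<hbar>^m\<close>.\<close>

definition ssum :: "(nat \<Rightarrow> 'm::comm_monoid_add fps) \<Rightarrow> 'm fps" where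
  "ssum F = Abs_fps (\<lambda>n. \<Sum>m\<le>n. fps_nth (F m) n)"

definition cscale :: "('r, 'o, 'm) smc2cat \<Rightarrow> complex \<Rightarrow> 'm \<Rightarrow> 'm" where
  "cscale C z x = rscale C (cunit C z) x"

definition sscale :: "('r, 'o, 'm::ab_group_add) smc2cat \<Rightarrow> complex \<Rightarrow> 'm fps \<Rightarrow> 'm fps"
    (infixr "*\<^sub>s\<index>" 80) where
  "sscale C z A = Abs_fps (\<lambda>n. cscale C z (fps_nth A n))"

definition scomp :: "('r, 'o, 'm::ab_group_add) smc2cat \<Rightarrow> 'm fps \<Rightarrow> 'm fps \<Rightarrow> 'm fps"
    (infixl "\<odot>\<index>" 70) where
  "scomp C A B = Abs_fps (\<lambda>n. \<Sum>i\<le>n. mcomp C (fps_nth A i) (fps_nth B (n - i)))"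

definition stens :: "('r, 'o, 'm::ab_group_add) smc2cat \<Rightarrow> 'm fps \<Rightarrow> 'm fps \<Rightarrow> 'm fps"
    (infixr "\<boxdot>\<index>" 75) where
  "stens C A B = Abs_fps (\<lambda>n. \<Sum>i\<le>n. tmor C (fps_nth A i) (fps_nth B (n - i)))"

definition sid :: "('r, 'o, 'm::ab_group_add) smc2cat \<Rightarrow> 'o \<Rightarrow> 'm fps" ("\<one>\<index>") where
  "sid C X = fps_const (idm C X)"

definition ssym :: "('r, 'o, 'm::ab_group_add) smc2cat \<Rightarrow> 'o \<Rightarrow> 'o \<Rightarrow> 'm fps" where
  "ssym C U V = fps_const (symm C U V)"

context
  fixes C :: "('r::comm_ring_1, 'o, 'm::ab_group_add) smc2cat" (structure)
begin

definition SHom :: "int \<Rightarrow> 'o \<Rightarrow> 'o \<Rightarrow> 'm fps set" where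
  "SHom n U V = {A. \<forall>m. fps_nth A m \<in> Hom C n U V}"

definition sinv :: "'o \<Rightarrow> 'o \<Rightarrow> 'm fps \<Rightarrow> 'm fps" where
  "sinv X Y A = (THE B. B \<in> SHom 0 Y X \<and> B \<odot> A = \<one> X \<and> A \<odot> B = \<one> Y)"

fun spow :: "'o \<Rightarrow> 'm fps \<Rightarrow> nat \<Rightarrow> 'm fps" where
  "spow X A 0 = \<one> X"
| "spow X A (Suc n) = A \<odot> spow X A n"

text \<open>Exponentials are only formed of series with zero constant coefficient.\<close>

definition sexp :: "'o \<Rightarrow> 'm fps \<Rightarrow> 'm fps" where
  "sexp X A = ssum (\<lambda>m. (1 / fact m) *\<^sub>s spow X A m)"

definition epow :: "'o \<Rightarrow> real \<Rightarrow> 'm fps \<Rightarrow> 'm fps" where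
  "epow X \<epsilon> A = sexp X (of_real (ln \<epsilon>) *\<^sub>s A)"

text \<open>
  The hom-modules carry no topology. Limits, derivatives and integrals are those of the complex
  coefficients in finite linear combinations of fixed elements; the results do not depend on the
  chosen combinations.
\<close>

definition flim :: "('e \<Rightarrow> 'm) \<Rightarrow> 'm \<Rightarrow> 'e filter \<Rightarrow> bool" where
  "flim f L \<F> \<longleftrightarrow> (\<exists>N (c :: nat \<Rightarrow> 'e \<Rightarrow> complex) l w.
     eventually (\<lambda>e. f e = (\<Sum>i<N. cscale C (c i e) (w i))) \<F> \<and>
     (\<forall>i<N. (c i \<longlongrightarrow> l i) \<F>) \<and> L = (\<Sum>i<N. cscale C (l i) (w i)))"

definition fintegral :: "(real \<Rightarrow> 'm) \<Rightarrow> 'm \<Rightarrow> bool" where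
  "fintegral f I \<longleftrightarrow> (\<exists>N (c :: nat \<Rightarrow> real \<Rightarrow> complex) j w.
     (\<forall>r\<in>{0..1}. f r = (\<Sum>i<N. cscale C (c i r) (w i))) \<and>
     (\<forall>i<N. (c i has_integral j i) {0..1}) \<and> I = (\<Sum>i<N. cscale C (j i) (w i)))"

definition slimit :: "(real \<Rightarrow> 'm fps) \<Rightarrow> 'm fps" where
  "slimit F = Abs_fps (\<lambda>n. THE L. flim (\<lambda>\<epsilon>. fps_nth (F \<epsilon>) n) L (at_right 0))"

definition sintegral :: "(real \<Rightarrow> 'm fps) \<Rightarrow> 'm fps" where
  "sintegral F = Abs_fps (\<lambda>n. THE I. fintegral (\<lambda>r. fps_nth (F r) n) I)"

text \<open>
  \<open>Y\<close> solves \<open>Y'(r) = G(r) Y(r)\<close>, \<open>Y(r') = 1\<close> on \<open>[0,1]\<close>; it is continuous, and the finite set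
  \<open>S\<close> contains the break points of a piecewise smooth path.
\<close>

definition solves :: "'o \<Rightarrow> (real \<Rightarrow> 'm fps) \<Rightarrow> real \<Rightarrow> (real \<Rightarrow> 'm fps) \<Rightarrow> bool" where
  "solves X G r' Y \<longleftrightarrow>
     Y r' = \<one> X \<and>
     (\<forall>r\<in>{0..1}. Y r \<in> SHom 0 X X) \<and>
     (\<forall>n. \<forall>r\<in>{0..1}. flim (\<lambda>x. fps_nth (Y x) n) (fps_nth (Y r) n) (at r within {0..1})) \<and>
     (\<exists>S. finite S \<and> (\<forall>n. \<forall>r\<in>{0..1} - S.
        flim (\<lambda>x. cscale C (of_real (1 / (x - r))) (fps_nth (Y x) n - fps_nth (Y r) n))
          (fps_nth (G r \<odot> Y r) n) (at r within {0..1})))"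

definition transport :: "'o \<Rightarrow> (real \<Rightarrow> 'm fps) \<Rightarrow> real \<Rightarrow> real \<Rightarrow> 'm fps" where
  "transport X G r r' = (THE A. \<exists>Y. solves X G r' Y \<and> A = Y r)"

definition velocity :: "(real \<Rightarrow> complex) \<Rightarrow> real \<Rightarrow> complex" where
  "velocity c r = vector_derivative c (at r within {0..1})"

definition Gam :: "'m fps \<Rightarrow> 'm fps \<Rightarrow> (real \<Rightarrow> complex) \<Rightarrow> real \<Rightarrow> 'm fps" where
  "Gam A B c r = (velocity c r / c r) *\<^sub>s A + (velocity c r / (c r - 1)) *\<^sub>s B"

definition cI :: "real \<Rightarrow> real \<Rightarrow> complex" where
  "cI \<epsilon> s = of_real (\<epsilon> + s * (1 - 2 * \<epsilon>))"

definition PhiE :: "'o \<Rightarrow> real \<Rightarrow> 'm fps \<Rightarrow> 'm fps \<Rightarrow> 'm fps" where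
  "PhiE X \<epsilon> A B = epow X \<epsilon> (- B) \<odot> transport X (Gam A B (cI \<epsilon>)) 1 0 \<odot> epow X \<epsilon> A"

definition Phi :: "'o \<Rightarrow> 'm fps \<Rightarrow> 'm fps \<Rightarrow> 'm fps" where
  "Phi X A B = slimit (\<lambda>\<epsilon>. PhiE X \<epsilon> A B)"

end

context
  fixes C :: "('r::comm_ring_1, 'o, 'm::ab_group_add) smc2cat" (structure)
    and t :: "('o, 'm) trans2"
begin

definition braid :: "'o \<Rightarrow> 'o \<Rightarrow> 'm fps" where
  "braid U V = ssym C U V \<odot> sexp C (U \<otimes> V) ((\<i> * of_real pi) *\<^sub>s hpow 1 (cmp t (U, V)))"

text \<open>Homotopy components of \<open>\<hbar>t\<close>, extended \<open>\<hbar>\<close>-bilinearly to power series \<open>A\<close>, \<open>B\<close>\<close>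

definition hty_series :: "'o \<times> 'o \<Rightarrow> 'o \<times> 'o \<Rightarrow> 'm fps \<Rightarrow> 'm fps \<Rightarrow> 'm fps" where
  "hty_series x x' A B = Abs_fps (\<lambda>n. case n of 0 \<Rightarrow> 0
     | Suc k \<Rightarrow> (\<Sum>i\<le>k. hty t x x' (fps_nth A i, fps_nth B (k - i))))"

text \<open>The term \<open>m = 0\<close> vanishes since its inner sum is empty.\<close>

definition exp_hty :: "'o \<times> 'o \<Rightarrow> 'o \<times> 'o \<Rightarrow> 'm fps \<Rightarrow> 'm fps \<Rightarrow> 'm fps" where
  "exp_hty x x' A B = ssum (\<lambda>m. ((\<i> * of_real pi) ^ m / fact m) *\<^sub>s
     (\<Sum>j<m. spow C (fst x' \<otimes> snd x') (hpow 1 (cmp t x')) j \<odot> hty_series x x' A B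
              \<odot> spow C (fst x \<otimes> snd x) (hpow 1 (cmp t x)) (m - 1 - j)))"

definition braid_hty :: "'o \<times> 'o \<Rightarrow> 'o \<times> 'o \<Rightarrow> 'm fps \<Rightarrow> 'm fps \<Rightarrow> 'm fps" where
  "braid_hty x x' A B = ssym C (fst x') (snd x') \<odot> exp_hty x x' A B"

end


section \<open>Paths and 2-paths\<close>

type_synonym path2 = "real \<Rightarrow> complex \<times> complex"

context
  fixes \<epsilon> :: real and a :: complex
begin

definition cII :: "real \<Rightarrow> complex" where
  "cII r = (2 - of_real \<epsilon> - of_real \<epsilon> * exp (\<i> * of_real pi * of_real r)) /
           (2 - of_real \<epsilon> + of_real \<epsilon> * exp (\<i> * of_real pi * of_real r))"

definition cIII :: "real \<Rightarrow> complex" where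
  "cIII r = 1 / (1 - cI \<epsilon> r)"

definition cIV :: "real \<Rightarrow> complex" where
  "cIV r = 1 / 2 + (1 / of_real \<epsilon> - 1 / 2) * exp (- \<i> * of_real pi * of_real r)"

definition zV :: "real \<Rightarrow> complex" where
  "zV r = cI \<epsilon> r / (cI \<epsilon> r - 1)"

definition zVI :: "real \<Rightarrow> complex" where
  "zVI r = 2 * of_real \<epsilon> /
           (of_real \<epsilon> + (2 - of_real \<epsilon>) * exp (\<i> * of_real pi * of_real r))"

definition lam :: "real \<Rightarrow> complex" where
  "lam r = (1 - cI \<epsilon> r) / (1 - of_real \<epsilon>)"

definition pI :: path2 where "pI r = (cI \<epsilon> (1 - r), a)"
definition pII :: path2 where "pII r = (cII r, a)"
definition pIII :: path2 where "pIII r = (cIII r, lam r * a)"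
definition pIV :: path2 where "pIV r = (cIV r, a * of_real \<epsilon> / (1 - of_real \<epsilon>))"
definition pV :: path2 where "pV r = (zV r, lam r * a)"
definition pVI :: path2 where "pVI r = (zVI r, a)"
definition qIV :: path2 where "qIV r = (cIV r, a / (cIV r - 1))"
definition qV :: path2 where "qV r = (zV r, (cI \<epsilon> r - 1) * a)"
definition qVI :: path2 where "qVI r = (zVI r, a * of_real \<epsilon> / zVI r)"
definition qdown1 :: path2 where "qdown1 r = (1 - 1 / of_real \<epsilon>, a / (cIV r - 1))"

definition PV :: "real \<Rightarrow> path2" where
  "PV s r = (if r \<le> s / 2 then (zV (2 * r), a)
             else if r \<le> s then (zV s, lam (2 * r - s) * a)
             else pV r)"

definition PIII :: "real \<Rightarrow> path2" where
  "PIII s r = (if r \<le> s / 2 then (cIII (2 * r), a)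
               else if r \<le> s then (cIII s, lam (2 * r - s) * a)
               else pIII r)"

definition PIV :: "real \<Rightarrow> path2" where
  "PIV s r = (if r \<le> s / 2 then (cIV (2 * r), a)
              else if r \<le> (1 + s) / 2 then (cIV s, lam (2 * r - s) * a)
              else pIV (2 * r - 1))"

definition QVI :: "real \<Rightarrow> path2" where
  "QVI s r = (if r \<le> s / 2 then pVI (2 * r)
              else if r \<le> s then (zVI s, a * of_real \<epsilon> / zVI (2 * r - s))
              else qVI r)"

definition QV :: "real \<Rightarrow> path2" where
  "QV s r = (if r \<le> s / 2 then pV (2 * r)
             else if r \<le> (1 + s) / 2 then (zV s, a * of_real \<epsilon> * lam s / zVI (2 * r - s))
             else qV (2 * r - 1))"

definition QIV :: "real \<Rightarrow> path2" where
  "QIV s r = (if r \<le> s / 2 then pIV (2 * r)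
              else if r \<le> s then (cIV s, a / (cIV (2 * r - s) - 1))
              else qIV r)"

end


section \<open>Hexagonators\<close>

context
  fixes C :: "('r::comm_ring_1, 'o, 'm::ab_group_add) smc2cat" (structure)
    and t :: "('o, 'm) trans2"
begin

context
  fixes U V W :: 'o
begin

text \<open>
  Components at \<open>(U, V, W)\<close> in the formal setting, where \<open>t\<close> stands for \<open>\<hbar>t\<close> and the relationators
  carry the factor \<open>\<hbar>^2\<close>
\<close>

definition s12 :: "'m fps" where "s12 = hpow 1 (cmp (t12 C t) (U, V, W))"
definition s23 :: "'m fps" where "s23 = hpow 1 (cmp (t23 C t) (U, V, W))"
definition s13 :: "'m fps" where "s13 = hpow 1 (cmp (t13 C t) (U, V, W))"
definition s12_3 :: "'m fps" where "s12_3 = hpow 1 (cmp (t12_3 C t) (U, V, W))"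
definition sLam :: "'m fps" where "sLam = s12 + s23 + s13"
definition sL :: "'m fps" where "sL = hpow 2 (relL C t U V W)"
definition sR :: "'m fps" where "sR = hpow 2 (relR C t U V W)"

definition assoc :: "'m fps" where
  "assoc = Phi C (U \<otimes> V \<otimes> W) s12 s23"

definition Nabla :: "path2 \<Rightarrow> real \<Rightarrow> 'm fps" where
  "Nabla p r = Gam C s12 s23 (fst \<circ> p) r + (velocity (snd \<circ> p) r / snd (p r)) *\<^sub>s sLam"

text \<open>The 2-form \<open>\<Delta>\<close> at \<open>P s r\<close>, evaluated on \<open>\<partial>\<^sub>s P\<close> and \<open>\<partial>\<^sub>r P\<close> in this order\<close>

definition Delta :: "(real \<Rightarrow> path2) \<Rightarrow> real \<Rightarrow> real \<Rightarrow> 'm fps" where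
  "Delta P s r =
     (let z = fst (P s r); v = snd (P s r);
          dsz = velocity (\<lambda>s. fst (P s r)) s; dsv = velocity (\<lambda>s. snd (P s r)) s;
          drz = velocity (\<lambda>r. fst (P s r)) r; drv = velocity (\<lambda>r. snd (P s r)) r
      in ((dsz * drv - drz * dsv) / v) *\<^sub>s ((1 / z) *\<^sub>s sL + (1 / (z - 1)) *\<^sub>s sR))"

definition Wc :: "(real \<Rightarrow> complex) \<Rightarrow> 'm fps" where
  "Wc c = transport C (U \<otimes> V \<otimes> W) (Gam C s12 s23 c) 1 0"

definition Wp :: "path2 \<Rightarrow> 'm fps" where
  "Wp p = transport C (U \<otimes> V \<otimes> W) (Nabla p) 1 0"

definition W2 :: "(real \<Rightarrow> path2) \<Rightarrow> 'm fps" where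
  "W2 P = sintegral C (\<lambda>s. sintegral C (\<lambda>r.
     transport C (U \<otimes> V \<otimes> W) (Nabla (P s)) 1 r \<odot> Delta P s r
       \<odot> transport C (U \<otimes> V \<otimes> W) (Nabla (P s)) r 0))"

context
  fixes \<epsilon> :: real and a :: complex
begin

text \<open>
  2-holonomies of the concatenations \<open>\<P>\<close> and \<open>\<Q>\<close> of the 2-paths above and their reverses; the
  remaining constituents lie in \<open>{v = a}\<close> or \<open>{z = 1 - 1/\<epsilon>}\<close>, where the 2-holonomy is \<open>0\<close>.
\<close>

definition WcalP :: "'m fps" where
  "WcalP = W2 (PV \<epsilon> a) \<odot> Wp (pVI \<epsilon> a) \<odot> Wp (pI \<epsilon> a)
     - W2 (PIV \<epsilon> a) \<odot> Wc (cIII \<epsilon>) \<odot> Wp (pII \<epsilon> a)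
     - Wp (pIV \<epsilon> a) \<odot> W2 (PIII \<epsilon> a) \<odot> Wp (pII \<epsilon> a)"

definition WcalQ :: "'m fps" where
  "WcalQ = Wp (qV \<epsilon> a) \<odot> W2 (QVI \<epsilon> a) \<odot> Wp (pI \<epsilon> a)
     + W2 (QV \<epsilon> a) \<odot> Wp (pVI \<epsilon> a) \<odot> Wp (pI \<epsilon> a)
     + Wp (qdown1 \<epsilon> a) \<odot> WcalP
     - W2 (QIV \<epsilon> a) \<odot> Wp (pIII \<epsilon> a) \<odot> Wp (pII \<epsilon> a)"

text \<open>The terms with \<open>m = 0\<close> or \<open>n = 0\<close> vanish since their inner sums are empty.\<close>

definition teps :: "'m fps" where
  "teps = ssum (\<lambda>m. ssum (\<lambda>n.
       ((- of_real (ln \<epsilon>)) ^ n * (\<i> * of_real pi) ^ m / (fact n * fact m)) *\<^sub>s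
       (\<Sum>j<m. \<Sum>k<n.
          spow C (U \<otimes> V \<otimes> W) s12_3 j \<odot> spow C (U \<otimes> V \<otimes> W) s12 k \<odot> sL
          \<odot> spow C (U \<otimes> V \<otimes> W) s12 (n - 1 - k) \<odot> spow C (U \<otimes> V \<otimes> W) s12_3 (m - 1 - j))))
     \<odot> epow C (U \<otimes> V \<otimes> W) \<epsilon> s12"

definition Keps :: "'m fps" where
  "Keps = epow C (U \<otimes> V \<otimes> W) \<epsilon> (- s12) \<odot> Wp (qVI \<epsilon> a)
     \<odot> sexp C (U \<otimes> V \<otimes> W) ((- \<i> * of_real pi) *\<^sub>s s12_3) \<odot> epow C (U \<otimes> V \<otimes> W) \<epsilon> s12"

end

text \<open>Recall \<open>t\<^sub>j\<^sub>i = t\<^sub>i\<^sub>j\<close>, so \<open>\<Phi>\<^sub>2\<^sub>1\<^sub>3 = \<Phi>(t\<^sub>1\<^sub>2, t\<^sub>1\<^sub>3)\<close> and \<open>\<Phi>\<^sub>3\<^sub>2\<^sub>1 = \<Phi>(t\<^sub>2\<^sub>3, t\<^sub>1\<^sub>2)\<close>.\<close>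

definition prehexR :: "complex \<Rightarrow> 'm fps" where
  "prehexR a = slimit C (\<lambda>\<epsilon>.
     epow C (U \<otimes> V \<otimes> W) \<epsilon> (- s13) \<odot> WcalQ \<epsilon> a \<odot> epow C (U \<otimes> V \<otimes> W) \<epsilon> s23
     - PhiE C (U \<otimes> V \<otimes> W) \<epsilon> s12 s13 \<odot> Keps \<epsilon> a \<odot> teps \<epsilon>
         \<odot> PhiE C (U \<otimes> V \<otimes> W) \<epsilon> s23 s12)"

definition revperm :: "'m fps" where
  "revperm = (ssym C V W \<boxdot> \<one> U) \<odot> ssym C U (V \<otimes> W)"

end

definition prehexL :: "complex \<Rightarrow> 'o \<Rightarrow> 'o \<Rightarrow> 'o \<Rightarrow> 'm fps" where
  "prehexL a U V W =
     sinv C (U \<otimes> V \<otimes> W) (W \<otimes> V \<otimes> U) (revperm U V W) \<odot> prehexR W V U a \<odot> revperm U V W"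

definition hexR :: "complex \<Rightarrow> 'o \<Rightarrow> 'o \<Rightarrow> 'o \<Rightarrow> 'm fps" where
  "hexR a U V W = ssym C (U \<otimes> V) W \<odot> prehexR U V W a"

definition hexL :: "complex \<Rightarrow> 'o \<Rightarrow> 'o \<Rightarrow> 'o \<Rightarrow> 'm fps" where
  "hexL a U V W = ssym C U (V \<otimes> W) \<odot> prehexL a U V W"

definition assoc_inv :: "'o \<Rightarrow> 'o \<Rightarrow> 'o \<Rightarrow> 'm fps" where
  "assoc_inv U V W = sinv C (U \<otimes> V \<otimes> W) (U \<otimes> V \<otimes> W) (assoc U V W)"

end

end

theory Submission
  imports Defs "HOL-Complex_Analysis.Complex_Analysis" "HOL-Real_Asymp.Real_Asymp"
begin

text \<open>
  Let \<open>x = t\<^sub>1\<^sub>2\<close>, \<open>y = t\<^sub>2\<^sub>3\<close> and \<open>\<Lambda>\<close> be free noncommuting variables, and \<open>z = \<Lambda> - x - y\<close>. Evaluating them at the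
  components of \<open>t\<close> maps power series to series of degree \<open>0\<close>. In the span of the power series
  \<open>a (x \<Lambda> - \<Lambda> x) b\<close> and \<open>a (y \<Lambda> - \<Lambda> y) b\<close>, replacing the two commutators by \<open>\<L>\<close> and \<open>\<R>\<close> gives a well-defined
  bimodule map \<open>S\<close> to degree \<open>-1\<close>, thanks to \<open>(\<partial>k')k = k'(\<partial>k)\<close>. Every 2-holonomy is \<open>S\<close> of the
  difference of the two boundary holonomies formed with \<open>x, y, \<Lambda>\<close>. Hence \<open>\<^bold>R\<close> is \<open>S\<close> of
  \<open>\<Phi>(x,z) exp(i\<pi>(y + z)) \<Phi>(y,x) - exp(i\<pi>z) \<Phi>(y,z) exp(i\<pi>y)\<close>.

  Total symmetry and coherence make \<open>S\<close> equivariant under permuting the three objects, which permutes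
  \<open>x, y, z\<close>. So each term of the axiom is \<open>S\<close> of an explicit power series, and in the resulting identity
  between power series everything cancels by \<open>\<Phi>(x,y) \<Phi>(y,x) = 1\<close>.
\<close>

section \<open>Noncommutative power series\<close>

text \<open>The hom-modules have no topology, and transport, limits and integrals are definite
  descriptions over finite linear combinations, so analysis cannot be done in them directly. In free
  variables every coefficient is a complex function, and evaluation carries derivatives, integrals
  and limits over word by word. Taking \<Lambda> instead of z as the third variable makes the
  relationators correspond exactly to the commutators of x and y with it. For constant v the
  connection is then an ordinary KZ connection in two free variables, and only moving v produces
  curvature. The map S is not constructed on the ideal: it is defined on all words through a normal
  form, and the bimodule rule is claimed for a class \<open>good\<close> that is closed under sums,
  multiplication on either side, limits and integrals. The obstacle in the limit is that x does not
  commute with y + z, so conjugating exp(i\<pi>(y + z)) by \<epsilon>^x produces powers of ln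
  \<epsilon>.\<close>

typedef 'a ncs = "UNIV :: ('a list \<Rightarrow> complex) set"
  morphisms coef Abs_ncs by simp

lemma coef_Abs_ncs [simp]: "coef (Abs_ncs f) = f"
  by (simp add: Abs_ncs_inverse)

lemma ncs_eqI: "(\<And>w. coef f w = coef g w) \<Longrightarrow> f = g"
  by (metis coef_inject ext)

instantiation ncs :: (type) ring_1
begin

definition "0 = Abs_ncs (\<lambda>w. 0)"
definition "1 = Abs_ncs (\<lambda>w. if w = [] then 1 else 0)"
definition "f + g = Abs_ncs (\<lambda>w. coef f w + coef g w)"
definition "- f = Abs_ncs (\<lambda>w. - coef f w)" for f :: "'a ncs"
definition "f - g = Abs_ncs (\<lambda>w. coef f w - coef g w)" for f g :: "'a ncs"
definition "f * g = Abs_ncs (\<lambda>w. \<Sum>i\<le>length w. coef f (take i w) * coef g (drop i w))"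

lemma coef_simps [simp]:
  "coef 0 w = 0" "coef 1 w = (if w = [] then 1 else 0)" "coef (f + g) w = coef f w + coef g w"
  "coef (- f) w = - coef f w" "coef (f - g) w = coef f w - coef g w"
  by (simp_all add: zero_ncs_def one_ncs_def plus_ncs_def uminus_ncs_def minus_ncs_def)

lemma coef_mult: "coef (f * g) w = (\<Sum>i\<le>length w. coef f (take i w) * coef g (drop i w))"
  by (simp add: times_ncs_def)

lemma coef_mult_Nil [simp]: "coef (f * g) [] = coef f [] * coef g []"
  by (simp add: coef_mult)

lemma coef_mult_Cons:
  "coef (f * g) (a # w) = coef f [] * coef g (a # w) + coef (Abs_ncs (\<lambda>u. coef f (a # u)) * g) w"
  by (simp add: coef_mult sum.atMost_Suc_shift del: sum.atMost_Suc)

instance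
proof
  fix f g h :: "'a ncs"
  have distr: "(f + g) * h = f * h + g * h" for f g h :: "'a ncs"
    by (rule ncs_eqI) (simp add: coef_mult algebra_simps sum.distrib)
  show "f * g * h = f * (g * h)"
  proof (rule ncs_eqI)
    fix w show "coef (f * g * h) w = coef (f * (g * h)) w"
    proof (induction w arbitrary: f)
      case (Cons a w)
      define f1 where "f1 = Abs_ncs (\<lambda>u. coef f (a # u))"
      define g1 where "g1 = Abs_ncs (\<lambda>u. coef g (a # u))"
      \<comment> \<open>Removing the first letter from \<open>f * g\<close> leaves the constant
        coefficient of \<open>f\<close> times the shifted \<open>g\<close>. With the constant series
        \<open>c\<close> this scalar multiple becomes a product, so distributivity applies.\<close>
      define c :: "'a ncs" where "c = Abs_ncs (\<lambda>u. if u = [] then coef f [] else 0)"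
      have cm: "coef (c * k) u = coef f [] * coef k u" for k :: "'a ncs" and u
        by (cases u) (simp_all add: c_def coef_mult sum.atMost_Suc_shift del: sum.atMost_Suc)
      have "Abs_ncs (\<lambda>u. coef (f * g) (a # u)) = c * g1 + f1 * g"
        by (rule ncs_eqI) (simp add: coef_mult_Cons f1_def g1_def cm)
      moreover have "coef (c * g1 * h) w = coef f [] * coef (g1 * h) w"
        by (simp add: coef_mult[of _ h] coef_mult[of g1 h] cm sum_distrib_left mult.assoc)
      ultimately show ?case
        using Cons[of f1]
        by (simp add: coef_mult_Cons[of _ _ a w] distr f1_def g1_def algebra_simps)
    qed simp
  qed
  show "1 * f = f"
    by (rule ncs_eqI, case_tac w)
      (simp_all add: coef_mult sum.atMost_Suc_shift del: sum.atMost_Suc)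
  show "f * 1 = f"
  proof (rule ncs_eqI)
    fix w show "coef (f * 1) w = coef f w"
      by (cases w rule: rev_cases) (simp_all add: coef_mult)
  qed
  show "(f + g) * h = f * h + g * h" by (rule distr)
  show "f * (g + h) = f * g + f * h"
    by (rule ncs_eqI) (simp add: coef_mult algebra_simps sum.distrib)
  show "(0 :: 'a ncs) \<noteq> 1"
  proof
    assume "(0 :: 'a ncs) = 1"
    hence "coef (0 :: 'a ncs) [] = coef 1 []" by simp
    thus False by simp
  qed
qed (auto intro!: ncs_eqI)

end

lemma coef_sum: "coef (sum f A) w = (\<Sum>x\<in>A. coef (f x) w)"
  by (induction A rule: infinite_finite_induct) simp_all

definition nscale :: "complex \<Rightarrow> 'a ncs \<Rightarrow> 'a ncs" (infixr "*\<^sub>n" 75) where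
  "c *\<^sub>n f = Abs_ncs (\<lambda>w. c * coef f w)"

lemma coef_nscale [simp]: "coef (c *\<^sub>n f) w = c * coef f w"
  by (simp add: nscale_def)

lemma nscale_mult_left [simp]: "(c *\<^sub>n f) * g = c *\<^sub>n (f * g)"
  and nscale_mult_right [simp]: "f * (c *\<^sub>n g) = c *\<^sub>n (f * g)"
  by (rule ncs_eqI, simp add: coef_mult sum_distrib_left algebra_simps)+

lemma nscale_nscale [simp]: "c *\<^sub>n d *\<^sub>n f = (c * d) *\<^sub>n f"
  and nscale_one [simp]: "1 *\<^sub>n f = f"
  and nscale_zero [simp]: "0 *\<^sub>n f = 0" "c *\<^sub>n 0 = 0"
  and nscale_minus_one: "(- 1) *\<^sub>n f = - f"
  and nscale_add: "c *\<^sub>n (f + g) = c *\<^sub>n f + c *\<^sub>n g"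
  and nscale_diff: "c *\<^sub>n (f - g) = c *\<^sub>n f - c *\<^sub>n g"
  and nscale_minus: "c *\<^sub>n (- f) = - (c *\<^sub>n f)" "(- c) *\<^sub>n f = - (c *\<^sub>n f)"
  and nscale_add_left: "(c + d) *\<^sub>n f = c *\<^sub>n f + d *\<^sub>n f"
  by (rule ncs_eqI, simp add: algebra_simps)+

lemma nscale_power: "(c *\<^sub>n f) ^ m = c ^ m *\<^sub>n f ^ m"
  by (induction m) (simp_all add: algebra_simps)

text \<open>Without a constant coefficient, \<open>m\<close> factors need at least \<open>m\<close>
  letters. Hence a power series in \<open>f\<close> is a finite sum on each word, which is how
  inverses and exponentials are encoded.\<close>

lemma coef_power_eq_0: "coef f [] = 0 \<Longrightarrow> length w < m \<Longrightarrow> coef (f ^ m) w = 0"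
proof (induction m arbitrary: w)
  case (Suc m)
  have "coef f (take i w) * coef (f ^ m) (drop i w) = 0" if "i \<le> length w" for i
    using Suc that by (cases "i = 0") auto
  then show ?case by (auto simp: coef_mult intro!: sum.neutral)
qed simp

lemma coef_mult_cong:
  assumes "\<And>u. length u \<le> length w \<Longrightarrow> coef f u = coef f' u"
    and "\<And>u. length u \<le> length w \<Longrightarrow> coef g u = coef g' u"
  shows "coef (f * g) w = coef (f' * g') w"
  by (simp add: coef_mult assms)

text \<open>The geometric series in \<open>1 - f\<close>, cut off at the word length. It is the
  inverse when the constant coefficient of \<open>f\<close> is 1, since the omitted powers then
  vanish on the word.\<close>

definition ninv :: "'a ncs \<Rightarrow> 'a ncs" where
  "ninv f = Abs_ncs (\<lambda>w. \<Sum>m\<le>length w. coef ((1 - f) ^ m) w)"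

lemma coef_ninv_Nil [simp]: "coef (ninv f) [] = 1"
  by (simp add: ninv_def)

lemma coef_ninv_eq:
  assumes "coef f [] = 1" "length w \<le> n"
  shows "coef (ninv f) w = coef (\<Sum>m\<le>n. (1 - f) ^ m) w"
proof -
  have "(\<Sum>m\<le>n. coef ((1 - f) ^ m) w) = (\<Sum>m\<le>length w. coef ((1 - f) ^ m) w)"
    using assms by (intro sum.mono_neutral_right) (auto simp: coef_power_eq_0)
  then show ?thesis by (simp add: ninv_def coef_sum)
qed

lemma ninv:
  assumes "coef f [] = 1"
  shows "f * ninv f = 1" "ninv f * f = 1"
proof -
  have "(1 - g) * (\<Sum>m\<le>n. g ^ m) = 1 - g ^ Suc n" "(\<Sum>m\<le>n. g ^ m) * (1 - g) = 1 - g ^ Suc n"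
    for g :: "'a ncs" and n
  proof (induction n)
    case (Suc n)
    have "g ^ Suc n * (1 - g) = g ^ Suc n - g ^ Suc (Suc n)" "(1 - g) * g ^ Suc n = g ^ Suc n - g ^ Suc (Suc n)"
      by (simp_all add: algebra_simps power_commutes)
    with Suc show "(1 - g) * (\<Sum>m\<le>Suc n. g ^ m) = 1 - g ^ Suc (Suc n)"
        "(\<Sum>m\<le>Suc n. g ^ m) * (1 - g) = 1 - g ^ Suc (Suc n)"
      by (simp_all only: sum.atMost_Suc distrib_left distrib_right) simp_all
  qed simp_all
  from this[of "1 - f"] have *: "f * (\<Sum>m\<le>n. (1 - f) ^ m) = 1 - (1 - f) ^ Suc n"
    "(\<Sum>m\<le>n. (1 - f) ^ m) * f = 1 - (1 - f) ^ Suc n" for n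
    by simp_all
  show "f * ninv f = 1"
  proof (rule ncs_eqI)
    fix w
    have "coef (f * ninv f) w = coef (f * (\<Sum>m\<le>length w. (1 - f) ^ m)) w"
      by (rule coef_mult_cong) (simp_all add: coef_ninv_eq assms)
    then show "coef (f * ninv f) w = coef 1 w"
      using coef_power_eq_0[of "1 - f" w "Suc (length w)"] assms unfolding * by simp
  qed
  show "ninv f * f = 1"
  proof (rule ncs_eqI)
    fix w
    have "coef (ninv f * f) w = coef ((\<Sum>m\<le>length w. (1 - f) ^ m) * f) w"
      by (rule coef_mult_cong) (simp_all add: coef_ninv_eq assms)
    then show "coef (ninv f * f) w = coef 1 w"
      using coef_power_eq_0[of "1 - f" w "Suc (length w)"] assms unfolding * by simp
  qed
qed

lemma ninv_unique: "coef f [] = 1 \<Longrightarrow> f * g = 1 \<Longrightarrow> ninv f = g"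
  by (metis mult.assoc mult_1 mult_1_right ninv(2))

lemma ninv_mult_assoc [simp]:
  assumes "coef f [] = 1"
  shows "f * (ninv f * g) = g" "ninv f * (f * g) = g"
  by (simp_all add: assms ninv flip: mult.assoc)

lemma ninv_one [simp]: "ninv 1 = 1"
  by (rule ninv_unique) simp_all

lemma ninv_mult:
  assumes "coef f [] = 1" "coef g [] = 1"
  shows "ninv (f * g) = ninv g * ninv f"
  by (rule ninv_unique) (simp_all add: assms ninv mult.assoc)


section \<open>Coefficientwise calculus\<close>

text \<open>\<open>solves\<close> speaks of limits of difference quotients; in this form derivatives
  of coefficients can be fed into it and read off from it.\<close>

lemma has_vector_derivative_iff_tendsto:
  fixes f :: "real \<Rightarrow> 'b::real_normed_vector"
  shows "(f has_vector_derivative D) (at x within S) \<longleftrightarrow>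
    ((\<lambda>y. (f y - f x) /\<^sub>R (y - x)) \<longlongrightarrow> D) (at x within S)"
proof -
  have eq: "norm ((1 / \<bar>y - x\<bar>) *\<^sub>R (f y - (f x + (y - x) *\<^sub>R D))) = norm ((f y - f x) /\<^sub>R (y - x) - D)"
    if "y \<noteq> x" for y
  proof -
    have "(f y - f x) /\<^sub>R (y - x) - D = inverse (y - x) *\<^sub>R (f y - (f x + (y - x) *\<^sub>R D))"
      using that by (simp add: scaleR_diff_right diff_diff_eq[symmetric])
    then show ?thesis by (simp add: abs_inverse divide_inverse)
  qed
  have "(f has_vector_derivative D) (at x within S) \<longleftrightarrow>
      ((\<lambda>y. norm ((1 / \<bar>y - x\<bar>) *\<^sub>R (f y - (f x + (y - x) *\<^sub>R D)))) \<longlongrightarrow> 0) (at x within S)"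
    unfolding has_vector_derivative_def has_derivative_within real_norm_def tendsto_norm_zero_iff
    by (simp add: bounded_linear_scaleR_left del: norm_scaleR)
  also have "\<dots> \<longleftrightarrow> ((\<lambda>y. norm ((f y - f x) /\<^sub>R (y - x) - D)) \<longlongrightarrow> 0) (at x within S)"
    by (intro filterlim_cong refl) (simp only: eventually_at_filter eq, simp add: eq del: norm_scaleR)
  also have "\<dots> \<longleftrightarrow> ((\<lambda>y. (f y - f x) /\<^sub>R (y - x)) \<longlongrightarrow> D) (at x within S)"
    unfolding tendsto_norm_zero_iff by (rule LIM_zero_iff)
  finally show ?thesis .
qed

definition nc_cont :: "real set \<Rightarrow> (real \<Rightarrow> 'a ncs) \<Rightarrow> bool" where
  "nc_cont S Y \<longleftrightarrow> (\<forall>w. continuous_on S (\<lambda>x. coef (Y x) w))"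

definition nc_tendsto :: "('b \<Rightarrow> 'a ncs) \<Rightarrow> 'a ncs \<Rightarrow> 'b filter \<Rightarrow> bool" where
  "nc_tendsto Y L F \<longleftrightarrow> (\<forall>w. ((\<lambda>x. coef (Y x) w) \<longlongrightarrow> coef L w) F)"

definition nc_deriv :: "(real \<Rightarrow> 'a ncs) \<Rightarrow> 'a ncs \<Rightarrow> real \<Rightarrow> bool" where
  "nc_deriv Y Y' x \<longleftrightarrow> (\<forall>w. ((\<lambda>x. coef (Y x) w) has_vector_derivative coef Y' w) (at x))"

lemma nc_deriv_const [intro]: "nc_deriv (\<lambda>_. f) 0 x"
  by (simp add: nc_deriv_def)

lemma nc_deriv_diff:
  "nc_deriv f f' x \<Longrightarrow> nc_deriv g g' x \<Longrightarrow> nc_deriv (\<lambda>x. f x - g x) (f' - g') x"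
  by (auto simp: nc_deriv_def intro: has_vector_derivative_diff)

lemma nc_deriv_mult:
  assumes "nc_deriv f f' x" "nc_deriv g g' x"
  shows "nc_deriv (\<lambda>x. f x * g x) (f' * g x + f x * g') x"
  unfolding nc_deriv_def
proof
  fix w
  have "((\<lambda>x. \<Sum>i\<le>length w. coef (f x) (take i w) * coef (g x) (drop i w)) has_vector_derivative
    (\<Sum>i\<le>length w. coef (f x) (take i w) * coef g' (drop i w) + coef f' (take i w) * coef (g x) (drop i w))) (at x)"
    using assms by (intro has_vector_derivative_sum has_vector_derivative_mult) (auto simp: nc_deriv_def)
  then show "((\<lambda>x. coef (f x * g x) w) has_vector_derivative coef (f' * g x + f x * g') w) (at x)"
    by (simp add: coef_mult sum.distrib add.commute)
qed

lemma nc_deriv_mult_left: "nc_deriv f f' x \<Longrightarrow> nc_deriv (\<lambda>x. c * f x) (c * f') x"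
  using nc_deriv_mult[OF nc_deriv_const[of c x], of f f'] by simp

lemma nc_deriv_mult_right: "nc_deriv f f' x \<Longrightarrow> nc_deriv (\<lambda>x. f x * c) (f' * c) x"
  using nc_deriv_mult[OF _ nc_deriv_const[of c x], of f f'] by simp

lemma nc_deriv_unique: "nc_deriv f f' x \<Longrightarrow> nc_deriv f f'' x \<Longrightarrow> f' = f''"
  by (rule ncs_eqI) (auto simp: nc_deriv_def intro: vector_derivative_unique_at)

lemma nc_deriv_power_ex: "nc_deriv f f' x \<Longrightarrow> \<exists>g. nc_deriv (\<lambda>x. f x ^ m) g x"
proof (induction m)
  case (Suc m)
  then obtain g where "nc_deriv (\<lambda>x. f x ^ m) g x" by blast
  then show ?case using nc_deriv_mult[OF Suc(2)] by auto
qed auto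

text \<open>Differentiability comes from the finite sums of powers. The value is then forced by
  differentiating \<open>f x * ninv (f x) = 1\<close>, which avoids a noncommutative power
  rule.\<close>

lemma nc_deriv_ninv:
  assumes "nc_deriv f f' x" "\<And>x. coef (f x) [] = 1"
  shows "nc_deriv (\<lambda>x. ninv (f x)) (- ninv (f x) * f' * ninv (f x)) x"
proof -
  have d: "nc_deriv (\<lambda>x. 1 - f x) (0 - f') x"
    by (intro nc_deriv_diff nc_deriv_const assms)
  obtain g where g: "\<And>m. nc_deriv (\<lambda>x. (1 - f x) ^ m) (g m) x"
    using nc_deriv_power_ex[OF d] by metis
  define k where "k = Abs_ncs (\<lambda>w. \<Sum>m\<le>length w. coef (g m) w)"
  have k: "nc_deriv (\<lambda>x. ninv (f x)) k x"
    unfolding nc_deriv_def ninv_def k_def coef_Abs_ncs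
    using g by (auto simp: nc_deriv_def intro!: has_vector_derivative_sum)
  have "nc_deriv (\<lambda>x. f x * ninv (f x)) (f' * ninv (f x) + f x * k) x"
    by (intro nc_deriv_mult assms k)
  moreover have "nc_deriv (\<lambda>x. f x * ninv (f x)) 0 x"
    using nc_deriv_const[of 1 x] by (simp add: ninv assms(2))
  ultimately have "f' * ninv (f x) + f x * k = 0" by (rule nc_deriv_unique)
  hence "f x * k = - (f' * ninv (f x))" by (simp add: eq_neg_iff_add_eq_0 add.commute)
  hence "ninv (f x) * (f x * k) = - ninv (f x) * f' * ninv (f x)"
    by (simp add: mult.assoc)
  then show ?thesis using k by (simp add: assms)
qed

lemma nc_deriv_chain:
  assumes "nc_deriv Y Y' (c x)" "(c has_real_derivative c') (at x)"
  shows "nc_deriv (\<lambda>x. Y (c x)) (of_real c' *\<^sub>n Y') x"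
  unfolding nc_deriv_def
proof
  fix w
  have "((\<lambda>x. coef (Y x) w) \<circ> c has_vector_derivative c' *\<^sub>R coef Y' w) (at x)"
    using assms by (intro vector_diff_chain_at)
      (auto simp: nc_deriv_def has_real_derivative_iff_has_vector_derivative)
  then show "((\<lambda>x. coef (Y (c x)) w) has_vector_derivative coef (of_real c' *\<^sub>n Y') w) (at x)"
    by (simp add: o_def scaleR_conv_of_real)
qed

lemma nc_deriv_zero_imp_eq:
  assumes "\<And>x. x \<in> {a..b} \<Longrightarrow> nc_deriv Y 0 x" "x \<in> {a..b}" "y \<in> {a..b}"
  shows "Y x = Y y"
proof (rule ncs_eqI)
  fix w
  have "((\<lambda>x. coef (Y x) w) has_vector_derivative 0) (at x within {a..b})" if "x \<in> {a..b}" for x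
    using assms(1)[OF that] by (auto simp: nc_deriv_def intro: has_vector_derivative_at_within)
  then obtain c where "\<And>x. x \<in> {a..b} \<Longrightarrow> coef (Y x) w = c"
    using has_vector_derivative_zero_constant[of "{a..b}" "\<lambda>x. coef (Y x) w"] by auto
  with assms show "coef (Y x) w = coef (Y y) w" by auto
qed

lemma nc_deriv_imp_cont:
  assumes "\<And>x. x \<in> S \<Longrightarrow> \<exists>Y'. nc_deriv Y Y' x"
  shows "nc_cont S Y"
  unfolding nc_cont_def
proof
  fix w show "continuous_on S (\<lambda>x. coef (Y x) w)"
    using assms unfolding nc_deriv_def
    by (intro continuous_at_imp_continuous_on ballI) (meson has_vector_derivative_continuous)
qed

lemma nc_tendsto_mult:
  "nc_tendsto f a F \<Longrightarrow> nc_tendsto g b F \<Longrightarrow> nc_tendsto (\<lambda>x. f x * g x) (a * b) F"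
  by (auto simp: nc_tendsto_def coef_mult intro!: tendsto_intros)

lemma nc_tendsto_diff:
  "nc_tendsto f a F \<Longrightarrow> nc_tendsto g b F \<Longrightarrow> nc_tendsto (\<lambda>x. f x - g x) (a - b) F"
  by (auto simp: nc_tendsto_def intro!: tendsto_intros)

lemma nc_tendsto_const: "nc_tendsto (\<lambda>_. a) a F"
  by (auto simp: nc_tendsto_def)


subsection \<open>Exponentials\<close>

text \<open>The exponential of \<open>u\<close> times \<open>A\<close>, cut off at the word length.
  The scalar is kept apart because it will be a logarithm, varying along a path or with \<epsilon>,
  while \<open>A\<close> stays fixed.\<close>

definition nexp :: "complex \<Rightarrow> 'a ncs \<Rightarrow> 'a ncs" where
  "nexp u A = Abs_ncs (\<lambda>w. \<Sum>m\<le>length w. u ^ m / fact m * coef (A ^ m) w)"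

lemma coef_nexp_Nil [simp]: "coef (nexp u A) [] = 1"
  by (simp add: nexp_def)

lemma nexp_zero [simp]: "nexp 0 A = 1"
proof (rule ncs_eqI)
  fix w :: "'a list"
  have "(\<Sum>m\<le>length w. 0 ^ m / fact m * coef (A ^ m) w) = coef (1 :: 'a ncs) w"
    by (cases w) (simp_all add: sum.atMost_Suc_shift del: sum.atMost_Suc)
  then show "coef (nexp 0 A) w = coef 1 w" by (simp add: nexp_def)
qed

lemma coef_nexp_eq:
  assumes "coef A [] = 0" "length w \<le> n"
  shows "coef (nexp u A) w = coef (\<Sum>m\<le>n. (u ^ m / fact m) *\<^sub>n A ^ m) w"
proof -
  have "(\<Sum>m\<le>n. u ^ m / fact m * coef (A ^ m) w) = (\<Sum>m\<le>length w. u ^ m / fact m * coef (A ^ m) w)"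
    using assms by (intro sum.mono_neutral_right) (auto simp: coef_power_eq_0)
  then show ?thesis by (simp add: nexp_def coef_sum)
qed

lemma coef_nexp_mult_nexp:
  assumes "coef A [] = 0" "coef B [] = 0" "length w \<le> N"
  shows "coef (nexp u A * nexp v B) w =
    coef (\<Sum>n\<le>N. \<Sum>m\<le>N. (u ^ n * v ^ m / (fact n * fact m)) *\<^sub>n (A ^ n * B ^ m)) w"
proof -
  have "coef (nexp u A * nexp v B) w =
      coef ((\<Sum>n\<le>N. (u ^ n / fact n) *\<^sub>n A ^ n) * (\<Sum>m\<le>N. (v ^ m / fact m) *\<^sub>n B ^ m)) w"
    using assms(3) by (intro coef_mult_cong coef_nexp_eq assms) simp_all
  also have "(\<Sum>n\<le>N. (u ^ n / fact n) *\<^sub>n A ^ n) * (\<Sum>m\<le>N. (v ^ m / fact m) *\<^sub>n B ^ m) =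
     (\<Sum>n\<le>N. \<Sum>m\<le>N. (u ^ n * v ^ m / (fact n * fact m)) *\<^sub>n (A ^ n * B ^ m))"
    unfolding sum_product by (simp add: mult.commute)
  finally show ?thesis .
qed

lemma nexp_commute:
  assumes "coef A [] = 0" "A * B = B * A"
  shows "nexp u A * B = B * nexp u A"
proof -
  have "A ^ m * B = B * A ^ m" for m
    using assms(2) by (induction m) (simp_all add: mult.assoc, metis mult.assoc)
  hence *: "(\<Sum>m\<le>n. (u ^ m / fact m) *\<^sub>n A ^ m) * B = B * (\<Sum>m\<le>n. (u ^ m / fact m) *\<^sub>n A ^ m)" for n
    by (simp add: sum_distrib_left sum_distrib_right)
  show ?thesis
  proof (rule ncs_eqI)
    fix w
    have "coef (nexp u A * B) w = coef ((\<Sum>m\<le>length w. (u ^ m / fact m) *\<^sub>n A ^ m) * B) w"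
      by (intro coef_mult_cong coef_nexp_eq assms) simp_all
    also have "\<dots> = coef (B * nexp u A) w"
      unfolding * by (intro coef_mult_cong coef_nexp_eq[symmetric] assms) simp_all
    finally show "coef (nexp u A * B) w = coef (B * nexp u A) w" .
  qed
qed

lemma nc_deriv_nexp:
  assumes "(u has_vector_derivative u') (at x)" "coef A [] = 0"
  shows "nc_deriv (\<lambda>x. nexp (u x) A) (u' *\<^sub>n (A * nexp (u x) A)) x"
  unfolding nc_deriv_def
proof
  fix w
  have pow: "((\<lambda>x. u x ^ m) has_vector_derivative of_nat m * u x ^ (m - 1) * u') (at x)" for m
  proof -
    have "((\<lambda>z. z ^ m) has_field_derivative of_nat m * u x ^ (m - 1)) (at (u x))"
      by (auto intro!: derivative_eq_intros)
    from field_vector_diff_chain_at[OF assms(1) this] show ?thesis by (simp add: o_def mult_ac)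
  qed
  have "((\<lambda>x. \<Sum>m\<le>length w. u x ^ m / fact m * coef (A ^ m) w) has_vector_derivative
     (\<Sum>m\<le>length w. of_nat m * u x ^ (m - 1) * u' / fact m * coef (A ^ m) w)) (at x)"
    by (intro has_vector_derivative_sum has_vector_derivative_mult_left has_vector_derivative_divide pow)
  moreover have "(\<Sum>m\<le>length w. of_nat m * u x ^ (m - 1) * u' / fact m * coef (A ^ m) w) =
      coef (u' *\<^sub>n (A * nexp (u x) A)) w"
  proof (cases "length w")
    case 0
    then show ?thesis using assms by simp
  next
    case (Suc n)
    have "coef (A * nexp (u x) A) w = coef (A * (\<Sum>m\<le>n. (u x ^ m / fact m) *\<^sub>n A ^ m)) w"
    proof -
      \<comment> \<open>The empty prefix contributes nothing, so the exponential is only evaluated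
        on words of length at most \<open>n\<close>.\<close>
      have "coef A (take i w) * coef (nexp (u x) A) (drop i w) =
        coef A (take i w) * coef (\<Sum>m\<le>n. (u x ^ m / fact m) *\<^sub>n A ^ m) (drop i w)"
        if "i \<le> length w" for i
        using Suc assms that by (cases "i = 0") (auto intro!: coef_nexp_eq)
      then show ?thesis by (auto simp: coef_mult intro!: sum.cong)
    qed
    also have "\<dots> = (\<Sum>m\<le>n. u x ^ m / fact m * coef (A ^ Suc m) w)"
      by (simp add: sum_distrib_left coef_sum)
    finally show ?thesis
      unfolding Suc sum.atMost_Suc_shift
      by (simp add: sum_distrib_left del: of_nat_Suc power_Suc) (simp add: field_simps)
  qed
  ultimately show "((\<lambda>x. coef (nexp (u x) A) w) has_vector_derivative
      coef (u' *\<^sub>n (A * nexp (u x) A)) w) (at x)"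
    by (simp add: nexp_def)
qed

text \<open>Both factors commute with \<open>A\<close>, so the product along \<open>x * u\<close>
  has derivative zero in \<open>x\<close>; its values at \<open>x = 1\<close> and
  \<open>x = 0\<close> are the two sides.\<close>

lemma nexp_mult_uminus:
  assumes "coef A [] = 0"
  shows "nexp (u + v) A * nexp (- u) A = nexp v A"
proof -
  have 1: "((\<lambda>x. of_real x * u + v) has_vector_derivative u) (at x)" for x
    by (auto intro!: derivative_eq_intros simp: has_vector_derivative_def scaleR_conv_of_real)
  have 2: "((\<lambda>x. - (of_real x * u)) has_vector_derivative - u) (at x)" for x
    by (auto intro!: derivative_eq_intros simp: has_vector_derivative_def scaleR_conv_of_real)
  have "nc_deriv (\<lambda>x. nexp (of_real x * u + v) A * nexp (- (of_real x * u)) A) 0 x" for x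
  proof -
    have "nexp (of_real x * u + v) A * A = A * nexp (of_real x * u + v) A"
      by (rule nexp_commute) (simp_all add: assms)
    hence "nexp (of_real x * u + v) A * (A * B) = A * nexp (of_real x * u + v) A * B" for B
      by (simp flip: mult.assoc)
    then show ?thesis
      using nc_deriv_mult[OF nc_deriv_nexp[OF 1 assms] nc_deriv_nexp[OF 2 assms], of x]
      by (simp add: nscale_minus mult.assoc)
  qed
  from nc_deriv_zero_imp_eq[of 0 1, OF this, of 1 0] show ?thesis by simp
qed

lemma nexp_add:
  assumes "coef A [] = 0"
  shows "nexp (u + v) A = nexp u A * nexp v A"
proof -
  have *: "nexp (- u) A * nexp u A = 1"
    using nexp_mult_uminus[OF assms, of "- u" 0] by simp
  have "nexp (u + v) A * (nexp (- u) A * nexp u A) = nexp v A * nexp u A"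
    by (simp add: nexp_mult_uminus[OF assms] flip: mult.assoc)
  hence "nexp (u + v) A = nexp v A * nexp u A" by (simp add: *)
  also have "\<dots> = nexp u A * nexp v A"
    using nexp_commute[OF assms nexp_commute[OF assms refl, of u, symmetric], of v] by simp
  finally show ?thesis .
qed

lemma nexp_cancel [simp]:
  assumes "coef A [] = 0"
  shows "nexp u A * nexp (- u) A = 1" "nexp (- u) A * nexp u A = 1"
    "nexp u A * (nexp (- u) A * B) = B" "nexp (- u) A * (nexp u A * B) = B"
  using nexp_add[OF assms, of u "- u"] nexp_add[OF assms, of "- u" u]
  by (simp_all flip: mult.assoc)

lemma ninv_nexp: "coef A [] = 0 \<Longrightarrow> ninv (nexp u A) = nexp (- u) A"
  by (rule ninv_unique) simp_all

lemma nexp_minus: "nexp u (- A) = nexp (- u) A"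
proof -
  have "(u ^ m / fact m) * coef ((- A) ^ m) w = ((- u) ^ m / fact m) * coef (A ^ m) w" for m w
    using nscale_power[of "-1" A m] by (simp add: nscale_minus_one power_minus[of u])
  then show ?thesis by (simp add: nexp_def)
qed

section \<open>The Knizhnik--Zamolodchikov equation\<close>

definition linear_ncs :: "'a ncs \<Rightarrow> bool" where
  "linear_ncs A \<longleftrightarrow> (\<forall>w. length w \<noteq> 1 \<longrightarrow> coef A w = 0)"

lemma linear_ncs_Nil [simp]: "linear_ncs A \<Longrightarrow> coef A [] = 0"
  by (simp add: linear_ncs_def)

lemma linear_ncs_intros [intro]:
  "linear_ncs A \<Longrightarrow> linear_ncs B \<Longrightarrow> linear_ncs (A + B)"
  "linear_ncs A \<Longrightarrow> linear_ncs B \<Longrightarrow> linear_ncs (A - B)"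
  "linear_ncs A \<Longrightarrow> linear_ncs (- A)"
  "linear_ncs A \<Longrightarrow> linear_ncs (c *\<^sub>n A)"
  by (simp_all add: linear_ncs_def)

lemma coef_linear_mult:
  assumes "linear_ncs A"
  shows "coef (A * f) (a # w) = coef A [a] * coef f w"
proof -
  have "coef A (take i (a # w)) * coef f (drop i (a # w)) = 0" if "i \<noteq> 1" "i \<le> length (a # w)" for i
    using assms that by (auto simp: linear_ncs_def min_def)
  hence "coef (A * f) (a # w) = (\<Sum>i\<in>{1}. coef A (take i (a # w)) * coef f (drop i (a # w)))"
    unfolding coef_mult by (intro sum.mono_neutral_right) auto
  then show ?thesis by simp
qed

lemma coef_mult_linear:
  assumes "linear_ncs A"
  shows "coef (f * A) (w @ [a]) = coef f w * coef A [a]"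
proof -
  have "coef f (take i (w @ [a])) * coef A (drop i (w @ [a])) = 0"
    if "i \<noteq> length w" "i \<le> length (w @ [a])" for i
    using assms that by (auto simp: linear_ncs_def)
  hence "coef (f * A) (w @ [a]) = (\<Sum>i\<in>{length w}. coef f (take i (w @ [a])) * coef A (drop i (w @ [a])))"
    unfolding coef_mult by (intro sum.mono_neutral_right) auto
  then show ?thesis by simp
qed

text \<open>The plane cut along the ray going up from 1. It contains the half plane left of 1 and
  the closed lower half plane without 1, where all the paths run.\<close>

definition slit_plane :: "complex set" where
  "slit_plane = {z. Re z \<noteq> 1 \<or> Im z < 0}"

lemma open_slit_plane: "open slit_plane"
proof -
  have "slit_plane = {z. Re z < 1} \<union> {z. Re z > 1} \<union> {z. Im z < 0}"
    by (auto simp: slit_plane_def)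
  moreover have "open ({z. Re z < 1} \<union> {z. Re z > 1} \<union> {z. Im z < 0})"
    by (intro open_Un open_halfspace_Re_lt open_halfspace_Re_gt open_halfspace_Im_lt)
  ultimately show ?thesis by simp
qed

text \<open>The centre \<open>1 - \<i>\<close> lies straight below the cut, so segments from it to
  points of the region never meet the cut.\<close>

lemma starlike_slit_plane: "starlike slit_plane"
proof -
  have "closed_segment (1 - \<i>) x \<subseteq> slit_plane" if "x \<in> slit_plane" for x
  proof
    fix y assume "y \<in> closed_segment (1 - \<i>) x"
    then obtain u where u: "0 \<le> u" "u \<le> 1" "y = (1 - u) *\<^sub>R (1 - \<i>) + u *\<^sub>R x"
      by (auto simp: closed_segment_def)
    show "y \<in> slit_plane"
    proof (cases "Re x = 1")
      case True
      with that have "Im x < 0" by (auto simp: slit_plane_def)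
      hence "(1 - u) * 1 + u * (- Im x) > 0"
        using u(1,2) mult_pos_neg[of u "Im x"] by (cases "u = 0") auto
      then show ?thesis by (simp add: u slit_plane_def)
    next
      case False
      show ?thesis
      proof (cases "u = 0")
        case nz: False
        have "Re y - 1 = u * (Re x - 1)" by (simp add: u algebra_simps)
        with nz False show ?thesis by (auto simp: slit_plane_def)
      qed (simp add: u slit_plane_def)
    qed
  qed
  moreover have "1 - \<i> \<in> slit_plane" by (simp add: slit_plane_def)
  ultimately show ?thesis unfolding starlike_def by blast
qed

lemma slit_plane_simps [simp]: "0 \<in> slit_plane" "1 \<notin> slit_plane"
  by (simp_all add: slit_plane_def)

text \<open>The zero of \<open>f\<close> at 0 cancels the pole there, so the integrand is
  holomorphic on a starlike region and has a primitive.\<close>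

lemma kz_primitive:
  assumes "f holomorphic_on slit_plane" "f 0 = 0" "g holomorphic_on slit_plane"
  obtains F where "F holomorphic_on slit_plane" "F 0 = 0"
    "\<And>z. z \<in> slit_plane \<Longrightarrow> z \<noteq> 0 \<Longrightarrow> (F has_field_derivative f z / z + g z / (z - 1)) (at z)"
proof -
  define h where "h z = (if z = 0 then deriv f 0 else f z / z)" for z
  have "h holomorphic_on slit_plane"
    by (rule pole_theorem_open_0[OF assms(1) open_slit_plane, of 0]) (auto simp: h_def assms)
  moreover have "z - 1 \<noteq> 0" if "z \<in> slit_plane" for z using that by auto
  ultimately have hol: "(\<lambda>z. h z + g z / (z - 1)) holomorphic_on slit_plane"
    by (intro holomorphic_intros assms) auto
  then obtain F where F: "\<And>z. z \<in> slit_plane \<Longrightarrow> (F has_field_derivative h z + g z / (z - 1)) (at z)"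
    using holomorphic_starlike_primitive[OF holomorphic_on_imp_continuous_on[OF hol]
        starlike_slit_plane open_slit_plane finite.emptyI]
      holomorphic_on_imp_differentiable_at[OF hol open_slit_plane] by auto
  show ?thesis
  proof (rule that[of "\<lambda>z. F z - F 0"])
    show "(\<lambda>z. F z - F 0) holomorphic_on slit_plane"
      using F by (intro holomorphic_intros) (auto simp: holomorphic_on_open open_slit_plane)
    show "((\<lambda>z. F z - F 0) has_field_derivative f z / z + g z / (z - 1)) (at z)"
      if "z \<in> slit_plane" "z \<noteq> 0" for z
      using DERIV_diff[OF F[OF that(1)] DERIV_const[of "F 0"]] that by (simp add: h_def)
  qed simp
qed

text \<open>
  Coefficients of the holomorphic factor \<open>P\<close> in the solution \<open>P(z) z\<^sup>A\<close> of
  \<open>Y' = (A/z + B/(z-1)) Y\<close> with \<open>P(0) = 1\<close>: it satisfies \<open>P' = (A P - P A)/z + B P/(z-1)\<close>,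
  which determines its coefficients by induction on the length of the word.
\<close>

function kz_coef :: "'a ncs \<Rightarrow> 'a ncs \<Rightarrow> 'a list \<Rightarrow> complex \<Rightarrow> complex" where
  "kz_coef A B [] = (\<lambda>_. 1)"
| "kz_coef A B (a # w) = (SOME F. F holomorphic_on slit_plane \<and> F 0 = 0 \<and>
     (\<forall>z\<in>slit_plane. z \<noteq> 0 \<longrightarrow> (F has_field_derivative
        (coef A [a] * kz_coef A B w z - kz_coef A B (butlast (a # w)) z * coef A [last (a # w)]) / z
          + coef B [a] * kz_coef A B w z / (z - 1)) (at z)))"
  by pat_completeness auto
termination by (relation "Wellfounded.measure (\<lambda>(A, B, w). length w)") auto

declare kz_coef.simps(2) [simp del]

lemma kz_coef:
  "kz_coef A B w holomorphic_on slit_plane \<and> kz_coef A B w 0 = (if w = [] then 1 else 0) \<and>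
   (\<forall>a u. w = a # u \<longrightarrow> (\<forall>z\<in>slit_plane. z \<noteq> 0 \<longrightarrow> (kz_coef A B w has_field_derivative
      (coef A [a] * kz_coef A B u z - kz_coef A B (butlast w) z * coef A [last w]) / z
        + coef B [a] * kz_coef A B u z / (z - 1)) (at z)))"
proof (induction "length w" arbitrary: w rule: less_induct)
  case less
  show ?case
  proof (cases w)
    case (Cons a u)
    define f where "f z = coef A [a] * kz_coef A B u z - kz_coef A B (butlast w) z * coef A [last w]" for z
    have IH: "kz_coef A B u holomorphic_on slit_plane" "kz_coef A B (butlast w) holomorphic_on slit_plane"
       "kz_coef A B u 0 = (if u = [] then 1 else 0)"
       "kz_coef A B (butlast w) 0 = (if butlast w = [] then 1 else 0)"
      using less[of u] less[of "butlast w"] by (simp_all add: Cons del: butlast.simps)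
    have nil: "butlast w = [] \<longleftrightarrow> u = []" "u = [] \<Longrightarrow> last w = a"
      by (simp_all add: Cons)
    have "f holomorphic_on slit_plane"
      unfolding f_def by (intro holomorphic_intros IH)
    \<comment> \<open>For a one-letter word the two terms are both \<open>coef A [a]\<close>; for a
      longer word both shorter coefficients vanish at 0.\<close>
    moreover have "f 0 = 0"
      by (simp add: f_def IH(3,4) nil)
    moreover have "(\<lambda>z. coef B [a] * kz_coef A B u z) holomorphic_on slit_plane"
      by (intro holomorphic_intros IH)
    ultimately have "\<exists>F. F holomorphic_on slit_plane \<and> F 0 = 0 \<and>
     (\<forall>z\<in>slit_plane. z \<noteq> 0 \<longrightarrow> (F has_field_derivative f z / z + coef B [a] * kz_coef A B u z / (z - 1)) (at z))"
      using kz_primitive by metis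
    from someI_ex[OF this] show ?thesis
      unfolding Cons kz_coef.simps(2)[of A B a u] f_def by (auto simp del: butlast.simps last.simps)
  qed auto
qed

definition kzs :: "'a ncs \<Rightarrow> 'a ncs \<Rightarrow> complex \<Rightarrow> 'a ncs" where
  "kzs A B z = Abs_ncs (\<lambda>w. kz_coef A B w z)"

lemma kzs_0 [simp]: "kzs A B 0 = 1"
  by (rule ncs_eqI) (simp add: kzs_def kz_coef)

lemma coef_kzs_Nil [simp]: "coef (kzs A B z) [] = 1"
  by (simp add: kzs_def)

lemma nc_deriv_kzs:
  assumes A: "linear_ncs A" and B: "linear_ncs B"
    and c: "(c has_vector_derivative c') (at x)" "c x \<in> slit_plane" "c x \<noteq> 0"
  shows "nc_deriv (\<lambda>x. kzs A B (c x)) ((c' / c x) *\<^sub>n (A * kzs A B (c x) - kzs A B (c x) * A)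
      + (c' / (c x - 1)) *\<^sub>n (B * kzs A B (c x))) x"
  unfolding nc_deriv_def
proof
  fix w
  show "((\<lambda>x. coef (kzs A B (c x)) w) has_vector_derivative
      coef ((c' / c x) *\<^sub>n (A * kzs A B (c x) - kzs A B (c x) * A) + (c' / (c x - 1)) *\<^sub>n (B * kzs A B (c x))) w) (at x)"
  proof (cases w)
    case Nil
    then show ?thesis using A B by simp
  next
    case (Cons a u)
    have "coef (kzs A B (c x) * A) w = kz_coef A B (butlast w) (c x) * coef A [last w]"
      using coef_mult_linear[OF A, of "kzs A B (c x)" "butlast w" "last w"] Cons
      by (simp add: kzs_def del: butlast.simps last.simps)
    moreover have "((kz_coef A B w \<circ> c) has_vector_derivative c' *
      ((coef A [a] * kz_coef A B u (c x) - kz_coef A B (butlast w) (c x) * coef A [last w]) / c x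
        + coef B [a] * kz_coef A B u (c x) / (c x - 1))) (at x)"
      using kz_coef[of A B w] c Cons by (intro field_vector_diff_chain_at) auto
    moreover have "coef (A * kzs A B (c x)) w = coef A [a] * kz_coef A B u (c x)"
        "coef (B * kzs A B (c x)) w = coef B [a] * kz_coef A B u (c x)"
      by (simp_all add: Cons coef_linear_mult A B kzs_def)
    ultimately show ?thesis
      by (simp add: kzs_def o_def algebra_simps add_divide_distrib diff_divide_distrib)
  qed
qed

text \<open>This covers \<open>c x = 0\<close>, where the explicit derivative would divide by zero.
  The limits in \<epsilon> need differentiability at exactly that point.\<close>

lemma nc_deriv_kzs_ex:
  assumes "(c has_vector_derivative c') (at x)" "c x \<in> slit_plane"
  shows "\<exists>D. nc_deriv (\<lambda>x. kzs A B (c x)) D x"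
proof -
  have "\<exists>D. ((\<lambda>x. kz_coef A B w (c x)) has_vector_derivative D) (at x)" for w
  proof -
    have "kz_coef A B w field_differentiable at (c x)"
      using kz_coef[of A B w] assms(2) holomorphic_on_imp_differentiable_at[OF _ open_slit_plane] by blast
    then obtain D where "(kz_coef A B w has_field_derivative D) (at (c x))"
      by (auto simp: field_differentiable_def)
    from field_vector_diff_chain_at[OF assms(1) this] show ?thesis by (auto simp: o_def)
  qed
  then obtain D where "\<And>w. ((\<lambda>x. kz_coef A B w (c x)) has_vector_derivative D w) (at x)" by metis
  then have "nc_deriv (\<lambda>x. kzs A B (c x)) (Abs_ncs D) x"
    by (simp add: nc_deriv_def kzs_def)
  then show ?thesis by blast
qed

text \<open>The derivative of the exponential cancels the term \<open>- P A\<close> in the equation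
  of the regular factor. Since \<open>l\<close> enters only through its derivative, any branch of
  the logarithm along the path may be used.\<close>

lemma kz_along:
  assumes A: "linear_ncs A" and B: "linear_ncs B"
    and c: "(c has_vector_derivative c') (at x)" "c x \<in> slit_plane" "c x \<noteq> 0"
    and l: "(l has_vector_derivative c' / c x) (at x)"
  shows "nc_deriv (\<lambda>x. kzs A B (c x) * nexp (l x) A)
     (((c' / c x) *\<^sub>n A + (c' / (c x - 1)) *\<^sub>n B) * (kzs A B (c x) * nexp (l x) A)) x"
  using nc_deriv_mult[OF nc_deriv_kzs[OF assms(1-5)] nc_deriv_nexp[OF l linear_ncs_Nil[OF A]]]
  by (simp add: algebra_simps nscale_add nscale_diff)

lemma nc_quotient_deriv:
  assumes "nc_deriv Y (G * Y x) x" "nc_deriv Z (G * Z x) x" "\<And>x. coef (Y x) [] = 1"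
  shows "nc_deriv (\<lambda>x. ninv (Y x) * Z x) 0 x"
proof -
  have "- ninv (Y x) * (G * Y x) * ninv (Y x) * Z x + ninv (Y x) * (G * Z x) = 0"
    using assms(3) by (simp add: mult.assoc)
  with nc_deriv_mult[OF nc_deriv_ninv[OF assms(1,3)] assms(2)] show ?thesis by simp
qed

definition kz_sol :: "'a ncs \<Rightarrow> 'a ncs \<Rightarrow> real \<Rightarrow> 'a ncs" where
  "kz_sol A B x = kzs A B (of_real x) * nexp (of_real (ln x)) A"

text \<open>\<open>kz_sol A B x\<close> behaves like \<open>x\<close> to the power \<open>A\<close>
  at 0, and by the symmetry exchanging \<open>x\<close> with \<open>1 - x\<close>,
  \<open>kz_sol B A (1 - x)\<close> solves the same equation and is normalised at 1. Their quotient
  is Drinfeld's associator; read off at the fixed point 1/2, it is visibly inverted when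
  \<open>A\<close> and \<open>B\<close> are exchanged.\<close>

definition kz_assoc :: "'a ncs \<Rightarrow> 'a ncs \<Rightarrow> 'a ncs" where
  "kz_assoc A B = ninv (kz_sol B A (1 / 2)) * kz_sol A B (1 / 2)"

lemma coef_kz_sol_Nil [simp]: "coef (kz_sol A B x) [] = 1"
  by (simp add: kz_sol_def)

lemma kz_assoc_inverse: "kz_assoc B A * kz_assoc A B = 1"
  by (simp add: kz_assoc_def mult.assoc ninv)

lemma has_vector_derivative_ln:
  "0 < x \<Longrightarrow> ((\<lambda>x. of_real (ln x) :: complex) has_vector_derivative of_real (1 / x)) (at x)"
  by (intro has_vector_derivative_of_real) (auto intro!: derivative_eq_intros)

lemma nc_deriv_kz_sol:
  assumes "linear_ncs A" "linear_ncs B" "0 < x" "x < 1"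
  shows "nc_deriv (kz_sol A B) ((of_real (1 / x) *\<^sub>n A + of_real (1 / (x - 1)) *\<^sub>n B) * kz_sol A B x) x"
proof -
  have "nc_deriv (\<lambda>x. kzs A B (of_real x) * nexp (of_real (ln x)) A)
     (((1 / of_real x) *\<^sub>n A + (1 / (of_real x - 1)) *\<^sub>n B) * (kzs A B (of_real x) * nexp (of_real (ln x)) A)) x"
  proof (rule kz_along[OF assms(1,2)])
    show "(complex_of_real has_vector_derivative 1) (at x)"
      using has_vector_derivative_of_real[OF DERIV_ident] by simp
    show "((\<lambda>x. complex_of_real (ln x)) has_vector_derivative 1 / complex_of_real x) (at x)"
      using has_vector_derivative_ln[OF assms(3)] by simp
  qed (use assms(3,4) in \<open>auto simp: slit_plane_def\<close>)
  then show ?thesis by (simp add: kz_sol_def[abs_def])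
qed

text \<open>The quotient of the two solutions is constant between 0 and 1, and
  \<open>kz_assoc\<close> is its value at 1/2.\<close>

lemma kz_connection:
  assumes A: "linear_ncs A" and B: "linear_ncs B" and x: "0 < x" "x < 1"
  shows "kz_sol A B x = kz_sol B A (1 - x) * kz_assoc A B"
proof -
  define a where "a = min x (1 / 2)"
  define b where "b = max x (1 / 2)"
  have ab: "0 < a" "b < 1" using x by (auto simp: a_def b_def)
  have "ninv (kz_sol B A (1 - x)) * kz_sol A B x = ninv (kz_sol B A (1 - 1 / 2)) * kz_sol A B (1 / 2)"
  proof (rule nc_deriv_zero_imp_eq[where a = a and b = b])
    fix y assume y: "y \<in> {a..b}"
    hence y': "0 < y" "y < 1" using ab by auto
    have "nc_deriv (\<lambda>y. kz_sol B A (1 - y)) (of_real (- 1) *\<^sub>n ((of_real (1 / (1 - y)) *\<^sub>n B +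
         of_real (1 / (1 - y - 1)) *\<^sub>n A) * kz_sol B A (1 - y))) y"
      using y' by (intro nc_deriv_chain nc_deriv_kz_sol A B derivative_eq_intros) auto
    also have "of_real (- 1) *\<^sub>n ((of_real (1 / (1 - y)) *\<^sub>n B + of_real (1 / (1 - y - 1)) *\<^sub>n A) * kz_sol B A (1 - y))
       = (of_real (1 / y) *\<^sub>n A + of_real (1 / (y - 1)) *\<^sub>n B) * kz_sol B A (1 - y)"
    proof -
      have 1: "- (1 / (1 - y)) = 1 / (y - 1)" "- (1 / (1 - y - 1)) = 1 / y"
        using y' by (simp_all add: field_simps)
      have "of_real (- 1) *\<^sub>n (of_real (1 / (1 - y)) *\<^sub>n B + of_real (1 / (1 - y - 1)) *\<^sub>n A)
         = of_real (1 / y) *\<^sub>n A + of_real (1 / (y - 1)) *\<^sub>n B"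
        by (simp only: nscale_add nscale_nscale flip: of_real_mult) (simp add: 1 add.commute del: of_real_divide of_real_diff of_real_minus)
      then show ?thesis by (metis nscale_mult_left)
    qed
    finally show "nc_deriv (\<lambda>x. ninv (kz_sol B A (1 - x)) * kz_sol A B x) 0 y"
      by (rule nc_quotient_deriv[OF _ nc_deriv_kz_sol[OF A B y']]) simp
  qed (auto simp: a_def b_def)
  hence "kz_sol B A (1 - x) * (ninv (kz_sol B A (1 - x)) * kz_sol A B x) = kz_sol B A (1 - x) * kz_assoc A B"
    by (simp add: kz_assoc_def)
  then show ?thesis by simp
qed


subsection \<open>Limits\<close>

text \<open>Growth slower than every negative power of \<epsilon>, as for powers of the logarithm.
  Allowing every positive \<open>d\<close> makes the class closed under products, since
  \<open>d\<close> can be split in half.\<close>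

definition nc_slow :: "(real \<Rightarrow> 'a ncs) \<Rightarrow> bool" where
  "nc_slow f \<longleftrightarrow> (\<forall>w. \<forall>d>0. ((\<lambda>\<epsilon>. coef (f \<epsilon>) w * of_real (\<epsilon> powr d)) \<longlongrightarrow> 0) (at_right 0))"

lemma nc_slow_mult:
  assumes "nc_slow f" "nc_slow g"
  shows "nc_slow (\<lambda>x. f x * g x)"
  unfolding nc_slow_def
proof (intro allI impI)
  fix w and d :: real assume d: "d > 0"
  have "((\<lambda>\<epsilon>. \<Sum>i\<le>length w. (coef (f \<epsilon>) (take i w) * of_real (\<epsilon> powr (d / 2))) *
     (coef (g \<epsilon>) (drop i w) * of_real (\<epsilon> powr (d / 2)))) \<longlongrightarrow> (\<Sum>i\<le>length w. 0 * 0)) (at_right 0)"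
    using assms d by (intro tendsto_intros) (auto simp: nc_slow_def)
  moreover have "(\<Sum>i\<le>length w. (coef (f \<epsilon>) (take i w) * of_real (\<epsilon> powr (d / 2))) *
     (coef (g \<epsilon>) (drop i w) * of_real (\<epsilon> powr (d / 2)))) = coef (f \<epsilon> * g \<epsilon>) w * of_real (\<epsilon> powr d)" for \<epsilon>
  proof -
    have "\<epsilon> powr d = \<epsilon> powr (d / 2) * \<epsilon> powr (d / 2)" by (simp flip: powr_add)
    hence *: "of_real (\<epsilon> powr d) = of_real (\<epsilon> powr (d / 2)) * (of_real (\<epsilon> powr (d / 2)) :: complex)"
      by (simp flip: of_real_mult)
    show ?thesis unfolding coef_mult sum_distrib_right *
      by (intro sum.cong) (simp_all add: mult_ac)
  qed
  ultimately show "((\<lambda>\<epsilon>. coef (f \<epsilon> * g \<epsilon>) w * of_real (\<epsilon> powr d)) \<longlongrightarrow> 0) (at_right 0)"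
    by simp
qed

lemma powr_ln_tendsto_0:
  assumes "d > 0"
  shows "((\<lambda>\<epsilon>::real. ln \<epsilon> ^ m * \<epsilon> powr d) \<longlongrightarrow> 0) (at_right 0)"
  using assms by real_asymp

lemma nc_slow_nexp: "nc_slow (\<lambda>\<epsilon>. nexp (c * of_real (ln \<epsilon>)) A)"
  unfolding nc_slow_def
proof (intro allI impI)
  fix w :: "'a list" and d :: real assume d: "d > 0"
  have "((\<lambda>\<epsilon>. \<Sum>m\<le>length w. c ^ m / fact m * coef (A ^ m) w * of_real (ln \<epsilon> ^ m * \<epsilon> powr d)) \<longlongrightarrow>
     (\<Sum>m\<le>length w. c ^ m / fact m * coef (A ^ m) w * of_real 0)) (at_right 0)"
    by (intro tendsto_intros powr_ln_tendsto_0 d)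
  then show "((\<lambda>\<epsilon>. coef (nexp (c * of_real (ln \<epsilon>)) A) w * of_real (\<epsilon> powr d)) \<longlongrightarrow> 0) (at_right 0)"
    by (simp add: nexp_def sum_distrib_left sum_distrib_right power_mult_distrib mult_ac)
qed

lemma nc_slow_quotient:
  assumes "nc_deriv M D 0"
  shows "nc_slow (\<lambda>\<epsilon>. of_real (1 / \<epsilon>) *\<^sub>n (M \<epsilon> - M 0))"
  unfolding nc_slow_def
proof (intro allI impI)
  fix w and d :: real assume d: "d > 0"
  have "((\<lambda>y. (coef (M y) w - coef (M 0) w) /\<^sub>R (y - 0)) \<longlongrightarrow> coef D w) (at 0)"
    using assms by (simp add: nc_deriv_def has_vector_derivative_iff_tendsto)
  hence "((\<lambda>y. (coef (M y) w - coef (M 0) w) /\<^sub>R y) \<longlongrightarrow> coef D w) (at_right 0)"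
    by (auto intro: tendsto_within_subset)
  moreover have "((\<lambda>\<epsilon>::real. \<epsilon> powr d) \<longlongrightarrow> 0) (at_right 0)"
    using d by real_asymp
  ultimately have "((\<lambda>\<epsilon>. (coef (M \<epsilon>) w - coef (M 0) w) /\<^sub>R \<epsilon> * of_real (\<epsilon> powr d)) \<longlongrightarrow> coef D w * of_real 0) (at_right 0)"
    by (intro tendsto_intros)
  then show "((\<lambda>\<epsilon>. coef (of_real (1 / \<epsilon>) *\<^sub>n (M \<epsilon> - M 0)) w * of_real (\<epsilon> powr d)) \<longlongrightarrow> 0) (at_right 0)"
    by (simp add: scaleR_conv_of_real field_simps)
qed

text \<open>\<open>M \<epsilon> - 1\<close> is of order \<epsilon>, while on each word the
  conjugation costs only powers of ln \<epsilon>.\<close>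

lemma nc_conj_tendsto_1:
  assumes "nc_deriv M D 0" "M 0 = 1" "linear_ncs A"
  shows "nc_tendsto (\<lambda>\<epsilon>. nexp (- of_real (ln \<epsilon>)) A * M \<epsilon> * nexp (of_real (ln \<epsilon>)) A) 1 (at_right 0)"
  unfolding nc_tendsto_def
proof
  fix w
  define X where "X \<epsilon> = nexp (- of_real (ln \<epsilon>)) A * (of_real (1 / \<epsilon>) *\<^sub>n (M \<epsilon> - 1)) * nexp (of_real (ln \<epsilon>)) A" for \<epsilon>
  have "nc_slow X"
    unfolding X_def using nc_slow_nexp[of "-1" A] nc_slow_nexp[of 1 A] nc_slow_quotient[OF assms(1)]
    by (intro nc_slow_mult) (simp_all add: assms(2))
  hence "((\<lambda>\<epsilon>. coef (X \<epsilon>) w * of_real (\<epsilon> powr 1)) \<longlongrightarrow> 0) (at_right 0)"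
    unfolding nc_slow_def using zero_less_one by blast
  hence "((\<lambda>\<epsilon>. coef 1 w + coef (X \<epsilon>) w * of_real (\<epsilon> powr 1)) \<longlongrightarrow> coef 1 w + 0) (at_right 0)"
    by (intro tendsto_add tendsto_const)
  moreover have "eventually (\<lambda>\<epsilon>. coef (nexp (- of_real (ln \<epsilon>)) A * M \<epsilon> * nexp (of_real (ln \<epsilon>)) A) w =
      coef 1 w + coef (X \<epsilon>) w * of_real (\<epsilon> powr 1)) (at_right 0)"
    using eventually_at_right_less[of 0]
  proof eventually_elim
    case (elim \<epsilon>)
    have "nexp (- of_real (ln \<epsilon>)) A * M \<epsilon> * nexp (of_real (ln \<epsilon>)) A = 1 + of_real \<epsilon> *\<^sub>n X \<epsilon>"
      using elim assms(3) by (simp add: X_def algebra_simps)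
    then show ?case using elim by (simp add: mult.commute)
  qed
  ultimately show "((\<lambda>\<epsilon>. coef (nexp (- of_real (ln \<epsilon>)) A * M \<epsilon> * nexp (of_real (ln \<epsilon>)) A) w) \<longlongrightarrow> coef 1 w) (at_right 0)"
    by (simp add: filterlim_cong)
qed

section \<open>Holonomies with values in power series\<close>

text \<open>Paths and 2-paths are given by case distinctions; inside a piece the curve is replaced
  by a smooth formula on an open set.\<close>

lemma velocityI:
  assumes "(g has_vector_derivative d) (at r)" "r \<in> {0..1}" "open T" "r \<in> T" "\<And>x. x \<in> T \<Longrightarrow> g x = f x"
  shows "velocity f r = d"
proof -
  have "(f has_vector_derivative d) (at r)"
    using has_vector_derivative_transform_within_open[OF assms(1,3,4,5)] by blast
  hence "(f has_vector_derivative d) (at r within cbox 0 1)"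
    by (rule has_vector_derivative_at_within)
  then show ?thesis
    unfolding velocity_def using vector_derivative_within_cbox[of 0 1 r f d] assms(2) by simp
qed

lemma velocity_eq: "(f has_vector_derivative d) (at r) \<Longrightarrow> r \<in> {0..1} \<Longrightarrow> velocity f r = d"
  by (rule velocityI[of f d r UNIV]) auto

definition nc_connection :: "'a ncs \<Rightarrow> 'a ncs \<Rightarrow> 'a ncs \<Rightarrow> path2 \<Rightarrow> real \<Rightarrow> 'a ncs" where
  "nc_connection p q l P r =
     (velocity (fst \<circ> P) r / fst (P r)) *\<^sub>n p + (velocity (fst \<circ> P) r / (fst (P r) - 1)) *\<^sub>n q
       + (velocity (snd \<circ> P) r / snd (P r)) *\<^sub>n l"

text \<open>The 2-form with the relationators replaced by the commutators that they bound, so that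
  the Stokes formula becomes an identity between power series.\<close>

definition nc_curving :: "'a ncs \<Rightarrow> 'a ncs \<Rightarrow> 'a ncs \<Rightarrow> (real \<Rightarrow> path2) \<Rightarrow> real \<Rightarrow> real \<Rightarrow> 'a ncs" where
  "nc_curving p q l P s r =
     (let z = fst (P s r); v = snd (P s r);
          dsz = velocity (\<lambda>s. fst (P s r)) s; dsv = velocity (\<lambda>s. snd (P s r)) s;
          drz = velocity (\<lambda>r. fst (P s r)) r; drv = velocity (\<lambda>r. snd (P s r)) r
      in ((dsz * drv - drz * dsv) / v) *\<^sub>n ((1 / z) *\<^sub>n (p * l - l * p) + (1 / (z - 1)) *\<^sub>n (q * l - l * q)))"

text \<open>No initial value is imposed: the transport from \<open>r'\<close> to \<open>r\<close> is
  \<open>Y r * ninv (Y r')\<close>. The finite exceptional set and the derivatives within the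
  interval mirror \<open>solves\<close>, since the curves of a 2-path have corners.\<close>

definition fundamental :: "(real \<Rightarrow> 'a ncs) \<Rightarrow> (real \<Rightarrow> 'a ncs) \<Rightarrow> bool" where
  "fundamental G Y \<longleftrightarrow> (\<forall>r. coef (Y r) [] = 1) \<and> nc_cont {0..1} Y \<and>
     (\<exists>S. finite S \<and> (\<forall>r\<in>{0..1} - S. \<forall>w.
        ((\<lambda>x. coef (Y x) w) has_vector_derivative coef (G r * Y r) w) (at r within {0..1})))"

lemma fundamentalI:
  assumes "\<And>r. r \<in> {0..1} \<Longrightarrow> nc_deriv Y (G r * Y r) r" "\<And>r. coef (Y r) [] = 1"
  shows "fundamental G Y"
  unfolding fundamental_def
proof (intro conjI allI exI[of _ "{}"] ballI)
  show "nc_cont {0..1} Y" using assms(1) by (blast intro: nc_deriv_imp_cont)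
qed (use assms in \<open>auto simp: nc_deriv_def intro: has_vector_derivative_at_within\<close>)

lemma nc_cont_mult: "nc_cont S f \<Longrightarrow> nc_cont S g \<Longrightarrow> nc_cont S (\<lambda>x. f x * g x)"
  by (auto simp: nc_cont_def coef_mult intro!: continuous_intros)

lemma nc_cont_const: "nc_cont S (\<lambda>x. c)"
  by (simp add: nc_cont_def)

lemma nc_cont_compose: "nc_cont T f \<Longrightarrow> continuous_on S g \<Longrightarrow> g ` S \<subseteq> T \<Longrightarrow> nc_cont S (\<lambda>x. f (g x))"
  by (auto simp: nc_cont_def intro: continuous_on_compose2)

lemma nc_cont_cases_le:
  fixes a :: real
  assumes "nc_cont {x \<in> S. x \<le> a} f" "nc_cont {x \<in> S. a \<le> x} g" "f a = g a"
  shows "nc_cont S (\<lambda>x. if x \<le> a then f x else g x)"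
proof -
  have "continuous_on S (\<lambda>x. if x \<le> a then coef (f x) w else coef (g x) w)" for w
    using assms by (intro continuous_on_cases_le) (auto simp: nc_cont_def continuous_on_id)
  moreover have "(\<lambda>x. coef (if x \<le> a then f x else g x) w) = (\<lambda>x. if x \<le> a then coef (f x) w else coef (g x) w)" for w
    by auto
  ultimately show ?thesis unfolding nc_cont_def by (simp only:) simp
qed

lemma nc_deriv_transform:
  assumes "nc_deriv f f' x" "open T" "x \<in> T" "\<And>y. y \<in> T \<Longrightarrow> f y = g y"
  shows "nc_deriv g f' x"
  unfolding nc_deriv_def
proof
  fix w show "((\<lambda>x. coef (g x) w) has_vector_derivative coef f' w) (at x)"
    using assms has_vector_derivative_transform_within_open[of "\<lambda>x. coef (f x) w" "coef f' w" x T "\<lambda>x. coef (g x) w"]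
    by (auto simp: nc_deriv_def)
qed

section \<open>Stokes formula for 2-paths swept out by a vertical segment\<close>

definition has_holonomy2 :: "'a ncs \<Rightarrow> 'a ncs \<Rightarrow> 'a ncs \<Rightarrow> (real \<Rightarrow> path2) \<Rightarrow> 'a ncs \<Rightarrow> bool" where
  "has_holonomy2 p q l P B \<longleftrightarrow> (\<exists>Y I.
     (\<forall>s\<in>{0..1}. fundamental (nc_connection p q l (P s)) (Y s) \<and> Y s 0 = 1 \<and>
       (\<forall>w. ((\<lambda>r. coef (Y s 1 * ninv (Y s r) * nc_curving p q l P s r * Y s r) w)
          has_integral coef (I s) w) {0..1})) \<and>
     (\<forall>w. ((\<lambda>s. coef (I s) w) has_integral coef B w) {0..1}))"

text \<open>
  The 2-path \<open>P\<close> interpolates between the path \<open>(z, v\<^sub>1)\<close> followed by a vertical segment and, at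
  \<open>s = 0\<close>, the path \<open>(z, v\<^sub>1 \<cdot> (n \<circ> en))\<close>. At time \<open>s\<close> the vertical segment sits over \<open>z(s)\<close>; it is
  the only place where the 2-form does not vanish. If \<open>full\<close>, all of \<open>n\<close> is used for it, so that \<open>P\<close> fills
  a rectangle; otherwise it stops at \<open>n(s)\<close>, and \<open>P\<close> fills a triangle.
\<close>

locale sweep =
  fixes p q l :: "'a ncs" and z z' v v' n n' N :: "real \<Rightarrow> complex" and full :: bool
    and H Y :: "real \<Rightarrow> 'a ncs" and P :: "real \<Rightarrow> path2"
  assumes lin: "linear_ncs l"
    and z: "\<And>r. r \<in> {0..1} \<Longrightarrow> (z has_vector_derivative z' r) (at r)"
    and v: "\<And>r. r \<in> {0..1} \<Longrightarrow> (v has_vector_derivative v' r) (at r)" "\<And>r. r \<in> {0..1} \<Longrightarrow> v r \<noteq> 0"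
    and n: "\<And>r. r \<in> {0..1} \<Longrightarrow> (n has_vector_derivative n' r) (at r)" "\<And>r. r \<in> {0..1} \<Longrightarrow> n r \<noteq> 0"
    and N: "\<And>r. r \<in> {0..1} \<Longrightarrow> (N has_vector_derivative n' r / n r) (at r)" "N 0 = 0" "n 0 = 1"
    and H: "\<And>r. r \<in> {0..1} \<Longrightarrow> nc_deriv H (((z' r / z r) *\<^sub>n p + (z' r / (z r - 1)) *\<^sub>n q
               + (v' r / v r) *\<^sub>n l) * H r) r"
      "\<And>r. coef (H r) [] = 1" "H 0 = 1"
    and Y: "\<And>r. r \<in> {0..1} \<Longrightarrow> nc_deriv Y (((z' r / z r) *\<^sub>n p + (z' r / (z r - 1)) *\<^sub>n q
               + (v' r / v r + (if full then 0 else n' r / n r)) *\<^sub>n l) * Y r) r"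
      "\<And>r. coef (Y r) [] = 1"
    and P: "\<And>s r. P s r = (if r \<le> s / 2 then (z (2 * r), v (2 * r))
       else if r \<le> (if full then (1 + s) / 2 else s) then (z s, v s * n (2 * r - s))
       else if full then (z (2 * r - 1), v (2 * r - 1) * n 1)
       else (z r, v r * n r))"
begin

definition en :: "real \<Rightarrow> real" where "en s = (if full then 1 else s)"
definition mid :: "real \<Rightarrow> real" where "mid s = (s + en s) / 2"
definition tl :: "real \<Rightarrow> real" where "tl r = (if full then 2 * r - 1 else r)"
definition gam where "gam s = (z' s / z s) *\<^sub>n p + (z' s / (z s - 1)) *\<^sub>n q"
definition D where "D s = Y 1 * ninv (Y s)"
definition E where "E s = nexp (N (en s)) l"

text \<open>\<open>H\<close> transports along the first stretch, the exponential up the vertical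
  segment, and \<open>Y\<close> over the rest. The constant right factor glues the last piece
  continuously at \<open>mid s\<close>; the total is \<open>D s * E s * H s\<close>.\<close>

definition sol :: "real \<Rightarrow> real \<Rightarrow> 'a ncs" where
  "sol s r = (if r \<le> s / 2 then H (2 * r)
     else if r \<le> mid s then nexp (N (2 * r - s)) l * H s
     else Y (tl r) * (ninv (Y s) * E s * H s))"

lemma P': "P s r = (if r \<le> s / 2 then (z (2 * r), v (2 * r))
       else if r \<le> mid s then (z s, v s * n (2 * r - s))
       else (z (tl r), v (tl r) * n (en (tl r))))"
  by (auto simp: P mid_def tl_def en_def)

lemma mid:
  "s \<in> {0..1} \<Longrightarrow> s / 2 \<le> mid s" "s \<in> {0..1} \<Longrightarrow> mid s \<le> 1" "2 * mid s - s = en s" "tl (mid s) = s"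
  "s \<in> {0..1} \<Longrightarrow> en s \<in> {0..1}" "tl 1 = 1" "en 1 = 1" "mid 1 = 1"
  "s \<in> {0..1} \<Longrightarrow> r \<le> 1 \<Longrightarrow> mid s \<le> r \<Longrightarrow> tl r \<in> {0..1}"
  "s \<in> {0..1} \<Longrightarrow> s / 2 \<le> r \<Longrightarrow> r \<le> mid s \<Longrightarrow> 2 * r - s \<in> {0..1}"
  by (auto simp: mid_def tl_def en_def field_simps split: if_splits)

lemma coef_sol [simp]: "coef (sol s r) [] = 1"
  by (simp add: sol_def H Y E_def)

lemma sol_0: "s \<in> {0..1} \<Longrightarrow> sol s 0 = 1"
  by (simp add: sol_def H)

lemma sol_1: "s \<in> {0..1} \<Longrightarrow> sol s 1 = D s * E s * H s"
proof (cases "s = 1")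
  case True
  \<comment> \<open>At \<open>s = 1\<close> the endpoint \<open>r = 1\<close> still belongs to the
    vertical stretch, and \<open>D 1\<close> is 1.\<close>
  then show ?thesis using mid by (simp add: sol_def D_def E_def Y ninv)
next
  case False
  assume "s \<in> {0..1}"
  with False show ?thesis using mid by (auto simp: sol_def D_def mid_def en_def mult.assoc)
qed

lemma deriv_affine:
  fixes f :: "real \<Rightarrow> complex"
  assumes "(f has_vector_derivative f') (at (c * r + d))"
  shows "((\<lambda>r. f (c * r + d)) has_vector_derivative of_real c * f') (at r)"
proof -
  have "((\<lambda>r. c * r + d) has_vector_derivative c) (at r)"
    by (auto intro!: derivative_eq_intros simp: has_vector_derivative_def)
  from vector_diff_chain_at[OF this assms] show ?thesis by (simp add: o_def scaleR_conv_of_real)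
qed

lemma nc_deriv_affine:
  assumes "nc_deriv f f' (c * r + d)"
  shows "nc_deriv (\<lambda>r. f (c * r + d)) (of_real c *\<^sub>n f') r"
  by (rule nc_deriv_chain[of f _ "\<lambda>r. c * r + d", OF assms]) (auto intro!: derivative_eq_intros)

definition k where "k = (if full then 2 else 1 :: real)"
definition k0 where "k0 = (if full then - 1 else 0 :: real)"
lemma tl_eq: "tl r = k * r + k0" by (simp add: tl_def k_def k0_def)

definition v2 where "v2 r = v r * n (en r)"
definition v2' where "v2' r = v' r * n (en r) + (if full then 0 else v r * n' r)"

lemma v2: "r \<in> {0..1} \<Longrightarrow> (v2 has_vector_derivative v2' r) (at r)"
proof -
  assume r: "r \<in> {0..1}"
  show ?thesis
  proof (cases full)
    case True
    then show ?thesis using has_vector_derivative_mult_left[OF v(1)[OF r]]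
      unfolding v2_def v2'_def en_def by simp
  next
    case False
    then show ?thesis using has_vector_derivative_mult[OF v(1)[OF r] n(1)[OF r]]
      unfolding v2_def v2'_def en_def by (simp add: add.commute)
  qed
qed

lemma v2_log: "r \<in> {0..1} \<Longrightarrow> v2' r / v2 r = v' r / v r + (if full then 0 else n' r / n r)"
  using v(2)[of r] n(2)[of r] n(2)[of 1] by (simp add: v2_def v2'_def en_def field_simps)

lemma sol_fundamental:
  assumes s: "s \<in> {0..1}"
  shows "fundamental (nc_connection p q l (P s)) (sol s)"
  unfolding fundamental_def
proof (intro conjI allI exI[of _ "{s / 2, mid s}"] ballI)
  have Hc: "nc_cont {0..1} H" and Yc: "nc_cont {0..1} Y"
    using H Y by (blast intro: nc_deriv_imp_cont)+
  have Ec: "nc_cont {0..1} (\<lambda>x. nexp (N x) l)"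
    using nc_deriv_nexp[OF N(1) linear_ncs_Nil[OF lin]] by (blast intro: nc_deriv_imp_cont)
  show "nc_cont {0..1} (sol s)"
    unfolding sol_def[abs_def]
  proof (intro nc_cont_cases_le)
    show "nc_cont {x \<in> {0..1}. x \<le> s / 2} (\<lambda>x. H (2 * x))"
      using s by (intro nc_cont_compose[OF Hc] continuous_intros) auto
    show "nc_cont {x \<in> {x \<in> {0..1}. s / 2 \<le> x}. x \<le> mid s} (\<lambda>x. nexp (N (2 * x - s)) l * H s)"
      using mid(10)[OF s]
      by (intro nc_cont_mult nc_cont_const nc_cont_compose[OF Ec] continuous_intros) auto
    show "nc_cont {x \<in> {x \<in> {0..1}. s / 2 \<le> x}. mid s \<le> x} (\<lambda>x. Y (tl x) * (ninv (Y s) * E s * H s))"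
      using mid(9)[OF s] unfolding tl_eq
      by (intro nc_cont_mult nc_cont_const nc_cont_compose[OF Yc] continuous_intros) auto
    show "nexp (N (2 * mid s - s)) l * H s = Y (tl (mid s)) * (ninv (Y s) * E s * H s)"
      by (simp add: mid(3,4) E_def Y(2) mult.assoc)
    show "H (2 * (s / 2)) = (if s / 2 \<le> mid s then nexp (N (2 * (s / 2) - s)) l * H s
        else Y (tl (s / 2)) * (ninv (Y s) * E s * H s))"
      using mid(1)[OF s] by (simp add: N(2))
  qed
  fix r w assume r: "r \<in> {0..1} - {s / 2, mid s}"
  hence r01: "r \<in> {0..1}" by simp
  have "nc_deriv (sol s) (nc_connection p q l (P s) r * sol s r) r"
  proof -
    consider "r < s / 2" | "s / 2 < r" "r < mid s" | "mid s < r" "s / 2 < r" using r mid(1)[OF s] by force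
    then show ?thesis
    proof cases
      case 1
      hence r2: "2 * r \<in> {0..1}" using r s by auto
      have "velocity (fst \<circ> P s) r = 2 * z' (2 * r)"
        using deriv_affine[of z "z' (2 * r)" 2 r 0] z[OF r2] 1
        by (intro velocityI[OF _ r01, of "\<lambda>r. z (2 * r)" _ "{..<s/2}"]) (auto simp: P')
      moreover have "velocity (snd \<circ> P s) r = 2 * v' (2 * r)"
        using deriv_affine[of v "v' (2 * r)" 2 r 0] v[OF r2] 1
        by (intro velocityI[OF _ r01, of "\<lambda>r. v (2 * r)" _ "{..<s/2}"]) (auto simp: P')
      moreover have "nc_deriv (sol s) (2 *\<^sub>n (((z' (2 * r) / z (2 * r)) *\<^sub>n p + (z' (2 * r) / (z (2 * r) - 1)) *\<^sub>n q
               + (v' (2 * r) / v (2 * r)) *\<^sub>n l) * H (2 * r))) r"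
        by (rule nc_deriv_transform[OF nc_deriv_affine[of H _ 2 r 0, simplified, OF H(1)[OF r2]], of "{..<s/2}"])
          (use 1 in \<open>auto simp: sol_def\<close>)
      ultimately show ?thesis
        using 1 by (simp add: nc_connection_def P' sol_def nscale_add distrib_right)
    next
      case 2
      hence r2: "2 * r - s \<in> {0..1}" using mid s by auto
      have "velocity (fst \<circ> P s) r = 0"
        using 2 by (intro velocityI[OF _ r01, of "\<lambda>r. z s" _ "{s/2<..<mid s}"]) (auto simp: P')
      moreover have "velocity (snd \<circ> P s) r = v s * (2 * n' (2 * r - s))"
        using has_vector_derivative_mult_right[OF deriv_affine[of n "n' (2 * r - s)" 2 r "- s"], of "v s"] n[OF r2] 2
        by (intro velocityI[OF _ r01, of "\<lambda>r. v s * n (2 * r - s)" _ "{s/2<..<mid s}"]) (auto simp: P')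
      moreover have "nc_deriv (sol s) (((2 * (n' (2 * r - s) / n (2 * r - s))) *\<^sub>n (l * nexp (N (2 * r - s)) l)) * H s) r"
      proof (rule nc_deriv_transform[of "\<lambda>r. nexp (N (2 * r - s)) l * H s" _ r "{s/2<..<mid s}"])
        have "((\<lambda>r. N (2 * r - s)) has_vector_derivative 2 * (n' (2 * r - s) / n (2 * r - s))) (at r)"
          using deriv_affine[of N "n' (2 * r - s) / n (2 * r - s)" 2 r "- s"] N(1)[OF r2] by simp
        from nc_deriv_mult_right[OF nc_deriv_nexp[OF this linear_ncs_Nil[OF lin]]]
        show "nc_deriv (\<lambda>r. nexp (N (2 * r - s)) l * H s) (((2 * (n' (2 * r - s) / n (2 * r - s))) *\<^sub>n (l * nexp (N (2 * r - s)) l)) * H s) r" .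
      qed (use 2 in \<open>auto simp: sol_def\<close>)
      ultimately show ?thesis
        using 2 v(2)[OF s] by (simp add: nc_connection_def P' sol_def mult.assoc)
    next
      case 3
      hence r2: "tl r \<in> {0..1}" using mid s r by auto
      have "velocity (fst \<circ> P s) r = k * z' (tl r)"
        using deriv_affine[of z "z' (tl r)" k r k0] z[OF r2] 3
        by (intro velocityI[OF _ r01, of "\<lambda>r. z (tl r)" _ "{mid s<..} \<inter> {s/2<..}"]) (auto simp: P' tl_eq)
      moreover have "velocity (snd \<circ> P s) r = k * v2' (tl r)"
        using deriv_affine[of v2 "v2' (tl r)" k r k0] v2[OF r2] 3
        by (intro velocityI[OF _ r01, of "\<lambda>r. v2 (tl r)" _ "{mid s<..} \<inter> {s/2<..}"]) (auto simp: P' v2_def tl_eq)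
      moreover have "nc_deriv (sol s) ((of_real k *\<^sub>n (((z' (tl r) / z (tl r)) *\<^sub>n p + (z' (tl r) / (z (tl r) - 1)) *\<^sub>n q
               + (v2' (tl r) / v2 (tl r)) *\<^sub>n l) * Y (tl r))) * (ninv (Y s) * E s * H s)) r"
      proof (rule nc_deriv_transform[of "\<lambda>r. Y (tl r) * (ninv (Y s) * E s * H s)" _ r "{mid s<..} \<inter> {s/2<..}"])
        show "nc_deriv (\<lambda>r. Y (tl r) * (ninv (Y s) * E s * H s)) ((of_real k *\<^sub>n (((z' (tl r) / z (tl r)) *\<^sub>n p + (z' (tl r) / (z (tl r) - 1)) *\<^sub>n q
               + (v2' (tl r) / v2 (tl r)) *\<^sub>n l) * Y (tl r))) * (ninv (Y s) * E s * H s)) r"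
          unfolding v2_log[OF r2] unfolding tl_eq
          by (rule nc_deriv_mult_right[OF nc_deriv_affine[OF Y(1)[OF r2, unfolded tl_eq]]])
      qed (use 3 in \<open>auto simp: sol_def\<close>)
      ultimately show ?thesis
        using 3 by (simp add: nc_connection_def P' sol_def nscale_add distrib_right mult.assoc flip: v2_def)
    qed
  qed
  then show "((\<lambda>x. coef (sol s x) w) has_vector_derivative coef (nc_connection p q l (P s) r * sol s r) w) (at r within {0..1})"
    by (auto simp: nc_deriv_def intro: has_vector_derivative_at_within)
qed simp_all

definition inner where "inner s = D s * (gam s * E s - E s * gam s) * H s"

text \<open>On the vertical stretch the integrand is the derivative of an expression in which the
  horizontal connection \<open>gam s\<close> is inserted at variable height between two exponentials
  of \<open>l\<close>: differentiating the exponentials produces the commutator of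
  \<open>gam s\<close> with \<open>l\<close>. So the integral is the difference between inserting it
  at the far end and at the near end.\<close>

lemma inner_integral:
  assumes s: "s \<in> {0..1}"
  shows "((\<lambda>r. coef (sol s 1 * ninv (sol s r) * nc_curving p q l P s r * sol s r) w) has_integral coef (inner s) w) {0..1}"
proof -
  define A where "A r = D s * (nexp (N (en s) - N (2 * r - s)) l * gam s * nexp (N (2 * r - s)) l) * H s" for r
  define A' where "A' r = (2 * (n' (2 * r - s) / n (2 * r - s))) *\<^sub>n
     (D s * (nexp (N (en s) - N (2 * r - s)) l * (gam s * l - l * gam s) * nexp (N (2 * r - s)) l) * H s)" for r
  have comm: "nexp u l * l = l * nexp u l" for u
    by (rule nexp_commute) (simp_all add: lin)
  have comm': "nexp u l * (l * x) = l * (nexp u l * x)" for u x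
    by (simp add: comm flip: mult.assoc)
  have "nc_deriv A (A' r) r" if "r \<in> {s / 2..mid s}" for r
  proof -
    have r2: "2 * r - s \<in> {0..1}" using that mid(10)[OF s, of r] by auto
    have d: "((\<lambda>r. N (2 * r - s)) has_vector_derivative 2 * (n' (2 * r - s) / n (2 * r - s))) (at r)"
      using deriv_affine[of N "n' (2 * r - s) / n (2 * r - s)" 2 r "- s"] N(1)[OF r2] by simp
    have d': "((\<lambda>r. N (en s) - N (2 * r - s)) has_vector_derivative - (2 * (n' (2 * r - s) / n (2 * r - s)))) (at r)"
      using has_vector_derivative_diff[OF has_vector_derivative_const d] by simp
    have l0: "coef l [] = 0" using lin by simp
    show ?thesis
      unfolding A_def[abs_def]
      using nc_deriv_mult_right[OF nc_deriv_mult_left[OF nc_deriv_mult[OF nc_deriv_mult_right[OF nc_deriv_nexp[OF d' l0]] nc_deriv_nexp[OF d l0]]]]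
      by (rule back_subst[of "\<lambda>D. nc_deriv _ D r"])
        (simp add: A'_def algebra_simps nscale_minus nscale_diff comm comm')
  qed
  hence "((\<lambda>r. coef (A' r) w) has_integral coef (A (mid s)) w - coef (A (s / 2)) w) {s / 2..mid s}"
    by (intro fundamental_theorem_of_calculus mid(1) s)
      (auto simp: nc_deriv_def intro: has_vector_derivative_at_within)
  moreover have "coef (A (mid s)) w - coef (A (s / 2)) w = coef (inner s) w"
    by (simp add: A_def inner_def mid N E_def right_diff_distrib left_diff_distrib mult.assoc)
  ultimately have int: "((\<lambda>r. if r \<in> {s / 2..mid s} then coef (A' r) w else 0) has_integral coef (inner s) w) {0..1}"
    using mid(1,2)[OF s] s by (subst has_integral_restrict) auto
  have "coef (sol s 1 * ninv (sol s r) * nc_curving p q l P s r * sol s r) w =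
     (if r \<in> {s / 2..mid s} then coef (A' r) w else 0)"
    if r: "r \<in> {0..1} - {s / 2, mid s}" for r
  proof -
    have r01: "r \<in> {0..1}" using r by simp
    consider "r < s / 2" | "s / 2 < r" "r < mid s" | "mid s < r" "s / 2 < r" using r mid(1)[OF s] by force
    then show ?thesis
    proof cases
      case 1
      \<comment> \<open>Near this point the 2-path does not depend on \<open>s\<close>, so the
        2-form vanishes.\<close>
      have "velocity (\<lambda>s. fst (P s r)) s = 0" "velocity (\<lambda>s. snd (P s r)) s = 0"
        using 1 by (intro velocityI[OF _ s, of "\<lambda>s. z (2 * r)" _ "{2 * r<..}"] 
            velocityI[OF _ s, of "\<lambda>s. v (2 * r)" _ "{2 * r<..}"]; auto simp: P')+
      with 1 show ?thesis using mid(1)[OF s] by (simp add: nc_curving_def)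
    next
      case 3
      have op: "open {s. mid s < r \<and> s / 2 < r}"
        unfolding mid_def en_def by (cases full) (auto intro!: open_Collect_conj open_Collect_less continuous_intros)
      have "velocity (\<lambda>s. fst (P s r)) s = 0" "velocity (\<lambda>s. snd (P s r)) s = 0"
        using 3 by (intro velocityI[OF _ s op, of "\<lambda>s. z (tl r)"] 
            velocityI[OF _ s op, of "\<lambda>s. v (tl r) * n (en (tl r))"]; auto simp: P')+
      with 3 show ?thesis using mid(1)[OF s] by (simp add: nc_curving_def)
    next
      case 2
      have r2: "2 * r - s \<in> {0..1}" using mid(10)[OF s, of r] 2 by auto
      have op: "open {s. s / 2 < r \<and> r < mid s}"
        unfolding mid_def en_def by (cases full) (auto intro!: open_Collect_conj open_Collect_less continuous_intros)
      \<comment> \<open>Since the first coordinate is constant in \<open>r\<close> here, the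
        \<open>s\<close>-velocity of the second coordinate drops out of the 2-form.\<close>
      have "velocity (\<lambda>s. fst (P s r)) s = z' s"
        using 2 by (intro velocityI[OF _ s op, of z] z s) (auto simp: P')
      moreover have "velocity (\<lambda>r. fst (P s r)) r = 0"
        using 2 by (intro velocityI[OF _ r01, of "\<lambda>r. z s" _ "{s/2<..<mid s}"]) (auto simp: P')
      moreover have "velocity (\<lambda>r. snd (P s r)) r = v s * (2 * n' (2 * r - s))"
        using has_vector_derivative_mult_right[OF deriv_affine[of n "n' (2 * r - s)" 2 r "- s"], of "v s"] n[OF r2] 2
        by (intro velocityI[OF _ r01, of "\<lambda>r. v s * n (2 * r - s)" _ "{s/2<..<mid s}"]) (auto simp: P')
      moreover have "gam s * l - l * gam s = z' s *\<^sub>n ((1 / z s) *\<^sub>n (p * l - l * p) + (1 / (z s - 1)) *\<^sub>n (q * l - l * q))"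
        by (simp add: gam_def algebra_simps nscale_add nscale_diff)
      ultimately have cur: "nc_curving p q l P s r = (2 * (n' (2 * r - s) / n (2 * r - s))) *\<^sub>n (gam s * l - l * gam s)"
        using 2 v(2)[OF s] by (simp add: nc_curving_def P' Let_def mult_ac)
      have "sol s 1 * ninv (sol s r) = D s * (nexp (N (en s) - N (2 * r - s)) l)"
      proof -
        have l0: "coef l [] = 0" using lin by simp
        have "sol s r = nexp (N (2 * r - s)) l * H s" using 2 by (simp add: sol_def)
        hence "ninv (sol s r) = ninv (H s) * nexp (- N (2 * r - s)) l"
          by (simp add: ninv_mult H ninv_nexp l0)
        then show ?thesis
          using nexp_add[OF l0, of "N (en s)" "- N (2 * r - s)"]
          by (simp add: sol_1[OF s] mult.assoc H E_def)
      qed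
      then show ?thesis
        using 2 by (simp add: cur A'_def sol_def mult.assoc)
    qed
  qed
  then show ?thesis
    by (rule has_integral_spike_finite[OF _ _ int, of "{s / 2, mid s}", rotated]) simp_all
qed

text \<open>The holonomy \<open>D s * E s * H s\<close> of the path at time \<open>s\<close> has
  derivative \<open>- inner s\<close>: the last stretch loses \<open>gam s\<close>, the first gains
  it, and the contributions of \<open>l\<close> cancel because \<open>l\<close> commutes with
  \<open>E s\<close>. Integration leaves the holonomy at \<open>s = 0\<close> minus the one at
  \<open>s = 1\<close>.\<close>

lemma outer_integral:
  "((\<lambda>s. coef (inner s) w) has_integral coef (Y 1 * ninv (Y 0) * nexp (N (en 0)) l - nexp (N 1) l * H 1) w) {0..1}"
proof -
  have comm: "nexp u l * l = l * nexp u l" for u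
    by (rule nexp_commute) (simp_all add: lin)
  have comm': "nexp u l * (l * x) = l * (nexp u l * x)" for u x
    by (simp add: comm flip: mult.assoc)
  have "nc_deriv (\<lambda>s. D s * (E s * H s)) (- inner s) s" if s: "s \<in> {0..1}" for s
  proof -
    define h where "h = v' s / v s"
    define m where "m = (if full then 0 else n' s / n s)"
    have "nc_deriv D (Y 1 * (- ninv (Y s) * ((gam s + (h + m) *\<^sub>n l) * Y s) * ninv (Y s))) s"
      unfolding D_def[abs_def] gam_def h_def m_def by (intro nc_deriv_mult_left nc_deriv_ninv Y s)
    hence D': "nc_deriv D (- D s * (gam s + (h + m) *\<^sub>n l)) s"
      by (simp add: D_def mult.assoc Y ninv)
    have "((\<lambda>s. N (en s)) has_vector_derivative m) (at s)"
      using N(1)[OF s] by (simp add: en_def m_def)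
    hence E': "nc_deriv E (m *\<^sub>n (l * E s)) s"
      unfolding E_def[abs_def] by (rule nc_deriv_nexp) (simp add: lin)
    have H': "nc_deriv H ((gam s + h *\<^sub>n l) * H s) s"
      using H(1)[OF s] by (simp add: gam_def h_def)
    show ?thesis
      using nc_deriv_mult[OF D' nc_deriv_mult[OF E' H']]
      by (rule back_subst[of "\<lambda>D. nc_deriv _ D s"])
        (simp add: inner_def algebra_simps nscale_minus nscale_add_left E_def comm comm')
  qed
  hence "((\<lambda>s. coef (- inner s) w) has_integral coef (D 1 * (E 1 * H 1)) w - coef (D 0 * (E 0 * H 0)) w) {0..1}"
    by (intro fundamental_theorem_of_calculus) (auto simp: nc_deriv_def intro: has_vector_derivative_at_within)
  from has_integral_neg[OF this] show ?thesis
    by (simp add: D_def E_def H Y ninv mid mult.assoc)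
qed

lemma has_holonomy2:
  "has_holonomy2 p q l P (Y 1 * ninv (Y 0) * nexp (N (en 0)) l - nexp (N 1) l * H 1)"
  unfolding has_holonomy2_def
  using sol_fundamental sol_0 inner_integral outer_integral by (intro exI[of _ sol] exI[of _ inner]) auto

end

section \<open>The explicit paths\<close>

lemma has_vector_derivative_exp_log:
  fixes N n :: "real \<Rightarrow> complex"
  assumes "(N has_vector_derivative N') (at x)" "(n has_vector_derivative n') (at x)" "\<And>x. exp (N x) = n x"
  shows "n' = N' * n x"
proof -
  have "((exp \<circ> N) has_vector_derivative N' * exp (N x)) (at x)"
    by (rule field_vector_diff_chain_at[OF assms(1)]) (rule DERIV_exp)
  moreover have "exp \<circ> N = n" using assms(3) by auto
  ultimately show ?thesis using assms(2,3) vector_derivative_unique_at by metis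
qed

text \<open>A logarithm with the cut along the positive imaginary axis\<close>

definition lower_log :: "complex \<Rightarrow> complex" where
  "lower_log z = Ln (\<i> * z) - \<i> * of_real (pi / 2)"

lemma lower_log_derivative:
  assumes "(c has_vector_derivative c') (at x)" "Im (c x) \<le> 0" "c x \<noteq> 0"
  shows "((\<lambda>x. lower_log (c x)) has_vector_derivative c' / c x) (at x)"
proof -
  have "\<i> * c x \<notin> \<real>\<^sub>\<le>\<^sub>0"
    using assms(2,3) by (auto simp: complex_nonpos_Reals_iff complex_eq_iff)
  hence "(lower_log has_field_derivative 1 / c x) (at (c x))"
    unfolding lower_log_def[abs_def] using assms(3)
    by (auto intro!: derivative_eq_intros simp: divide_simps)
  from field_vector_diff_chain_at[OF assms(1) this] show ?thesis by (simp add: o_def)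
qed

text \<open>A single-valued solution on the closed lower half plane without 0 and 1. The first
  coordinates of all the paths lie there, so for constant \<open>v\<close> the holonomies are
  quotients of values of this one function.\<close>

definition kz_lower :: "'a ncs \<Rightarrow> 'a ncs \<Rightarrow> complex \<Rightarrow> 'a ncs" where
  "kz_lower A B z = kzs A B z * nexp (lower_log z) A"

lemma coef_kz_lower [simp]: "coef (kz_lower A B z) [] = 1"
  by (simp add: kz_lower_def)

lemma nc_deriv_kz_lower:
  assumes "linear_ncs A" "linear_ncs B" "(c has_vector_derivative c') (at x)"
    "Im (c x) \<le> 0" "c x \<noteq> 0" "c x \<noteq> 1"
  shows "nc_deriv (\<lambda>x. kz_lower A B (c x)) (((c' / c x) *\<^sub>n A + (c' / (c x - 1)) *\<^sub>n B) * kz_lower A B (c x)) x"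
proof -
  have "c x \<in> slit_plane" using assms(4,6) by (auto simp: slit_plane_def complex_eq_iff)
  from kz_along[OF assms(1-3) this assms(5) lower_log_derivative[OF assms(3-5)]]
  show ?thesis by (simp add: kz_lower_def)
qed

definition holonomy :: "(real \<Rightarrow> 'a ncs) \<Rightarrow> 'a ncs" where
  "holonomy Y = Y 1 * ninv (Y 0)"

text \<open>Two solutions of one equation differ by a constant right factor, which cancels in the
  quotient. So each path may be given whichever normalisation suits the computation.\<close>

lemma holonomy_unique:
  assumes "\<And>r. r \<in> {0..1} \<Longrightarrow> nc_deriv Y (G r * Y r) r" "\<And>r. coef (Y r) [] = 1"
    and "\<And>r. r \<in> {0..1} \<Longrightarrow> nc_deriv Z (G r * Z r) r" "\<And>r. coef (Z r) [] = 1"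
  shows "holonomy Y = holonomy Z"
proof -
  have "ninv (Y 1) * Z 1 = ninv (Y 0) * Z 0"
    by (rule nc_deriv_zero_imp_eq[of 0 1]) (use assms in \<open>auto intro!: nc_quotient_deriv\<close>)
  hence "Y 1 * (ninv (Y 1) * Z 1) * ninv (Z 0) = Y 1 * (ninv (Y 0) * Z 0) * ninv (Z 0)" by simp
  then show ?thesis by (simp add: holonomy_def assms mult.assoc ninv)
qed

lemma nc_deriv_normalized:
  "nc_deriv Y (G * Y x) x \<Longrightarrow> nc_deriv (\<lambda>x. Y x * ninv (Y 0)) (G * (Y x * ninv (Y 0))) x"
  using nc_deriv_mult_right[of Y "G * Y x" x "ninv (Y 0)"] by (simp add: mult.assoc)

section \<open>Common parametrisation of the explicit paths\<close>

locale kz_paths =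
  fixes p q l :: "'a ncs" and \<epsilon> :: real and a :: complex
  assumes lin: "linear_ncs p" "linear_ncs q" "linear_ncs l"
    and \<epsilon>: "0 < \<epsilon>" "\<epsilon> \<le> 1 / 4" and a: "a \<noteq> 0"
begin

definition "e r = \<epsilon> + r * (1 - 2 * \<epsilon>)"
definition "e' = complex_of_real (1 - 2 * \<epsilon>)"
definition "m = l - p - q"

lemma lin_m: "linear_ncs m"
  unfolding m_def by (intro linear_ncs_intros lin)

lemma e_bounds:
  assumes "r \<in> {0..1}"
  shows "0 < e r" "e r < 1"
proof -
  have 1: "0 \<le> r * (1 - 2 * \<epsilon>)" using \<epsilon> assms by (auto intro!: mult_nonneg_nonneg)
  have 2: "r * (1 - 2 * \<epsilon>) \<le> 1 - 2 * \<epsilon>" using \<epsilon> assms by (intro mult_left_le_one_le) auto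
  show "0 < e r" using 1 \<epsilon> unfolding e_def by (rule_tac add_pos_nonneg) auto
  have "e r \<le> \<epsilon> + (1 - 2 * \<epsilon>)" using 2 unfolding e_def by (rule add_left_mono)
  then show "e r < 1" using \<epsilon> by simp
qed

lemma e: "e 0 = \<epsilon>" "e 1 = 1 - \<epsilon>" "cI \<epsilon> r = of_real (e r)"
  by (auto simp: e_def cI_def)

lemma cI_deriv: "(cI \<epsilon> has_vector_derivative e') (at r)"
  unfolding cI_def[abs_def] e'_def
  by (intro has_vector_derivative_of_real) (auto intro!: derivative_eq_intros)

lemma cI_ne: "r \<in> {0..1} \<Longrightarrow> cI \<epsilon> r \<noteq> 0" "r \<in> {0..1} \<Longrightarrow> cI \<epsilon> r \<noteq> 1"
   "r \<in> {0..1} \<Longrightarrow> cI \<epsilon> r - 1 \<noteq> 0" "r \<in> {0..1} \<Longrightarrow> 1 - cI \<epsilon> r \<noteq> 0"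
  using e_bounds[of r] by (auto simp: e(3))

lemma eps_ne: "complex_of_real \<epsilon> \<noteq> 0" "1 - complex_of_real \<epsilon> \<noteq> 0" "2 - complex_of_real \<epsilon> \<noteq> 0" "complex_of_real \<epsilon> - 1 \<noteq> 0"
  using \<epsilon> by (auto simp: complex_eq_iff)

lemma nc_deriv_sol_e:
  assumes "linear_ncs A" "linear_ncs B" "r \<in> {0..1}"
  shows "nc_deriv (\<lambda>r. kz_sol A B (e r)) (((e' / cI \<epsilon> r) *\<^sub>n A + (e' / (cI \<epsilon> r - 1)) *\<^sub>n B) * kz_sol A B (e r)) r"
proof -
  have "nc_deriv (\<lambda>r. kz_sol A B (e r)) (of_real (1 - 2 * \<epsilon>) *\<^sub>n ((of_real (1 / e r) *\<^sub>n A + of_real (1 / (e r - 1)) *\<^sub>n B) * kz_sol A B (e r))) r"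
    using e_bounds[OF assms(3)] assms(1,2)
    by (intro nc_deriv_chain nc_deriv_kz_sol) (auto simp: e_def intro!: derivative_eq_intros)
  then show ?thesis by (simp add: e'_def e(3) nscale_add distrib_right)
qed

definition "eh \<sigma> r = exp (of_real \<sigma> * \<i> * of_real pi * of_real r)" for \<sigma> r :: real
definition "den \<tau> \<sigma> r = 2 - of_real \<epsilon> + of_real (\<tau> * \<epsilon>) * eh \<sigma> r" for \<tau> \<sigma> r :: real
text \<open>A continuous logarithm of \<open>eh \<sigma> r / den \<tau> \<sigma> r\<close>: the
  denominator stays in the right half plane, where the principal branch is continuous, and the
  winding numerator contributes its exponent. The derivative \<open>dlg\<close> is left
  unevaluated.\<close>

definition "lg \<tau> \<sigma> r = of_real \<sigma> * \<i> * of_real pi * of_real r - Ln (den \<tau> \<sigma> r)" for \<tau> \<sigma> r :: real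
definition "dlg \<tau> \<sigma> r = vector_derivative (lg \<tau> \<sigma>) (at r)" for \<tau> \<sigma> r :: real

lemma norm_eh: "norm (eh \<sigma> r) = 1"
  by (simp add: eh_def)

lemma eh_0_1: "eh \<sigma> 0 = 1" "eh 1 1 = -1" "eh (- 1) 1 = -1"
  by (simp_all add: eh_def mult.commute exp_minus)

lemma den_pos: "\<bar>\<tau>\<bar> = 1 \<Longrightarrow> Re (den \<tau> \<sigma> r) > 0"
proof -
  assume "\<bar>\<tau>\<bar> = 1"
  hence "norm (of_real (\<tau> * \<epsilon>) * eh \<sigma> r) = \<epsilon>"
    using \<epsilon> by (simp add: norm_mult norm_eh abs_mult)
  hence "\<bar>Re (of_real (\<tau> * \<epsilon>) * eh \<sigma> r)\<bar> \<le> \<epsilon>"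
    by (metis abs_Re_le_cmod)
  then show ?thesis using \<epsilon> unfolding den_def by simp
qed

lemma den_ne: "\<bar>\<tau>\<bar> = 1 \<Longrightarrow> den \<tau> \<sigma> r \<noteq> 0" "\<bar>\<tau>\<bar> = 1 \<Longrightarrow> den \<tau> \<sigma> r \<notin> \<real>\<^sub>\<le>\<^sub>0"
  using den_pos[of \<tau> \<sigma> r] by (auto simp: complex_nonpos_Reals_iff)

lemma lg_deriv: "\<bar>\<tau>\<bar> = 1 \<Longrightarrow> (lg \<tau> \<sigma> has_vector_derivative dlg \<tau> \<sigma> r) (at r)"
proof -
  assume \<tau>: "\<bar>\<tau>\<bar> = 1"
  define f where "f x = of_real \<sigma> * \<i> * of_real pi * x - Ln (2 - of_real \<epsilon> + of_real (\<tau> * \<epsilon>) * exp (of_real \<sigma> * \<i> * of_real pi * x))" for x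
  have "\<exists>d. (f has_field_derivative d) (at (of_real r))"
    unfolding f_def[abs_def]
    by (rule exI) (use den_ne[OF \<tau>, of \<sigma> r] in \<open>auto intro!: derivative_eq_intros simp: den_def eh_def\<close>)
  then obtain d where "(f has_field_derivative d) (at (of_real r))" by blast
  from has_vector_derivative_real_field[OF this]
  have "(lg \<tau> \<sigma> has_vector_derivative d) (at r)"
    by (simp add: f_def lg_def[abs_def] den_def eh_def)
  then show ?thesis unfolding dlg_def by (metis vector_derivative_at)
qed

lemma exp_lg: "\<bar>\<tau>\<bar> = 1 \<Longrightarrow> exp (lg \<tau> \<sigma> r) = eh \<sigma> r / den \<tau> \<sigma> r"
  using den_ne[of \<tau> \<sigma> r] by (simp add: lg_def exp_diff eh_def)

lemma lg_0_1:
  "lg 1 \<sigma> 0 = - of_real (ln 2)" "lg (- 1) 1 0 = - of_real (ln (2 * (1 - \<epsilon>)))"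
  "\<bar>\<sigma>\<bar> = 1 \<Longrightarrow> lg 1 \<sigma> 1 = of_real \<sigma> * \<i> * of_real pi - of_real (ln (2 * (1 - \<epsilon>)))" "lg (- 1) 1 1 = \<i> * of_real pi - of_real (ln 2)"
proof -
  have *: "Ln (2 - 2 * of_real \<epsilon>) = of_real (ln (2 * (1 - \<epsilon>)))"
    using \<epsilon> Ln_of_real[of "2 * (1 - \<epsilon>)"] by (simp add: algebra_simps)
  have 2: "Ln 2 = of_real (ln 2)" using Ln_of_real[of 2] by simp
  have den: "den 1 \<sigma> 0 = 2" "den (- 1) 1 0 = 2 - 2 * of_real \<epsilon>" "den (- 1) 1 1 = 2"
    "\<bar>\<sigma>\<bar> = 1 \<Longrightarrow> den 1 \<sigma> 1 = 2 - 2 * of_real \<epsilon>"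
    by (auto simp: den_def eh_0_1 abs_if split: if_splits)
  show "lg 1 \<sigma> 0 = - of_real (ln 2)"
    unfolding lg_def den 2 by simp
  show "lg (- 1) 1 0 = - of_real (ln (2 * (1 - \<epsilon>)))"
    unfolding lg_def den * by simp
  show "lg (- 1) 1 1 = \<i> * of_real pi - of_real (ln 2)"
    unfolding lg_def den 2 by simp
  assume "\<bar>\<sigma>\<bar> = 1"
  from den(4)[OF this] show "lg 1 \<sigma> 1 = of_real \<sigma> * \<i> * of_real pi - of_real (ln (2 * (1 - \<epsilon>)))"
    by (simp only: lg_def * of_real_1 mult_1_right)
qed

text \<open>A half turn about 0 from \<epsilon> to \<open>\<epsilon> / (\<epsilon> - 1)\<close>,
  counterclockwise for \<sigma> = 1 and clockwise for \<sigma> = -1. \<open>cII\<close> and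
  \<open>cIV\<close> are \<open>1 - w\<close> and \<open>1 / w\<close> for the first sign, and
  \<open>zVI\<close> is \<open>w\<close> for the second: half turns about 1, infinity and 0.\<close>

definition "w \<sigma> r = 2 * of_real \<epsilon> * eh \<sigma> r / den 1 \<sigma> r" for \<sigma> r :: real
definition "lw \<sigma> r = of_real (ln (2 * \<epsilon>)) + lg 1 \<sigma> r" for \<sigma> r :: real

lemma exp_ln_real: "x > 0 \<Longrightarrow> exp (complex_of_real (ln x)) = of_real x"
  by (metis exp_ln exp_of_real)

lemma exp_lw: "exp (lw \<sigma> r) = w \<sigma> r"
  using \<epsilon> exp_ln_real[of "2 * \<epsilon>"] by (simp add: lw_def exp_add exp_lg w_def)

lemma lw_deriv: "(lw \<sigma> has_vector_derivative dlg 1 \<sigma> r) (at r)"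
  unfolding lw_def[abs_def] using has_vector_derivative_add[OF has_vector_derivative_const lg_deriv[of 1 \<sigma> r]] by simp

lemma w_deriv: "(w \<sigma> has_vector_derivative dlg 1 \<sigma> r * w \<sigma> r) (at r)"
proof -
  have "((exp \<circ> lw \<sigma>) has_vector_derivative dlg 1 \<sigma> r * exp (lw \<sigma> r)) (at r)"
    by (rule field_vector_diff_chain_at[OF lw_deriv]) (rule DERIV_exp)
  moreover have "exp \<circ> lw \<sigma> = w \<sigma>" by (auto simp: exp_lw)
  ultimately show ?thesis by (simp add: exp_lw)
qed

lemma w_ne: "w \<sigma> r \<noteq> 0"
  using exp_lw[of \<sigma> r] by (metis exp_not_eq_zero)

lemma norm_w: "norm (w \<sigma> r) < 1"
proof -
  have "norm (2 - complex_of_real \<epsilon>) = 2 - \<epsilon>" "norm (complex_of_real \<epsilon> * eh \<sigma> r) = \<epsilon>"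
    using \<epsilon> norm_of_real[of "2 - \<epsilon>", where 'a = complex] by (simp_all add: norm_mult norm_eh)
  hence "2 - \<epsilon> - \<epsilon> \<le> norm (den 1 \<sigma> r)"
    unfolding den_def using norm_diff_ineq[of "2 - complex_of_real \<epsilon>" "of_real (1 * \<epsilon>) * eh \<sigma> r"] by simp
  moreover have "2 * \<epsilon> < 2 - \<epsilon> - \<epsilon>" using \<epsilon> by simp
  ultimately have "2 * \<epsilon> < norm (den 1 \<sigma> r)" by linarith
  then show ?thesis
    using \<epsilon> by (simp add: w_def norm_divide norm_mult norm_eh divide_less_eq)
qed

lemma w_slit: "w \<sigma> r \<in> slit_plane" "w \<sigma> r \<noteq> 1" "w \<sigma> r - 1 \<noteq> 0" "1 - w \<sigma> r \<noteq> 0"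
proof -
  have "Re (w \<sigma> r) < 1" using norm_w[of \<sigma> r] complex_Re_le_cmod[of "w \<sigma> r"] by linarith
  then show "w \<sigma> r \<in> slit_plane" "w \<sigma> r \<noteq> 1" "w \<sigma> r - 1 \<noteq> 0" "1 - w \<sigma> r \<noteq> 0"
    by (auto simp: slit_plane_def)
qed

lemma Im_complex_of_real_mult: "Im (of_real c * z) = c * Im z"
  by simp

lemma Im_w: "r \<in> {0..1} \<Longrightarrow> Im (w 1 r) \<ge> 0" "r \<in> {0..1} \<Longrightarrow> Im (w (- 1) r) \<le> 0"
proof -
  assume r: "r \<in> {0..1}"
  have s: "sin (pi * r) \<ge> 0"
    using r by (intro sin_ge_zero) (auto simp: mult_left_le)
  have cis: "eh 1 r = cis (pi * r)" "eh (- 1) r = cis (- (pi * r))"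
    by (simp_all add: eh_def cis_conv_exp mult.assoc)
  have *: "Im (w \<sigma> r) = 2 * \<epsilon> * (2 - \<epsilon>) / (cmod (den 1 \<sigma> r))\<^sup>2 * sin x" if "eh \<sigma> r = cis x" for \<sigma> x
  proof -
    have "w \<sigma> r = of_real (2 * \<epsilon> / (cmod (den 1 \<sigma> r))\<^sup>2) * (cis x * cnj (2 - of_real \<epsilon> + of_real \<epsilon> * cis x))"
      unfolding w_def complex_div_cnj[of _ "den 1 \<sigma> r"] by (simp add: den_def that)
    hence "Im (w \<sigma> r) = 2 * \<epsilon> / (cmod (den 1 \<sigma> r))\<^sup>2 * Im (cis x * cnj (2 - of_real \<epsilon> + of_real \<epsilon> * cis x))"
      by (simp only: Im_complex_of_real_mult)
    also have "Im (cis x * cnj (2 - of_real \<epsilon> + of_real \<epsilon> * cis x)) = (2 - \<epsilon>) * sin x"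
      by (simp add: ring_distribs)
    finally show ?thesis by simp
  qed
  have "2 * \<epsilon> * (2 - \<epsilon>) / (cmod (den 1 \<sigma> r))\<^sup>2 \<ge> 0" for \<sigma> using \<epsilon> by simp
  with s show "Im (w 1 r) \<ge> 0" "Im (w (- 1) r) \<le> 0"
    unfolding *[OF cis(1)] *[OF cis(2)] by (auto intro!: mult_nonneg_nonneg simp del: times_divide_eq_left)
qed

lemma eh_ne: "eh \<sigma> r \<noteq> 0"
  by (simp add: eh_def)

lemma eh_minus: "eh (- 1) r = inverse (eh 1 r)"
  by (simp add: eh_def exp_minus)

lemma exp_eh: "exp (\<i> * of_real pi * of_real r) = eh 1 r" "exp (- \<i> * of_real pi * of_real r) = inverse (eh 1 r)"
  by (simp_all add: eh_def exp_minus)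

lemma cII_eq: "cII \<epsilon> r = 1 - w 1 r"
proof -
  have "den 1 1 r = 2 - of_real \<epsilon> + of_real \<epsilon> * eh 1 r" by (simp add: den_def)
  moreover have "den 1 1 r \<noteq> 0" by (rule den_ne) simp
  ultimately show ?thesis
    unfolding cII_def w_def exp_eh by (simp add: diff_divide_eq_iff flip: \<open>den 1 1 r = _\<close>) (simp add: den_def)
qed

lemma cIV_eq: "cIV \<epsilon> r = 1 / w 1 r"
proof -
  have "cIV \<epsilon> r = (of_real \<epsilon> + (2 - of_real \<epsilon>) * inverse (eh 1 r)) / (2 * of_real \<epsilon>)"
  proof -
    have "1 / 2 + (1 / of_real \<epsilon> - 1 / 2) * x = (of_real \<epsilon> + (2 - of_real \<epsilon>) * x) / (2 * of_real \<epsilon>)" for x :: complex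
      using eps_ne(1) by (simp add: field_simps)
    then show ?thesis unfolding cIV_def exp_eh by simp
  qed
  also have "of_real \<epsilon> + (2 - of_real \<epsilon>) * inverse (eh 1 r) = den 1 1 r / eh 1 r"
    using eh_ne[of 1 r] by (simp add: den_def divide_inverse distrib_right mult.assoc)
  finally show ?thesis by (simp add: w_def)
qed

lemma zVI_eq: "zVI \<epsilon> r = w (- 1) r"
proof -
  have "of_real \<epsilon> + (2 - of_real \<epsilon>) * eh 1 r = den 1 (- 1) r * eh 1 r"
    using eh_ne[of 1 r] by (simp add: den_def eh_minus distrib_right)
  then show ?thesis unfolding zVI_def w_def exp_eh eh_minus by (simp add: divide_inverse)
qed

lemma w_0_1: "w \<sigma> 0 = of_real \<epsilon>" "\<bar>\<sigma>\<bar> = 1 \<Longrightarrow> w \<sigma> 1 = of_real \<epsilon> / (of_real \<epsilon> - 1)"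
proof -
  show "w \<sigma> 0 = of_real \<epsilon>" by (simp add: w_def den_def eh_0_1)
  assume "\<bar>\<sigma>\<bar> = 1"
  hence "\<sigma> = 1 \<or> \<sigma> = - 1" by auto
  then show "w \<sigma> 1 = of_real \<epsilon> / (of_real \<epsilon> - 1)"
    using eps_ne by (auto simp: w_def den_def eh_0_1 field_simps)
qed

lemma lw_0_1: "lw \<sigma> 0 = of_real (ln \<epsilon>)"
  "\<bar>\<sigma>\<bar> = 1 \<Longrightarrow> lw \<sigma> 1 = of_real (ln \<epsilon>) + (of_real \<sigma> * \<i> * of_real pi - of_real (ln (1 - \<epsilon>)))"
proof -
  have ln: "ln (2 * \<epsilon>) = ln 2 + ln \<epsilon>" "ln (2 * (1 - \<epsilon>)) = ln 2 + ln (1 - \<epsilon>)"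
    using \<epsilon> ln_mult_pos[of 2 \<epsilon>] ln_mult_pos[of 2 "1 - \<epsilon>"] by simp_all
  show "lw \<sigma> 0 = of_real (ln \<epsilon>)" by (simp add: lw_def lg_0_1 ln)
  assume "\<bar>\<sigma>\<bar> = 1"
  then show "lw \<sigma> 1 = of_real (ln \<epsilon>) + (of_real \<sigma> * \<i> * of_real pi - of_real (ln (1 - \<epsilon>)))"
    unfolding lw_def lg_0_1(3)[OF \<open>\<bar>\<sigma>\<bar> = 1\<close>] ln by simp
qed

text \<open>Where \<open>v\<close> moves along with the first coordinate, the residues
  \<open>p\<close> and \<open>q\<close> are replaced by others among \<open>p\<close>,
  \<open>q\<close>, \<open>m\<close> and their translates by \<open>l\<close>, which explains the
  arguments. \<open>XII\<close>, \<open>XIV\<close> and \<open>XVI\<close> are solutions in the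
  coordinate \<open>w\<close>, normalised at the puncture about which the half turn runs; those made
  from \<open>kz_lower\<close> belong to constant \<open>v\<close> and serve to close the
  loop.\<close>

definition "YI r = kz_sol q p (e r)"
definition "YII r = kz_lower p q (cII \<epsilon> r)"
definition "XII r = kzs q p (w 1 r) * nexp (lw 1 r) q"
definition "YIII r = kz_sol q m (e r)"
definition "ZIII r = kz_lower p q (cIII \<epsilon> r)"
definition "YIV r = kz_lower p q (cIV \<epsilon> r)"
definition "XIV r = kzs m (q - l) (w 1 r) * nexp (lw 1 r) m"
definition "YV r = kz_sol p m (e r)"
definition "ZV r = kz_lower p q (zV \<epsilon> r)"
definition "YVI r = kz_lower p q (zVI \<epsilon> r)"
definition "XVI r = kzs (p - l) q (w (- 1) r) * nexp (lw (- 1) r) (p - l)"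

lemmas Y_defs = YI_def YII_def XII_def YIII_def ZIII_def YIV_def XIV_def YV_def ZV_def YVI_def XVI_def

lemma coef_Y [simp]:
  "coef (YI r) [] = 1" "coef (YII r) [] = 1" "coef (XII r) [] = 1" "coef (YIII r) [] = 1"
  "coef (ZIII r) [] = 1" "coef (YIV r) [] = 1" "coef (XIV r) [] = 1" "coef (YV r) [] = 1"
  "coef (ZV r) [] = 1" "coef (YVI r) [] = 1" "coef (XVI r) [] = 1"
  by (simp_all add: Y_defs)

lemma paths_deriv:
  assumes r: "r \<in> {0..1}"
  shows "(cIII \<epsilon> has_vector_derivative e' / (1 - cI \<epsilon> r)\<^sup>2) (at r)"
    and "(zV \<epsilon> has_vector_derivative - e' / (cI \<epsilon> r - 1)\<^sup>2) (at r)"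
    and "(lam \<epsilon> has_vector_derivative - e' / (1 - of_real \<epsilon>)) (at r)"
    and "(cII \<epsilon> has_vector_derivative - (dlg 1 1 r * w 1 r)) (at r)"
    and "(cIV \<epsilon> has_vector_derivative - (dlg 1 1 r / w 1 r)) (at r)"
    and "(zVI \<epsilon> has_vector_derivative dlg 1 (- 1) r * w (- 1) r) (at r)"
proof -
  have chain: "((\<lambda>x. f (c x)) has_vector_derivative c' * f') (at r)"
    if "(c has_vector_derivative c') (at r)" "(f has_field_derivative f') (at (c r))" for f c c' f'
    using field_vector_diff_chain_at[OF that] by (simp add: o_def)
  note ne = cI_ne[OF r]
  have "((\<lambda>z. 1 / (1 - z)) has_field_derivative 1 / (1 - cI \<epsilon> r)\<^sup>2) (at (cI \<epsilon> r))"
    using ne by (auto intro!: derivative_eq_intros simp: power2_eq_square)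
  from chain[OF cI_deriv this] show "(cIII \<epsilon> has_vector_derivative e' / (1 - cI \<epsilon> r)\<^sup>2) (at r)"
    by (simp add: cIII_def[abs_def])
  have "((\<lambda>z. z / (z - 1)) has_field_derivative - 1 / (cI \<epsilon> r - 1)\<^sup>2) (at (cI \<epsilon> r))"
    using ne by (auto intro!: derivative_eq_intros simp: power2_eq_square)
  from chain[OF cI_deriv this] show "(zV \<epsilon> has_vector_derivative - e' / (cI \<epsilon> r - 1)\<^sup>2) (at r)"
    by (simp add: zV_def[abs_def])
  have "((\<lambda>z. (1 - z) / (1 - of_real \<epsilon>)) has_field_derivative - 1 / (1 - of_real \<epsilon>)) (at (cI \<epsilon> r))"
    using DERIV_cdivide[OF DERIV_diff[OF DERIV_const DERIV_ident]] by simp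
  from chain[OF cI_deriv this] show "(lam \<epsilon> has_vector_derivative - e' / (1 - of_real \<epsilon>)) (at r)"
    by (simp add: lam_def[abs_def])
  have "((\<lambda>z. 1 - z) has_field_derivative - 1) (at (w 1 r))"
    by (auto intro!: derivative_eq_intros)
  from chain[OF w_deriv this] show "(cII \<epsilon> has_vector_derivative - (dlg 1 1 r * w 1 r)) (at r)"
    by (simp add: cII_eq[abs_def])
  have "((\<lambda>z. 1 / z) has_field_derivative - 1 / (w 1 r)\<^sup>2) (at (w 1 r))"
    using w_ne by (auto intro!: derivative_eq_intros simp: power2_eq_square)
  from chain[OF w_deriv this] show "(cIV \<epsilon> has_vector_derivative - (dlg 1 1 r / w 1 r)) (at r)"
    using w_ne by (simp add: cIV_eq[abs_def] power2_eq_square)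
  show "(zVI \<epsilon> has_vector_derivative dlg 1 (- 1) r * w (- 1) r) (at r)"
    using w_deriv[of "- 1" r] by (simp add: zVI_eq[abs_def])
qed

lemma paths_lower:
  assumes r: "r \<in> {0..1}"
  shows "Im (cII \<epsilon> r) \<le> 0" "cII \<epsilon> r \<noteq> 0" "cII \<epsilon> r \<noteq> 1"
    "Im (cIII \<epsilon> r) \<le> 0" "cIII \<epsilon> r \<noteq> 0" "cIII \<epsilon> r \<noteq> 1"
    "Im (cIV \<epsilon> r) \<le> 0" "cIV \<epsilon> r \<noteq> 0" "cIV \<epsilon> r \<noteq> 1"
    "Im (zV \<epsilon> r) \<le> 0" "zV \<epsilon> r \<noteq> 0" "zV \<epsilon> r \<noteq> 1"
    "Im (zVI \<epsilon> r) \<le> 0" "zVI \<epsilon> r \<noteq> 0" "zVI \<epsilon> r \<noteq> 1"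
proof -
  have real_lower: "Im z \<le> 0 \<and> z \<noteq> 0 \<and> z \<noteq> 1" if "z = of_real x" "x \<noteq> 0" "x \<noteq> 1" for x z
    using that by simp
  show "Im (cII \<epsilon> r) \<le> 0" "cII \<epsilon> r \<noteq> 0" "cII \<epsilon> r \<noteq> 1"
    using Im_w[OF r] w_slit[of 1 r] w_ne[of 1 r] by (auto simp: cII_eq)
  show "Im (cIII \<epsilon> r) \<le> 0" "cIII \<epsilon> r \<noteq> 0" "cIII \<epsilon> r \<noteq> 1"
    using real_lower[of "cIII \<epsilon> r" "1 / (1 - e r)"] e_bounds[OF r] by (auto simp: cIII_def e(3))
  show "Im (cIV \<epsilon> r) \<le> 0" "cIV \<epsilon> r \<noteq> 0" "cIV \<epsilon> r \<noteq> 1"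
    using Im_w(1)[OF r] w_slit(2)[of 1 r] w_ne[of 1 r] unfolding cIV_eq
    by (simp_all add: Im_divide divide_nonneg_nonneg)
  show "Im (zV \<epsilon> r) \<le> 0" "zV \<epsilon> r \<noteq> 0" "zV \<epsilon> r \<noteq> 1"
    using real_lower[of "zV \<epsilon> r" "e r / (e r - 1)"] e_bounds[OF r] by (auto simp: zV_def e(3))
  show "Im (zVI \<epsilon> r) \<le> 0" "zVI \<epsilon> r \<noteq> 0" "zVI \<epsilon> r \<noteq> 1"
    using Im_w[OF r] w_slit[of "- 1" r] w_ne[of "- 1" r] by (auto simp: zVI_eq)
qed


definition "n6 r = of_real \<epsilon> / zVI \<epsilon> r"
definition "n4 r = of_real ((1 - \<epsilon>) / \<epsilon>) / (cIV \<epsilon> r - 1)"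
definition "N6 r = of_real (ln \<epsilon>) - lw (- 1) r"
definition "N4 r = of_real (ln (2 * (1 - \<epsilon>))) + lg (- 1) 1 r"
definition "N5 r = complex_of_real (ln ((1 - e r) / (1 - \<epsilon>)))"
definition "\<mu> = \<i> * of_real pi + of_real (ln (1 - \<epsilon>))"

lemma lam_eq: "lam \<epsilon> r = of_real ((1 - e r) / (1 - \<epsilon>))"
  by (simp add: lam_def e(3))

lemma lam_ne: "r \<in> {0..1} \<Longrightarrow> lam \<epsilon> r \<noteq> 0"
  using e_bounds[of r] \<epsilon> by (simp only: lam_eq of_real_eq_0_iff) auto

lemma n_0: "lam \<epsilon> 0 = 1" "n6 0 = 1" "n4 0 = 1"
  using \<epsilon> eps_ne by (simp_all add: lam_eq e n6_def zVI_eq w_0_1 n4_def cIV_eq field_simps)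

lemma N_0: "N5 0 = 0" "N6 0 = 0" "N4 0 = 0"
  using \<epsilon> by (simp_all add: N5_def e N6_def lw_0_1 N4_def lg_0_1)

text \<open>Both \<open>n6\<close> and \<open>n4\<close> end at \<open>\<epsilon> - 1\<close>, of
  which \<mu> is a logarithm. That their continuous logarithms end on the same branch lets the
  vertical factors cancel in \<open>boundary\<close>.\<close>

lemma N_1: "N6 1 = \<mu>" "N4 1 = \<mu>"
proof -
  have ln: "ln (2 * (1 - \<epsilon>)) = ln 2 + ln (1 - \<epsilon>)"
    using \<epsilon> ln_mult_pos[of 2 "1 - \<epsilon>"] by simp
  show "N6 1 = \<mu>" "N4 1 = \<mu>"
    unfolding N6_def N4_def \<mu>_def lg_0_1 ln using lw_0_1(2)[of "- 1"] by simp_all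
qed

lemma exp_N: "r \<in> {0..1} \<Longrightarrow> exp (N5 r) = lam \<epsilon> r" "exp (N6 r) = n6 r" "exp (N4 r) = n4 r"
proof -
  assume "r \<in> {0..1}"
  hence "(1 - e r) / (1 - \<epsilon>) > 0" using e_bounds[of r] \<epsilon> by auto
  then show "exp (N5 r) = lam \<epsilon> r" unfolding N5_def lam_eq by (rule exp_ln_real)
next
  show "exp (N6 r) = n6 r"
    using \<epsilon> exp_ln_real[of \<epsilon>] by (simp add: N6_def n6_def exp_diff exp_lw zVI_eq)
next
  have d: "den (- 1) 1 r \<noteq> 0" "den 1 1 r \<noteq> 0" by (rule den_ne, simp)+
  have "cIV \<epsilon> r - 1 = (1 - w 1 r) / w 1 r" using w_ne[of 1 r] by (simp add: cIV_eq field_simps)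
  also have "1 - w 1 r = den (- 1) 1 r / den 1 1 r"
    using d(2) unfolding w_def by (simp add: diff_divide_eq_iff) (simp add: den_def)
  finally have "cIV \<epsilon> r - 1 = den (- 1) 1 r / (2 * of_real \<epsilon> * eh 1 r)"
    using d(2) by (simp add: w_def)
  hence "n4 r = of_real (2 * (1 - \<epsilon>)) * (eh 1 r / den (- 1) 1 r)"
    using eps_ne(1) by (simp add: n4_def)
  moreover have "exp (N4 r) = of_real (2 * (1 - \<epsilon>)) * (eh 1 r / den (- 1) 1 r)"
    unfolding N4_def exp_add using \<epsilon> by (subst exp_ln_real exp_lg, simp)+ simp
  ultimately show "exp (N4 r) = n4 r" by simp
qed

lemma N_deriv:
  assumes r: "r \<in> {0..1}"
  shows "(N5 has_vector_derivative (- e' / (1 - of_real \<epsilon>)) / lam \<epsilon> r) (at r)"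
    and "(N6 has_vector_derivative - dlg 1 (- 1) r) (at r)"
    and "(N4 has_vector_derivative - (dlg 1 1 r / (w 1 r - 1))) (at r)"
proof -
  have pos: "(1 - e r) / (1 - \<epsilon>) > 0" using e_bounds[OF r] \<epsilon> by auto
  have "((\<lambda>r. ln ((1 - e r) / (1 - \<epsilon>))) has_real_derivative (- (1 - 2 * \<epsilon>) / (1 - \<epsilon>)) / ((1 - e r) / (1 - \<epsilon>))) (at r)"
  proof -
    have "((\<lambda>r. (1 - e r) / (1 - \<epsilon>)) has_real_derivative - (1 - 2 * \<epsilon>) / (1 - \<epsilon>)) (at r)"
      unfolding e_def by (intro DERIV_cdivide) (auto intro!: derivative_eq_intros)
    from DERIV_chain2[OF DERIV_ln_divide[OF pos] this] \<epsilon> show ?thesis by simp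
  qed
  from has_vector_derivative_of_real[OF this]
  have "(N5 has_vector_derivative of_real (- (1 - 2 * \<epsilon>) / (1 - \<epsilon>) / ((1 - e r) / (1 - \<epsilon>)))) (at r)"
    unfolding N5_def[abs_def] .
  then show "(N5 has_vector_derivative (- e' / (1 - of_real \<epsilon>)) / lam \<epsilon> r) (at r)"
    unfolding lam_eq e'_def by (simp only: of_real_divide of_real_minus of_real_diff of_real_1)
  show "(N6 has_vector_derivative - dlg 1 (- 1) r) (at r)"
    unfolding N6_def[abs_def] using has_vector_derivative_diff[OF has_vector_derivative_const lw_deriv[of "- 1" r]] by simp
  have N: "(N4 has_vector_derivative dlg (- 1) 1 r) (at r)"
    unfolding N4_def[abs_def] using has_vector_derivative_add[OF has_vector_derivative_const lg_deriv[of "- 1" 1 r]] by simp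
  have ne: "cIV \<epsilon> r - 1 \<noteq> 0" using paths_lower(9)[OF r] by simp
  have "((\<lambda>z. of_real ((1 - \<epsilon>) / \<epsilon>) / (z - 1)) has_field_derivative - (of_real ((1 - \<epsilon>) / \<epsilon>) / (cIV \<epsilon> r - 1)) / (cIV \<epsilon> r - 1)) (at (cIV \<epsilon> r))"
    using ne by (auto intro!: derivative_eq_intros simp: power2_eq_square simp del: of_real_divide)
  from field_vector_diff_chain_at[OF paths_deriv(5)[OF r] this]
  have n: "(n4 has_vector_derivative - (dlg 1 1 r / w 1 r) * (- n4 r / (cIV \<epsilon> r - 1))) (at r)"
    by (simp add: n4_def[abs_def] o_def)
  \<comment> \<open>Differentiating \<open>n4\<close> directly and through its logarithm determines
    the so far implicit \<open>dlg (- 1) 1 r\<close>.\<close>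
  have "- (dlg 1 1 r / w 1 r) * (- n4 r / (cIV \<epsilon> r - 1)) = dlg (- 1) 1 r * n4 r"
    by (rule has_vector_derivative_exp_log[OF N n exp_N(3)])
  hence "(dlg 1 1 r / w 1 r / (cIV \<epsilon> r - 1)) * n4 r = dlg (- 1) 1 r * n4 r"
    by simp
  moreover have "n4 r \<noteq> 0" using exp_N(3) by (metis exp_not_eq_zero)
  ultimately have "dlg (- 1) 1 r = dlg 1 1 r / w 1 r / (cIV \<epsilon> r - 1)"
    by (metis mult_right_cancel)
  also have "\<dots> = - (dlg 1 1 r / (w 1 r - 1))"
    using w_ne[of 1 r] w_slit[of 1 r] by (simp add: cIV_eq field_simps)
  finally show "(N4 has_vector_derivative - (dlg 1 1 r / (w 1 r - 1))) (at r)" using N by simp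
qed

text \<open>Every first coordinate is a Moebius image of \<open>cI\<close> or of a half turn
  \<open>w\<close>, and the moving second coordinates are built from the same variable. So all
  logarithmic derivatives are integer combinations of the two for the punctures 0 and 1.\<close>

lemma log_derivs:
  assumes r: "r \<in> {0..1}"
  defines "c \<equiv> cI \<epsilon> r"
  shows "(- e' / (c - 1)\<^sup>2) / zV \<epsilon> r = e' / c - e' / (c - 1)"
    "(- e' / (c - 1)\<^sup>2) / (zV \<epsilon> r - 1) = - (e' / (c - 1))"
    "(- e' / (1 - of_real \<epsilon>)) / lam \<epsilon> r = e' / (c - 1)"
    "(e' / (1 - c)\<^sup>2) / cIII \<epsilon> r = - (e' / (c - 1))"
    "(e' / (1 - c)\<^sup>2) / (cIII \<epsilon> r - 1) = e' / c - e' / (c - 1)"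
    "- (dlg 1 1 r / w 1 r) / cIV \<epsilon> r = - dlg 1 1 r"
    "- (dlg 1 1 r / w 1 r) / (cIV \<epsilon> r - 1) = dlg 1 1 r / (w 1 r - 1)"
    "dlg 1 (- 1) r * w (- 1) r / zVI \<epsilon> r = dlg 1 (- 1) r"
    "- (dlg 1 1 r * w 1 r) / cII \<epsilon> r = dlg 1 1 r * w 1 r / (w 1 r - 1)"
    "- (dlg 1 1 r * w 1 r) / (cII \<epsilon> r - 1) = dlg 1 1 r"
    "dlg 1 1 r * w 1 r / (w 1 r - 1) = dlg 1 1 r + dlg 1 1 r / (w 1 r - 1)"
proof -
  have ne: "c \<noteq> 0" "c - 1 \<noteq> 0" "1 - c \<noteq> 0" using cI_ne[OF r] by (auto simp: c_def)
  have z: "zV \<epsilon> r = c / (c - 1)" "zV \<epsilon> r - 1 = 1 / (c - 1)" "cIII \<epsilon> r = 1 / (1 - c)" "cIII \<epsilon> r - 1 = c / (1 - c)"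
    "lam \<epsilon> r = (1 - c) / (1 - of_real \<epsilon>)"
    using ne by (simp_all add: zV_def cIII_def lam_def c_def[symmetric] field_simps)
  have w: "cIV \<epsilon> r - 1 = (1 - w 1 r) / w 1 r" "cII \<epsilon> r - 1 = - w 1 r"
    using w_ne[of 1 r] by (simp_all add: cIV_eq cII_eq field_simps)
  show "(- e' / (c - 1)\<^sup>2) / zV \<epsilon> r = e' / c - e' / (c - 1)"
    "(- e' / (c - 1)\<^sup>2) / (zV \<epsilon> r - 1) = - (e' / (c - 1))"
    "(e' / (1 - c)\<^sup>2) / (cIII \<epsilon> r - 1) = e' / c - e' / (c - 1)"
    unfolding z using ne by (simp_all add: divide_simps power2_eq_square) (simp_all add: algebra_simps)
  show "(e' / (1 - c)\<^sup>2) / cIII \<epsilon> r = - (e' / (c - 1))"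
  proof -
    have "e' / (1 - c) = - (e' / (c - 1))" by (metis minus_diff_eq minus_divide_right)
    moreover have "(e' / (1 - c)\<^sup>2) / (1 / (1 - c)) = e' / (1 - c)" using ne by (simp add: power2_eq_square)
    ultimately show ?thesis unfolding z by simp
  qed
  show "(- e' / (1 - of_real \<epsilon>)) / lam \<epsilon> r = e' / (c - 1)"
  proof -
    have "- e' / (1 - c) = e' / (c - 1)" by (metis minus_diff_eq minus_divide_divide)
    then show ?thesis unfolding z using eps_ne(2) by simp
  qed
  show "- (dlg 1 1 r / w 1 r) / cIV \<epsilon> r = - dlg 1 1 r"
    using w_ne by (simp add: cIV_eq)
  show "- (dlg 1 1 r / w 1 r) / (cIV \<epsilon> r - 1) = dlg 1 1 r / (w 1 r - 1)"
    unfolding w using w_ne[of 1 r] w_slit[of 1 r] by (simp add: divide_simps) (simp add: algebra_simps)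
  show "dlg 1 (- 1) r * w (- 1) r / zVI \<epsilon> r = dlg 1 (- 1) r"
    using w_ne by (simp add: zVI_eq)
  show "- (dlg 1 1 r * w 1 r) / cII \<epsilon> r = dlg 1 1 r * w 1 r / (w 1 r - 1)"
    unfolding cII_eq by (metis minus_diff_eq minus_divide_divide)
  show "- (dlg 1 1 r * w 1 r) / (cII \<epsilon> r - 1) = dlg 1 1 r"
    unfolding w using w_ne by simp
  show "dlg 1 1 r * w 1 r / (w 1 r - 1) = dlg 1 1 r + dlg 1 1 r / (w 1 r - 1)"
    using w_slit(3)[of 1 r] by (simp add: field_simps)
qed

lemma Y_deriv:
  assumes r: "r \<in> {0..1}"
  shows "nc_deriv YV (((- e' / (cI \<epsilon> r - 1)\<^sup>2 / zV \<epsilon> r) *\<^sub>n p + (- e' / (cI \<epsilon> r - 1)\<^sup>2 / (zV \<epsilon> r - 1)) *\<^sub>n q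
       + (- e' / (1 - of_real \<epsilon>) / lam \<epsilon> r) *\<^sub>n l) * YV r) r" (is ?V)
    and "nc_deriv YIII (((e' / (1 - cI \<epsilon> r)\<^sup>2 / cIII \<epsilon> r) *\<^sub>n p + (e' / (1 - cI \<epsilon> r)\<^sup>2 / (cIII \<epsilon> r - 1)) *\<^sub>n q
       + (- e' / (1 - of_real \<epsilon>) / lam \<epsilon> r) *\<^sub>n l) * YIII r) r" (is ?III)
    and "nc_deriv XVI (((dlg 1 (- 1) r * w (- 1) r / zVI \<epsilon> r) *\<^sub>n p + (dlg 1 (- 1) r * w (- 1) r / (zVI \<epsilon> r - 1)) *\<^sub>n q
       + (- dlg 1 (- 1) r) *\<^sub>n l) * XVI r) r" (is ?VI)
    and "nc_deriv XIV (((- (dlg 1 1 r / w 1 r) / cIV \<epsilon> r) *\<^sub>n p + (- (dlg 1 1 r / w 1 r) / (cIV \<epsilon> r - 1)) *\<^sub>n q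
       + (- (dlg 1 1 r / (w 1 r - 1))) *\<^sub>n l) * XIV r) r" (is ?IV)
    and "nc_deriv XII (((- (dlg 1 1 r * w 1 r) / cII \<epsilon> r) *\<^sub>n p + (- (dlg 1 1 r * w 1 r) / (cII \<epsilon> r - 1)) *\<^sub>n q) * XII r) r" (is ?II)
    and "nc_deriv YI (((- e' / cI \<epsilon> (1 - r)) *\<^sub>n p + (- e' / (cI \<epsilon> (1 - r) - 1)) *\<^sub>n q) * YI r) r" (is ?I)
    and "nc_deriv YII (((- (dlg 1 1 r * w 1 r) / cII \<epsilon> r) *\<^sub>n p + (- (dlg 1 1 r * w 1 r) / (cII \<epsilon> r - 1)) *\<^sub>n q) * YII r) r"
    and "nc_deriv ZIII (((e' / (1 - cI \<epsilon> r)\<^sup>2 / cIII \<epsilon> r) *\<^sub>n p + (e' / (1 - cI \<epsilon> r)\<^sup>2 / (cIII \<epsilon> r - 1)) *\<^sub>n q) * ZIII r) r"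
    and "nc_deriv YIV (((- (dlg 1 1 r / w 1 r) / cIV \<epsilon> r) *\<^sub>n p + (- (dlg 1 1 r / w 1 r) / (cIV \<epsilon> r - 1)) *\<^sub>n q) * YIV r) r"
    and "nc_deriv ZV (((- e' / (cI \<epsilon> r - 1)\<^sup>2 / zV \<epsilon> r) *\<^sub>n p + (- e' / (cI \<epsilon> r - 1)\<^sup>2 / (zV \<epsilon> r - 1)) *\<^sub>n q) * ZV r) r"
    and "nc_deriv YVI (((dlg 1 (- 1) r * w (- 1) r / zVI \<epsilon> r) *\<^sub>n p + (dlg 1 (- 1) r * w (- 1) r / (zVI \<epsilon> r - 1)) *\<^sub>n q) * YVI r) r"
proof -
  note ld = log_derivs[OF r]
  have "(- e' / (cI \<epsilon> r - 1)\<^sup>2 / zV \<epsilon> r) *\<^sub>n p + (- e' / (cI \<epsilon> r - 1)\<^sup>2 / (zV \<epsilon> r - 1)) *\<^sub>n q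
       + (- e' / (1 - of_real \<epsilon>) / lam \<epsilon> r) *\<^sub>n l = (e' / cI \<epsilon> r) *\<^sub>n p + (e' / (cI \<epsilon> r - 1)) *\<^sub>n m"
    unfolding ld by (rule ncs_eqI) (simp only: coef_simps coef_nscale m_def ring_distribs minus_mult_left, simp add: algebra_simps)
  then show ?V using nc_deriv_sol_e[OF lin(1) lin_m r] by (simp add: YV_def[abs_def])
  have "(e' / (1 - cI \<epsilon> r)\<^sup>2 / cIII \<epsilon> r) *\<^sub>n p + (e' / (1 - cI \<epsilon> r)\<^sup>2 / (cIII \<epsilon> r - 1)) *\<^sub>n q
       + (- e' / (1 - of_real \<epsilon>) / lam \<epsilon> r) *\<^sub>n l = (e' / cI \<epsilon> r) *\<^sub>n q + (e' / (cI \<epsilon> r - 1)) *\<^sub>n m"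
    unfolding ld by (rule ncs_eqI) (simp only: coef_simps coef_nscale m_def ring_distribs minus_mult_left, simp add: algebra_simps)
  then show ?III using nc_deriv_sol_e[OF lin(2) lin_m r] by (simp add: YIII_def[abs_def])
  have lp: "linear_ncs (p - l)" "linear_ncs (q - l)" by (intro linear_ncs_intros lin)+
  have "nc_deriv XVI (((dlg 1 (- 1) r * w (- 1) r / w (- 1) r) *\<^sub>n (p - l) + (dlg 1 (- 1) r * w (- 1) r / (w (- 1) r - 1)) *\<^sub>n q) * XVI r) r"
    unfolding XVI_def[abs_def]
    by (rule kz_along[OF lp(1) lin(2) w_deriv w_slit(1) w_ne]) (use lw_deriv[of "- 1" r] w_ne in simp)
  moreover have "(dlg 1 (- 1) r * w (- 1) r / w (- 1) r) *\<^sub>n (p - l) + (dlg 1 (- 1) r * w (- 1) r / (w (- 1) r - 1)) *\<^sub>n q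
     = (dlg 1 (- 1) r * w (- 1) r / zVI \<epsilon> r) *\<^sub>n p + (dlg 1 (- 1) r * w (- 1) r / (zVI \<epsilon> r - 1)) *\<^sub>n q + (- dlg 1 (- 1) r) *\<^sub>n l"
    using w_ne by (simp add: zVI_eq nscale_diff nscale_minus)
  ultimately show ?VI by (simp only:)
  have "nc_deriv XIV (((dlg 1 1 r * w 1 r / w 1 r) *\<^sub>n m + (dlg 1 1 r * w 1 r / (w 1 r - 1)) *\<^sub>n (q - l)) * XIV r) r"
    unfolding XIV_def[abs_def]
    by (rule kz_along[OF lin_m lp(2) w_deriv w_slit(1) w_ne]) (use lw_deriv[of 1 r] w_ne in simp)
  moreover have "(dlg 1 1 r * w 1 r / w 1 r) *\<^sub>n m + (dlg 1 1 r * w 1 r / (w 1 r - 1)) *\<^sub>n (q - l) =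
     (- (dlg 1 1 r / w 1 r) / cIV \<epsilon> r) *\<^sub>n p + (- (dlg 1 1 r / w 1 r) / (cIV \<epsilon> r - 1)) *\<^sub>n q
       + (- (dlg 1 1 r / (w 1 r - 1))) *\<^sub>n l"
  proof -
    have "dlg 1 1 r * w 1 r / w 1 r = dlg 1 1 r" using w_ne by simp
    then show ?thesis unfolding ld(6,7,11)
      by (intro ncs_eqI) (simp only: coef_simps coef_nscale m_def ring_distribs minus_mult_left, simp add: algebra_simps)
  qed
  ultimately show ?IV by (simp only:)
  have "nc_deriv XII (((dlg 1 1 r * w 1 r / w 1 r) *\<^sub>n q + (dlg 1 1 r * w 1 r / (w 1 r - 1)) *\<^sub>n p) * XII r) r"
    unfolding XII_def[abs_def]
    by (rule kz_along[OF lin(2,1) w_deriv w_slit(1) w_ne]) (use lw_deriv[of 1 r] w_ne in simp)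
  then show ?II unfolding ld(9,10) using w_ne by (simp add: add.commute)
  have "- e' / cI \<epsilon> (1 - r) = e' / (cI \<epsilon> r - 1)" "- e' / (cI \<epsilon> (1 - r) - 1) = e' / cI \<epsilon> r"
  proof -
    have *: "cI \<epsilon> (1 - r) = 1 - cI \<epsilon> r" by (simp add: cI_def algebra_simps)
    show "- e' / cI \<epsilon> (1 - r) = e' / (cI \<epsilon> r - 1)" unfolding * by (metis minus_diff_eq minus_divide_divide)
    show "- e' / (cI \<epsilon> (1 - r) - 1) = e' / cI \<epsilon> r" unfolding * by simp
  qed
  then show ?I using nc_deriv_sol_e[OF lin(2,1) r] by (simp add: YI_def[abs_def] add.commute)
qed (unfold YII_def[abs_def] ZIII_def[abs_def] YIV_def[abs_def] ZV_def[abs_def] YVI_def[abs_def];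
      rule nc_deriv_kz_lower[OF lin(1,2)]; rule paths_deriv[OF r] paths_lower[OF r])+

end

section \<open>Holonomies and 2-holonomies of the explicit paths\<close>

definition nc_Gam :: "'a ncs \<Rightarrow> 'a ncs \<Rightarrow> (real \<Rightarrow> complex) \<Rightarrow> real \<Rightarrow> 'a ncs" where
  "nc_Gam p q c r = (velocity c r / c r) *\<^sub>n p + (velocity c r / (c r - 1)) *\<^sub>n q"

lemma fundamental_Gam:
  assumes "\<And>r. r \<in> {0..1} \<Longrightarrow> (c has_vector_derivative c' r) (at r)"
    and "\<And>r. r \<in> {0..1} \<Longrightarrow> nc_deriv Y (((c' r / c r) *\<^sub>n p + (c' r / (c r - 1)) *\<^sub>n q) * Y r) r"
    and "\<And>r. coef (Y r) [] = 1"
  shows "fundamental (nc_Gam p q c) Y"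
proof (rule fundamentalI)
  fix r :: real assume r: "r \<in> {0..1}"
  show "nc_deriv Y (nc_Gam p q c r * Y r) r"
    unfolding nc_Gam_def velocity_eq[OF assms(1)[OF r] r] by (rule assms(2)[OF r])
qed (rule assms)

lemma fundamental_connection:
  assumes "\<And>r. P r = (z r, v r)"
    and "\<And>r. r \<in> {0..1} \<Longrightarrow> (z has_vector_derivative z' r) (at r)"
    and "\<And>r. r \<in> {0..1} \<Longrightarrow> (v has_vector_derivative v' r) (at r)"
    and "\<And>r. r \<in> {0..1} \<Longrightarrow> nc_deriv Y (((z' r / z r) *\<^sub>n p + (z' r / (z r - 1)) *\<^sub>n q + (v' r / v r) *\<^sub>n l) * Y r) r"
    and "\<And>r. coef (Y r) [] = 1"
  shows "fundamental (nc_connection p q l P) Y"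
proof (rule fundamentalI)
  fix r :: real assume r: "r \<in> {0..1}"
  have "fst \<circ> P = z" "snd \<circ> P = v" using assms(1) by auto
  hence "nc_connection p q l P r = (z' r / z r) *\<^sub>n p + (z' r / (z r - 1)) *\<^sub>n q + (v' r / v r) *\<^sub>n l"
    by (simp add: nc_connection_def velocity_eq[OF assms(2)[OF r] r] velocity_eq[OF assms(3)[OF r] r] assms(1))
  with assms(4)[OF r] show "nc_deriv Y (nc_connection p q l P r * Y r) r" by simp
qed (rule assms)

text \<open>The logarithmic derivatives are passed as separate functions \<open>h\<close> and
  \<open>k\<close>, so that solutions known in simplified form fit. The solution on the first
  stretch is normalised here instead of by the user.\<close>

lemma sweep_holonomy:
  fixes full :: bool
  assumes lin: "linear_ncs l"
    and z: "\<And>r. r \<in> {0..1} \<Longrightarrow> (z has_vector_derivative z' r) (at r)"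
    and v: "\<And>r. r \<in> {0..1} \<Longrightarrow> (v has_vector_derivative v' r) (at r)" "\<And>r. r \<in> {0..1} \<Longrightarrow> v r \<noteq> 0"
       "\<And>r. r \<in> {0..1} \<Longrightarrow> v' r / v r = h r"
    and n: "\<And>r. r \<in> {0..1} \<Longrightarrow> (n has_vector_derivative n' r) (at r)" "\<And>r. r \<in> {0..1} \<Longrightarrow> n r \<noteq> 0"
       "\<And>r. r \<in> {0..1} \<Longrightarrow> n' r / n r = k r"
    and N: "\<And>r. r \<in> {0..1} \<Longrightarrow> (N has_vector_derivative k r) (at r)" "N 0 = 0" "n 0 = 1"
    and Z: "\<And>r. r \<in> {0..1} \<Longrightarrow> nc_deriv Z (((z' r / z r) *\<^sub>n p + (z' r / (z r - 1)) *\<^sub>n q + h r *\<^sub>n l) * Z r) r"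
      "\<And>r. coef (Z r) [] = 1"
    and Y: "\<And>r. r \<in> {0..1} \<Longrightarrow> nc_deriv Y (((z' r / z r) *\<^sub>n p + (z' r / (z r - 1)) *\<^sub>n q
               + (h r + (if full then 0 else k r)) *\<^sub>n l) * Y r) r"
      "\<And>r. coef (Y r) [] = 1"
    and P: "\<And>s r. P s r = (if r \<le> s / 2 then (z (2 * r), v (2 * r))
       else if r \<le> (if full then (1 + s) / 2 else s) then (z s, v s * n (2 * r - s))
       else if full then (z (2 * r - 1), v (2 * r - 1) * n 1)
       else (z r, v r * n r))"
  shows "has_holonomy2 p q l P (holonomy Y * nexp (if full then N 1 else 0) l - nexp (N 1) l * holonomy Z)"
proof -
  interpret sweep p q l z z' v v' n n' N full "\<lambda>r. Z r * ninv (Z 0)" Y P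
  proof
    fix r :: real assume r: "r \<in> {0..1}"
    show "nc_deriv (\<lambda>r. Z r * ninv (Z 0)) (((z' r / z r) *\<^sub>n p + (z' r / (z r - 1)) *\<^sub>n q + (v' r / v r) *\<^sub>n l) * (Z r * ninv (Z 0))) r"
      unfolding v(3)[OF r] by (rule nc_deriv_normalized[OF Z(1)[OF r]])
    show "nc_deriv Y (((z' r / z r) *\<^sub>n p + (z' r / (z r - 1)) *\<^sub>n q
               + (v' r / v r + (if full then 0 else n' r / n r)) *\<^sub>n l) * Y r) r"
      unfolding v(3)[OF r] n(3)[OF r] by (rule Y(1)[OF r])
    show "(N has_vector_derivative n' r / n r) (at r)"
      unfolding n(3)[OF r] by (rule N(1)[OF r])
  qed (fact lin z v n N Y P | simp add: Z Y ninv)+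
  show ?thesis using has_holonomy2 by (simp add: en_def N holonomy_def split: if_splits)
qed

context kz_paths
begin

lemma const_deriv: "((\<lambda>_. c) has_vector_derivative 0) (at r)"
  by simp

lemma times_a_deriv: "(f has_vector_derivative f') (at r) \<Longrightarrow> ((\<lambda>x. f x * a) has_vector_derivative f' * a) (at r)" for f :: "real \<Rightarrow> complex"
  by (rule has_vector_derivative_mult_left)

lemma div_a: "x * a / (y * a) = x / y"
  using a by simp

lemma exp_deriv:
  fixes M n :: "real \<Rightarrow> complex"
  assumes "(M has_vector_derivative d) (at r)" "\<And>x. exp (M x) = n x"
  shows "(n has_vector_derivative d * n r) (at r)" "n r \<noteq> 0"
proof -
  have "((exp \<circ> M) has_vector_derivative d * exp (M r)) (at r)"
    by (rule field_vector_diff_chain_at[OF assms(1)]) (rule DERIV_exp)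
  moreover have "exp \<circ> M = n" using assms(2) by auto
  ultimately show "(n has_vector_derivative d * n r) (at r)" by (simp add: assms(2))
  show "n r \<noteq> 0" using assms(2) by (metis exp_not_eq_zero)
qed

lemmas n6_deriv = exp_deriv[OF N_deriv(2) exp_N(2)]
lemmas n4_deriv = exp_deriv[OF N_deriv(3) exp_N(3)]

lemma v4_eq: "a * of_real \<epsilon> / (1 - of_real \<epsilon>) * n4 r = a / (cIV \<epsilon> r - 1)"
  using eps_ne by (simp add: n4_def)

lemma qdown_deriv:
  assumes r: "r \<in> {0..1}"
  shows "((\<lambda>r. a / (cIV \<epsilon> r - 1)) has_vector_derivative a * of_real \<epsilon> / (1 - of_real \<epsilon>) * (- (dlg 1 1 r / (w 1 r - 1)) * n4 r)) (at r)"
    "a * of_real \<epsilon> / (1 - of_real \<epsilon>) * (- (dlg 1 1 r / (w 1 r - 1)) * n4 r) / (a / (cIV \<epsilon> r - 1)) = - (dlg 1 1 r / (w 1 r - 1))"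
proof -
  show "((\<lambda>r. a / (cIV \<epsilon> r - 1)) has_vector_derivative a * of_real \<epsilon> / (1 - of_real \<epsilon>) * (- (dlg 1 1 r / (w 1 r - 1)) * n4 r)) (at r)"
    using has_vector_derivative_mult_right[OF n4_deriv(1)[OF r]] unfolding v4_eq[symmetric] by blast
  have "n4 r \<noteq> 0" using exp_N(3)[of r] by (metis exp_not_eq_zero)
  then show "a * of_real \<epsilon> / (1 - of_real \<epsilon>) * (- (dlg 1 1 r / (w 1 r - 1)) * n4 r) / (a / (cIV \<epsilon> r - 1)) = - (dlg 1 1 r / (w 1 r - 1))"
    unfolding v4_eq[symmetric] using a eps_ne by simp
qed

lemma cI_reverse_deriv: "((\<lambda>r. cI \<epsilon> (1 - r)) has_vector_derivative - e') (at r)"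
proof -
  have "((\<lambda>r. 1 - r :: real) has_vector_derivative - 1) (at r)"
    by (auto intro!: derivative_eq_intros simp: has_vector_derivative_def)
  from vector_diff_chain_at[OF this cI_deriv] show ?thesis by (simp add: o_def)
qed

lemma fundamental_paths:
  "fundamental (nc_connection p q l (pI \<epsilon> a)) YI"
  "fundamental (nc_connection p q l (pII \<epsilon> a)) XII"
  "fundamental (nc_connection p q l (pIII \<epsilon> a)) YIII"
  "fundamental (nc_connection p q l (pIV \<epsilon> a)) YIV"
  "fundamental (nc_connection p q l (pVI \<epsilon> a)) YVI"
  "fundamental (nc_connection p q l (qV \<epsilon> a)) YV"
  "fundamental (nc_connection p q l (qVI \<epsilon> a)) XVI"
  "fundamental (nc_connection p q l (qdown1 \<epsilon> a)) (\<lambda>r. nexp (N4 r) l)"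
  "fundamental (nc_Gam p q (cIII \<epsilon>)) ZIII"
proof -
  show "fundamental (nc_connection p q l (pI \<epsilon> a)) YI"
    by (rule fundamental_connection[OF pI_def cI_reverse_deriv const_deriv]) (use Y_deriv in auto)
  show "fundamental (nc_connection p q l (pII \<epsilon> a)) XII"
    by (rule fundamental_connection[OF pII_def paths_deriv(4) const_deriv]) (use Y_deriv in auto)
  show "fundamental (nc_connection p q l (pIV \<epsilon> a)) YIV"
    by (rule fundamental_connection[OF pIV_def paths_deriv(5) const_deriv]) (use Y_deriv in auto)
  show "fundamental (nc_connection p q l (pVI \<epsilon> a)) YVI"
    by (rule fundamental_connection[OF pVI_def paths_deriv(6) const_deriv]) (use Y_deriv in auto)
  show "fundamental (nc_connection p q l (pIII \<epsilon> a)) YIII"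
    by (rule fundamental_connection[OF pIII_def paths_deriv(1) times_a_deriv[OF paths_deriv(3)]])
      (use Y_deriv(2) in \<open>auto simp only: div_a coef_Y\<close>)
  have "((\<lambda>r. (cI \<epsilon> r - 1) * a) has_vector_derivative e' * a) (at r)" for r
    using has_vector_derivative_diff[OF cI_deriv const_deriv[of 1]] by (intro times_a_deriv) simp
  then show "fundamental (nc_connection p q l (qV \<epsilon> a)) YV"
    by (intro fundamental_connection[OF qV_def paths_deriv(2)])
      (use Y_deriv(1) in \<open>auto simp only: div_a coef_Y log_derivs(3)\<close>)
  show "fundamental (nc_connection p q l (qVI \<epsilon> a)) XVI"
  proof (rule fundamental_connection[of _ "zVI \<epsilon>" "\<lambda>r. a * n6 r"])
    fix r :: real assume r: "r \<in> {0..1}"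
    show "((\<lambda>r. a * n6 r) has_vector_derivative a * (- dlg 1 (- 1) r * n6 r)) (at r)"
      by (rule has_vector_derivative_mult_right[OF n6_deriv(1)[OF r]])
    have "a * (- dlg 1 (- 1) r * n6 r) / (a * n6 r) = - dlg 1 (- 1) r"
      using n6_deriv(2)[OF r] a by simp
    then show "nc_deriv XVI (((dlg 1 (- 1) r * w (- 1) r / zVI \<epsilon> r) *\<^sub>n p + (dlg 1 (- 1) r * w (- 1) r / (zVI \<epsilon> r - 1)) *\<^sub>n q
       + (a * (- dlg 1 (- 1) r * n6 r) / (a * n6 r)) *\<^sub>n l) * XVI r) r"
      using Y_deriv(3)[OF r] by (simp only:)
  qed (auto simp: qVI_def n6_def paths_deriv)
  show "fundamental (nc_connection p q l (qdown1 \<epsilon> a)) (\<lambda>r. nexp (N4 r) l)"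
  proof (rule fundamental_connection[OF qdown1_def const_deriv qdown_deriv(1)])
    fix r :: real assume r: "r \<in> {0..1}"
    show "nc_deriv (\<lambda>r. nexp (N4 r) l) (((0 / (1 - 1 / of_real \<epsilon>)) *\<^sub>n p + (0 / (1 - 1 / of_real \<epsilon> - 1)) *\<^sub>n q
       + (a * of_real \<epsilon> / (1 - of_real \<epsilon>) * (- (dlg 1 1 r / (w 1 r - 1)) * n4 r) / (a / (cIV \<epsilon> r - 1))) *\<^sub>n l) * nexp (N4 r) l) r"
      unfolding qdown_deriv(2)[OF r] using nc_deriv_nexp[OF N_deriv(3)[OF r] linear_ncs_Nil[OF lin(3)]] by simp
  qed auto
  show "fundamental (nc_Gam p q (cIII \<epsilon>)) ZIII"
    by (rule fundamental_Gam[OF paths_deriv(1)]) (use Y_deriv in auto)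
qed

lemma fundamental_cI:
  "linear_ncs A \<Longrightarrow> linear_ncs B \<Longrightarrow> fundamental (nc_Gam A B (cI \<epsilon>)) (\<lambda>r. kz_sol A B (e r))"
  by (rule fundamental_Gam[OF cI_deriv]) (use nc_deriv_sol_e in auto)

text \<open>\<open>PIV\<close> and \<open>QV\<close> fill rectangles, where the vertical segment
  survives at \<open>s = 0\<close> and its exponential stands on the right. In the four triangles it
  shrinks to a point there.\<close>

lemma holonomies2:
  "has_holonomy2 p q l (PV \<epsilon> a) (holonomy YV - nexp (N5 1) l * holonomy ZV)"
  "has_holonomy2 p q l (PIII \<epsilon> a) (holonomy YIII - nexp (N5 1) l * holonomy ZIII)"
  "has_holonomy2 p q l (PIV \<epsilon> a) (holonomy YIV * nexp (N5 1) l - nexp (N5 1) l * holonomy YIV)"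
  "has_holonomy2 p q l (QVI \<epsilon> a) (holonomy XVI - nexp \<mu> l * holonomy YVI)"
  "has_holonomy2 p q l (QV \<epsilon> a) (holonomy YV * nexp \<mu> l - nexp \<mu> l * holonomy YV)"
  "has_holonomy2 p q l (QIV \<epsilon> a) (holonomy XIV - nexp \<mu> l * holonomy YIV)"
proof -
  have horiz: "nc_deriv Z (G * Z r) r \<Longrightarrow> nc_deriv Z ((G + 0 *\<^sub>n l) * Z r) r" for Z G r by simp
  have tri: "nc_deriv Z ((G + c *\<^sub>n l) * Z r) r \<Longrightarrow> nc_deriv Z ((G + (0 + (if False then 0 else c)) *\<^sub>n l) * Z r) r" for Z G r c by simp
  have rect: "nc_deriv Z ((G + c *\<^sub>n l) * Z r) r \<Longrightarrow> nc_deriv Z ((G + (c + (if True then 0 else d)) *\<^sub>n l) * Z r) r" for Z G r c d by simp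
  have rect0: "nc_deriv Z (G * Z r) r \<Longrightarrow> nc_deriv Z ((G + (0 + (if True then 0 else d)) *\<^sub>n l) * Z r) r" for Z G r d by simp
  have triv: "0 / c = (0 :: complex)" for c by simp
  have cancel: "d * x / x = d" if "x \<noteq> 0" for d x :: complex using that by simp
  have lam1: "lam \<epsilon> 1 = of_real \<epsilon> / (1 - of_real \<epsilon>)"
    by (simp add: lam_def e(3) e(2))
  have "has_holonomy2 p q l (PV \<epsilon> a) (holonomy YV * nexp (if False then N5 1 else 0) l - nexp (N5 1) l * holonomy ZV)"
    by (rule sweep_holonomy[OF lin(3) paths_deriv(2) const_deriv a triv paths_deriv(3) lam_ne refl N_deriv(1) N_0(1) n_0(1)
        horiz[OF Y_deriv(10)] coef_Y(9) tri[OF Y_deriv(1)] coef_Y(8)]) (auto simp: PV_def pV_def)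
  then show "has_holonomy2 p q l (PV \<epsilon> a) (holonomy YV - nexp (N5 1) l * holonomy ZV)" by simp
  have "has_holonomy2 p q l (PIII \<epsilon> a) (holonomy YIII * nexp (if False then N5 1 else 0) l - nexp (N5 1) l * holonomy ZIII)"
    by (rule sweep_holonomy[OF lin(3) paths_deriv(1) const_deriv a triv paths_deriv(3) lam_ne refl N_deriv(1) N_0(1) n_0(1)
        horiz[OF Y_deriv(8)] coef_Y(5) tri[OF Y_deriv(2)] coef_Y(4)]) (auto simp: PIII_def pIII_def)
  then show "has_holonomy2 p q l (PIII \<epsilon> a) (holonomy YIII - nexp (N5 1) l * holonomy ZIII)" by simp
  have "has_holonomy2 p q l (PIV \<epsilon> a) (holonomy YIV * nexp (if True then N5 1 else 0) l - nexp (N5 1) l * holonomy YIV)"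
    by (rule sweep_holonomy[OF lin(3) paths_deriv(5) const_deriv a triv paths_deriv(3) lam_ne refl N_deriv(1) N_0(1) n_0(1)
        horiz[OF Y_deriv(9)] coef_Y(6) rect0[OF Y_deriv(9)] coef_Y(6)]) (auto simp: PIV_def pIV_def lam1)
  then show "has_holonomy2 p q l (PIV \<epsilon> a) (holonomy YIV * nexp (N5 1) l - nexp (N5 1) l * holonomy YIV)" by simp
  have "has_holonomy2 p q l (QVI \<epsilon> a) (holonomy XVI * nexp (if False then N6 1 else 0) l - nexp (N6 1) l * holonomy YVI)"
    by (rule sweep_holonomy[OF lin(3) paths_deriv(6) const_deriv a triv n6_deriv cancel[OF n6_deriv(2)] N_deriv(2) N_0(2) n_0(2)
        horiz[OF Y_deriv(11)] coef_Y(10) tri[OF Y_deriv(3)] coef_Y(11)]) (auto simp: QVI_def pVI_def qVI_def n6_def)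
  then show "has_holonomy2 p q l (QVI \<epsilon> a) (holonomy XVI - nexp \<mu> l * holonomy YVI)" by (simp add: N_1)
  \<comment> \<open>The far edge of the rectangle is \<open>qV\<close>, because \<open>n6\<close>
    ends at \<open>\<epsilon> - 1\<close>, which turns \<open>lam\<close> into
    \<open>cI - 1\<close>.\<close>
  have lamn6: "lam \<epsilon> r * a * n6 1 = (cI \<epsilon> r - 1) * a" for r
  proof -
    have "n6 1 = of_real \<epsilon> - 1" using eps_ne w_0_1(2)[of "- 1"] by (simp add: n6_def zVI_eq)
    moreover have "lam \<epsilon> r * (of_real \<epsilon> - 1) = cI \<epsilon> r - 1" using eps_ne by (simp add: lam_def field_simps)
    ultimately show ?thesis by (metis mult.commute mult.assoc)
  qed
  have lam_a: "lam \<epsilon> r * a \<noteq> 0" if "r \<in> {0..1}" for r using lam_ne[OF that] a by simp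
  have "has_holonomy2 p q l (QV \<epsilon> a) (holonomy YV * nexp (if True then N6 1 else 0) l - nexp (N6 1) l * holonomy YV)"
    by (rule sweep_holonomy[OF lin(3) paths_deriv(2) times_a_deriv[OF paths_deriv(3)] lam_a div_a n6_deriv cancel[OF n6_deriv(2)] N_deriv(2) N_0(2) n_0(2)
        Y_deriv(1) coef_Y(8) rect[OF Y_deriv(1)] coef_Y(8)]) (auto simp: QV_def pV_def qV_def lamn6, simp_all add: n6_def)
  then show "has_holonomy2 p q l (QV \<epsilon> a) (holonomy YV * nexp \<mu> l - nexp \<mu> l * holonomy YV)" by (simp add: N_1)
  have v_ne: "a * of_real \<epsilon> / (1 - of_real \<epsilon>) \<noteq> 0" using a eps_ne by simp
  have "has_holonomy2 p q l (QIV \<epsilon> a) (holonomy XIV * nexp (if False then N4 1 else 0) l - nexp (N4 1) l * holonomy YIV)"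
  proof (rule sweep_holonomy[OF lin(3) paths_deriv(5) const_deriv v_ne triv n4_deriv cancel[OF n4_deriv(2)] N_deriv(3) N_0(3) n_0(3)
        horiz[OF Y_deriv(9)] coef_Y(6) tri[OF Y_deriv(4)] coef_Y(7)])
    fix s r
    show "QIV \<epsilon> a s r = (if r \<le> s / 2 then (cIV \<epsilon> (2 * r), a * of_real \<epsilon> / (1 - of_real \<epsilon>))
       else if r \<le> (if False then (1 + s) / 2 else s) then (cIV \<epsilon> s, a * of_real \<epsilon> / (1 - of_real \<epsilon>) * n4 (2 * r - s))
       else if False then (cIV \<epsilon> (2 * r - 1), a * of_real \<epsilon> / (1 - of_real \<epsilon>) * n4 1)
       else (cIV \<epsilon> r, a * of_real \<epsilon> / (1 - of_real \<epsilon>) * n4 r))"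
      unfolding v4_eq by (simp add: QIV_def pIV_def qIV_def)
  qed
  then show "has_holonomy2 p q l (QIV \<epsilon> a) (holonomy XIV - nexp \<mu> l * holonomy YIV)" by (simp add: N_1)
qed

text \<open>For constant \<open>v\<close> each factor is a quotient of values of
  \<open>kz_lower p q\<close>, and both concatenations have the same endpoints, so the products
  telescope. This is the flatness of the connection in the plane \<open>v = a\<close>.\<close>

lemma loop:
  "holonomy YIV * holonomy ZIII * holonomy XII = holonomy ZV * holonomy YVI * holonomy YI"
proof -
  have "nc_deriv (\<lambda>r. kz_lower p q (cI \<epsilon> (1 - r))) (((- e' / cI \<epsilon> (1 - r)) *\<^sub>n p + (- e' / (cI \<epsilon> (1 - r) - 1)) *\<^sub>n q) * kz_lower p q (cI \<epsilon> (1 - r))) r"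
    if "r \<in> {0..1}" for r
    using that cI_ne[of "1 - r"] by (intro nc_deriv_kz_lower lin cI_reverse_deriv) (auto simp: e(3))
  hence I: "holonomy YI = holonomy (\<lambda>r. kz_lower p q (cI \<epsilon> (1 - r)))"
    using Y_deriv(6) by (intro holonomy_unique) auto
  have II: "holonomy XII = holonomy YII"
    by (rule holonomy_unique[OF Y_deriv(5) _ Y_deriv(7)]) auto
  have pts: "cI \<epsilon> 0 = of_real \<epsilon>" "cI \<epsilon> 1 = 1 - of_real \<epsilon>" "cII \<epsilon> 0 = 1 - of_real \<epsilon>" "cII \<epsilon> 1 = 1 / (1 - of_real \<epsilon>)"
    "cIII \<epsilon> 0 = 1 / (1 - of_real \<epsilon>)" "cIII \<epsilon> 1 = 1 / of_real \<epsilon>" "cIV \<epsilon> 0 = 1 / of_real \<epsilon>" "cIV \<epsilon> 1 = zV \<epsilon> 1"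
    "zVI \<epsilon> 0 = of_real \<epsilon>" "zVI \<epsilon> 1 = zV \<epsilon> 0"
    using eps_ne by (simp_all add: e cII_eq cIV_eq zVI_eq w_0_1 cIII_def zV_def divide_simps)
  show ?thesis
    unfolding I II unfolding holonomy_def ZIII_def YII_def YIV_def ZV_def YVI_def
    by (simp add: pts mult.assoc)
qed

text \<open>Interior edges occur twice with opposite signs: the vertical factors match because
  \<open>N4 1\<close> and \<open>N6 1\<close> agree, and the two remaining products in the plane
  \<open>v = a\<close> match by \<open>loop\<close>. Only the outer boundary is left.\<close>

lemma boundary:
  "holonomy YV * (holonomy XVI - nexp \<mu> l * holonomy YVI) * holonomy YI
     + (holonomy YV * nexp \<mu> l - nexp \<mu> l * holonomy YV) * holonomy YVI * holonomy YI
     + nexp (N4 1) l * ((holonomy YV - nexp (N5 1) l * holonomy ZV) * holonomy YVI * holonomy YI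
         - (holonomy YIV * nexp (N5 1) l - nexp (N5 1) l * holonomy YIV) * holonomy ZIII * holonomy XII
         - holonomy YIV * (holonomy YIII - nexp (N5 1) l * holonomy ZIII) * holonomy XII)
     - (holonomy XIV - nexp \<mu> l * holonomy YIV) * holonomy YIII * holonomy XII
   = holonomy YV * holonomy XVI * holonomy YI - holonomy XIV * holonomy YIII * holonomy XII"
proof -
  have "holonomy YIV * (holonomy ZIII * holonomy XII) = holonomy ZV * (holonomy YVI * holonomy YI)"
    using loop by (simp add: mult.assoc)
  then show ?thesis by (simp add: N_1 algebra_simps)
qed

end

subsection \<open>The limit\<close>

lemma nc_tendsto_cong_rev:
  "nc_tendsto g M F \<Longrightarrow> eventually (\<lambda>x. f x = g x) F \<Longrightarrow> M = L \<Longrightarrow> nc_tendsto f L F"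
  unfolding nc_tendsto_def
proof
  fix w
  assume *: "\<forall>w. ((\<lambda>x. coef (g x) w) \<longlongrightarrow> coef M w) F" "eventually (\<lambda>x. f x = g x) F" "M = L"
  have "eventually (\<lambda>x. coef (g x) w = coef (f x) w) F"
    using *(2) by eventually_elim simp
  with *(1,3) show "((\<lambda>x. coef (f x) w) \<longlongrightarrow> coef L w) F"
    using Lim_transform_eventually by metis
qed

definition nc_Phi :: "real \<Rightarrow> 'a ncs \<Rightarrow> 'a ncs \<Rightarrow> 'a ncs" where
  "nc_Phi \<epsilon> A B = nexp (- of_real (ln \<epsilon>)) B * (kz_sol A B (1 - \<epsilon>) * ninv (kz_sol A B \<epsilon>)) * nexp (of_real (ln \<epsilon>)) A"

lemma of_real_deriv: "((\<lambda>x. complex_of_real x) has_vector_derivative 1) (at x)"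
  using has_vector_derivative_of_real[OF DERIV_ident] by simp

lemma nc_deriv_kzs_0:
  "\<exists>D. nc_deriv (\<lambda>\<epsilon>. kzs A B (of_real \<epsilon>)) D 0"
  "\<exists>D. nc_deriv (\<lambda>\<epsilon>. kzs A B (of_real \<epsilon> / (of_real \<epsilon> - 1))) D 0"
proof -
  show "\<exists>D. nc_deriv (\<lambda>\<epsilon>. kzs A B (of_real \<epsilon>)) D 0"
    by (rule nc_deriv_kzs_ex[OF of_real_deriv]) simp
  have "((\<lambda>z. z / (z - 1)) has_field_derivative - 1) (at (of_real 0 :: complex))"
    by (auto intro!: derivative_eq_intros)
  from field_vector_diff_chain_at[OF of_real_deriv this]
  show "\<exists>D. nc_deriv (\<lambda>\<epsilon>. kzs A B (of_real \<epsilon> / (of_real \<epsilon> - 1))) D 0"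
    by (intro nc_deriv_kzs_ex[of "\<lambda>\<epsilon>. of_real \<epsilon> / (of_real \<epsilon> - 1)"]) (auto simp: o_def)
qed

text \<open>Passing to the solution normalised at 1 puts the associator between two conjugated
  regular factors, one belonging to each puncture; each conjugate tends to 1.\<close>

lemma nc_Phi_eq:
  assumes "linear_ncs A" "linear_ncs B" "0 < \<epsilon>" "\<epsilon> < 1"
  shows "nc_Phi \<epsilon> A B = (nexp (- of_real (ln \<epsilon>)) B * kzs B A (of_real \<epsilon>) * nexp (of_real (ln \<epsilon>)) B)
     * kz_assoc A B * (nexp (- of_real (ln \<epsilon>)) A * ninv (kzs A B (of_real \<epsilon>)) * nexp (of_real (ln \<epsilon>)) A)"
proof -
  have "kz_sol A B (1 - \<epsilon>) = kz_sol B A \<epsilon> * kz_assoc A B"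
    using kz_connection[OF assms(1,2), of "1 - \<epsilon>"] assms by simp
  moreover have "ninv (kz_sol A B \<epsilon>) = nexp (- of_real (ln \<epsilon>)) A * ninv (kzs A B (of_real \<epsilon>))"
    by (simp add: kz_sol_def ninv_mult ninv_nexp assms)
  ultimately show ?thesis by (simp add: nc_Phi_def kz_sol_def mult.assoc)
qed

lemma nc_Phi_tendsto:
  assumes A: "linear_ncs A" and B: "linear_ncs B"
  shows "nc_tendsto (\<lambda>\<epsilon>. nc_Phi \<epsilon> A B) (kz_assoc A B) (at_right 0)"
proof -
  obtain D D' where D: "nc_deriv (\<lambda>\<epsilon>. kzs B A (of_real \<epsilon>)) D 0" "nc_deriv (\<lambda>\<epsilon>. ninv (kzs A B (of_real \<epsilon>))) D' 0"
    using nc_deriv_kzs_0(1)[of B A] nc_deriv_kzs_0(1)[of A B] nc_deriv_ninv[of "\<lambda>\<epsilon>. kzs A B (of_real \<epsilon>)"]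
    by (metis coef_kzs_Nil)
  have "nc_tendsto (\<lambda>\<epsilon>. (nexp (- of_real (ln \<epsilon>)) B * kzs B A (of_real \<epsilon>) * nexp (of_real (ln \<epsilon>)) B)
     * kz_assoc A B * (nexp (- of_real (ln \<epsilon>)) A * ninv (kzs A B (of_real \<epsilon>)) * nexp (of_real (ln \<epsilon>)) A))
     (1 * kz_assoc A B * 1) (at_right 0)"
    using D A B by (intro nc_tendsto_mult nc_tendsto_const nc_conj_tendsto_1) auto
  then show ?thesis
  proof (rule nc_tendsto_cong_rev)
    have "eventually (\<lambda>\<epsilon>::real. \<epsilon> \<in> {0<..<1}) (at_right 0)"
      by (rule eventually_at_right_real) simp
    then show "eventually (\<lambda>\<epsilon>. nc_Phi \<epsilon> A B = (nexp (- of_real (ln \<epsilon>)) B * kzs B A (of_real \<epsilon>) * nexp (of_real (ln \<epsilon>)) B)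
     * kz_assoc A B * (nexp (- of_real (ln \<epsilon>)) A * ninv (kzs A B (of_real \<epsilon>)) * nexp (of_real (ln \<epsilon>)) A)) (at_right 0)"
      by eventually_elim (auto intro!: nc_Phi_eq A B)
  qed simp
qed

text \<open>The holonomy of a half turn divided by its limiting exponential. At \<epsilon> = 0 it is
  differentiable with value 1, so conjugation by powers of \<epsilon> does no harm.\<close>

definition nc_half_turn :: "'a ncs \<Rightarrow> 'a ncs \<Rightarrow> complex \<Rightarrow> real \<Rightarrow> 'a ncs" where
  "nc_half_turn A B c \<epsilon> = kzs A B (of_real \<epsilon> / (of_real \<epsilon> - 1)) * nexp (c - of_real (ln (1 - \<epsilon>))) A
      * ninv (kzs A B (of_real \<epsilon>)) * nexp (- c) A"

lemma nc_half_turn_conj_tendsto: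
  assumes A: "linear_ncs A" and P: "linear_ncs P"
  shows "nc_tendsto (\<lambda>\<epsilon>. nexp (- of_real (ln \<epsilon>)) P * nc_half_turn A B c \<epsilon> * nexp (of_real (ln \<epsilon>)) P) 1 (at_right 0)"
proof -
  obtain D1 D2 where D: "nc_deriv (\<lambda>\<epsilon>. kzs A B (of_real \<epsilon> / (of_real \<epsilon> - 1))) D1 0" "nc_deriv (\<lambda>\<epsilon>. ninv (kzs A B (of_real \<epsilon>))) D2 0"
    using nc_deriv_kzs_0(2)[of A B] nc_deriv_kzs_0(1)[of A B] nc_deriv_ninv[of "\<lambda>\<epsilon>. kzs A B (of_real \<epsilon>)"]
    by (metis coef_kzs_Nil)
  have "((\<lambda>x. ln (1 - x)) has_real_derivative - 1) (at (0::real))"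
    by (auto intro!: derivative_eq_intros)
  hence "((\<lambda>x. c - complex_of_real (ln (1 - x))) has_vector_derivative 0 - of_real (- 1)) (at 0)"
    by (intro has_vector_derivative_diff has_vector_derivative_const has_vector_derivative_of_real)
  from nc_deriv_nexp[OF this linear_ncs_Nil[OF A]]
  obtain D3 where D3: "nc_deriv (\<lambda>x. nexp (c - of_real (ln (1 - x))) A) D3 0" by blast
  show ?thesis
    by (rule nc_conj_tendsto_1[OF _ _ P], unfold nc_half_turn_def,
       rule nc_deriv_mult_right[OF nc_deriv_mult[OF nc_deriv_mult[OF D(1) D3] D(2)]]) (simp add: A)
qed

text \<open>Source minus target of the pre-hexagonator, written in free variables, where the two do
  not agree.\<close>

definition nc_hexagon :: "'a ncs \<Rightarrow> 'a ncs \<Rightarrow> 'a ncs \<Rightarrow> 'a ncs" where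
  "nc_hexagon p q m = kz_assoc p m * nexp (\<i> * of_real pi) (q + m) * kz_assoc q p
     - nexp (\<i> * of_real pi) m * kz_assoc q m * nexp (\<i> * of_real pi) q"

context kz_paths
begin

definition "nc_K = nexp (- of_real (ln \<epsilon>)) p * holonomy XVI * nexp (- (\<i> * of_real pi)) (q + m) * nexp (of_real (ln \<epsilon>)) p"
definition "nc_t = (nexp (- of_real (ln \<epsilon>)) p * nexp (\<i> * of_real pi) (q + m)
     - nexp (\<i> * of_real pi) (q + m) * nexp (- of_real (ln \<epsilon>)) p) * nexp (of_real (ln \<epsilon>)) p"
definition "nc_prehex = nexp (- of_real (ln \<epsilon>)) m * (holonomy YV * holonomy XVI * holonomy YI - holonomy XIV * holonomy YIII * holonomy XII)
       * nexp (of_real (ln \<epsilon>)) q - nc_Phi \<epsilon> p m * nc_K * nc_t * nc_Phi \<epsilon> q p"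

text \<open>The exponent \<open>q + m\<close> for \<open>XVI\<close> arises from the residue
  \<open>p - l = - (q + m)\<close> and the clockwise turn, whose two signs cancel.\<close>

lemma holonomy_half_turn:
  "holonomy XVI = nc_half_turn (p - l) q (- (\<i> * of_real pi)) \<epsilon> * nexp (\<i> * of_real pi) (q + m)"
  "holonomy XIV = nc_half_turn m (q - l) (\<i> * of_real pi) \<epsilon> * nexp (\<i> * of_real pi) m"
  "holonomy XII = nc_half_turn q p (\<i> * of_real pi) \<epsilon> * nexp (\<i> * of_real pi) q"
proof -
  have *: "kzs A B (w \<sigma> 1) * nexp (lw \<sigma> 1) A * ninv (kzs A B (w \<sigma> 0) * nexp (lw \<sigma> 0) A) =
     nc_half_turn A B (of_real \<sigma> * \<i> * of_real pi) \<epsilon> * nexp (of_real \<sigma> * \<i> * of_real pi) A"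
    if "linear_ncs A" "\<bar>\<sigma>\<bar> = 1" for A B \<sigma>
  proof -
    have A: "coef A [] = 0" using that by simp
    have "nexp (lw \<sigma> 1) A * nexp (- of_real (ln \<epsilon>)) A = nexp (of_real \<sigma> * \<i> * of_real pi - of_real (ln (1 - \<epsilon>))) A"
      unfolding lw_0_1(2)[OF that(2)] nexp_add[OF A, symmetric] by simp
    then show ?thesis
      by (simp add: nc_half_turn_def w_0_1 that lw_0_1(1) ninv_mult ninv_nexp mult.assoc A flip: mult.assoc[of "nexp (lw \<sigma> 1) A"])
  qed
  have pl: "linear_ncs (p - l)" "linear_ncs (q - l)" by (intro linear_ncs_intros lin)+
  have "nexp (- (\<i> * of_real pi)) (p - l) = nexp (\<i> * of_real pi) (q + m)"
    using nexp_minus[of "\<i> * of_real pi" "p - l"] by (simp add: m_def)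
  then show "holonomy XVI = nc_half_turn (p - l) q (- (\<i> * of_real pi)) \<epsilon> * nexp (\<i> * of_real pi) (q + m)"
    unfolding holonomy_def XVI_def using *[OF pl(1), of "- 1" q] by simp
  show "holonomy XIV = nc_half_turn m (q - l) (\<i> * of_real pi) \<epsilon> * nexp (\<i> * of_real pi) m"
    unfolding holonomy_def XIV_def using *[OF lin_m, of 1 "q - l"] by simp
  show "holonomy XII = nc_half_turn q p (\<i> * of_real pi) \<epsilon> * nexp (\<i> * of_real pi) q"
    unfolding holonomy_def XII_def using *[OF lin(2), of 1 p] by simp
qed

text \<open>The clockwise half turn carries the exponential of \<open>q + m\<close>, which does not
  commute with \<open>p\<close>, so conjugating it by \<epsilon> to the power \<open>p\<close>
  creates divergent powers of the logarithm. Subtracting the correction with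
  \<open>nc_K * nc_t\<close> replaces this conjugate by the plain exponential; only
  \<open>nc_half_turn\<close> stays conjugated, and that tends to 1.\<close>

lemma nc_prehex_eq:
  "nc_prehex = nc_Phi \<epsilon> p m * (nexp (- of_real (ln \<epsilon>)) p * nc_half_turn (p - l) q (- (\<i> * of_real pi)) \<epsilon> * nexp (of_real (ln \<epsilon>)) p)
       * nexp (\<i> * of_real pi) (q + m) * nc_Phi \<epsilon> q p
     - (nexp (- of_real (ln \<epsilon>)) m * nc_half_turn m (q - l) (\<i> * of_real pi) \<epsilon> * nexp (of_real (ln \<epsilon>)) m)
       * nexp (\<i> * of_real pi) m * nc_Phi \<epsilon> q m
       * (nexp (- of_real (ln \<epsilon>)) q * nc_half_turn q p (\<i> * of_real pi) \<epsilon> * nexp (of_real (ln \<epsilon>)) q)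
       * nexp (\<i> * of_real pi) q"
proof -
  have l0: "coef p [] = 0" "coef q [] = 0" "coef m [] = 0" "coef (q + m) [] = 0"
    using lin lin_m by simp_all
  define L where "L = complex_of_real (ln \<epsilon>)"
  define J where "J = \<i> * complex_of_real pi"
  have hol: "kz_sol A B (1 - \<epsilon>) * ninv (kz_sol A B \<epsilon>) = nexp L B * nc_Phi \<epsilon> A B * nexp (- L) A"
    if "coef A [] = 0" "coef B [] = 0" for A B
    using that by (simp add: nc_Phi_def L_def mult.assoc)
  have Y: "holonomy YV = nexp L m * nc_Phi \<epsilon> p m * nexp (- L) p"
    "holonomy YI = nexp L p * nc_Phi \<epsilon> q p * nexp (- L) q"
    "holonomy YIII = nexp L m * nc_Phi \<epsilon> q m * nexp (- L) q"
    unfolding holonomy_def Y_defs e by (rule hol; fact l0)+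
  have comm: "nexp L A * nexp J A = nexp J A * nexp L A" if "coef A [] = 0" for A
    by (simp add: add.commute that flip: nexp_add)
  have comm': "nexp L A * (nexp J A * X) = nexp J A * (nexp L A * X)" if "coef A [] = 0" for A X
    using comm[OF that] by (metis mult.assoc)
  show ?thesis
    unfolding nc_prehex_def nc_K_def nc_t_def holonomy_half_turn Y L_def[symmetric] J_def[symmetric]
    by (simp add: mult.assoc left_diff_distrib right_diff_distrib l0 comm comm')
qed

end

lemma nc_prehex_tendsto:
  assumes "linear_ncs p" "linear_ncs q" "linear_ncs l"
  shows "nc_tendsto (\<lambda>\<epsilon>. kz_paths.nc_prehex p q l \<epsilon>) (nc_hexagon p q (l - p - q)) (at_right 0)"
proof -
  define m0 where "m0 = l - p - q"
  have m: "linear_ncs m0" unfolding m0_def by (intro linear_ncs_intros assms)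
  have lin: "linear_ncs (p - l)" "linear_ncs (q - l)" by (intro linear_ncs_intros assms)+
  have "nc_tendsto (\<lambda>\<epsilon>. nc_Phi \<epsilon> p m0 * (nexp (- of_real (ln \<epsilon>)) p * nc_half_turn (p - l) q (- (\<i> * of_real pi)) \<epsilon> * nexp (of_real (ln \<epsilon>)) p)
       * nexp (\<i> * of_real pi) (q + m0) * nc_Phi \<epsilon> q p
     - (nexp (- of_real (ln \<epsilon>)) m0 * nc_half_turn m0 (q - l) (\<i> * of_real pi) \<epsilon> * nexp (of_real (ln \<epsilon>)) m0)
       * nexp (\<i> * of_real pi) m0 * nc_Phi \<epsilon> q m0
       * (nexp (- of_real (ln \<epsilon>)) q * nc_half_turn q p (\<i> * of_real pi) \<epsilon> * nexp (of_real (ln \<epsilon>)) q)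
       * nexp (\<i> * of_real pi) q)
     (kz_assoc p m0 * 1 * nexp (\<i> * of_real pi) (q + m0) * kz_assoc q p
       - 1 * nexp (\<i> * of_real pi) m0 * kz_assoc q m0 * 1 * nexp (\<i> * of_real pi) q) (at_right 0)"
    by (intro nc_tendsto_diff nc_tendsto_mult nc_tendsto_const nc_Phi_tendsto nc_half_turn_conj_tendsto assms m lin)
  then show ?thesis
  proof (rule nc_tendsto_cong_rev)
    have "eventually (\<lambda>\<epsilon>::real. \<epsilon> \<in> {0<..<1/4}) (at_right 0)"
      by (rule eventually_at_right_real) simp
    then show "eventually (\<lambda>\<epsilon>. kz_paths.nc_prehex p q l \<epsilon> = nc_Phi \<epsilon> p m0 * (nexp (- of_real (ln \<epsilon>)) p * nc_half_turn (p - l) q (- (\<i> * of_real pi)) \<epsilon> * nexp (of_real (ln \<epsilon>)) p)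
       * nexp (\<i> * of_real pi) (q + m0) * nc_Phi \<epsilon> q p
     - (nexp (- of_real (ln \<epsilon>)) m0 * nc_half_turn m0 (q - l) (\<i> * of_real pi) \<epsilon> * nexp (of_real (ln \<epsilon>)) m0)
       * nexp (\<i> * of_real pi) m0 * nc_Phi \<epsilon> q m0
       * (nexp (- of_real (ln \<epsilon>)) q * nc_half_turn q p (\<i> * of_real pi) \<epsilon> * nexp (of_real (ln \<epsilon>)) q)
       * nexp (\<i> * of_real pi) q) (at_right 0)"
    proof eventually_elim
      case (elim \<epsilon>)
      then interpret kz_paths p q l \<epsilon> 1
        by unfold_locales (use assms in auto)
      show ?case unfolding nc_prehex_eq by (simp only: m_def m0_def)
    qed
  qed (simp add: nc_hexagon_def m0_def)
qed

section \<open>Hom-modules as complex vector spaces\<close>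

locale cochain2 =
  fixes C :: "('r::comm_ring_1, 'o, 'm::ab_group_add) smc2cat" (structure)
  assumes cochain: "cochain_2category C"
begin

lemmas cochain_1 = cochain[unfolded cochain_2category_def]
lemmas cochain_2 = cochain_1[THEN conjunct2]
lemmas cochain_3 = cochain_2[THEN conjunct2]
lemmas cochain_4 = cochain_3[THEN conjunct2]
lemmas cochain_5 = cochain_4[THEN conjunct2]
lemmas cochain_6 = cochain_5[THEN conjunct2]
lemmas cochain_7 = cochain_6[THEN conjunct2]
lemmas cochain_8 = cochain_7[THEN conjunct2]
lemmas cochain_9 = cochain_8[THEN conjunct2]
lemmas cochain_10 = cochain_9[THEN conjunct2]
lemmas cochain_11 = cochain_10[THEN conjunct2]

lemmas cat_module = cochain_1[THEN conjunct1]
lemmas cunit = cochain_2[THEN conjunct1] cochain_3[THEN conjunct1, rule_format] cochain_4[THEN conjunct1, rule_format]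
lemmas Hom_subspace = cochain_5[THEN conjunct1, rule_format]
lemmas Hom_trivial = cochain_6[THEN conjunct1, rule_format]
lemmas idm_Hom = cochain_8[THEN conjunct1, rule_format]
lemmas comp_bilinear = cochain_9[THEN conjunct1, rule_format]
lemmas comp_Hom = cochain_10[THEN conjunct1, rule_format, THEN conjunct1]
lemmas diff_comp = cochain_10[THEN conjunct1, rule_format, THEN conjunct2]
lemmas comp_assoc = cochain_11[THEN conjunct2, rule_format]

lemma diff_linear: "linear_on C (Hom C n U V) (\<partial>)"
  and diff_Hom: "f \<in> Hom C n U V \<Longrightarrow> \<partial> f \<in> Hom C (n + 1) U V"
  using cochain_7[THEN conjunct1] by simp_all

lemma idm_left: "f \<in> Hom C n U V \<Longrightarrow> idm C V \<cdot> f = f"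
  and idm_right: "f \<in> Hom C n U V \<Longrightarrow> f \<cdot> idm C U = f"
  using cochain_11[THEN conjunct1] by simp_all

abbreviation "cs \<equiv> cscale C"

sublocale cs: vector_space "cscale C"
  by standard (simp_all add: cscale_def cunit module.scale_right_distrib[OF cat_module]
      module.scale_left_distrib[OF cat_module] module.scale_scale[OF cat_module] module.scale_one[OF cat_module])

lemma Hom_closed [intro]:
  "0 \<in> Hom C n U V"
  "x \<in> Hom C n U V \<Longrightarrow> y \<in> Hom C n U V \<Longrightarrow> x + y \<in> Hom C n U V"
  "x \<in> Hom C n U V \<Longrightarrow> y \<in> Hom C n U V \<Longrightarrow> x - y \<in> Hom C n U V"
  "x \<in> Hom C n U V \<Longrightarrow> - x \<in> Hom C n U V"
  "x \<in> Hom C n U V \<Longrightarrow> cs c x \<in> Hom C n U V"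
  by (rule module.subspace_0[OF cat_module Hom_subspace] module.subspace_add[OF cat_module Hom_subspace]
      module.subspace_diff[OF cat_module Hom_subspace] module.subspace_neg[OF cat_module Hom_subspace]; assumption |
    simp add: cscale_def module.subspace_scale[OF cat_module Hom_subspace])+

lemma Hom_sum [intro]: "(\<And>i. i \<in> I \<Longrightarrow> f i \<in> Hom C n U V) \<Longrightarrow> sum f I \<in> Hom C n U V"
  by (induction I rule: infinite_finite_induct) (simp_all add: Hom_closed(1,2))

lemma linear_onD:
  assumes "linear_on C A F"
  shows "x \<in> A \<Longrightarrow> y \<in> A \<Longrightarrow> F (x + y) = F x + F y" "x \<in> A \<Longrightarrow> F (cs c x) = cs c (F x)"
  using assms by (simp_all add: linear_on_def cscale_def)

lemma linear_on_Hom: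
  assumes "linear_on C (Hom C n U V) F"
  shows "F 0 = 0" "x \<in> Hom C n U V \<Longrightarrow> F (- x) = - F x"
    "x \<in> Hom C n U V \<Longrightarrow> y \<in> Hom C n U V \<Longrightarrow> F (x - y) = F x - F y"
    "(\<And>i. i \<in> I \<Longrightarrow> f i \<in> Hom C n U V) \<Longrightarrow> F (sum f I) = (\<Sum>i\<in>I. F (f i))"
proof -
  note D = linear_onD[OF assms]
  show 0: "F 0 = 0" using D(2)[OF Hom_closed(1), of 0] by simp
  show neg: "F (- x) = - F x" if "x \<in> Hom C n U V" for x
    using D(2)[OF that, of "- 1"] by simp
  show "F (x - y) = F x - F y" if "x \<in> Hom C n U V" "y \<in> Hom C n U V"
    using D(1)[OF that(1) Hom_closed(4)[OF that(2)]] neg[OF that(2)] by simp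
  show "(\<And>i. i \<in> I \<Longrightarrow> f i \<in> Hom C n U V) \<Longrightarrow> F (sum f I) = (\<Sum>i\<in>I. F (f i))"
  proof (induction I rule: infinite_finite_induct)
    case (insert x I)
    then have "F (f x + sum f I) = F (f x) + F (sum f I)"
      by (intro D(1) Hom_sum) simp_all
    with insert show ?case by simp
  qed (simp_all add: 0)
qed

lemma comp_linear_left: "f \<in> Hom C n U V \<Longrightarrow> linear_on C (Hom C m V W) (\<lambda>g. g \<cdot> f)"
  and comp_linear_right: "g \<in> Hom C m V W \<Longrightarrow> linear_on C (Hom C n U V) (\<lambda>f. g \<cdot> f)"
  using comp_bilinear by (simp_all add: bilinear_on_def)

lemma comp_sum_sum:
  assumes "\<And>i. i \<in> I \<Longrightarrow> x i \<in> Hom C m V W" "\<And>j. j \<in> J \<Longrightarrow> y j \<in> Hom C n U V"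
  shows "(\<Sum>i\<in>I. cs (c i) (x i)) \<cdot> (\<Sum>j\<in>J. cs (d j) (y j)) = (\<Sum>i\<in>I. \<Sum>j\<in>J. cs (c i * d j) (x i \<cdot> y j))"
proof -
  have Y: "(\<Sum>j\<in>J. cs (d j) (y j)) \<in> Hom C n U V" using assms by auto
  have "(\<Sum>i\<in>I. cs (c i) (x i)) \<cdot> (\<Sum>j\<in>J. cs (d j) (y j)) = (\<Sum>i\<in>I. cs (c i) (x i) \<cdot> (\<Sum>j\<in>J. cs (d j) (y j)))"
    by (rule linear_on_Hom(4)[OF comp_linear_left[OF Y]]) (use assms in auto)
  also have "\<dots> = (\<Sum>i\<in>I. \<Sum>j\<in>J. cs (c i * d j) (x i \<cdot> y j))"
  proof (rule sum.cong[OF refl])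
    fix i assume i: "i \<in> I"
    have "cs (c i) (x i) \<cdot> (\<Sum>j\<in>J. cs (d j) (y j)) = cs (c i) (x i \<cdot> (\<Sum>j\<in>J. cs (d j) (y j)))"
      by (rule linear_onD(2)[OF comp_linear_left[OF Y]]) (use assms i in auto)
    also have "x i \<cdot> (\<Sum>j\<in>J. cs (d j) (y j)) = (\<Sum>j\<in>J. x i \<cdot> cs (d j) (y j))"
      by (rule linear_on_Hom(4)[OF comp_linear_right]) (use assms i in auto)
    also have "\<dots> = (\<Sum>j\<in>J. cs (d j) (x i \<cdot> y j))"
      by (intro sum.cong refl linear_onD(2)[OF comp_linear_right]) (use assms i in auto)
    finally show "cs (c i) (x i) \<cdot> (\<Sum>j\<in>J. cs (d j) (y j)) = (\<Sum>j\<in>J. cs (c i * d j) (x i \<cdot> y j))"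
      by (simp add: cs.scale_sum_right)
  qed
  finally show ?thesis .
qed

definition functional :: "('m \<Rightarrow> complex) \<Rightarrow> bool" where
  "functional \<phi> \<longleftrightarrow> (\<forall>x y. \<phi> (x + y) = \<phi> x + \<phi> y) \<and> (\<forall>c x. \<phi> (cs c x) = c * \<phi> x)"

lemma functional_simps:
  assumes "functional \<phi>"
  shows "\<phi> 0 = 0" "\<phi> (x + y) = \<phi> x + \<phi> y" "\<phi> (cs c x) = c * \<phi> x" "\<phi> (x - y) = \<phi> x - \<phi> y"
    "\<phi> (sum f I) = (\<Sum>i\<in>I. \<phi> (f i))"
proof -
  have 0: "\<phi> (x + y) = \<phi> x + \<phi> y" "\<phi> (cs c x) = c * \<phi> x" for x y c
    using assms by (auto simp: functional_def)
  show z: "\<phi> 0 = 0" using 0(2)[of 0 0] by simp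
  show "\<phi> (x + y) = \<phi> x + \<phi> y" "\<phi> (cs c x) = c * \<phi> x" by (rule 0)+
  show "\<phi> (x - y) = \<phi> x - \<phi> y" using 0(1)[of x "- y"] 0(2)[of "- 1" y] by simp
  show "\<phi> (sum f I) = (\<Sum>i\<in>I. \<phi> (f i))"
    by (induction I rule: infinite_finite_induct) (simp_all add: z 0)
qed

text \<open>Coordinates in a complex basis of the ambient module are functionals. This reduces
  uniqueness of limits, integrals and solutions in a module without topology to the complex
  numbers.\<close>

lemma functional_separates:
  assumes "\<And>\<phi>. functional \<phi> \<Longrightarrow> \<phi> x = \<phi> y"
  shows "x = y"
proof -
  define B where "B = cs.extend_basis {}"
  have B: "cs.independent B" "cs.span B = UNIV"
    unfolding B_def by (simp_all add: cs.independent_extend_basis cs.span_extend_basis cs.independent_empty)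
  have "functional (\<lambda>x. cs.representation B x b)" for b
    using B by (simp add: functional_def cs.representation_add cs.representation_scale)
  hence "cs.representation B x b = cs.representation B y b" for b
    using assms by blast
  hence "cs.representation B x = cs.representation B y" by blast
  moreover have "(\<Sum>b | cs.representation B v b \<noteq> 0. cs (cs.representation B v b) b) = v" for v
    by (rule cs.sum_nonzero_representation_eq[OF B(1)]) (simp add: B(2))
  ultimately show ?thesis by metis
qed

lemma flim_functional:
  assumes "flim C f L F" "functional \<phi>"
  shows "((\<lambda>x. \<phi> (f x)) \<longlongrightarrow> \<phi> L) F"
proof -
  from assms(1) obtain N :: nat and c l w where
    *: "eventually (\<lambda>e. f e = (\<Sum>i<N. cs (c i e) (w i))) F" "\<forall>i<N. (c i \<longlongrightarrow> l i) F" "L = (\<Sum>i<N. cs (l i) (w i))"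
    unfolding flim_def by blast
  have "((\<lambda>e. \<Sum>i<N. c i e * \<phi> (w i)) \<longlongrightarrow> (\<Sum>i<N. l i * \<phi> (w i))) F"
    using *(2) by (intro tendsto_intros) auto
  moreover have "eventually (\<lambda>e. (\<Sum>i<N. c i e * \<phi> (w i)) = \<phi> (f e)) F"
    using *(1) by eventually_elim (simp add: functional_simps[OF assms(2)])
  moreover have "(\<Sum>i<N. l i * \<phi> (w i)) = \<phi> L"
    by (simp add: *(3) functional_simps[OF assms(2)])
  ultimately show ?thesis by (simp add: Lim_transform_eventually)
qed

lemma flim_unique: "flim C f L F \<Longrightarrow> flim C f L' F \<Longrightarrow> F \<noteq> bot \<Longrightarrow> L = L'"
  by (rule functional_separates) (rule tendsto_unique[OF _ flim_functional flim_functional])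

lemma flimI:
  assumes "finite A" "eventually (\<lambda>e. f e = (\<Sum>w\<in>A. cs (c w e) (v w))) F"
    "\<And>w. w \<in> A \<Longrightarrow> (c w \<longlongrightarrow> l w) F" "L = (\<Sum>w\<in>A. cs (l w) (v w))"
  shows "flim C f L F"
proof -
  obtain h where h: "bij_betw h {..<card A} A"
    using ex_bij_betw_nat_finite[OF assms(1)] by (auto simp: atLeast0LessThan)
  have "(\<Sum>w\<in>A. g w) = (\<Sum>i<card A. g (h i))" for g :: "_ \<Rightarrow> 'm"
    by (rule sum.reindex_bij_betw[OF h, symmetric])
  note eq = assms(2,4)[unfolded this]
  have "\<forall>i<card A. (c (h i) \<longlongrightarrow> l (h i)) F"
    using assms(3) bij_betwE[OF h] by simp
  with eq show ?thesis
    unfolding flim_def by (intro exI conjI)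
qed

lemma fintegral_functional:
  assumes "fintegral C f L" "functional \<phi>"
  shows "((\<lambda>x. \<phi> (f x)) has_integral \<phi> L) {0..1}"
proof -
  from assms(1) obtain N :: nat and c j w where
    *: "\<forall>r\<in>{0..1}. f r = (\<Sum>i<N. cs (c i r) (w i))" "\<forall>i<N. (c i has_integral j i) {0..1}" "L = (\<Sum>i<N. cs (j i) (w i))"
    unfolding fintegral_def by blast
  have "((\<lambda>e. \<Sum>i<N. c i e * \<phi> (w i)) has_integral (\<Sum>i<N. j i * \<phi> (w i))) {0..1}"
    using *(2) by (intro has_integral_sum has_integral_mult_left) auto
  moreover have "(\<Sum>i<N. j i * \<phi> (w i)) = \<phi> L"
    by (simp add: *(3) functional_simps[OF assms(2)])
  ultimately show ?thesis
    using *(1) by (auto intro!: has_integral_eq[of _ "\<lambda>e. \<Sum>i<N. c i e * \<phi> (w i)"] simp: functional_simps[OF assms(2)])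
qed

lemma fintegral_unique: "fintegral C f L \<Longrightarrow> fintegral C f L' \<Longrightarrow> L = L'"
  by (rule functional_separates) (rule has_integral_unique[OF fintegral_functional fintegral_functional])

lemma fintegralI:
  assumes "finite A" "\<And>r. r \<in> {0..1} \<Longrightarrow> f r = (\<Sum>w\<in>A. cs (c w r) (v w))"
    "\<And>w. w \<in> A \<Longrightarrow> (c w has_integral l w) {0..1}" "L = (\<Sum>w\<in>A. cs (l w) (v w))"
  shows "fintegral C f L"
proof -
  obtain h where h: "bij_betw h {..<card A} A"
    using ex_bij_betw_nat_finite[OF assms(1)] by (auto simp: atLeast0LessThan)
  have "(\<Sum>w\<in>A. g w) = (\<Sum>i<card A. g (h i))" for g :: "_ \<Rightarrow> 'm"
    by (rule sum.reindex_bij_betw[OF h, symmetric])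
  note eq = assms(2,4)[unfolded this]
  have "\<forall>i<card A. (c (h i) has_integral l (h i)) {0..1}"
    using assms(3) bij_betwE[OF h] by simp
  with eq show ?thesis
    unfolding fintegral_def by (intro exI conjI ballI)
qed


subsection \<open>Uniqueness of parallel transport\<close>

lemma scomp_nth: "fps_nth (A \<odot> B) n = (\<Sum>i\<le>n. fps_nth A i \<cdot> fps_nth B (n - i))"
  by (simp add: scomp_def)

lemma solvesD:
  assumes "solves C X G r' Y"
  shows "Y r' = \<one> X" "r \<in> {0..1} \<Longrightarrow> fps_nth (Y r) n \<in> Hom C 0 X X"
    "r \<in> {0..1} \<Longrightarrow> flim C (\<lambda>x. fps_nth (Y x) n) (fps_nth (Y r) n) (at r within {0..1})"
    "\<exists>S. finite S \<and> (\<forall>n. \<forall>r\<in>{0..1} - S.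
        flim C (\<lambda>x. cs (of_real (1 / (x - r))) (fps_nth (Y x) n - fps_nth (Y r) n))
          (fps_nth (G r \<odot> Y r) n) (at r within {0..1}))"
  using assms by (simp_all add: solves_def SHom_def)

text \<open>Induction on the order in \<hbar>: \<open>G\<close> starts in order 1, so order
  \<open>n\<close> of the right-hand side involves only lower orders of the solution. Tested against
  functionals, the difference of two solutions is continuous with zero derivative off a finite
  set.\<close>

lemma solves_unique:
  assumes Y: "solves C X G r' Y" "solves C X G r' Z" and G: "\<And>r. r \<in> {0..1} \<Longrightarrow> fps_nth (G r) 0 = 0"
    and r': "r' \<in> {0..1}" and r: "r \<in> {0..1}"
  shows "Y r = Z r"
proof (rule fps_ext)
  fix n
  show "fps_nth (Y r) n = fps_nth (Z r) n"
    using r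
  proof (induction n arbitrary: r rule: less_induct)
    case (less n)
    obtain S where S: "finite S" "\<forall>n. \<forall>r\<in>{0..1} - S. flim C (\<lambda>x. cs (of_real (1 / (x - r))) (fps_nth (Y x) n - fps_nth (Y r) n))
          (fps_nth (G r \<odot> Y r) n) (at r within {0..1})"
      using solvesD(4)[OF Y(1)] by (elim exE conjE)
    obtain S' where S': "finite S'" "\<forall>n. \<forall>r\<in>{0..1} - S'. flim C (\<lambda>x. cs (of_real (1 / (x - r))) (fps_nth (Z x) n - fps_nth (Z r) n))
          (fps_nth (G r \<odot> Z r) n) (at r within {0..1})"
      using solvesD(4)[OF Y(2)] by (elim exE conjE)
    have eq: "fps_nth (G x \<odot> Y x) n = fps_nth (G x \<odot> Z x) n" if "x \<in> {0..1}" for x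
    proof -
      have "fps_nth (G x) i \<cdot> fps_nth (Y x) (n - i) = fps_nth (G x) i \<cdot> fps_nth (Z x) (n - i)" if "i \<le> n" for i
      proof (cases "i = 0")
        case True
        have "fps_nth (Y x) n \<in> Hom C 0 X X" "fps_nth (Z x) n \<in> Hom C 0 X X"
          using solvesD(2)[OF Y(1)] solvesD(2)[OF Y(2)] \<open>x \<in> {0..1}\<close> by blast+
        then show ?thesis
          using True G[OF \<open>x \<in> {0..1}\<close>] linear_on_Hom(1)[OF comp_linear_left] by simp
      next
        case False
        then show ?thesis using less(1)[of "n - i" x] \<open>x \<in> {0..1}\<close> that by simp
      qed
      then show ?thesis by (simp add: scomp_nth)
    qed
    show ?case
    proof (rule functional_separates)
      fix \<phi> assume \<phi>: "functional \<phi>"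
      have cont: "continuous_on {0..1} (\<lambda>x. \<phi> (fps_nth (Y x) n - fps_nth (Z x) n))"
        unfolding continuous_on_def functional_simps(4)[OF \<phi>]
        by (intro ballI tendsto_diff flim_functional[OF solvesD(3)[OF Y(1)] \<phi>] flim_functional[OF solvesD(3)[OF Y(2)] \<phi>])
      have der: "((\<lambda>x. \<phi> (fps_nth (Y x) n - fps_nth (Z x) n)) has_vector_derivative 0) (at x within {0..1})"
        if x: "x \<in> {0..1} - (S \<union> S')" for x
      proof -
        have "((\<lambda>y. \<phi> (cs (of_real (1 / (y - x))) (fps_nth (Y y) n - fps_nth (Y x) n)) -
            \<phi> (cs (of_real (1 / (y - x))) (fps_nth (Z y) n - fps_nth (Z x) n))) \<longlongrightarrow>
           \<phi> (fps_nth (G x \<odot> Y x) n) - \<phi> (fps_nth (G x \<odot> Z x) n)) (at x within {0..1})"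
          using S(2) S'(2) x by (intro tendsto_diff flim_functional[OF _ \<phi>]) auto
        moreover have "\<phi> (cs (of_real (1 / (y - x))) (fps_nth (Y y) n - fps_nth (Y x) n)) -
            \<phi> (cs (of_real (1 / (y - x))) (fps_nth (Z y) n - fps_nth (Z x) n)) =
            (\<phi> (fps_nth (Y y) n - fps_nth (Z y) n) - \<phi> (fps_nth (Y x) n - fps_nth (Z x) n)) /\<^sub>R (y - x)" for y
          by (simp add: functional_simps[OF \<phi>] scaleR_conv_of_real divide_inverse algebra_simps del: of_real_diff)
        ultimately show ?thesis
          using eq[of x] x by (simp add: has_vector_derivative_iff_tendsto)
      qed
      have const: "\<phi> (fps_nth (Y x) n - fps_nth (Z x) n) = \<phi> (fps_nth (Y 0) n - fps_nth (Z 0) n)" if "x \<in> {0..1}" for x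
        using S(1) S'(1) der
        by (intro has_derivative_zero_unique_strong_interval[OF _ cont refl _ that, of "S \<union> S'"])
          (simp_all add: has_vector_derivative_def)
      have "\<phi> (fps_nth (Y r) n - fps_nth (Z r) n) = \<phi> (fps_nth (Y r') n - fps_nth (Z r') n)"
        unfolding const[OF less(2)] const[OF r'] ..
      moreover have "Y r' = Z r'" using solvesD(1)[OF Y(1)] solvesD(1)[OF Y(2)] by simp
      ultimately show "\<phi> (fps_nth (Y r) n) = \<phi> (fps_nth (Z r) n)"
        by (simp add: functional_simps[OF \<phi>])
    qed
  qed
qed

lemma transport_eq:
  assumes "solves C X G r' Y" "\<And>r. r \<in> {0..1} \<Longrightarrow> fps_nth (G r) 0 = 0" "r' \<in> {0..1}" "r \<in> {0..1}"
  shows "transport C X G r r' = Y r"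
  unfolding transport_def
proof (rule the_equality)
  fix A assume "\<exists>Y. solves C X G r' Y \<and> A = Y r"
  then obtain Z where "solves C X G r' Z" "A = Z r" by (elim exE conjE)
  with solves_unique[OF \<open>solves C X G r' Z\<close> assms(1,2,3,4)] show "A = Y r" by simp
next
  show "\<exists>Z. solves C X G r' Z \<and> Y r = Z r" by (rule exI[of _ Y]) (simp add: assms(1))
qed

end

section \<open>Evaluation of power series on morphisms\<close>

abbreviation words :: "nat \<Rightarrow> 'a list set" where
  "words n \<equiv> {w. length w = n}"

lemma finite_words [simp]: "finite (words n :: 'a::finite list set)"
  using finite_lists_length_eq[of "UNIV :: 'a set" n] by simp

lemma fps_nth_sum: "fps_nth (sum f A) n = (\<Sum>x\<in>A. fps_nth (f x) n)" for f :: "'b \<Rightarrow> 'm::ab_group_add fps"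
  by (induction A rule: infinite_finite_induct) simp_all

context cochain2
begin

text \<open>Every letter carries one power of \<hbar>, so order \<open>n\<close> is a finite sum
  over the words of length \<open>n\<close>. The map on words is arbitrary because both the
  multiplicative evaluation and \<open>S\<close> are extended in this way.\<close>

definition gev :: "('a::finite list \<Rightarrow> 'm) \<Rightarrow> 'a ncs \<Rightarrow> 'm fps" where
  "gev T f = Abs_fps (\<lambda>n. \<Sum>w\<in>words n. cs (coef f w) (T w))"

lemma gev_nth: "fps_nth (gev T f) n = (\<Sum>w\<in>words n. cs (coef f w) (T w))"
  by (simp add: gev_def)

lemma gev_add: "gev T (f + g) = gev T f + gev T g"
  and gev_diff: "gev T (f - g) = gev T f - gev T g"
  and gev_minus: "gev T (- f) = - gev T f"
  by (rule fps_ext, simp add: gev_nth cs.scale_left_distrib cs.scale_left_diff_distrib sum.distrib sum_subtractf sum_negf)+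

lemma gev_0 [simp]: "gev T 0 = 0"
  by (rule fps_ext) (simp add: gev_nth)

lemma gev_scale: "gev T (c *\<^sub>n f) = c *\<^sub>s gev T f"
  by (rule fps_ext) (simp add: gev_nth sscale_def cs.scale_sum_right)

lemma gev_sum: "gev T (sum f A) = (\<Sum>x\<in>A. gev T (f x))"
  by (induction A rule: infinite_finite_induct) (simp_all add: gev_add)

lemma sscale_nth: "fps_nth (c *\<^sub>s A) n = cs c (fps_nth A n)"
  by (simp add: sscale_def)

lemma SHomI: "(\<And>n. fps_nth A n \<in> Hom C k U V) \<Longrightarrow> A \<in> SHom C k U V"
  by (simp add: SHom_def)

lemma SHomD: "A \<in> SHom C k U V \<Longrightarrow> fps_nth A n \<in> Hom C k U V"
  by (simp add: SHom_def)

lemma gev_SHom: "(\<And>w. T w \<in> Hom C k U V) \<Longrightarrow> gev T f \<in> SHom C k U V"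
  by (intro SHomI) (auto simp: gev_nth)

lemma sid_nth: "fps_nth (\<one> X) n = (if n = 0 then idm C X else 0)"
  by (simp add: sid_def)

lemma comp_zero: "f \<in> Hom C n U V \<Longrightarrow> 0 \<cdot> f = 0" "g \<in> Hom C n U V \<Longrightarrow> g \<cdot> 0 = 0"
  using linear_on_Hom(1)[OF comp_linear_left] linear_on_Hom(1)[OF comp_linear_right] by blast+

lemma scomp_SHom: "A \<in> SHom C j V W \<Longrightarrow> B \<in> SHom C k U V \<Longrightarrow> A \<odot> B \<in> SHom C (j + k) U W"
  by (intro SHomI) (auto simp: scomp_nth intro: comp_Hom SHomD)

lemma scomp_id_left: "A \<in> SHom C k U V \<Longrightarrow> \<one> V \<odot> A = A"
proof (rule fps_ext)
  fix n assume A: "A \<in> SHom C k U V"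
  have "(\<Sum>i\<le>n. fps_nth (\<one> V) i \<cdot> fps_nth A (n - i)) = (\<Sum>i\<in>{0}. fps_nth (\<one> V) i \<cdot> fps_nth A (n - i))"
    using comp_zero(1)[OF SHomD[OF A]] by (intro sum.mono_neutral_right) (auto simp: sid_nth)
  then show "fps_nth (\<one> V \<odot> A) n = fps_nth A n"
    using idm_left[OF SHomD[OF A]] by (simp add: scomp_nth sid_nth)
qed

lemma scomp_id_right: "A \<in> SHom C k U V \<Longrightarrow> A \<odot> \<one> U = A"
proof (rule fps_ext)
  fix n assume A: "A \<in> SHom C k U V"
  have "(\<Sum>i\<le>n. fps_nth A i \<cdot> fps_nth (\<one> U) (n - i)) = (\<Sum>i\<in>{n}. fps_nth A i \<cdot> fps_nth (\<one> U) (n - i))"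
    using comp_zero(2)[OF SHomD[OF A]] by (intro sum.mono_neutral_right) (auto simp: sid_nth)
  then show "fps_nth (A \<odot> \<one> U) n = fps_nth A n"
    using idm_right[OF SHomD[OF A]] by (simp add: scomp_nth sid_nth)
qed

lemma comp_sum_left: "(\<And>i. i \<in> I \<Longrightarrow> x i \<in> Hom C m V W) \<Longrightarrow> y \<in> Hom C n U V \<Longrightarrow> sum x I \<cdot> y = (\<Sum>i\<in>I. x i \<cdot> y)"
  using linear_on_Hom(4)[OF comp_linear_left] by blast

lemma comp_sum_right: "(\<And>i. i \<in> I \<Longrightarrow> x i \<in> Hom C m U V) \<Longrightarrow> y \<in> Hom C n V W \<Longrightarrow> y \<cdot> sum x I = (\<Sum>i\<in>I. y \<cdot> x i)"
  using linear_on_Hom(4)[OF comp_linear_right] by blast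

lemma scomp_assoc:
  assumes A: "A \<in> SHom C i W X" and B: "B \<in> SHom C j V W" and D: "D \<in> SHom C k U V"
  shows "(A \<odot> B) \<odot> D = A \<odot> (B \<odot> D)"
proof (rule fps_ext)
  fix n
  have "fps_nth ((A \<odot> B) \<odot> D) n = (\<Sum>m\<le>n. \<Sum>i\<le>m. fps_nth A i \<cdot> fps_nth B (m - i) \<cdot> fps_nth D (n - m))"
    unfolding scomp_nth
    by (rule sum.cong[OF refl], rule comp_sum_left[OF comp_Hom[OF SHomD[OF A] SHomD[OF B]] SHomD[OF D]])
  also have "\<dots> = (\<Sum>m\<le>n. \<Sum>i\<le>m. fps_nth A i \<cdot> (fps_nth B (m - i) \<cdot> fps_nth D (n - m)))"
    by (intro sum.cong refl comp_assoc[OF SHomD[OF A] SHomD[OF B] SHomD[OF D]])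
  also have "\<dots> = (\<Sum>i\<le>n. \<Sum>m\<le>n - i. fps_nth A i \<cdot> (fps_nth B m \<cdot> fps_nth D (n - i - m)))"
    unfolding sum.Sigma[OF finite_atMost ballI[OF finite_atMost]]
    by (rule sum.reindex_bij_witness[of _ "\<lambda>(i, m). (i + m, i)" "\<lambda>(m, i). (i, m - i)"]) auto
  also have "\<dots> = fps_nth (A \<odot> (B \<odot> D)) n"
    unfolding scomp_nth
    by (rule sum.cong[OF refl], rule comp_sum_right[OF comp_Hom[OF SHomD[OF B] SHomD[OF D]] SHomD[OF A], symmetric])
  finally show "fps_nth ((A \<odot> B) \<odot> D) n = fps_nth (A \<odot> (B \<odot> D)) n" .
qed

lemma word_sum_mult:
  fixes T :: "'a::finite list \<Rightarrow> 'm"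
  shows "(\<Sum>w\<in>words n. cs (coef (f * g) w) (T w)) =
    (\<Sum>i\<le>n. \<Sum>u\<in>words i. \<Sum>v\<in>words (n - i). cs (coef f u * coef g v) (T (u @ v)))"
proof -
  have "(\<Sum>w\<in>words n. cs (coef (f * g) w) (T w)) =
      (\<Sum>w\<in>words n. \<Sum>i\<le>n. cs (coef f (take i w) * coef g (drop i w)) (T w))"
    by (intro sum.cong refl) (simp add: coef_mult cs.scale_sum_left)
  also have "\<dots> = (\<Sum>i\<le>n. \<Sum>w\<in>words n. cs (coef f (take i w) * coef g (drop i w)) (T w))"
    by (rule sum.swap)
  also have "\<dots> = (\<Sum>i\<le>n. \<Sum>(u, v)\<in>words i \<times> words (n - i). cs (coef f u * coef g v) (T (u @ v)))"
  proof (rule sum.cong[OF refl])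
    fix i assume "i \<in> {..n}"
    then show "(\<Sum>w\<in>words n. cs (coef f (take i w) * coef g (drop i w)) (T w)) =
        (\<Sum>(u, v)\<in>words i \<times> words (n - i). cs (coef f u * coef g v) (T (u @ v)))"
      by (intro sum.reindex_bij_witness[of _ "\<lambda>(u, v). u @ v" "\<lambda>w. (take i w, drop i w)"]) auto
  qed
  finally show ?thesis by (simp add: sum.cartesian_product)
qed

end

text \<open>
  \<open>E\<close> evaluates words at degree \<open>0\<close>, and \<open>S\<close> is a map from words to degree \<open>-1\<close> which behaves like a
  bimodule map on the ideal of \<open>good\<close> power series.
\<close>

locale evaluation = cochain2 C for C :: "('r::comm_ring_1, 'o, 'm::ab_group_add) smc2cat" (structure) +
  fixes X :: 'o and E S :: "'a::finite list \<Rightarrow> 'm"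
  assumes E_Nil: "E [] = idm C X" and E_append: "E (u @ v) = E u \<cdot> E v"
    and E_Hom: "E w \<in> Hom C 0 X X" and S_Hom: "S w \<in> Hom C (-1) X X"
begin

abbreviation "ev \<equiv> gev E"
abbreviation "se \<equiv> gev S"

lemma ev_SHom: "ev f \<in> SHom C 0 X X" and se_SHom: "se f \<in> SHom C (-1) X X"
  by (auto intro: gev_SHom E_Hom S_Hom)

lemma ev_mult: "ev (f * g) = ev f \<odot> ev g"
  by (rule fps_ext) (simp add: gev_nth scomp_nth word_sum_mult comp_sum_sum[OF E_Hom E_Hom] E_append)

lemma ev_1: "ev 1 = \<one> X"
proof (rule fps_ext)
  fix n
  have "(\<Sum>w\<in>words n. cs (coef (1 :: 'a ncs) w) (E w)) = (if n = 0 then idm C X else 0)"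
  proof (cases n)
    case 0
    hence "words n = {[] :: 'a list}" by auto
    then show ?thesis by (simp add: 0 E_Nil)
  next
    case (Suc k)
    then show ?thesis by (auto intro!: sum.neutral)
  qed
  then show "fps_nth (ev 1) n = fps_nth (\<one> X) n" by (simp add: gev_nth sid_nth)
qed

text \<open>The rule is demanded between arbitrary words and separately in each order, so that it
  passes to products and to infinite series.\<close>

definition good :: "'a ncs \<Rightarrow> bool" where
  "good f \<longleftrightarrow> (\<forall>u v n. (\<Sum>w\<in>words n. cs (coef f w) (S (u @ w @ v))) = (\<Sum>w\<in>words n. cs (coef f w) (E u \<cdot> S w \<cdot> E v)))"

lemma se_mult:
  assumes "good f"
  shows "se (g * f * h) = ev g \<odot> se f \<odot> ev h"
proof (rule fps_ext)
  fix n
  have gf: "(\<Sum>u\<in>words i. cs (coef (g * f) u) (S (u @ v))) =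
      (\<Sum>j\<le>i. \<Sum>u\<in>words j. \<Sum>w\<in>words (i - j). cs (coef g u * coef f w) (E u \<cdot> S w \<cdot> E v))" for v i
  proof -
    have "(\<Sum>w\<in>words k. cs (coef g u * coef f w) (S ((u @ w) @ v))) =
       (\<Sum>w\<in>words k. cs (coef g u * coef f w) (E u \<cdot> S w \<cdot> E v))" for u k
    proof -
      have "(\<Sum>w\<in>words k. cs (coef f w) (S ((u @ w) @ v))) = (\<Sum>w\<in>words k. cs (coef f w) (E u \<cdot> S w \<cdot> E v))"
        using assms unfolding good_def by simp
      from arg_cong[OF this, of "cs (coef g u)"] show ?thesis by (simp add: cs.scale_sum_right)
    qed
    then show ?thesis unfolding word_sum_mult by simp
  qed
  have reorder: "(\<Sum>u\<in>words i. \<Sum>v\<in>words k. cs (coef (g * f) u * coef h v) (S (u @ v))) =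
      (\<Sum>j\<le>i. \<Sum>u\<in>words j. \<Sum>w\<in>words (i - j). \<Sum>v\<in>words k. cs (coef g u * coef f w * coef h v) (E u \<cdot> S w \<cdot> E v))" for i k
  proof -
    have "(\<Sum>u\<in>words i. \<Sum>v\<in>words k. cs (coef (g * f) u * coef h v) (S (u @ v))) =
       (\<Sum>v\<in>words k. \<Sum>u\<in>words i. cs (coef (g * f) u * coef h v) (S (u @ v)))"
      by (rule sum.swap)
    also have "\<dots> = (\<Sum>v\<in>words k. cs (coef h v) (\<Sum>u\<in>words i. cs (coef (g * f) u) (S (u @ v))))"
      by (simp add: cs.scale_sum_right mult.commute)
    also have "\<dots> = (\<Sum>v\<in>words k. \<Sum>j\<le>i. \<Sum>u\<in>words j. \<Sum>w\<in>words (i - j). cs (coef g u * coef f w * coef h v) (E u \<cdot> S w \<cdot> E v))"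
      unfolding gf by (simp add: cs.scale_sum_right mult_ac)
    also have "\<dots> = (\<Sum>j\<le>i. \<Sum>v\<in>words k. \<Sum>u\<in>words j. \<Sum>w\<in>words (i - j). cs (coef g u * coef f w * coef h v) (E u \<cdot> S w \<cdot> E v))"
      by (rule sum.swap)
    also have "\<dots> = (\<Sum>j\<le>i. \<Sum>u\<in>words j. \<Sum>v\<in>words k. \<Sum>w\<in>words (i - j). cs (coef g u * coef f w * coef h v) (E u \<cdot> S w \<cdot> E v))"
      by (rule sum.cong[OF refl]) (rule sum.swap)
    also have "\<dots> = (\<Sum>j\<le>i. \<Sum>u\<in>words j. \<Sum>w\<in>words (i - j). \<Sum>v\<in>words k. cs (coef g u * coef f w * coef h v) (E u \<cdot> S w \<cdot> E v))"
      by (rule sum.cong[OF refl], rule sum.cong[OF refl]) (rule sum.swap)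
    finally show ?thesis .
  qed
  have "fps_nth (se (g * f * h)) n = (\<Sum>i\<le>n. \<Sum>j\<le>i. \<Sum>u\<in>words j. \<Sum>w\<in>words (i - j). \<Sum>v\<in>words (n - i).
      cs (coef g u * coef f w * coef h v) (E u \<cdot> S w \<cdot> E v))"
    unfolding gev_nth word_sum_mult[where f = "g * f" and g = h] reorder ..
  also have "\<dots> = fps_nth (ev g \<odot> se f \<odot> ev h) n"
    unfolding scomp_nth gev_nth
  proof (rule sum.cong[OF refl])
    fix i
    have ES: "E u \<cdot> S w \<in> Hom C (-1) X X" for u w using comp_Hom[OF E_Hom S_Hom] by simp
    have "(\<Sum>j\<le>i. (\<Sum>w\<in>words j. cs (coef g w) (E w)) \<cdot> (\<Sum>w\<in>words (i - j). cs (coef f w) (S w))) \<cdot>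
        (\<Sum>w\<in>words (n - i). cs (coef h w) (E w)) =
      (\<Sum>j\<le>i. ((\<Sum>w\<in>words j. cs (coef g w) (E w)) \<cdot> (\<Sum>w\<in>words (i - j). cs (coef f w) (S w))) \<cdot>
        (\<Sum>w\<in>words (n - i). cs (coef h w) (E w)))"
      by (rule comp_sum_left[OF comp_Hom]) (auto intro: E_Hom S_Hom)
    also have "\<dots> = (\<Sum>j\<le>i. \<Sum>u\<in>words j. \<Sum>w\<in>words (i - j). \<Sum>v\<in>words (n - i).
      cs (coef g u * coef f w * coef h v) (E u \<cdot> S w \<cdot> E v))"
    proof (rule sum.cong[OF refl])
      fix j
      have "(\<Sum>w\<in>words j. cs (coef g w) (E w)) \<cdot> (\<Sum>w\<in>words (i - j). cs (coef f w) (S w)) =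
          (\<Sum>x\<in>words j \<times> words (i - j). cs (coef g (fst x) * coef f (snd x)) (E (fst x) \<cdot> S (snd x)))"
        by (simp add: comp_sum_sum[OF E_Hom S_Hom] sum.cartesian_product case_prod_unfold)
      moreover have "\<dots> \<cdot> (\<Sum>w\<in>words (n - i). cs (coef h w) (E w)) = (\<Sum>x\<in>words j \<times> words (i - j). \<Sum>v\<in>words (n - i).
          cs (coef g (fst x) * coef f (snd x) * coef h v) (E (fst x) \<cdot> S (snd x) \<cdot> E v))"
        by (rule comp_sum_sum[OF ES E_Hom])
      ultimately show "((\<Sum>w\<in>words j. cs (coef g w) (E w)) \<cdot> (\<Sum>w\<in>words (i - j). cs (coef f w) (S w))) \<cdot>
        (\<Sum>w\<in>words (n - i). cs (coef h w) (E w)) = (\<Sum>u\<in>words j. \<Sum>w\<in>words (i - j). \<Sum>v\<in>words (n - i).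
      cs (coef g u * coef f w * coef h v) (E u \<cdot> S w \<cdot> E v))"
        unfolding sum.cartesian_product[of _ "words (i - j)"] by (simp only: case_prod_unfold)
    qed
    finally show "(\<Sum>j\<le>i. \<Sum>u\<in>words j. \<Sum>w\<in>words (i - j). \<Sum>v\<in>words (n - i).
      cs (coef g u * coef f w * coef h v) (E u \<cdot> S w \<cdot> E v)) =
      (\<Sum>j\<le>i. (\<Sum>w\<in>words j. cs (coef g w) (E w)) \<cdot> (\<Sum>w\<in>words (i - j). cs (coef f w) (S w))) \<cdot>
        (\<Sum>w\<in>words (n - i). cs (coef h w) (E w))" by simp
  qed
  finally show "fps_nth (se (g * f * h)) n = fps_nth (ev g \<odot> se f \<odot> ev h) n" .
qed

lemma ev_id: "\<one> X \<odot> ev f = ev f" "ev f \<odot> \<one> X = ev f" "\<one> X \<odot> se f = se f" "se f \<odot> \<one> X = se f"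
  by (rule scomp_id_left[OF ev_SHom] scomp_id_right[OF ev_SHom] scomp_id_left[OF se_SHom] scomp_id_right[OF se_SHom])+

lemma se_mult_left: "good f \<Longrightarrow> se (g * f) = ev g \<odot> se f"
proof -
  assume f: "good f"
  have "ev g \<odot> se f \<in> SHom C (0 + - 1) X X" by (rule scomp_SHom[OF ev_SHom se_SHom])
  with se_mult[OF f, of g 1] show ?thesis by (simp add: ev_1 scomp_id_right)
qed

lemma se_mult_right: "good f \<Longrightarrow> se (f * h) = se f \<odot> ev h"
  using se_mult[of f 1 h] by (simp add: ev_1 ev_id)

lemma good_add: "good f \<Longrightarrow> good g \<Longrightarrow> good (f + g)"
  and good_diff: "good f \<Longrightarrow> good g \<Longrightarrow> good (f - g)"
  and good_minus: "good f \<Longrightarrow> good (- f)"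
  and good_0: "good 0"
  by (simp_all add: good_def cs.scale_left_distrib cs.scale_left_diff_distrib sum.distrib sum_subtractf sum_negf)

lemma good_scale: "good f \<Longrightarrow> good (c *\<^sub>n f)"
proof -
  have "(\<Sum>w\<in>words n. cs (coef (c *\<^sub>n f) w) (R w)) = cs c (\<Sum>w\<in>words n. cs (coef f w) (R w))" for R n
    by (simp add: cs.scale_sum_right)
  then show "good f \<Longrightarrow> good (c *\<^sub>n f)" unfolding good_def by simp
qed

lemma good_sum: "(\<And>i. i \<in> I \<Longrightarrow> good (f i)) \<Longrightarrow> good (sum f I)"
  by (induction I rule: infinite_finite_induct) (simp_all add: good_0 good_add)

lemma good_coefs:
  assumes "\<And>n. \<exists>g. good g \<and> (\<forall>w\<in>words n. coef f w = coef g w)"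
  shows "good f"
  unfolding good_def
proof (intro allI)
  fix u v n
  obtain g where "good g" "\<forall>w\<in>words n. coef f w = coef g w" using assms by blast
  then show "(\<Sum>w\<in>words n. cs (coef f w) (S (u @ w @ v))) = (\<Sum>w\<in>words n. cs (coef f w) (E u \<cdot> S w \<cdot> E v))"
    unfolding good_def by simp
qed

lemma good_mult: "good f \<Longrightarrow> good (g * f * h)"
proof -
  assume f: "good f"
  define T where "T u v = E u \<cdot> S v" for u v
  \<comment> \<open>\<open>R\<close> and \<open>R'\<close> will be the two sides of the rule for
    fixed \<open>u\<close> and \<open>v\<close>, as functions of the inner word; it is then enough
    to put single words around \<open>f\<close>.\<close>
  have key: "(\<Sum>w\<in>words n. cs (coef (g * f * h) w) (R w)) = (\<Sum>w\<in>words n. cs (coef (g * f * h) w) (R' w))"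
    if R: "\<And>a b n. (\<Sum>w\<in>words n. cs (coef f w) (R (a @ w @ b))) = (\<Sum>w\<in>words n. cs (coef f w) (R' (a @ w @ b)))" for n R R'
  proof -
    have "(\<Sum>u\<in>words i. \<Sum>v\<in>words k. cs (coef (g * f) u * coef h v) (R (u @ v))) =
       (\<Sum>u\<in>words i. \<Sum>v\<in>words k. cs (coef (g * f) u * coef h v) (R' (u @ v)))" for i k
    proof -
      have gf: "(\<Sum>u\<in>words i. cs (coef (g * f) u) (R (u @ v))) = (\<Sum>u\<in>words i. cs (coef (g * f) u) (R' (u @ v)))" for v
      proof -
        have "(\<Sum>w\<in>words k. cs (coef g u * coef f w) (R ((u @ w) @ v))) = (\<Sum>w\<in>words k. cs (coef g u * coef f w) (R' ((u @ w) @ v)))" for u k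
          using arg_cong[OF R[of u v k], of "cs (coef g u)"] by (simp add: cs.scale_sum_right)
        then show ?thesis unfolding word_sum_mult by simp
      qed
      have "(\<Sum>u\<in>words i. \<Sum>v\<in>words k. cs (coef (g * f) u * coef h v) (R (u @ v))) =
         (\<Sum>v\<in>words k. cs (coef h v) (\<Sum>u\<in>words i. cs (coef (g * f) u) (R (u @ v))))" for R :: "'a list \<Rightarrow> 'm"
        by (subst sum.swap) (simp add: cs.scale_sum_right mult.commute)
      then show ?thesis by (simp add: gf)
    qed
    then show ?thesis unfolding word_sum_mult[where f = "g * f" and g = h] by simp
  qed
  have EE: "E u \<cdot> (E a \<cdot> S w \<cdot> E b) \<cdot> E v = E (u @ a) \<cdot> S w \<cdot> E (b @ v)" for u a w b v
  proof -
    have 1: "E a \<cdot> S w \<in> Hom C (0 + - 1) X X" by (rule comp_Hom[OF E_Hom S_Hom])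
    have 2: "E (u @ a) \<cdot> S w = E u \<cdot> (E a \<cdot> S w)" unfolding E_append by (rule comp_assoc[OF E_Hom E_Hom S_Hom])
    have 3: "E u \<cdot> (E a \<cdot> S w) \<in> Hom C (0 + (0 + - 1)) X X" by (rule comp_Hom[OF E_Hom 1])
    have "E u \<cdot> (E a \<cdot> S w \<cdot> E b) = E u \<cdot> (E a \<cdot> S w) \<cdot> E b" by (rule comp_assoc[OF E_Hom 1 E_Hom, symmetric])
    then show ?thesis unfolding 2 E_append[of b v] by (simp add: comp_assoc[OF 3 E_Hom E_Hom])
  qed
  show ?thesis
    unfolding good_def
  proof (intro allI, rule key)
    fix u v n a b m
    have "(\<Sum>w\<in>words m. cs (coef f w) (S (u @ (a @ w @ b) @ v))) = (\<Sum>w\<in>words m. cs (coef f w) (E (u @ a) \<cdot> S w \<cdot> E (b @ v)))"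
      using f[unfolded good_def, rule_format, of "u @ a" "b @ v" m] by simp
    also have "\<dots> = (\<Sum>w\<in>words m. cs (coef f w) (E u \<cdot> (E a \<cdot> S w \<cdot> E b) \<cdot> E v))"
      by (simp add: EE)
    also have "\<dots> = E u \<cdot> (\<Sum>w\<in>words m. cs (coef f w) (E a \<cdot> S w \<cdot> E b)) \<cdot> E v"
    proof -
      have ES: "E a \<cdot> S w \<cdot> E b \<in> Hom C (-1) X X" for w using comp_Hom[OF comp_Hom[OF E_Hom S_Hom] E_Hom] by simp
      have EES: "E u \<cdot> (E a \<cdot> S w \<cdot> E b) \<in> Hom C (-1) X X" for w using comp_Hom[OF E_Hom ES] by simp
      show ?thesis
        using comp_sum_sum[of "{()}" "\<lambda>_. E u" 0 X X "words m" "\<lambda>w. E a \<cdot> S w \<cdot> E b" "-1" X "\<lambda>_. 1" "coef f"]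
          comp_sum_sum[of "words m" "\<lambda>w. E u \<cdot> (E a \<cdot> S w \<cdot> E b)" "-1" X X "{()}" "\<lambda>_. E v" 0 X "coef f" "\<lambda>_. 1"]
        by (simp add: E_Hom ES EES)
    qed
    also have "\<dots> = E u \<cdot> (\<Sum>w\<in>words m. cs (coef f w) (S (a @ w @ b))) \<cdot> E v"
      using f unfolding good_def by simp
    also have "\<dots> = (\<Sum>w\<in>words m. cs (coef f w) (E u \<cdot> S (a @ w @ b) \<cdot> E v))"
    proof -
      have ES: "E u \<cdot> S w \<in> Hom C (-1) X X" for w using comp_Hom[OF E_Hom S_Hom] by simp
      show ?thesis
        using comp_sum_sum[of "{()}" "\<lambda>_. E u" 0 X X "words m" "\<lambda>w. S (a @ w @ b)" "-1" X "\<lambda>_. 1" "coef f"]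
          comp_sum_sum[of "words m" "\<lambda>w. E u \<cdot> S (a @ w @ b)" "-1" X X "{()}" "\<lambda>_. E v" 0 X "coef f" "\<lambda>_. 1"]
        by (simp add: E_Hom ES S_Hom)
    qed
    finally show "(\<Sum>w\<in>words m. cs (coef f w) (S (u @ (a @ w @ b) @ v))) =
      (\<Sum>w\<in>words m. cs (coef f w) (E u \<cdot> S (a @ w @ b) \<cdot> E v))" .
  qed
qed

lemma good_mult_left: "good f \<Longrightarrow> good (g * f)" and good_mult_right: "good f \<Longrightarrow> good (f * h)"
  using good_mult[of f g 1] good_mult[of f 1 h] by simp_all

text \<open>Goodness is a family of linear conditions, each on finitely many coefficients once it is
  tested against functionals. This makes it stable under coefficientwise limits and
  integrals.\<close>

lemma good_closed:
  assumes "\<And>\<psi> V. finite V \<Longrightarrow> (\<And>g. good g \<Longrightarrow> (\<Sum>w\<in>V. coef g w * \<psi> w) = 0) \<Longrightarrow> (\<Sum>w\<in>V. coef f w * \<psi> w) = (0 :: complex)"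
  shows "good f"
  unfolding good_def
proof (intro allI)
  fix u v n
  show "(\<Sum>w\<in>words n. cs (coef f w) (S (u @ w @ v))) = (\<Sum>w\<in>words n. cs (coef f w) (E u \<cdot> S w \<cdot> E v))"
  proof (rule functional_separates)
    fix \<phi> assume \<phi>: "functional \<phi>"
    define \<psi> where "\<psi> w = \<phi> (S (u @ w @ v)) - \<phi> (E u \<cdot> S w \<cdot> E v)" for w
    have *: "\<phi> (\<Sum>w\<in>words n. cs (coef g w) (S (u @ w @ v))) - \<phi> (\<Sum>w\<in>words n. cs (coef g w) (E u \<cdot> S w \<cdot> E v)) =
       (\<Sum>w\<in>words n. coef g w * \<psi> w)" for g
      by (simp add: functional_simps[OF \<phi>] \<psi>_def sum_subtractf right_diff_distrib)
    have "(\<Sum>w\<in>words n. coef f w * \<psi> w) = 0"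
    proof (rule assms)
      fix g assume "good g"
      then show "(\<Sum>w\<in>words n. coef g w * \<psi> w) = 0" unfolding *[symmetric] good_def by simp
    qed simp
    then show "\<phi> (\<Sum>w\<in>words n. cs (coef f w) (S (u @ w @ v))) = \<phi> (\<Sum>w\<in>words n. cs (coef f w) (E u \<cdot> S w \<cdot> E v))"
      unfolding *[symmetric] by simp
  qed
qed

lemma good_tendsto:
  assumes "nc_tendsto f L F" "eventually (\<lambda>x. good (f x)) F" "F \<noteq> bot"
  shows "good L"
proof (rule good_closed)
  fix \<psi> V assume V: "finite V" "\<And>g. good g \<Longrightarrow> (\<Sum>w\<in>V. coef g w * \<psi> w) = (0 :: complex)"
  have "((\<lambda>x. \<Sum>w\<in>V. coef (f x) w * \<psi> w) \<longlongrightarrow> (\<Sum>w\<in>V. coef L w * \<psi> w)) F"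
    using assms(1) by (intro tendsto_intros) (auto simp: nc_tendsto_def)
  moreover have "eventually (\<lambda>x. 0 = (\<Sum>w\<in>V. coef (f x) w * \<psi> w)) F"
    using assms(2) by eventually_elim (simp add: V(2))
  hence "((\<lambda>x. \<Sum>w\<in>V. coef (f x) w * \<psi> w) \<longlongrightarrow> 0) F"
    by (rule Lim_transform_eventually[OF tendsto_const])
  ultimately show "(\<Sum>w\<in>V. coef L w * \<psi> w) = 0"
    by (rule tendsto_unique[OF assms(3)])
qed

lemma good_integral:
  assumes "\<And>w. ((\<lambda>r. coef (f r) w) has_integral coef L w) {0..1}" "\<And>r. r \<in> {0..1::real} \<Longrightarrow> good (f r)"
  shows "good L"
proof (rule good_closed)
  fix \<psi> V assume V: "finite V" "\<And>g. good g \<Longrightarrow> (\<Sum>w\<in>V. coef g w * \<psi> w) = (0 :: complex)"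
  have "((\<lambda>r. \<Sum>w\<in>V. coef (f r) w * \<psi> w) has_integral (\<Sum>w\<in>V. coef L w * \<psi> w)) {0..1}"
    using assms(1) by (intro has_integral_sum V(1) has_integral_mult_left)
  moreover have "((\<lambda>r. \<Sum>w\<in>V. coef (f r) w * \<psi> w) has_integral 0) {0..1}"
    by (rule has_integral_is_0) (simp add: V(2) assms(2))
  ultimately show "(\<Sum>w\<in>V. coef L w * \<psi> w) = 0" by (rule has_integral_unique)
qed

end

section \<open>Exponentials, transport and limits under evaluation\<close>

lemma ssum_nth: "fps_nth (ssum F) n = (\<Sum>m\<le>n. fps_nth (F m) n)"
  by (simp add: ssum_def)

text \<open>The commutator with \<open>F\<close> is a derivation; this is its Leibniz expansion on a
  power, the shape of the inner sums in \<open>teps\<close> and \<open>exp_hty\<close>.\<close>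

lemma telescope_commutator:
  fixes F B :: "'a ncs"
  shows "(\<Sum>j<m. B ^ j * (F * B - B * F) * B ^ (m - 1 - j)) = F * B ^ m - B ^ m * F"
proof (induction m)
  case (Suc m)
  have "B ^ j * (F * B - B * F) * B ^ (m - j) = B ^ j * (F * B - B * F) * B ^ (m - 1 - j) * B" if "j < m" for j
  proof -
    have "m - j = Suc (m - 1 - j)" using that by simp
    then show ?thesis by (simp only: power_Suc2 mult.assoc)
  qed
  hence "(\<Sum>j<Suc m. B ^ j * (F * B - B * F) * B ^ (Suc m - 1 - j)) =
      (\<Sum>j<m. B ^ j * (F * B - B * F) * B ^ (m - 1 - j)) * B + B ^ m * (F * B - B * F)"
    by (simp add: sum_distrib_right)
  also have "\<dots> = F * B ^ Suc m - B ^ Suc m * F"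
    unfolding Suc by (simp add: algebra_simps power_Suc2 del: power_Suc)
  finally show ?case .
qed simp

lemma telescope_commutator_left:
  fixes A B :: "'a ncs"
  shows "(\<Sum>k<n. A ^ k * (A * B - B * A) * A ^ (n - 1 - k)) = A ^ n * B - B * A ^ n"
proof -
  have "(\<Sum>k<n. A ^ k * (A * B - B * A) * A ^ (n - 1 - k)) = - (\<Sum>k<n. A ^ k * (B * A - A * B) * A ^ (n - 1 - k))"
    by (simp add: sum_negf[symmetric] algebra_simps)
  also have "\<dots> = A ^ n * B - B * A ^ n" unfolding telescope_commutator by simp
  finally show ?thesis .
qed

context evaluation
begin

lemma ev_power: "spow C X (ev A) m = ev (A ^ m)"
  by (induction m) (simp_all add: ev_1 ev_mult)

lemma gev_nth_cong:
  "(\<And>w. length w = n \<Longrightarrow> coef f w = coef g w) \<Longrightarrow> fps_nth (gev T f) n = fps_nth (gev T g) n"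
  by (simp add: gev_nth)

lemma sexp_ev:
  assumes "coef A [] = 0"
  shows "sexp C X (u *\<^sub>s ev A) = ev (nexp u A)"
proof (rule fps_ext)
  fix n
  have "fps_nth (ev (nexp u A)) n = fps_nth (ev (\<Sum>m\<le>n. (u ^ m / fact m) *\<^sub>n A ^ m)) n"
    by (rule gev_nth_cong) (simp add: coef_nexp_eq[OF assms])
  also have "\<dots> = fps_nth (sexp C X (u *\<^sub>s ev A)) n"
    unfolding sexp_def ssum_nth gev_scale[symmetric] ev_power nscale_power
    by (simp add: gev_sum fps_nth_sum)
  finally show "fps_nth (sexp C X (u *\<^sub>s ev A)) n = fps_nth (ev (nexp u A)) n" ..
qed

lemma epow_ev:
  assumes "coef A [] = 0"
  shows "epow C X \<epsilon> (ev A) = ev (nexp (of_real (ln \<epsilon>)) A)"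
    "epow C X \<epsilon> (- ev A) = ev (nexp (- of_real (ln \<epsilon>)) A)"
proof -
  show "epow C X \<epsilon> (ev A) = ev (nexp (of_real (ln \<epsilon>)) A)"
    unfolding epow_def by (rule sexp_ev[OF assms])
  have "coef (- A) [] = 0" using assms by simp
  from sexp_ev[OF this] show "epow C X \<epsilon> (- ev A) = ev (nexp (- of_real (ln \<epsilon>)) A)"
    unfolding epow_def gev_minus[symmetric] nexp_minus .
qed

lemma Gam_ev: "Gam C (ev A) (ev B) c r = ev (nc_Gam A B c r)"
  by (simp add: Gam_def nc_Gam_def gev_add gev_scale)

lemma nc_cont_mult_right: "nc_cont T Y \<Longrightarrow> nc_cont T (\<lambda>x. Y x * c)"
  by (rule nc_cont_mult[OF _ nc_cont_const])

text \<open>The coefficients of \<open>Y\<close> satisfy complex differential equations, so their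
  evaluation is a solution in the sense of \<open>solves\<close>, and uniqueness identifies the
  transport with it.\<close>

lemma transport_ev:
  assumes Y: "fundamental G Y" and G: "\<And>r. r \<in> {0..1} \<Longrightarrow> G' r = ev (G r)"
    and G0: "\<And>r. r \<in> {0..1} \<Longrightarrow> coef (G r) [] = 0" and r: "r' \<in> {0..1}" "r \<in> {0..1}"
  shows "transport C X G' r r' = ev (Y r * ninv (Y r'))"
proof -
  define Z where "Z x = Y x * ninv (Y r')" for x
  from Y obtain S where S: "finite S" "\<forall>r\<in>{0..1} - S. \<forall>w.
        ((\<lambda>x. coef (Y x) w) has_vector_derivative coef (G r * Y r) w) (at r within {0..1})"
    and Y1: "\<And>r. coef (Y r) [] = 1" and cont: "nc_cont {0..1} Y"
    unfolding fundamental_def by (elim conjE exE) simp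
  have Zc: "nc_cont {0..1} Z" unfolding Z_def by (rule nc_cont_mult_right[OF cont])
  have Zd: "((\<lambda>x. coef (Z x) w) has_vector_derivative coef (G x * Z x) w) (at x within {0..1})"
    if "x \<in> {0..1} - S" for x w
  proof -
    have "((\<lambda>x. \<Sum>i\<le>length w. coef (Y x) (take i w) * coef (ninv (Y r')) (drop i w)) has_vector_derivative
       (\<Sum>i\<le>length w. coef (G x * Y x) (take i w) * coef (ninv (Y r')) (drop i w))) (at x within {0..1})"
      using S(2) that by (intro has_vector_derivative_sum has_vector_derivative_mult_left) simp
    then show ?thesis unfolding Z_def mult.assoc[symmetric] by (simp only: coef_mult[of _ "ninv (Y r')"])
  qed
  have "solves C X G' r' (\<lambda>x. ev (Z x))"
    unfolding solves_def
  proof (intro conjI allI ballI exI[of _ S])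
    show "ev (Z r') = \<one> X" by (simp add: Z_def ninv Y1 ev_1)
    show "ev (Z x) \<in> SHom C 0 X X" for x by (rule ev_SHom)
    show "finite S" by (rule S)
    show "flim C (\<lambda>x. fps_nth (ev (Z x)) n) (fps_nth (ev (Z x)) n) (at x within {0..1})" if "x \<in> {0..1}" for x n
    proof (rule flimI[OF finite_words])
      show "\<forall>\<^sub>F x in at x within {0..1}. fps_nth (ev (Z x)) n = (\<Sum>w\<in>words n. cs (coef (Z x) w) (E w))"
        by (simp add: gev_nth)
      show "((\<lambda>x. coef (Z x) w) \<longlongrightarrow> coef (Z x) w) (at x within {0..1})" for w
        using Zc that unfolding nc_cont_def continuous_on_def by simp
    qed (simp add: gev_nth)
    show "flim C (\<lambda>y. cs (of_real (1 / (y - x))) (fps_nth (ev (Z y)) n - fps_nth (ev (Z x)) n))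
          (fps_nth (G' x \<odot> ev (Z x)) n) (at x within {0..1})" if x: "x \<in> {0..1} - S" for x n
    proof (rule flimI[OF finite_words])
      show "\<forall>\<^sub>F y in at x within {0..1}. cs (of_real (1 / (y - x))) (fps_nth (ev (Z y)) n - fps_nth (ev (Z x)) n) =
          (\<Sum>w\<in>words n. cs ((coef (Z y) w - coef (Z x) w) /\<^sub>R (y - x)) (E w))"
      proof (rule always_eventually, rule allI)
        fix y
        have "fps_nth (ev (Z y)) n - fps_nth (ev (Z x)) n = fps_nth (ev (Z y - Z x)) n" by (simp add: gev_diff)
        then show "cs (of_real (1 / (y - x))) (fps_nth (ev (Z y)) n - fps_nth (ev (Z x)) n) =
          (\<Sum>w\<in>words n. cs ((coef (Z y) w - coef (Z x) w) /\<^sub>R (y - x)) (E w))"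
          by (simp only: gev_nth cs.scale_sum_right cs.scale_scale) (simp add: scaleR_conv_of_real divide_inverse)
      qed
      show "((\<lambda>y. (coef (Z y) w - coef (Z x) w) /\<^sub>R (y - x)) \<longlongrightarrow> coef (G x * Z x) w) (at x within {0..1})" for w
        using Zd[OF x, of w] unfolding has_vector_derivative_iff_tendsto .
      have "G' x = ev (G x)" using G x by simp
      then show "fps_nth (G' x \<odot> ev (Z x)) n = (\<Sum>w\<in>words n. cs (coef (G x * Z x) w) (E w))"
        by (simp only: ev_mult[symmetric] gev_nth)
    qed
  qed
  moreover have "fps_nth (G' x) 0 = 0" if x: "x \<in> {0..1}" for x
  proof -
    have "words 0 = {[] :: 'a list}" by auto
    then show ?thesis using G0[OF x] by (simp add: G[OF x] gev_nth)
  qed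
  ultimately have "transport C X G' r r' = ev (Z r)"
    by (rule transport_eq[OF _ _ r])
  then show ?thesis by (simp add: Z_def)
qed

text \<open>\<open>slimit\<close> is a definite description: the converging coefficients give
  existence, and functionals give uniqueness.\<close>

lemma slimit_gev:
  fixes T :: "'a list \<Rightarrow> 'm"
  assumes "eventually (\<lambda>\<epsilon>. F \<epsilon> = gev T (f \<epsilon>)) (at_right 0)" "nc_tendsto f L (at_right 0)"
  shows "slimit C F = gev T L"
proof (rule fps_ext)
  fix n
  have "flim C (\<lambda>\<epsilon>. fps_nth (F \<epsilon>) n) (fps_nth (gev T L) n) (at_right 0)"
  proof (rule flimI[OF finite_words])
    show "\<forall>\<^sub>F \<epsilon> in at_right 0. fps_nth (F \<epsilon>) n = (\<Sum>w\<in>words n. cs (coef (f \<epsilon>) w) (T w))"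
      using assms(1) by eventually_elim (simp add: gev_nth)
    show "((\<lambda>\<epsilon>. coef (f \<epsilon>) w) \<longlongrightarrow> coef L w) (at_right 0)" for w
      using assms(2) by (simp add: nc_tendsto_def)
  qed (simp add: gev_nth)
  then show "fps_nth (slimit C F) n = fps_nth (gev T L) n"
    unfolding slimit_def fps_nth_Abs_fps
    by (intro the_equality) (assumption, rule flim_unique[OF _ _ trivial_limit_at_right_real])
qed

lemma sintegral_gev:
  fixes T :: "'a list \<Rightarrow> 'm"
  assumes "\<And>r. r \<in> {0..1} \<Longrightarrow> F r = gev T (f r)" "\<And>w. ((\<lambda>r. coef (f r) w) has_integral coef L w) {0..1}"
  shows "sintegral C F = gev T L"
proof (rule fps_ext)
  fix n
  have "fintegral C (\<lambda>\<epsilon>. fps_nth (F \<epsilon>) n) (fps_nth (gev T L) n)"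
  proof (rule fintegralI[OF finite_words])
    show "fps_nth (F r) n = (\<Sum>w\<in>words n. cs (coef (f r) w) (T w))" if "r \<in> {0..1}" for r
      by (simp add: assms(1)[OF that] gev_nth)
    show "((\<lambda>r. coef (f r) w) has_integral coef L w) {0..1}" for w by (rule assms(2))
  qed (simp add: gev_nth)
  then show "fps_nth (sintegral C F) n = fps_nth (gev T L) n"
    unfolding sintegral_def fps_nth_Abs_fps
    by (intro the_equality) (assumption, rule fintegral_unique)
qed

lemma PhiE_ev:
  assumes A: "linear_ncs A" and B: "linear_ncs B" and \<epsilon>: "0 < \<epsilon>" "\<epsilon> \<le> 1 / 4"
  shows "PhiE C X \<epsilon> (ev A) (ev B) = ev (nc_Phi \<epsilon> A B)"
proof -
  interpret kz_paths A B A \<epsilon> 1 by unfold_locales (use assms in auto)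
  have "transport C X (Gam C (ev A) (ev B) (cI \<epsilon>)) 1 0 = ev (kz_sol A B (e 1) * ninv (kz_sol A B (e 0)))"
    by (rule transport_ev[OF fundamental_cI[OF A B] Gam_ev]) (simp_all add: nc_Gam_def A B)
  then show ?thesis
    by (simp add: PhiE_def nc_Phi_def epow_ev A B ev_mult e)
qed

lemma Phi_ev:
  assumes "linear_ncs A" "linear_ncs B"
  shows "Phi C X (ev A) (ev B) = ev (kz_assoc A B)"
  unfolding Phi_def
proof (rule slimit_gev[OF _ nc_Phi_tendsto[OF assms]])
  have "eventually (\<lambda>\<epsilon>::real. \<epsilon> \<in> {0<..<1/4}) (at_right 0)"
    by (rule eventually_at_right_real) simp
  then show "\<forall>\<^sub>F \<epsilon> in at_right 0. PhiE C X \<epsilon> (ev A) (ev B) = ev (nc_Phi \<epsilon> A B)"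
    by eventually_elim (simp add: PhiE_ev assms)
qed

lemma good_commutator_power:
  assumes "good (A * B - B * A)"
  shows "good (A ^ n * B ^ m - B ^ m * A ^ n)"
proof -
  have "good (A ^ n * B - B * A ^ n)"
    unfolding telescope_commutator_left[symmetric]
    by (intro good_sum good_mult assms)
  then show ?thesis
    unfolding telescope_commutator[symmetric] by (intro good_sum good_mult)
qed

lemma commutator_nexp_coef:
  assumes "coef A [] = 0" "coef B [] = 0" "length w = N"
  shows "coef (nexp u A * nexp v B - nexp v B * nexp u A) w =
    coef (\<Sum>m\<le>N. \<Sum>n\<le>N. (u ^ n * v ^ m / (fact n * fact m)) *\<^sub>n (A ^ n * B ^ m - B ^ m * A ^ n)) w"
proof -
  have "coef (nexp u A * nexp v B) w = coef (\<Sum>n\<le>N. \<Sum>m\<le>N. (u ^ n * v ^ m / (fact n * fact m)) *\<^sub>n (A ^ n * B ^ m)) w"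
    by (rule coef_nexp_mult_nexp[OF assms(1,2)]) (simp add: assms)
  also have "(\<Sum>n\<le>N. \<Sum>m\<le>N. (u ^ n * v ^ m / (fact n * fact m)) *\<^sub>n (A ^ n * B ^ m)) =
      (\<Sum>m\<le>N. \<Sum>n\<le>N. (u ^ n * v ^ m / (fact n * fact m)) *\<^sub>n (A ^ n * B ^ m))"
    by (rule sum.swap)
  finally have 1: "coef (nexp u A * nexp v B) w = coef (\<Sum>m\<le>N. \<Sum>n\<le>N. (u ^ n * v ^ m / (fact n * fact m)) *\<^sub>n (A ^ n * B ^ m)) w" .
  have 2: "coef (nexp v B * nexp u A) w = coef (\<Sum>m\<le>N. \<Sum>n\<le>N. (v ^ m * u ^ n / (fact m * fact n)) *\<^sub>n (B ^ m * A ^ n)) w"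
    by (rule coef_nexp_mult_nexp[OF assms(2,1)]) (simp add: assms)
  show ?thesis
    by (simp add: 1 2 nscale_diff sum_subtractf mult.commute)
qed

lemma good_commutator_nexp:
  assumes "coef A [] = 0" "coef B [] = 0" "good (A * B - B * A)"
  shows "good (nexp u A * nexp v B - nexp v B * nexp u A)"
proof (rule good_coefs, intro exI conjI ballI)
  fix n and w :: "'a list" assume "w \<in> words n"
  then show "coef (nexp u A * nexp v B - nexp v B * nexp u A) w =
    coef (\<Sum>m\<le>n. \<Sum>k\<le>n. (u ^ k * v ^ m / (fact k * fact m)) *\<^sub>n (A ^ k * B ^ m - B ^ m * A ^ k)) w"
    by (intro commutator_nexp_coef assms) simp
qed (intro good_sum good_scale good_commutator_power assms)

text \<open>The right-hand side is the double series in \<open>teps\<close>: both exponentials are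
  expanded, and each commutator of powers is resolved by moving one factor past one other at a
  time.\<close>

lemma se_commutator_nexp:
  assumes A: "coef A [] = 0" and B: "coef B [] = 0" and good: "good (A * B - B * A)"
  shows "se (nexp u A * nexp v B - nexp v B * nexp u A) =
    ssum (\<lambda>m. ssum (\<lambda>n. (u ^ n * v ^ m / (fact n * fact m)) *\<^sub>s
       (\<Sum>j<m. \<Sum>k<n. spow C X (ev B) j \<odot> spow C X (ev A) k \<odot> se (A * B - B * A)
          \<odot> spow C X (ev A) (n - 1 - k) \<odot> spow C X (ev B) (m - 1 - j))))"
proof (rule fps_ext)
  fix N
  have "spow C X (ev B) j \<odot> spow C X (ev A) k \<odot> se (A * B - B * A) \<odot> spow C X (ev A) k' \<odot> spow C X (ev B) j' =
     se (B ^ j * A ^ k * (A * B - B * A) * A ^ k' * B ^ j')" for j k k' j'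
    by (simp only: ev_power ev_mult[symmetric] se_mult_left[OF good, symmetric]
        se_mult_right[OF good_mult_left[OF good], symmetric] se_mult_right[OF good_mult_right[OF good_mult_left[OF good]], symmetric])
  moreover have "(\<Sum>j<m. \<Sum>k<n. B ^ j * A ^ k * (A * B - B * A) * A ^ (n - 1 - k) * B ^ (m - 1 - j)) =
     A ^ n * B ^ m - B ^ m * A ^ n" for m n
  proof -
    have "(\<Sum>k<n. B ^ j * A ^ k * (A * B - B * A) * A ^ (n - 1 - k) * B ^ (m - 1 - j)) =
       B ^ j * (\<Sum>k<n. A ^ k * (A * B - B * A) * A ^ (n - 1 - k)) * B ^ (m - 1 - j)" for j
      unfolding sum_distrib_left sum_distrib_right by (simp only: mult.assoc)
    then show ?thesis unfolding telescope_commutator_left by (simp only: telescope_commutator)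
  qed
  ultimately have "(\<Sum>j<m. \<Sum>k<n. spow C X (ev B) j \<odot> spow C X (ev A) k \<odot> se (A * B - B * A)
          \<odot> spow C X (ev A) (n - 1 - k) \<odot> spow C X (ev B) (m - 1 - j)) = se (A ^ n * B ^ m - B ^ m * A ^ n)" for m n
    by (simp only: gev_sum[symmetric])
  then show "fps_nth (se (nexp u A * nexp v B - nexp v B * nexp u A)) N = fps_nth (ssum (\<lambda>m. ssum (\<lambda>n. (u ^ n * v ^ m / (fact n * fact m)) *\<^sub>s
       (\<Sum>j<m. \<Sum>k<n. spow C X (ev B) j \<odot> spow C X (ev A) k \<odot> se (A * B - B * A)
          \<odot> spow C X (ev A) (n - 1 - k) \<odot> spow C X (ev B) (m - 1 - j))))) N"
    using gev_nth_cong[where T = S, OF commutator_nexp_coef[OF A B], of N]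
    by (simp only: ssum_nth gev_sum fps_nth_sum gev_scale)
qed

lemma commutator_nexp_right_coef:
  assumes "coef B [] = 0" "length w = N"
  shows "coef (F * nexp v B - nexp v B * F) w = coef (\<Sum>m\<le>N. (v ^ m / fact m) *\<^sub>n (F * B ^ m - B ^ m * F)) w"
proof -
  have "coef (F * nexp v B) w = coef (F * (\<Sum>m\<le>N. (v ^ m / fact m) *\<^sub>n B ^ m)) w"
    "coef (nexp v B * F) w = coef ((\<Sum>m\<le>N. (v ^ m / fact m) *\<^sub>n B ^ m) * F) w"
    using assms by (intro coef_mult_cong coef_nexp_eq; simp)+
  then show ?thesis
    by (simp add: sum_distrib_left sum_distrib_right coef_sum sum_subtractf right_diff_distrib)
qed

text \<open>The series has the shape of \<open>exp_hty\<close>, with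
  \<open>se (F * B - B * F)\<close> in place of the homotopy component.\<close>

lemma se_commutator_nexp_right:
  assumes B: "coef B [] = 0" and good: "good (F * B - B * F)"
  shows "se (F * nexp v B - nexp v B * F) =
    ssum (\<lambda>m. (v ^ m / fact m) *\<^sub>s
       (\<Sum>j<m. spow C X (ev B) j \<odot> se (F * B - B * F) \<odot> spow C X (ev B) (m - 1 - j)))"
proof (rule fps_ext)
  fix N
  have "(\<Sum>j<m. spow C X (ev B) j \<odot> se (F * B - B * F) \<odot> spow C X (ev B) (m - 1 - j)) = se (F * B ^ m - B ^ m * F)" for m
    unfolding ev_power se_mult[OF good, symmetric] gev_sum[symmetric] telescope_commutator ..
  then show "fps_nth (se (F * nexp v B - nexp v B * F)) N = fps_nth (ssum (\<lambda>m. (v ^ m / fact m) *\<^sub>s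
       (\<Sum>j<m. spow C X (ev B) j \<odot> se (F * B - B * F) \<odot> spow C X (ev B) (m - 1 - j)))) N"
    using gev_nth_cong[where T = S, OF commutator_nexp_right_coef[OF B], of N]
    by (simp only: ssum_nth gev_sum fps_nth_sum gev_scale)
qed

end


section \<open>The pre-hexagonator\<close>

text \<open>\<open>p\<close>, \<open>q\<close> and \<open>l\<close> are linear series rather than
  letters: under a permutation of the objects the variables stay the same, while \<open>t12\<close>
  and \<open>t23\<close> become others among \<open>p\<close>, \<open>q\<close> and
  \<open>l - p - q\<close>.\<close>

locale hexagon_data = evaluation C X E S for C :: "('r::comm_ring_1, 'o, 'm::ab_group_add) smc2cat" (structure)
    and X :: 'o and E S :: "'a::finite list \<Rightarrow> 'm" +
  fixes t :: "('o, 'm) trans2" and U V W :: 'o and p q l :: "'a ncs"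
  assumes X: "X = U \<otimes> V \<otimes> W" and lin: "linear_ncs p" "linear_ncs q" "linear_ncs l"
    and ev_p: "ev p = s12 C t U V W" and ev_q: "ev q = s23 C t U V W" and ev_l: "ev l = sLam C t U V W"
    and s12_3: "s12_3 C t U V W = s23 C t U V W + s13 C t U V W"
    and good_p: "good (p * l - l * p)" and se_p: "se (p * l - l * p) = sL C t U V W"
    and good_q: "good (q * l - l * q)" and se_q: "se (q * l - l * q) = sR C t U V W"
begin

lemma ev_m: "ev (l - p - q) = s13 C t U V W"
  by (simp add: gev_diff ev_p ev_q ev_l sLam_def)

lemma ev_qm: "ev (q + (l - p - q)) = s12_3 C t U V W"
  by (simp only: gev_add ev_m ev_q s12_3)

lemma Nabla_ev: "Nabla C t U V W P r = ev (nc_connection p q l P r)"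
  by (simp add: Nabla_def nc_connection_def gev_add gev_scale ev_l[symmetric] ev_p[symmetric] ev_q[symmetric] Gam_def)

lemma coef_connection: "coef (nc_connection p q l P r) [] = 0"
  by (simp add: nc_connection_def lin)

lemma Delta_se: "Delta C t U V W P s r = se (nc_curving p q l P s r)"
  by (simp add: Delta_def nc_curving_def Let_def gev_scale gev_add se_p se_q)

lemma good_curving: "good (nc_curving p q l P s r)"
  unfolding nc_curving_def Let_def by (intro good_scale good_add good_p good_q)

lemma Wp_ev: "fundamental (nc_connection p q l P) Y \<Longrightarrow> Wp C t U V W P = ev (holonomy Y)"
  unfolding Wp_def holonomy_def X[symmetric]
  by (rule transport_ev[OF _ Nabla_ev coef_connection]) simp_all

lemma Wc_ev:
  assumes "fundamental (nc_Gam p q c) Y"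
  shows "Wc C t U V W c = ev (holonomy Y)"
  unfolding Wc_def holonomy_def X[symmetric] ev_p[symmetric] ev_q[symmetric]
  by (rule transport_ev[OF assms Gam_ev]) (simp_all add: nc_Gam_def lin)

lemma W2_se:
  assumes "has_holonomy2 p q l P B"
  shows "W2 C t U V W P = se B" "good B"
proof -
  obtain Y I where Y: "\<And>s. s \<in> {0..1} \<Longrightarrow> fundamental (nc_connection p q l (P s)) (Y s)" "\<And>s. s \<in> {0..1} \<Longrightarrow> Y s 0 = 1"
    and I: "\<And>s w. s \<in> {0..1} \<Longrightarrow> ((\<lambda>r. coef (Y s 1 * ninv (Y s r) * nc_curving p q l P s r * Y s r) w) has_integral coef (I s) w) {0..1}"
    and B: "\<And>w. ((\<lambda>s. coef (I s) w) has_integral coef B w) {0..1}"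
    using assms unfolding has_holonomy2_def by blast
  have inner: "sintegral C (\<lambda>r. transport C X (Nabla C t U V W (P s)) 1 r \<odot> Delta C t U V W P s r
       \<odot> transport C X (Nabla C t U V W (P s)) r 0) = se (I s)" if s: "s \<in> {0..1}" for s
  proof (rule sintegral_gev[OF _ I[OF s]])
    fix r :: real assume r: "r \<in> {0..1}"
    have tr: "transport C X (Nabla C t U V W (P s)) x y = ev (Y s x * ninv (Y s y))" if "x \<in> {0..1}" "y \<in> {0..1}" for x y
      by (rule transport_ev[OF Y(1)[OF s] Nabla_ev coef_connection that(2,1)])
    show "transport C X (Nabla C t U V W (P s)) 1 r \<odot> Delta C t U V W P s r \<odot> transport C X (Nabla C t U V W (P s)) r 0 =
       se (Y s 1 * ninv (Y s r) * nc_curving p q l P s r * Y s r)"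
      unfolding se_mult[OF good_curving] Delta_se[symmetric] using r by (simp add: tr Y(2)[OF s])
  qed
  show "W2 C t U V W P = se B"
    unfolding W2_def X[symmetric] by (rule sintegral_gev[OF inner B])
  show "good B"
  proof (rule good_integral[OF B])
    fix s :: real assume "s \<in> {0..1}"
    then show "good (I s)" by (intro good_integral[OF I] good_mult good_curving)
  qed
qed

lemma prehex_eps:
  assumes a: "a \<noteq> 0" and \<epsilon>: "0 < \<epsilon>" "\<epsilon> < 1 / 4"
  shows "epow C (U \<otimes> V \<otimes> W) \<epsilon> (- s13 C t U V W) \<odot> WcalQ C t U V W \<epsilon> a \<odot> epow C (U \<otimes> V \<otimes> W) \<epsilon> (s23 C t U V W)
     - PhiE C (U \<otimes> V \<otimes> W) \<epsilon> (s12 C t U V W) (s13 C t U V W) \<odot> Keps C t U V W \<epsilon> a \<odot> teps C t U V W \<epsilon>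
         \<odot> PhiE C (U \<otimes> V \<otimes> W) \<epsilon> (s23 C t U V W) (s12 C t U V W) = se (kz_paths.nc_prehex p q l \<epsilon>)"
    and "good (kz_paths.nc_prehex p q l \<epsilon>)"
proof -
  interpret kz_paths p q l \<epsilon> a by unfold_locales (use assms lin in auto)
  have ev_m: "ev m = s13 C t U V W" and ev_qm: "ev (q + m) = s12_3 C t U V W"
    unfolding m_def by (rule ev_m ev_qm)+
  have l0: "coef p [] = 0" "coef q [] = 0" "coef m [] = 0" "coef (q + m) [] = 0" using lin lin_m by simp_all
  note W = Wp_ev[OF fundamental_paths(1)] Wp_ev[OF fundamental_paths(2)] Wp_ev[OF fundamental_paths(3)] Wp_ev[OF fundamental_paths(4)]
    Wp_ev[OF fundamental_paths(5)] Wp_ev[OF fundamental_paths(6)] Wp_ev[OF fundamental_paths(7)] Wp_ev[OF fundamental_paths(8)] Wc_ev[OF fundamental_paths(9)]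
  note W2 = W2_se(1)[OF holonomies2(1)] W2_se(1)[OF holonomies2(2)] W2_se(1)[OF holonomies2(3)] W2_se(1)[OF holonomies2(4)]
    W2_se(1)[OF holonomies2(5)] W2_se(1)[OF holonomies2(6)]
  note g = W2_se(2)[OF holonomies2(1)] W2_se(2)[OF holonomies2(2)] W2_se(2)[OF holonomies2(3)] W2_se(2)[OF holonomies2(4)]
    W2_se(2)[OF holonomies2(5)] W2_se(2)[OF holonomies2(6)]
  define BP where "BP = (holonomy YV - nexp (N5 1) l * holonomy ZV) * holonomy YVI * holonomy YI
         - (holonomy YIV * nexp (N5 1) l - nexp (N5 1) l * holonomy YIV) * holonomy ZIII * holonomy XII
         - holonomy YIV * (holonomy YIII - nexp (N5 1) l * holonomy ZIII) * holonomy XII"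
  have gBP: "good BP" unfolding BP_def by (intro good_diff good_mult_right good_mult_left g)
  have BP: "WcalP C t U V W \<epsilon> a = se BP"
    unfolding WcalP_def W W2 BP_def
    by (simp only: gev_diff se_mult_right se_mult_left good_mult_right good_mult_left g)
  have down: "holonomy (\<lambda>r. nexp (N4 r) l) = nexp (N4 1) l"
    by (simp add: holonomy_def N_0)
  define BQ where "BQ = holonomy YV * (holonomy XVI - nexp \<mu> l * holonomy YVI) * holonomy YI
     + (holonomy YV * nexp \<mu> l - nexp \<mu> l * holonomy YV) * holonomy YVI * holonomy YI
     + nexp (N4 1) l * BP - (holonomy XIV - nexp \<mu> l * holonomy YIV) * holonomy YIII * holonomy XII"
  have gBQ: "good BQ" unfolding BQ_def by (intro good_diff good_add good_mult_right good_mult_left g gBP)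
  have BQ: "WcalQ C t U V W \<epsilon> a = se BQ"
    unfolding WcalQ_def W W2 BP BQ_def down
    by (simp only: gev_diff gev_add se_mult_right se_mult_left good_mult_right good_mult_left g gBP)
  have BQ_eq: "BQ = holonomy YV * holonomy XVI * holonomy YI - holonomy XIV * holonomy YIII * holonomy XII"
    unfolding BQ_def BP_def by (rule boundary)
  \<comment> \<open>As \<open>q + m = l - p\<close> and \<open>p\<close> commutes with itself, the
    relationator in \<open>teps\<close> is also the image of this commutator.\<close>
  have comm: "p * (q + m) - (q + m) * p = p * l - l * p"
    by (simp add: m_def algebra_simps)
  have gc: "good (p * (q + m) - (q + m) * p)" unfolding comm by (rule good_p)
  have "teps C t U V W \<epsilon> = se (nexp (- of_real (ln \<epsilon>)) p * nexp (\<i> * of_real pi) (q + m)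
     - nexp (\<i> * of_real pi) (q + m) * nexp (- of_real (ln \<epsilon>)) p) \<odot> ev (nexp (of_real (ln \<epsilon>)) p)"
    unfolding teps_def se_commutator_nexp[OF l0(1,4) gc] X[symmetric] ev_qm ev_p comm se_p
    by (simp only: epow_ev(1)[OF l0(1), unfolded ev_p])
  hence T: "teps C t U V W \<epsilon> = se nc_t" and gt: "good nc_t"
    unfolding nc_t_def using se_mult_right[OF good_commutator_nexp[OF l0(1,4) gc]]
      good_mult_right[OF good_commutator_nexp[OF l0(1,4) gc]] by simp_all
  have K: "Keps C t U V W \<epsilon> a = ev nc_K"
    unfolding Keps_def W nc_K_def X[symmetric] ev_p[symmetric] ev_qm[symmetric]
    by (simp add: epow_ev l0 sexp_ev ev_mult)
  have P: "PhiE C X \<epsilon> (s12 C t U V W) (s13 C t U V W) = ev (nc_Phi \<epsilon> p m)"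
    "PhiE C X \<epsilon> (s23 C t U V W) (s12 C t U V W) = ev (nc_Phi \<epsilon> q p)"
    unfolding ev_p[symmetric] ev_q[symmetric] ev_m[symmetric]
    using \<epsilon> by (intro PhiE_ev lin lin_m; simp)+
  show "good nc_prehex"
    unfolding nc_prehex_def BQ_eq[symmetric] by (intro good_diff good_mult_right good_mult_left gBQ gt)
  show "epow C (U \<otimes> V \<otimes> W) \<epsilon> (- s13 C t U V W) \<odot> WcalQ C t U V W \<epsilon> a \<odot> epow C (U \<otimes> V \<otimes> W) \<epsilon> (s23 C t U V W)
     - PhiE C (U \<otimes> V \<otimes> W) \<epsilon> (s12 C t U V W) (s13 C t U V W) \<odot> Keps C t U V W \<epsilon> a \<odot> teps C t U V W \<epsilon>
         \<odot> PhiE C (U \<otimes> V \<otimes> W) \<epsilon> (s23 C t U V W) (s12 C t U V W) = se nc_prehex"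
    unfolding X[symmetric] P K T BQ nc_prehex_def BQ_eq[symmetric]
    unfolding ev_m[symmetric] ev_q[symmetric] epow_ev[OF l0(2)] epow_ev[OF l0(3)] gev_diff
      se_mult_right[OF good_mult_left[OF gBQ]] se_mult_left[OF gBQ] se_mult_right[OF good_mult_left[OF gt]] se_mult_left[OF gt] ev_mult ..
qed

text \<open>Value and goodness both survive the limit because the coefficients converge. The
  parameter \<open>a\<close> is gone, since the connection sees \<open>v\<close> only through its
  logarithmic derivative.\<close>

theorem prehexR_eq:
  assumes "a \<noteq> 0"
  shows "prehexR C t U V W a = se (nc_hexagon p q (l - p - q))" "good (nc_hexagon p q (l - p - q))"
proof -
  have ev: "eventually (\<lambda>\<epsilon>::real. \<epsilon> \<in> {0<..<1/4}) (at_right 0)"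
    by (rule eventually_at_right_real) simp
  show "prehexR C t U V W a = se (nc_hexagon p q (l - p - q))"
    unfolding prehexR_def
  proof (rule slimit_gev[OF _ nc_prehex_tendsto[OF lin]])
    show "\<forall>\<^sub>F \<epsilon> in at_right 0. epow C (U \<otimes> V \<otimes> W) \<epsilon> (- s13 C t U V W) \<odot> WcalQ C t U V W \<epsilon> a \<odot> epow C (U \<otimes> V \<otimes> W) \<epsilon> (s23 C t U V W)
     - PhiE C (U \<otimes> V \<otimes> W) \<epsilon> (s12 C t U V W) (s13 C t U V W) \<odot> Keps C t U V W \<epsilon> a \<odot> teps C t U V W \<epsilon>
         \<odot> PhiE C (U \<otimes> V \<otimes> W) \<epsilon> (s23 C t U V W) (s12 C t U V W) = se (kz_paths.nc_prehex p q l \<epsilon>)"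
      using ev by eventually_elim (rule prehex_eps(1)[OF assms], simp_all)
  qed
  show "good (nc_hexagon p q (l - p - q))"
  proof (rule good_tendsto[OF nc_prehex_tendsto[OF lin]])
    show "\<forall>\<^sub>F \<epsilon> in at_right 0. good (kz_paths.nc_prehex p q l \<epsilon>)"
      using ev by eventually_elim (rule prehex_eps(2)[OF assms], simp_all)
  qed simp
qed

lemma assoc_eq: "assoc C t U V W = ev (kz_assoc p q)"
  unfolding assoc_def X[symmetric] ev_p[symmetric] ev_q[symmetric] by (rule Phi_ev[OF lin(1,2)])

end

section \<open>Normal forms of words\<close>

datatype letter = Lx | Ly | Ll

instance letter :: finite
proof
  have "UNIV = {Lx, Ly, Ll}" using letter.exhaust by auto
  then show "finite (UNIV :: letter set)" by (metis finite.emptyI finite.insertI)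
qed

definition nc_word :: "'a list \<Rightarrow> 'a ncs" where
  "nc_word u = Abs_ncs (\<lambda>w. if w = u then 1 else 0)"

lemma coef_nc_word [simp]: "coef (nc_word u) w = (if w = u then 1 else 0)"
  by (simp add: nc_word_def)

lemma nc_word_mult: "nc_word u * nc_word v = nc_word (u @ v)"
proof (rule ncs_eqI)
  fix w
  have "coef (nc_word u * nc_word v) w = (\<Sum>i\<le>length w. if i = length u \<and> w = u @ v then 1 else 0)"
    unfolding coef_mult
  proof (rule sum.cong[OF refl])
    fix i assume "i \<in> {..length w}"
    then have "take i w = u \<and> drop i w = v \<longleftrightarrow> i = length u \<and> w = u @ v"
      by (metis append_eq_conv_conj append_take_drop_id atMost_iff length_take min_absorb2)
    then show "coef (nc_word u) (take i w) * coef (nc_word v) (drop i w) = (if i = length u \<and> w = u @ v then 1 else 0)"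
      by auto
  qed
  also have "\<dots> = coef (nc_word (u @ v)) w"
    by (cases "w = u @ v") (simp_all add: if_distrib cong: if_cong)
  finally show "coef (nc_word u * nc_word v) w = coef (nc_word (u @ v)) w" .
qed

lemma linear_nc_word: "linear_ncs (nc_word [a])"
  by (auto simp: linear_ncs_def)

text \<open>
  Rewriting all words to the form \<open>\<Lambda>\<^sup>k f\<close> with \<open>f\<close> free of \<open>\<Lambda>\<close> costs a sum of conjugates of the
  homotopies \<open>L\<close>, \<open>R\<close>; this sum is \<open>Sw\<close>. By the Peiffer identity \<open>(\<partial>k')k = k'(\<partial>k)\<close>, moving one
  \<open>\<Lambda>\<close> past one letter anywhere in a word changes \<open>Sw\<close> in the expected way.
\<close>

locale word_eval = cochain2 C for C :: "('r::comm_ring_1, 'o, 'm::ab_group_add) smc2cat" (structure) +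
  fixes X :: 'o and x y \<Lambda> L R :: 'm
  assumes Hom0: "x \<in> Hom C 0 X X" "y \<in> Hom C 0 X X" "\<Lambda> \<in> Hom C 0 X X"
    and Hom1: "L \<in> Hom C (-1) X X" "R \<in> Hom C (-1) X X"
    and d: "\<partial> L = x \<cdot> \<Lambda> - \<Lambda> \<cdot> x" "\<partial> R = y \<cdot> \<Lambda> - \<Lambda> \<cdot> y"
begin

fun ltr :: "letter \<Rightarrow> 'm" where
  "ltr Lx = x" | "ltr Ly = y" | "ltr Ll = \<Lambda>"

fun rel :: "letter \<Rightarrow> 'm" where
  "rel Lx = L" | "rel Ly = R" | "rel Ll = 0"

fun evw :: "letter list \<Rightarrow> 'm" where
  "evw [] = idm C X"
| "evw (a # w) = ltr a \<cdot> evw w"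

fun pw :: "nat \<Rightarrow> 'm" where
  "pw 0 = idm C X"
| "pw (Suc k) = \<Lambda> \<cdot> pw k"

text \<open>A homotopy from \<open>ltr a \<cdot> pw k\<close> to \<open>pw k \<cdot> ltr a\<close>,
  which moves the letter past one \<Lambda> after another.\<close>

fun hom :: "letter \<Rightarrow> nat \<Rightarrow> 'm" where
  "hom a 0 = 0"
| "hom a (Suc k) = rel a \<cdot> pw k + \<Lambda> \<cdot> hom a k"

definition lams :: "letter list \<Rightarrow> nat" where "lams w = length (filter ((=) Ll) w)"
definition flt :: "letter list \<Rightarrow> letter list" where "flt w = filter ((\<noteq>) Ll) w"

text \<open>The tail is normalised first; then the leading letter is moved past all the factors
  \<Lambda> collected in front of the tail.\<close>

fun Sw :: "letter list \<Rightarrow> 'm" where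
  "Sw [] = 0"
| "Sw (a # w) = ltr a \<cdot> Sw w + hom a (lams w) \<cdot> evw (flt w)"

abbreviation "H0 \<equiv> Hom C 0 X X"
abbreviation "H1 \<equiv> Hom C (-1) X X"

lemma comp_H: "f \<in> H0 \<Longrightarrow> g \<in> H0 \<Longrightarrow> f \<cdot> g \<in> H0" "f \<in> H0 \<Longrightarrow> g \<in> H1 \<Longrightarrow> f \<cdot> g \<in> H1" "f \<in> H1 \<Longrightarrow> g \<in> H0 \<Longrightarrow> f \<cdot> g \<in> H1"
  using comp_Hom[of f 0 X X g 0 X] comp_Hom[of f 0 X X g "-1" X] comp_Hom[of f "-1" X X g 0 X] by simp_all

lemma ltr_Hom: "ltr a \<in> H0" and rel_Hom: "rel a \<in> H1"
  by (cases a; simp add: Hom0 Hom1 Hom_closed(1))+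

lemma evw_Hom: "evw w \<in> H0" and pw_Hom: "pw k \<in> H0"
  by (induction w, simp_all add: idm_Hom comp_H ltr_Hom) (induction k, simp_all add: idm_Hom comp_H Hom0)

lemma hom_Hom: "hom a k \<in> H1"
  by (induction k) (simp_all add: Hom_closed(1,2) comp_H rel_Hom pw_Hom Hom0)

lemma Sw_Hom: "Sw w \<in> H1"
  by (induction w) (simp_all add: Hom_closed(1,2) comp_H ltr_Hom evw_Hom hom_Hom)

lemma hom_Ll: "hom Ll k = 0"
  by (induction k) (simp_all add: comp_zero(1)[OF pw_Hom] comp_zero(2)[OF Hom0(3)])

lemma evw_append: "evw (u @ v) = evw u \<cdot> evw v"
  by (induction u) (simp_all add: idm_left[OF evw_Hom] comp_assoc[OF ltr_Hom evw_Hom evw_Hom])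

lemma diff_deg0: "f \<in> Hom C 0 U V \<Longrightarrow> \<partial> f = 0"
  using diff_Hom[of f 0 U V] Hom_trivial[of 1 U V] by simp

lemma diff_comp_left: "f \<in> H0 \<Longrightarrow> g \<in> H1 \<Longrightarrow> \<partial> (f \<cdot> g) = f \<cdot> \<partial> g"
  using diff_comp[of f 0 X X g "-1" X] comp_zero(1)[of g "-1" X X] by (simp add: diff_deg0)

lemma diff_comp_right: "f \<in> H1 \<Longrightarrow> g \<in> H0 \<Longrightarrow> \<partial> (f \<cdot> g) = \<partial> f \<cdot> g"
  using diff_comp[of f "-1" X X g 0 X] comp_zero(2)[of f "-1" X X] by (simp add: diff_deg0)

text \<open>The composite of two elements of degree -1 is zero, and the Leibniz rule applied to this
  zero gives the equation.\<close>

lemma peiffer: "f \<in> H1 \<Longrightarrow> g \<in> H1 \<Longrightarrow> \<partial> f \<cdot> g = f \<cdot> \<partial> g"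
proof -
  assume fg: "f \<in> H1" "g \<in> H1"
  have "f \<cdot> g \<in> Hom C (-2) X X" using comp_Hom[OF fg] by simp
  hence "f \<cdot> g = 0" using Hom_trivial[of "-2" X X] by simp
  hence "\<partial> (f \<cdot> g) = 0" using linear_on_Hom(1)[OF diff_linear] by simp
  with diff_comp[OF fg] show ?thesis by simp
qed

lemmas bil = linear_onD(1)[OF comp_linear_left] linear_onD(1)[OF comp_linear_right]
  linear_on_Hom(3)[OF comp_linear_left] linear_on_Hom(3)[OF comp_linear_right]

lemma diff_rel: "\<partial> (rel a) = ltr a \<cdot> \<Lambda> - \<Lambda> \<cdot> ltr a"
  by (cases a) (simp_all add: d linear_on_Hom(1)[OF diff_linear])

lemma diff_add: "f \<in> H1 \<Longrightarrow> g \<in> H1 \<Longrightarrow> \<partial> (f + g) = \<partial> f + \<partial> g"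
  by (rule linear_onD(1)[OF diff_linear])

lemma diff_hom: "\<partial> (hom a k) = ltr a \<cdot> pw k - pw k \<cdot> ltr a"
proof (induction k)
  case 0
  then show ?case by (simp add: idm_left[OF ltr_Hom] idm_right[OF ltr_Hom] linear_on_Hom(1)[OF diff_linear])
next
  case (Suc k)
  note H = ltr_Hom[of a] pw_Hom[of k] Hom0(3)
  have "\<partial> (hom a (Suc k)) = (ltr a \<cdot> \<Lambda> - \<Lambda> \<cdot> ltr a) \<cdot> pw k + \<Lambda> \<cdot> (ltr a \<cdot> pw k - pw k \<cdot> ltr a)"
    by (simp add: diff_add comp_H rel_Hom hom_Hom H diff_comp_left diff_comp_right diff_rel Suc)
  also have "(ltr a \<cdot> \<Lambda> - \<Lambda> \<cdot> ltr a) \<cdot> pw k = ltr a \<cdot> \<Lambda> \<cdot> pw k - \<Lambda> \<cdot> ltr a \<cdot> pw k"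
    by (rule bil(3)) (rule H comp_H)+
  also have "\<Lambda> \<cdot> (ltr a \<cdot> pw k - pw k \<cdot> ltr a) = \<Lambda> \<cdot> (ltr a \<cdot> pw k) - \<Lambda> \<cdot> (pw k \<cdot> ltr a)"
    by (rule bil(4)) (rule H comp_H)+
  finally show ?case
    by (simp add: comp_assoc[OF H(1) H(3) H(2)] comp_assoc[OF H(3) H(1) H(2)] comp_assoc[OF H(3) H(2) H(1)])
qed

lemma diff_Sw: "\<partial> (Sw w) = evw w - pw (lams w) \<cdot> evw (flt w)"
proof (induction w)
  case Nil
  then show ?case by (simp add: lams_def flt_def linear_on_Hom(1)[OF diff_linear] idm_left[OF idm_Hom])
next
  case (Cons a w)
  define k F where "k = lams w" and "F = evw (flt w)"
  have F: "F \<in> H0" by (simp add: F_def evw_Hom)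
  note H = ltr_Hom[of a] pw_Hom[of k] F
  have "\<partial> (Sw (a # w)) = ltr a \<cdot> (evw w - pw k \<cdot> F) + (ltr a \<cdot> pw k - pw k \<cdot> ltr a) \<cdot> F"
  proof -
    have "Sw (a # w) = ltr a \<cdot> Sw w + hom a k \<cdot> F" by (simp add: k_def F_def)
    moreover have "\<partial> (Sw w) = evw w - pw k \<cdot> F" by (simp add: Cons k_def F_def)
    ultimately show ?thesis
      by (simp add: diff_add comp_H ltr_Hom Sw_Hom hom_Hom F diff_comp_left diff_comp_right diff_hom)
  qed
  also have "ltr a \<cdot> (evw w - pw k \<cdot> F) = ltr a \<cdot> evw w - ltr a \<cdot> (pw k \<cdot> F)"
    by (rule bil(4)) (rule H comp_H evw_Hom)+
  also have "(ltr a \<cdot> pw k - pw k \<cdot> ltr a) \<cdot> F = ltr a \<cdot> pw k \<cdot> F - pw k \<cdot> ltr a \<cdot> F"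
    by (rule bil(3)) (rule H comp_H)+
  finally have *: "\<partial> (Sw (a # w)) = evw (a # w) - pw k \<cdot> (ltr a \<cdot> F)"
    by (simp add: comp_assoc[OF H] comp_assoc[OF H(2) H(1) H(3)])
  show ?case
  proof (cases "a = Ll")
    case True
    have "pw k \<cdot> \<Lambda> = \<Lambda> \<cdot> pw k"
      using diff_hom[of Ll k] by (simp add: hom_Ll linear_on_Hom(1)[OF diff_linear])
    hence "pw k \<cdot> (\<Lambda> \<cdot> F) = \<Lambda> \<cdot> pw k \<cdot> F"
      by (simp add: comp_assoc[OF H(2) Hom0(3) F, symmetric])
    with * True show ?thesis by (simp add: lams_def flt_def k_def F_def)
  next
    case False
    with * show ?thesis by (simp add: lams_def flt_def k_def F_def)
  qed
qed

lemma Sw_move: "Sw (u @ a # Ll # v) - Sw (u @ Ll # a # v) = evw u \<cdot> rel a \<cdot> evw v"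
proof (cases "a = Ll")
  case True
  then show ?thesis by (simp add: comp_zero(2)[OF evw_Hom] comp_zero(1)[OF evw_Hom])
next
  case a: False
  show ?thesis
  proof (induction u)
    case Nil
    define k F where "k = lams v" and "F = evw (flt v)"
    have F: "F \<in> H0" by (simp add: F_def evw_Hom)
    have 1: "Sw (a # Ll # v) = ltr a \<cdot> (\<Lambda> \<cdot> Sw v) + (rel a \<cdot> pw k + \<Lambda> \<cdot> hom a k) \<cdot> F"
      by (simp add: hom_Ll comp_zero(1)[OF evw_Hom] k_def F_def lams_def flt_def)
    have 2: "Sw (Ll # a # v) = \<Lambda> \<cdot> (ltr a \<cdot> Sw v + hom a k \<cdot> F)"
      by (simp add: hom_Ll comp_zero(1)[OF evw_Hom] k_def F_def)
    have 3: "(rel a \<cdot> pw k + \<Lambda> \<cdot> hom a k) \<cdot> F = rel a \<cdot> pw k \<cdot> F + \<Lambda> \<cdot> hom a k \<cdot> F"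
      by (rule bil(1)) (rule F comp_H rel_Hom pw_Hom Hom0 hom_Hom)+
    have 4: "\<Lambda> \<cdot> (ltr a \<cdot> Sw v + hom a k \<cdot> F) = \<Lambda> \<cdot> (ltr a \<cdot> Sw v) + \<Lambda> \<cdot> (hom a k \<cdot> F)"
      by (rule bil(2)) (rule F comp_H ltr_Hom Sw_Hom Hom0 hom_Hom)+
    have 5: "\<partial> (rel a) \<cdot> Sw v = ltr a \<cdot> \<Lambda> \<cdot> Sw v - \<Lambda> \<cdot> ltr a \<cdot> Sw v"
      unfolding diff_rel by (rule bil(3)) (rule comp_H ltr_Hom Sw_Hom Hom0)+
    \<comment> \<open>The composite computed just before, now with the boundary moved to the second
      factor by the Peiffer identity. Comparing the two values gives the difference of the two
      orders of the letters.\<close>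
    have 6: "\<partial> (rel a) \<cdot> Sw v = rel a \<cdot> evw v - rel a \<cdot> (pw k \<cdot> F)"
      unfolding peiffer[OF rel_Hom Sw_Hom] diff_Sw k_def[symmetric] F_def[symmetric]
      by (rule bil(4)) (rule comp_H F evw_Hom pw_Hom rel_Hom)+
    have 7: "evw [] \<cdot> rel a = rel a" by (simp add: idm_left[OF rel_Hom])
    have 8: "ltr a \<cdot> \<Lambda> \<cdot> Sw v = ltr a \<cdot> (\<Lambda> \<cdot> Sw v)" "\<Lambda> \<cdot> ltr a \<cdot> Sw v = \<Lambda> \<cdot> (ltr a \<cdot> Sw v)"
      "\<Lambda> \<cdot> hom a k \<cdot> F = \<Lambda> \<cdot> (hom a k \<cdot> F)" "rel a \<cdot> pw k \<cdot> F = rel a \<cdot> (pw k \<cdot> F)"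
      by (rule comp_assoc; rule ltr_Hom Hom0 Sw_Hom hom_Hom F rel_Hom pw_Hom)+
    from 5 6 show ?case unfolding append_Nil 1 2 3 4 7 8 by (simp add: algebra_simps)
  next
    case (Cons b u)
    \<comment> \<open>Exchanging the two letters changes neither the number of \<Lambda> nor the
      filtered word, so the homotopy added for the new first letter is the same for both
      words.\<close>
    have eq: "lams (u @ a # Ll # v) = lams (u @ Ll # a # v)" "flt (u @ a # Ll # v) = flt (u @ Ll # a # v)"
      using a by (simp_all add: lams_def flt_def)
    have "Sw ((b # u) @ a # Ll # v) - Sw ((b # u) @ Ll # a # v) = ltr b \<cdot> Sw (u @ a # Ll # v) - ltr b \<cdot> Sw (u @ Ll # a # v)"
      by (simp add: eq)
    also have "\<dots> = ltr b \<cdot> (Sw (u @ a # Ll # v) - Sw (u @ Ll # a # v))"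
      by (rule bil(4)[symmetric]) (rule ltr_Hom Sw_Hom)+
    also have "\<dots> = ltr b \<cdot> (evw u \<cdot> rel a \<cdot> evw v)" unfolding Cons ..
    also have "\<dots> = ltr b \<cdot> evw u \<cdot> rel a \<cdot> evw v"
      by (simp add: comp_assoc[OF ltr_Hom evw_Hom rel_Hom] comp_assoc[OF ltr_Hom comp_H(2)[OF evw_Hom rel_Hom] evw_Hom])
    finally show ?case by simp
  qed
qed

sublocale evaluation C X evw Sw
  by unfold_locales (simp_all add: evw_append evw_Hom Sw_Hom)

lemma gev_nc_word: "fps_nth (gev T (nc_word u)) n = (if n = length u then T u else 0)" for T :: "letter list \<Rightarrow> 'm"
proof -
  have "(\<Sum>w\<in>words n. cs (coef (nc_word u) w) (T w)) = (\<Sum>w\<in>words n. if w = u then T u else 0)"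
    by (intro sum.cong refl) auto
  then show ?thesis by (simp add: gev_nth)
qed

lemma ev_letter: "ev (nc_word [a]) = hpow 1 (ltr a)"
  by (rule fps_ext) (simp add: gev_nc_word hpow_def idm_right[OF ltr_Hom])

lemma commutator_letter: "nc_word [a] * nc_word [Ll] - nc_word [Ll] * nc_word [a] = nc_word [a, Ll] - nc_word [Ll, a]"
  by (simp add: nc_word_mult)

text \<open>The generators of the good series: \<open>Sw_move\<close> evaluates the commutator alone
  and inside a longer word, and the two results agree.\<close>

lemma good_letter: "good (nc_word [a] * nc_word [Ll] - nc_word [Ll] * nc_word [a])"
  unfolding good_def commutator_letter
proof (intro allI)
  fix u v n
  have sum: "(\<Sum>w\<in>words n. cs (coef (nc_word [a, Ll] - nc_word [Ll, a]) w) (T w)) = (if n = 2 then T [a, Ll] - T [Ll, a] else 0)" for T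
    using gev_nc_word[of T "[a, Ll]" n] gev_nc_word[of T "[Ll, a]" n]
    by (simp add: gev_nth cs.scale_left_diff_distrib sum_subtractf)
  have "Sw (u @ [a, Ll] @ v) - Sw (u @ [Ll, a] @ v) = evw u \<cdot> rel a \<cdot> evw v"
    using Sw_move[of u a v] by simp
  moreover have "evw u \<cdot> Sw [a, Ll] \<cdot> evw v - evw u \<cdot> Sw [Ll, a] \<cdot> evw v = evw u \<cdot> rel a \<cdot> evw v"
  proof -
    have r: "Sw [a, Ll] - Sw [Ll, a] = rel a"
      using Sw_move[of "[]" a "[]"] by (simp only: append_Nil evw.simps idm_left[OF rel_Hom] idm_right[OF rel_Hom])
    have "evw u \<cdot> Sw [a, Ll] - evw u \<cdot> Sw [Ll, a] = evw u \<cdot> rel a"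
      unfolding r[symmetric] by (rule bil(4)[symmetric]) (rule evw_Hom Sw_Hom)+
    moreover have "evw u \<cdot> Sw [a, Ll] \<cdot> evw v - evw u \<cdot> Sw [Ll, a] \<cdot> evw v = (evw u \<cdot> Sw [a, Ll] - evw u \<cdot> Sw [Ll, a]) \<cdot> evw v"
      by (rule bil(3)[symmetric]) (rule comp_H evw_Hom Sw_Hom)+
    ultimately show ?thesis by simp
  qed
  ultimately show "(\<Sum>w\<in>words n. cs (coef (nc_word [a, Ll] - nc_word [Ll, a]) w) (Sw (u @ w @ v))) =
       (\<Sum>w\<in>words n. cs (coef (nc_word [a, Ll] - nc_word [Ll, a]) w) (evw u \<cdot> Sw w \<cdot> evw v))"
    unfolding sum by simp
qed

lemma se_letter: "se (nc_word [a] * nc_word [Ll] - nc_word [Ll] * nc_word [a]) = hpow 2 (rel a)"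
proof (rule fps_ext)
  fix n
  have "Sw [a, Ll] - Sw [Ll, a] = rel a"
    using Sw_move[of "[]" a "[]"] by (simp only: append_Nil evw.simps idm_left[OF rel_Hom] idm_right[OF rel_Hom])
  then show "fps_nth (se (nc_word [a] * nc_word [Ll] - nc_word [Ll] * nc_word [a])) n = fps_nth (hpow 2 (rel a)) n"
    unfolding commutator_letter gev_diff by (simp add: gev_nc_word hpow_def del: Sw.simps)
qed

end

section \<open>Permuting the objects\<close>

context cochain2
begin

definition iso :: "'m \<Rightarrow> 'm \<Rightarrow> 'o \<Rightarrow> 'o \<Rightarrow> bool" where
  "iso g g' A B \<longleftrightarrow> g \<in> Hom C 0 A B \<and> g' \<in> Hom C 0 B A \<and> g' \<cdot> g = idm C A \<and> g \<cdot> g' = idm C B"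

lemma isoD:
  assumes "iso g g' A B"
  shows "g \<in> Hom C 0 A B" "g' \<in> Hom C 0 B A" "g' \<cdot> g = idm C A" "g \<cdot> g' = idm C B"
  using assms by (simp_all add: iso_def)

lemma comp0: "g \<in> Hom C 0 V W \<Longrightarrow> f \<in> Hom C n U V \<Longrightarrow> g \<cdot> f \<in> Hom C n U W"
  and comp0': "g \<in> Hom C n V W \<Longrightarrow> f \<in> Hom C 0 U V \<Longrightarrow> g \<cdot> f \<in> Hom C n U W"
  using comp_Hom[of g 0 V W f n U] comp_Hom[of g n V W f 0 U] by simp_all

lemma iso_sym: "iso g g' A B \<Longrightarrow> iso g' g B A"
  by (simp add: iso_def)

lemma iso_cancel:
  assumes "iso g g' A B"
  shows "f \<in> Hom C n U A \<Longrightarrow> g' \<cdot> (g \<cdot> f) = f" "f \<in> Hom C n B U \<Longrightarrow> f \<cdot> g \<cdot> g' = f"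
  using isoD[OF assms] comp_assoc[of g' 0 B A g 0 A f n U] comp_assoc[of f n B U g 0 A g' 0 B]
  by (simp_all add: idm_left idm_right)

lemma iso_comp:
  assumes g: "iso g g' A B" and h: "iso h h' B D"
  shows "iso (h \<cdot> g) (g' \<cdot> h') A D"
proof -
  note G = isoD[OF g] and H = isoD[OF h]
  have 1: "g' \<cdot> h' \<cdot> (h \<cdot> g) = g' \<cdot> (h' \<cdot> (h \<cdot> g))" by (rule comp_assoc[OF G(2) H(2) comp0[OF H(1) G(1)]])
  have 2: "h \<cdot> g \<cdot> (g' \<cdot> h') = h \<cdot> (g \<cdot> (g' \<cdot> h'))" by (rule comp_assoc[OF H(1) G(1) comp0[OF G(2) H(2)]])
  show ?thesis
    unfolding iso_def 1 2 using G H iso_cancel(1)[OF h G(1)] iso_cancel(1)[OF iso_sym[OF g] H(2)]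
    by (simp add: comp0)
qed

lemma iso_middle:
  assumes g: "iso g g' Y Z" and h: "h \<in> Hom C 0 B D" and k: "k \<in> Hom C 0 V A"
    and M: "M \<in> Hom C m Y B" and N: "N \<in> Hom C n A Y"
  shows "h \<cdot> M \<cdot> g' \<cdot> (g \<cdot> N \<cdot> k) = h \<cdot> (M \<cdot> N) \<cdot> k"
proof -
  note G = isoD[OF g]
  note hM = comp0[OF h M] and Nk = comp0'[OF N k]
  have "h \<cdot> M \<cdot> g' \<cdot> (g \<cdot> N \<cdot> k) = h \<cdot> M \<cdot> (g' \<cdot> (g \<cdot> (N \<cdot> k)))"
    using comp_assoc[OF hM G(2) comp0[OF G(1) Nk]] comp_assoc[OF G(1) N k] by simp
  also have "\<dots> = h \<cdot> M \<cdot> (N \<cdot> k)" by (simp add: iso_cancel(1)[OF g Nk])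
  also have "\<dots> = h \<cdot> (M \<cdot> N) \<cdot> k"
    using comp_assoc[OF hM N k] comp_assoc[OF h M N] by simp
  finally show ?thesis .
qed

definition cj :: "'m \<Rightarrow> ('a list \<Rightarrow> 'm) \<Rightarrow> 'm \<Rightarrow> 'a list \<Rightarrow> 'm" where
  "cj g T h w = g \<cdot> T w \<cdot> h"

lemma gev_cj_nth:
  fixes T :: "'a::finite list \<Rightarrow> 'm"
  assumes "g \<in> Hom C 0 B D" "\<And>w. T w \<in> Hom C n A B" "h \<in> Hom C 0 U A"
  shows "fps_nth (gev (cj g T h) f) m = g \<cdot> fps_nth (gev T f) m \<cdot> h"
proof -
  have gT: "g \<cdot> T w \<in> Hom C n A D" for w by (rule comp0[OF assms(1,2)])
  have "g \<cdot> (\<Sum>w\<in>words m. cs (coef f w) (T w)) = (\<Sum>w\<in>words m. cs (coef f w) (g \<cdot> T w))"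
    using comp_sum_sum[of "{()}" "\<lambda>_. g" 0 B D "words m" T n A "\<lambda>_. 1" "coef f"] by (simp add: assms)
  moreover have "(\<Sum>w\<in>words m. cs (coef f w) (g \<cdot> T w)) \<cdot> h = (\<Sum>w\<in>words m. cs (coef f w) (g \<cdot> T w \<cdot> h))"
    using comp_sum_sum[of "words m" "\<lambda>w. g \<cdot> T w" n A D "{()}" "\<lambda>_. h" 0 U "coef f" "\<lambda>_. 1"] by (simp add: assms gT)
  ultimately show ?thesis by (simp add: gev_nth cj_def)
qed

lemma gev_cj_hpow:
  fixes T :: "'a::finite list \<Rightarrow> 'm"
  assumes "g \<in> Hom C 0 B D" "\<And>w. T w \<in> Hom C n A B" "h \<in> Hom C 0 U A" "gev T f = hpow k x"
  shows "gev (cj g T h) f = hpow k (g \<cdot> x \<cdot> h)"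
  by (rule fps_ext) (simp add: gev_cj_nth[OF assms(1-3)] assms(4) hpow_def comp_zero(2)[OF assms(1)] comp_zero(1)[OF assms(3)])

end

context evaluation
begin

text \<open>Conjugation moves an evaluation to a permuted object while keeping its variables, so
  terms at different orders of the objects can be compared as series in the same letters.\<close>

lemma evaluation_conj:
  assumes g: "iso g g' X Y"
  shows "evaluation C Y (cj g E g') (cj g S g')"
proof
  note G = isoD[OF g]
  show "cj g E g' [] = idm C Y" by (simp add: cj_def E_Nil idm_right[OF G(1)] G(4))
  show "cj g E g' (u @ v) = cj g E g' u \<cdot> cj g E g' v" for u v
    unfolding cj_def E_append by (rule iso_middle[OF g G(1,2) E_Hom E_Hom, symmetric])
  show "cj g E g' w \<in> Hom C 0 Y Y" "cj g S g' w \<in> Hom C (-1) Y Y" for w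
    unfolding cj_def by (rule comp0'[OF comp0[OF G(1) E_Hom] G(2)] comp0'[OF comp0[OF G(1) S_Hom] G(2)])+
qed

lemma good_conj:
  assumes g: "iso g g' X Y" and f: "good f"
  shows "evaluation.good C (cj g E g') (cj g S g') f"
  unfolding evaluation.good_def[OF evaluation_conj[OF g]]
proof (intro allI)
  fix u v n
  note G = isoD[OF g]
  have ES: "E u \<cdot> S w \<in> Hom C (-1) X X" for w by (rule comp0[OF E_Hom S_Hom])
  have ESE: "E u \<cdot> S w \<cdot> E v \<in> Hom C (-1) X X" for w by (rule comp0'[OF ES E_Hom])
  have sum: "(\<Sum>w\<in>words n. cs (coef f w) (g \<cdot> T w \<cdot> g')) = g \<cdot> (\<Sum>w\<in>words n. cs (coef f w) (T w)) \<cdot> g'"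
    if "\<And>w. T w \<in> Hom C (-1) X X" for T
    using gev_cj_nth[OF G(1) that G(2), where f = f and m = n] by (simp add: gev_nth cj_def)
  have "cj g E g' u \<cdot> cj g S g' w \<cdot> cj g E g' v = g \<cdot> (E u \<cdot> S w \<cdot> E v) \<cdot> g'" for w
    unfolding cj_def iso_middle[OF g G(1,2) E_Hom S_Hom] by (rule iso_middle[OF g G(1,2) ES E_Hom])
  then show "(\<Sum>w\<in>words n. cs (coef f w) (cj g S g' (u @ w @ v))) =
      (\<Sum>w\<in>words n. cs (coef f w) (cj g E g' u \<cdot> cj g S g' w \<cdot> cj g E g' v))"
    using f[unfolded good_def, rule_format, of u v n] by (simp add: sum[OF ESE] sum[OF S_Hom] cj_def[of g S])
qed

end

lemma
  fixes x y :: "'m::ab_group_add"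
  shows hpow_add: "hpow n x + hpow n y = hpow n (x + y)"
  and hpow_diff: "hpow n x - hpow n y = hpow n (x - y)"
  and hpow_minus: "- hpow n x = hpow n (- x)"
  by (rule fps_ext, simp add: hpow_def)+

section \<open>Action of the transpositions of the three objects\<close>

locale braided = cochain2 C for C :: "('r::comm_ring_1, 'o, 'm::ab_group_add) smc2cat" (structure) +
  fixes t :: "('o, 'm) trans2"
  assumes monoidal: "symmetric_strict_monoidal C"
    and braiding: "infinitesimal_2braiding C t"
    and strict_t: "strict C t" and total_t: "totally_symmetric C t" and coherent_t: "coherent C t"
begin

lemmas mon_1 = monoidal[unfolded symmetric_strict_monoidal_def, THEN conjunct2]
lemmas mon_2 = mon_1[THEN conjunct2]
lemmas mon_3 = mon_2[THEN conjunct2]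
lemmas mon_4 = mon_3[THEN conjunct2]
lemmas mon_5 = mon_4[THEN conjunct2]
lemmas mon_6 = mon_5[THEN conjunct2]
lemmas mon_7 = mon_6[THEN conjunct2]
lemmas mon_8 = mon_7[THEN conjunct2]
lemmas mon_9 = mon_8[THEN conjunct2]
lemmas mon_10 = mon_9[THEN conjunct2]
lemmas mon_11 = mon_10[THEN conjunct2]

lemmas ob_assoc = mon_1[THEN conjunct1, rule_format]
lemmas tens_bilinear = mon_3[THEN conjunct1, rule_format]
lemmas tens_Hom = mon_4[THEN conjunct1, rule_format, THEN conjunct1]
lemmas tens_id = mon_5[THEN conjunct1, rule_format]
lemmas interchange = mon_6[THEN conjunct1, rule_format]
lemmas gamma_Hom = mon_9[THEN conjunct1, rule_format]
lemmas gamma_nat = mon_10[THEN conjunct1, rule_format]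
lemmas gamma_gamma = mon_11[THEN conjunct1, rule_format]
lemmas hexagon = mon_11[THEN conjunct2, rule_format]

lemmas br_1 = braiding[unfolded infinitesimal_2braiding_def]
lemmas br_2 = br_1[THEN conjunct2]
lemmas br_3 = br_2[THEN conjunct2]
lemmas br_4 = br_3[THEN conjunct2]
lemmas br_5 = br_4[THEN conjunct2]
lemmas br_6 = br_5[THEN conjunct2]

lemmas t_Hom = br_1[THEN conjunct1, rule_format]
lemmas hty_bilinear = br_2[THEN conjunct1, rule_format]
lemmas hty_Hom = br_3[THEN conjunct1, rule_format, THEN conjunct1]
lemmas hty_diff = br_3[THEN conjunct1, rule_format, THEN conjunct2]
lemmas hty_comp = br_6[rule_format]

lemma tens0: "f \<in> Hom C 0 U U' \<Longrightarrow> g \<in> Hom C 0 V V' \<Longrightarrow> f \<boxtimes> g \<in> Hom C 0 (U \<otimes> V) (U' \<otimes> V')"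
  using tens_Hom[of f 0 U U' g 0 V V'] by simp

lemma tens_left: "f \<in> Hom C 0 U U' \<Longrightarrow> f \<boxtimes> idm C W \<in> Hom C 0 (U \<otimes> W) (U' \<otimes> W)"
  and tens_right: "f \<in> Hom C 0 U U' \<Longrightarrow> idm C W \<boxtimes> f \<in> Hom C 0 (W \<otimes> U) (W \<otimes> U')"
  by (rule tens0; (assumption | rule idm_Hom))+

lemma tens_comp_left: "f \<in> Hom C m U V \<Longrightarrow> g \<in> Hom C n V V' \<Longrightarrow> (g \<cdot> f) \<boxtimes> idm C W = (g \<boxtimes> idm C W) \<cdot> (f \<boxtimes> idm C W)"
  and tens_comp_right: "f \<in> Hom C m U V \<Longrightarrow> g \<in> Hom C n V V' \<Longrightarrow> idm C W \<boxtimes> (g \<cdot> f) = (idm C W \<boxtimes> g) \<cdot> (idm C W \<boxtimes> f)"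
  using interchange[of f m U V "idm C W" 0 W W g n V' "idm C W" 0 W] interchange[of "idm C W" 0 W W f m U V "idm C W" 0 W g n V']
  by (simp_all add: idm_Hom idm_left[OF idm_Hom])

lemma iso_gamma: "iso (\<gamma> U V) (\<gamma> V U) (U \<otimes> V) (V \<otimes> U)"
  by (simp add: iso_def gamma_Hom gamma_gamma)

lemma iso_tens_left: "iso g g' A B \<Longrightarrow> iso (g \<boxtimes> idm C W) (g' \<boxtimes> idm C W) (A \<otimes> W) (B \<otimes> W)"
  and iso_tens_right: "iso g g' A B \<Longrightarrow> iso (idm C W \<boxtimes> g) (idm C W \<boxtimes> g') (W \<otimes> A) (W \<otimes> B)"
proof -
  assume "iso g g' A B"
  note G = isoD[OF this]
  show "iso (g \<boxtimes> idm C W) (g' \<boxtimes> idm C W) (A \<otimes> W) (B \<otimes> W)"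
    unfolding iso_def tens_comp_left[OF G(1) G(2), symmetric] tens_comp_left[OF G(2) G(1), symmetric] G(3,4) tens_id
    by (simp add: tens_left G(1,2))
  show "iso (idm C W \<boxtimes> g) (idm C W \<boxtimes> g') (W \<otimes> A) (W \<otimes> B)"
    unfolding iso_def tens_comp_right[OF G(1) G(2), symmetric] tens_comp_right[OF G(2) G(1), symmetric] G(3,4) tens_id
    by (simp add: tens_right G(1,2))
qed

lemma iso_12: "iso (\<gamma> U V \<boxtimes> idm C W) (\<gamma> V U \<boxtimes> idm C W) (U \<otimes> V \<otimes> W) (V \<otimes> U \<otimes> W)"
  using iso_tens_left[OF iso_gamma[of U V], of W] by (simp only: ob_assoc)

lemma iso_23: "iso (idm C U \<boxtimes> \<gamma> V W) (idm C U \<boxtimes> \<gamma> W V) (U \<otimes> V \<otimes> W) (U \<otimes> W \<otimes> V)"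
  by (rule iso_tens_right[OF iso_gamma])

lemma t12_Hom: "cmp (t12 C t) (U, V, W) \<in> Hom C 0 (U \<otimes> V \<otimes> W) (U \<otimes> V \<otimes> W)"
  and t23_Hom: "cmp (t23 C t) (U, V, W) \<in> Hom C 0 (U \<otimes> V \<otimes> W) (U \<otimes> V \<otimes> W)"
  using tens_left[OF t_Hom[of U V], of W] tens_right[OF t_Hom[of V W], of U] by (simp_all add: t12_def t23_def ob_assoc)

lemma t13_eq: "cmp (t13 C t) (U, V, W) = (\<gamma> V U \<boxtimes> idm C W) \<cdot> cmp (t23 C t) (V, U, W) \<cdot> (\<gamma> U V \<boxtimes> idm C W)"
  by (simp add: t13_def t23_def)

lemma t13_Hom: "cmp (t13 C t) (U, V, W) \<in> Hom C 0 (U \<otimes> V \<otimes> W) (U \<otimes> V \<otimes> W)"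
  unfolding t13_eq by (rule comp0'[OF comp0[OF isoD(2)[OF iso_12] t23_Hom] isoD(1)[OF iso_12]])

lemma conj_flip:
  assumes g: "iso g g' A B" and M: "M \<in> Hom C n B B"
  shows "g \<cdot> (g' \<cdot> M \<cdot> g) \<cdot> g' = M"
proof -
  note G = isoD[OF g]
  have "g \<cdot> (g' \<cdot> M \<cdot> g) = M \<cdot> g"
    using comp_assoc[OF G(2) M G(1)] iso_cancel(1)[OF iso_sym[OF g] comp0'[OF M G(1)]] by simp
  then show ?thesis using iso_cancel(2)[OF g M] by simp
qed

lemmas sym_t = total_t[unfolded totally_symmetric_def symmetric_def trans2_eq_def, THEN conjunct1]

lemma t_swap: "cmp t (V, U) = \<gamma> U V \<cdot> cmp t (U, V) \<cdot> \<gamma> V U"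
  using sym_t[THEN conjunct1, rule_format, of V U] unfolding swapped_def by simp

lemma hty_swap: "f \<in> Hom C 0 U U' \<Longrightarrow> g \<in> Hom C 0 V V' \<Longrightarrow>
    hty t (U, V) (U', V') (f, g) = \<gamma> V' U' \<cdot> hty t (V, U) (V', U') (g, f) \<cdot> \<gamma> U V"
  using sym_t[THEN conjunct2, rule_format, of f U U' g V V'] unfolding swapped_def by simp

lemma hty_gamma_left: "hty t (U \<otimes> V, W) (V \<otimes> U, W) (\<gamma> U V, idm C W) = 0"
  using total_t[unfolded totally_symmetric_def, THEN conjunct2, rule_format] .

text \<open>Total symmetry gives the vanishing in the first argument, and symmetry of
  \<open>t\<close> carries it to the second.\<close>

lemma hty_gamma_right: "hty t (U, V \<otimes> W) (U, W \<otimes> V) (idm C U, \<gamma> V W) = 0"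
  using hty_swap[OF idm_Hom[of U] gamma_Hom[of V W]] hty_gamma_left[of V W U]
  by (simp add: comp_zero(2)[OF gamma_Hom] comp_zero(1)[OF gamma_Hom])

lemma t12_swap12: "cmp (t12 C t) (V, U, W) = (\<gamma> U V \<boxtimes> idm C W) \<cdot> cmp (t12 C t) (U, V, W) \<cdot> (\<gamma> V U \<boxtimes> idm C W)"
  unfolding t12_def by (simp add: t_swap[of V U] tens_comp_left[OF gamma_Hom comp0[OF gamma_Hom t_Hom]] tens_comp_left[OF t_Hom gamma_Hom])

lemma t23_swap12: "cmp (t23 C t) (V, U, W) = (\<gamma> U V \<boxtimes> idm C W) \<cdot> cmp (t13 C t) (U, V, W) \<cdot> (\<gamma> V U \<boxtimes> idm C W)"
  unfolding t13_eq by (rule conj_flip[OF iso_12 t23_Hom, symmetric])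

lemma t23_swap23: "cmp (t23 C t) (U, W, V) = (idm C U \<boxtimes> \<gamma> V W) \<cdot> cmp (t23 C t) (U, V, W) \<cdot> (idm C U \<boxtimes> \<gamma> W V)"
  unfolding t23_def by (simp add: t_swap[of W V] tens_comp_right[OF gamma_Hom comp0[OF gamma_Hom t_Hom]] tens_comp_right[OF t_Hom gamma_Hom])

text \<open>By the hexagon, two adjacent transpositions compose to the symmetry moving
  \<open>V\<close> past \<open>U \<otimes> W\<close>; its naturality carries \<open>t\<close> on the
  last two factors to \<open>t\<close> on the first two.\<close>

lemma t12_swap23: "cmp (t12 C t) (U, W, V) = (idm C U \<boxtimes> \<gamma> V W) \<cdot> cmp (t13 C t) (U, V, W) \<cdot> (idm C U \<boxtimes> \<gamma> W V)"
proof -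
  note h = iso_12[of U V W] and k = iso_23[of U V W]
  note H = isoD[OF h] and K = isoD[OF k]
  define T where "T = idm C V \<boxtimes> cmp t (U, W)"
  have T: "T \<in> Hom C 0 (V \<otimes> U \<otimes> W) (V \<otimes> U \<otimes> W)" unfolding T_def by (rule tens_right[OF t_Hom])
  have T': "cmp (t12 C t) (U, W, V) \<in> Hom C 0 (U \<otimes> W \<otimes> V) (U \<otimes> W \<otimes> V)" by (rule t12_Hom)
  have kh: "(idm C U \<boxtimes> \<gamma> V W) \<cdot> (\<gamma> V U \<boxtimes> idm C W) = \<gamma> V (U \<otimes> W)"
    by (rule hexagon[symmetric])
  have nat: "\<gamma> V (U \<otimes> W) \<cdot> T = cmp (t12 C t) (U, W, V) \<cdot> \<gamma> V (U \<otimes> W)"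
    unfolding T_def t12_def by (simp add: gamma_nat[OF idm_Hom t_Hom])
  have kh_iso: "iso ((idm C U \<boxtimes> \<gamma> V W) \<cdot> (\<gamma> V U \<boxtimes> idm C W)) ((\<gamma> U V \<boxtimes> idm C W) \<cdot> (idm C U \<boxtimes> \<gamma> W V)) (V \<otimes> U \<otimes> W) (U \<otimes> W \<otimes> V)"
    by (rule iso_comp[OF iso_sym[OF h] k])
  have "(idm C U \<boxtimes> \<gamma> V W) \<cdot> cmp (t13 C t) (U, V, W) = (idm C U \<boxtimes> \<gamma> V W) \<cdot> (\<gamma> V U \<boxtimes> idm C W) \<cdot> T \<cdot> (\<gamma> U V \<boxtimes> idm C W)"
    unfolding t13_def T_def[symmetric]
    by (simp add: T_def[symmetric] comp_assoc[OF K(1) H(2) T] comp_assoc[OF K(1) comp0[OF H(2) T] H(1)])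
  hence "(idm C U \<boxtimes> \<gamma> V W) \<cdot> cmp (t13 C t) (U, V, W) \<cdot> (idm C U \<boxtimes> \<gamma> W V)
     = (idm C U \<boxtimes> \<gamma> V W) \<cdot> (\<gamma> V U \<boxtimes> idm C W) \<cdot> T \<cdot> ((\<gamma> U V \<boxtimes> idm C W) \<cdot> (idm C U \<boxtimes> \<gamma> W V))"
    by (simp add: comp_assoc[OF comp0[OF comp0[OF K(1) H(2)] T] H(1) K(2)])
  also have "\<dots> = cmp (t12 C t) (U, W, V) \<cdot> ((idm C U \<boxtimes> \<gamma> V W) \<cdot> (\<gamma> V U \<boxtimes> idm C W)) \<cdot> ((\<gamma> U V \<boxtimes> idm C W) \<cdot> (idm C U \<boxtimes> \<gamma> W V))"
    unfolding kh nat ..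
  also have "\<dots> = cmp (t12 C t) (U, W, V)"
    by (rule iso_cancel(2)[OF kh_iso T'])
  finally show ?thesis ..
qed

lemma t13_swap12: "cmp (t13 C t) (V, U, W) = (\<gamma> U V \<boxtimes> idm C W) \<cdot> cmp (t23 C t) (U, V, W) \<cdot> (\<gamma> V U \<boxtimes> idm C W)"
  by (rule t13_eq)

lemma t13_swap23: "cmp (t13 C t) (U, W, V) = (idm C U \<boxtimes> \<gamma> V W) \<cdot> cmp (t12 C t) (U, V, W) \<cdot> (idm C U \<boxtimes> \<gamma> W V)"
  unfolding t12_swap23[of U V W] by (rule conj_flip[OF iso_23 t13_Hom, symmetric])

lemma relL_Hom: "relL C t U V W \<in> Hom C (-1) (U \<otimes> V \<otimes> W) (U \<otimes> V \<otimes> W)"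
  and relR_Hom: "relR C t U V W \<in> Hom C (-1) (U \<otimes> V \<otimes> W) (U \<otimes> V \<otimes> W)"
  using hty_Hom[OF t_Hom[of U V] idm_Hom[of W]] hty_Hom[OF idm_Hom[of U] t_Hom[of V W]] by (simp_all add: relL_def relR_def ob_assoc)

text \<open>The homotopy component at the symmetry vanishes, so the composition rule loses one of
  its two terms.\<close>

lemma hty_pre: "f \<in> Hom C 0 (V \<otimes> U) A \<Longrightarrow> hty t (U \<otimes> V, W) (A, W) (f \<cdot> \<gamma> U V, idm C W) = hty t (V \<otimes> U, W) (A, W) (f, idm C W) \<cdot> (\<gamma> U V \<boxtimes> idm C W)"
  using hty_comp[OF gamma_Hom[of U V] idm_Hom[of W] _ idm_Hom[of W], of f A]
  by (simp add: idm_left[OF idm_Hom] hty_gamma_left comp_zero(2)[OF tens_left])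

lemma hty_post: "f \<in> Hom C 0 A (V \<otimes> U) \<Longrightarrow> hty t (A, W) (U \<otimes> V, W) (\<gamma> V U \<cdot> f, idm C W) = (\<gamma> V U \<boxtimes> idm C W) \<cdot> hty t (A, W) (V \<otimes> U, W) (f, idm C W)"
  using hty_comp[OF _ idm_Hom[of W] gamma_Hom[of V U] idm_Hom[of W], of f A]
  by (simp add: idm_left[OF idm_Hom] hty_gamma_left comp_zero(1)[OF tens_left])

lemma hty_post_right: "f \<in> Hom C 0 A (V \<otimes> W) \<Longrightarrow> hty t (U, A) (U, W \<otimes> V) (idm C U, \<gamma> V W \<cdot> f) = (idm C U \<boxtimes> \<gamma> V W) \<cdot> hty t (U, A) (U, V \<otimes> W) (idm C U, f)"
  using hty_comp[OF idm_Hom[of U] _ idm_Hom[of U] gamma_Hom[of V W], of f A]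
  by (simp add: idm_left[OF idm_Hom] hty_gamma_right comp_zero(1)[OF tens_right])

lemma hty_pre_right: "f \<in> Hom C 0 (W \<otimes> V) A \<Longrightarrow> hty t (U, V \<otimes> W) (U, A) (idm C U, f \<cdot> \<gamma> V W) = hty t (U, W \<otimes> V) (U, A) (idm C U, f) \<cdot> (idm C U \<boxtimes> \<gamma> V W)"
  using hty_comp[OF idm_Hom[of U] gamma_Hom[of V W] idm_Hom[of U], of f A]
  by (simp add: idm_left[OF idm_Hom] hty_gamma_right comp_zero(2)[OF tens_right])

lemma relL_swap12: "relL C t V U W = (\<gamma> U V \<boxtimes> idm C W) \<cdot> relL C t U V W \<cdot> (\<gamma> V U \<boxtimes> idm C W)"
  unfolding relL_def t_swap[of V U]
  by (simp add: hty_pre[OF comp0[OF gamma_Hom t_Hom]] hty_post[OF t_Hom])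

lemma relR_swap23: "relR C t U W V = (idm C U \<boxtimes> \<gamma> V W) \<cdot> relR C t U V W \<cdot> (idm C U \<boxtimes> \<gamma> W V)"
  unfolding relR_def t_swap[of W V]
  by (simp add: hty_pre_right[OF comp0[OF gamma_Hom t_Hom]] hty_post_right[OF t_Hom])

lemma conj_minus:
  assumes g: "iso g g' A B" and M: "M \<in> Hom C n A A" and N: "N \<in> Hom C n B B" and eq: "- (g' \<cdot> N \<cdot> g) = M"
  shows "N = - (g \<cdot> M \<cdot> g')"
proof -
  note G = isoD[OF g]
  have N': "g' \<cdot> N \<cdot> g \<in> Hom C n A A" by (rule comp0'[OF comp0[OF G(2) N] G(1)])
  have "g \<cdot> M = - (g \<cdot> (g' \<cdot> N \<cdot> g))"
    unfolding eq[symmetric] by (rule linear_on_Hom(2)[OF comp_linear_right[OF G(1)] N'])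
  hence "g \<cdot> M \<cdot> g' = - (g \<cdot> (g' \<cdot> N \<cdot> g) \<cdot> g')"
    using linear_on_Hom(2)[OF comp_linear_left[OF G(2)] comp0[OF G(1) N']] by simp
  then show ?thesis by (simp add: conj_flip[OF g N])
qed

text \<open>Coherence, solved for the relationator at the permuted objects by undoing the
  conjugation.\<close>

lemma relR_swap12: "relR C t V U W = - ((\<gamma> U V \<boxtimes> idm C W) \<cdot> (relL C t U V W + relR C t U V W) \<cdot> (\<gamma> V U \<boxtimes> idm C W))"
  using coherent_t unfolding coherent_def
  by (intro conj_minus[OF iso_12 Hom_closed(2)[OF relL_Hom relR_Hom] relR_Hom]) simp

lemma relL_swap23: "relL C t U W V = - ((idm C U \<boxtimes> \<gamma> V W) \<cdot> (relL C t U V W + relR C t U V W) \<cdot> (idm C U \<boxtimes> \<gamma> W V))"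
  using coherent_t unfolding coherent_def
  by (intro conj_minus[OF iso_23 Hom_closed(2)[OF relL_Hom relR_Hom] relL_Hom]) simp

lemma strict_eqs:
  "cmp (t1_23 C t) (U, V, W) = cmp (t12 C t) (U, V, W) + cmp (t13 C t) (U, V, W)"
  "cmp (t12_3 C t) (U, V, W) = cmp (t23 C t) (U, V, W) + cmp (t13 C t) (U, V, W)"
  using strict_t by (simp_all add: strict_def trans3_eq_def trans_add_def)

lemma s12_3_eq: "s12_3 C t U V W = s23 C t U V W + s13 C t U V W"
  by (simp add: s12_3_def s23_def s13_def strict_eqs hpow_add)

lemma sLam_eq: "sLam C t U V W = hpow 1 (cmp (t12 C t) (U, V, W) + cmp (t23 C t) (U, V, W) + cmp (t13 C t) (U, V, W))"
  by (simp add: sLam_def s12_def s23_def s13_def hpow_add)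

lemma conj_add3:
  assumes "iso g g' A B" "M \<in> Hom C n A A" "N \<in> Hom C n A A" "K \<in> Hom C n A A"
  shows "g \<cdot> (M + N) \<cdot> g' = g \<cdot> M \<cdot> g' + g \<cdot> N \<cdot> g'" "g \<cdot> (M + N + K) \<cdot> g' = g \<cdot> M \<cdot> g' + g \<cdot> N \<cdot> g' + g \<cdot> K \<cdot> g'"
proof -
  note G = isoD[OF assms(1)]
  have *: "g \<cdot> (M + N) \<cdot> g' = g \<cdot> M \<cdot> g' + g \<cdot> N \<cdot> g'" if "M \<in> Hom C n A A" "N \<in> Hom C n A A" for M N
    using linear_onD(1)[OF comp_linear_right[OF G(1)] that]
      linear_onD(1)[OF comp_linear_left[OF G(2)] comp0[OF G(1) that(1)] comp0[OF G(1) that(2)]] by simp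
  show "g \<cdot> (M + N) \<cdot> g' = g \<cdot> M \<cdot> g' + g \<cdot> N \<cdot> g'" "g \<cdot> (M + N + K) \<cdot> g' = g \<cdot> M \<cdot> g' + g \<cdot> N \<cdot> g' + g \<cdot> K \<cdot> g'"
    using *[OF assms(2,3)] *[OF Hom_closed(2)[OF assms(2,3)] assms(4)] by simp_all
qed

text \<open>The relationators bound commutators with \<open>t12_3\<close> and \<open>t1_23\<close>.
  By strictness these are \<Lambda> minus \<open>t12\<close> and \<Lambda> minus \<open>t23\<close>,
  and subtracting a morphism from \<Lambda> does not change its commutator with \<Lambda>.\<close>

lemma word_eval_base:
  "word_eval C (U \<otimes> V \<otimes> W) (cmp (t12 C t) (U, V, W)) (cmp (t23 C t) (U, V, W))
     (cmp (t12 C t) (U, V, W) + cmp (t23 C t) (U, V, W) + cmp (t13 C t) (U, V, W)) (relL C t U V W) (relR C t U V W)"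
proof
  note H = t12_Hom[of U V W] t23_Hom[of U V W] t13_Hom[of U V W]
  let ?x = "cmp (t12 C t) (U, V, W)" and ?y = "cmp (t23 C t) (U, V, W)" and ?z = "cmp (t13 C t) (U, V, W)"
  show "?x \<in> Hom C 0 (U \<otimes> V \<otimes> W) (U \<otimes> V \<otimes> W)" "?y \<in> Hom C 0 (U \<otimes> V \<otimes> W) (U \<otimes> V \<otimes> W)"
    "?x + ?y + ?z \<in> Hom C 0 (U \<otimes> V \<otimes> W) (U \<otimes> V \<otimes> W)"
    by (rule H Hom_closed(2))+
  show "relL C t U V W \<in> Hom C (-1) (U \<otimes> V \<otimes> W) (U \<otimes> V \<otimes> W)" "relR C t U V W \<in> Hom C (-1) (U \<otimes> V \<otimes> W) (U \<otimes> V \<otimes> W)"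
    by (rule relL_Hom relR_Hom)+
  have add: "a \<cdot> (b + c) = a \<cdot> b + a \<cdot> c" "(b + c) \<cdot> a = b \<cdot> a + c \<cdot> a"
    if "a \<in> Hom C 0 (U \<otimes> V \<otimes> W) (U \<otimes> V \<otimes> W)" "b \<in> Hom C 0 (U \<otimes> V \<otimes> W) (U \<otimes> V \<otimes> W)" "c \<in> Hom C 0 (U \<otimes> V \<otimes> W) (U \<otimes> V \<otimes> W)" for a b c
    using linear_onD(1)[OF comp_linear_right[OF that(1)] that(2,3)] linear_onD(1)[OF comp_linear_left[OF that(1)] that(2,3)] by simp_all
  have "\<partial> (relL C t U V W) = ?x \<cdot> (?y + ?z) - (?y + ?z) \<cdot> ?x"
    using hty_diff[OF t_Hom[of U V] idm_Hom[of W]] strict_eqs(2)[of U V W] by (simp add: relL_def t12_def t12_3_def)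
  then show "\<partial> (relL C t U V W) = ?x \<cdot> (?x + ?y + ?z) - (?x + ?y + ?z) \<cdot> ?x"
    by (simp add: add H Hom_closed(2))
  have "\<partial> (relR C t U V W) = ?y \<cdot> (?x + ?z) - (?x + ?z) \<cdot> ?y"
    using hty_diff[OF idm_Hom[of U] t_Hom[of V W]] strict_eqs(1)[of U V W] by (simp add: relR_def t23_def t1_23_def)
  then show "\<partial> (relR C t U V W) = ?y \<cdot> (?x + ?y + ?z) - (?x + ?y + ?z) \<cdot> ?y"
    by (simp add: add H Hom_closed(2))
qed

lemma hexagon_data_base:
  obtains E S :: "letter list \<Rightarrow> 'm" and p q l where "hexagon_data C (U \<otimes> V \<otimes> W) E S t U V W p q l"
proof -
  interpret word_eval C "U \<otimes> V \<otimes> W" "cmp (t12 C t) (U, V, W)" "cmp (t23 C t) (U, V, W)"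
     "cmp (t12 C t) (U, V, W) + cmp (t23 C t) (U, V, W) + cmp (t13 C t) (U, V, W)" "relL C t U V W" "relR C t U V W"
    by (rule word_eval_base)
  have "hexagon_data C (U \<otimes> V \<otimes> W) evw Sw t U V W (nc_word [Lx]) (nc_word [Ly]) (nc_word [Ll])"
    by unfold_locales (simp_all add: linear_nc_word ev_letter s12_def s23_def sLam_eq s12_3_eq good_letter se_letter sL_def sR_def)
  then show ?thesis by (rule that)
qed

lemma hexagon_data_conj:
  assumes "hexagon_data C X E S t U V W p q l" and g: "iso g g' X X'" and X': "X' = U' \<otimes> V' \<otimes> W'"
    and lin': "linear_ncs p'" "linear_ncs q'"
    and p': "gev E p' = hpow 1 x" "cmp (t12 C t) (U', V', W') = g \<cdot> x \<cdot> g'"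
    and q': "gev E q' = hpow 1 y" "cmp (t23 C t) (U', V', W') = g \<cdot> y \<cdot> g'"
    and l': "gev E l = hpow 1 z" "cmp (t12 C t) (U', V', W') + cmp (t23 C t) (U', V', W') + cmp (t13 C t) (U', V', W') = g \<cdot> z \<cdot> g'"
    and L: "gev S (p' * l - l * p') = hpow 2 ll" "relL C t U' V' W' = g \<cdot> ll \<cdot> g'" "evaluation.good C E S (p' * l - l * p')"
    and R: "gev S (q' * l - l * q') = hpow 2 rr" "relR C t U' V' W' = g \<cdot> rr \<cdot> g'" "evaluation.good C E S (q' * l - l * q')"
  shows "hexagon_data C X' (cj g E g') (cj g S g') t U' V' W' p' q' l"
proof -
  interpret hexagon_data C X E S t U V W p q l by (rule assms)
  note G = isoD[OF g]
  note E = gev_cj_hpow[OF G(1) E_Hom G(2)] and S = gev_cj_hpow[OF G(1) S_Hom G(2)]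
  interpret conj: evaluation C X' "cj g E g'" "cj g S g'" by (rule evaluation_conj[OF g])
  show ?thesis
    by unfold_locales (simp_all add: X' lin' hexagon_data.lin[OF assms(1)] E[OF p'(1)] E[OF q'(1)] E[OF l'(1)] S[OF L(1)] S[OF R(1)]
        s12_def s23_def sLam_eq p'(2)[symmetric] q'(2)[symmetric] l'(2)[symmetric] L(2)[symmetric] R(2)[symmetric] sL_def sR_def
        s12_3_eq good_conj[OF g L(3)] good_conj[OF g R(3)] flip: X')
qed

text \<open>An adjacent transposition exchanges \<open>l - p - q\<close> with \<open>q\<close> or
  with \<open>p\<close>. The commutator of \<open>l - p - q\<close> with \<open>l\<close> is minus
  the sum of the other two, and coherence says the same of the new relationator; the relationator
  that keeps its place is transported by total symmetry.\<close>

lemma hexagon_data_swap: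
  assumes "hexagon_data C X E S t U V W p q l"
  shows "hexagon_data C (V \<otimes> U \<otimes> W) (cj (\<gamma> U V \<boxtimes> idm C W) E (\<gamma> V U \<boxtimes> idm C W)) (cj (\<gamma> U V \<boxtimes> idm C W) S (\<gamma> V U \<boxtimes> idm C W))
      t V U W p (l - p - q) l" (is ?A)
    and "hexagon_data C (U \<otimes> W \<otimes> V) (cj (idm C U \<boxtimes> \<gamma> V W) E (idm C U \<boxtimes> \<gamma> W V)) (cj (idm C U \<boxtimes> \<gamma> V W) S (idm C U \<boxtimes> \<gamma> W V))
      t U W V (l - p - q) q l" (is ?B)
proof -
  interpret hexagon_data C X E S t U V W p q l by (rule assms)
  have m: "linear_ncs (l - p - q)" by (intro linear_ncs_intros hexagon_data.lin[OF assms])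
  have comm: "(l - p - q) * l - l * (l - p - q) = - (p * l - l * p) - (q * l - l * q)"
    by (simp add: algebra_simps)
  have gm: "good ((l - p - q) * l - l * (l - p - q))" unfolding comm by (intro good_diff good_minus good_p good_q)
  have sm: "se ((l - p - q) * l - l * (l - p - q)) = hpow 2 (- (relL C t U V W + relR C t U V W))"
    unfolding comm gev_diff[of _ "- (p * l - l * p)"] gev_minus se_p se_q sL_def sR_def hpow_minus hpow_diff by simp
  have neg: "g \<cdot> (- M) \<cdot> g' = - (g \<cdot> M \<cdot> g')" if "iso g g' X Y" "M \<in> Hom C (-1) X X" for g g' M Y
    using linear_on_Hom(2)[OF comp_linear_right[OF isoD(1)[OF that(1)]] that(2)]
      linear_on_Hom(2)[OF comp_linear_left[OF isoD(2)[OF that(1)]] comp0[OF isoD(1)[OF that(1)] that(2)]] by simp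
  note LR = Hom_closed(2)[OF relL_Hom[of U V W] relR_Hom[of U V W]]
  have ev: "ev p = hpow 1 (cmp (t12 C t) (U, V, W))" "ev q = hpow 1 (cmp (t23 C t) (U, V, W))"
    "ev (l - p - q) = hpow 1 (cmp (t13 C t) (U, V, W))"
    unfolding ev_p ev_q ev_m s12_def s23_def s13_def by (rule refl)+
  note i12 = iso_12[of U V W, folded X] and i23 = iso_23[of U V W, folded X]
  note R12 = relR_swap12[of V U W, folded neg[OF i12 LR[folded X]]] and L23 = relL_swap23[of U W V, folded neg[OF i23 LR[folded X]]]
  have l12: "cmp (t12 C t) (V, U, W) + cmp (t23 C t) (V, U, W) + cmp (t13 C t) (V, U, W) =
      (\<gamma> U V \<boxtimes> idm C W) \<cdot> (cmp (t12 C t) (U, V, W) + cmp (t23 C t) (U, V, W) + cmp (t13 C t) (U, V, W)) \<cdot> (\<gamma> V U \<boxtimes> idm C W)"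
    by (simp add: conj_add3(2)[OF iso_12 t12_Hom t23_Hom t13_Hom] t12_swap12[of V U] t23_swap12[of V U] t13_swap12[of V U])
  have l23: "cmp (t12 C t) (U, W, V) + cmp (t23 C t) (U, W, V) + cmp (t13 C t) (U, W, V) =
      (idm C U \<boxtimes> \<gamma> V W) \<cdot> (cmp (t12 C t) (U, V, W) + cmp (t23 C t) (U, V, W) + cmp (t13 C t) (U, V, W)) \<cdot> (idm C U \<boxtimes> \<gamma> W V)"
    by (simp add: conj_add3(2)[OF iso_23 t12_Hom t23_Hom t13_Hom] t12_swap23[of U W] t23_swap23[of U W] t13_swap23[of U W])
  show ?A
    by (rule hexagon_data_conj[OF assms i12 refl hexagon_data.lin(1)[OF assms] m ev(1) t12_swap12 ev(3) t23_swap12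
          ev_l[unfolded sLam_eq] l12 se_p[unfolded sL_def] relL_swap12 good_p sm R12 gm])
  show ?B
    by (rule hexagon_data_conj[OF assms i23 refl m hexagon_data.lin(2)[OF assms] ev(3) t12_swap23 ev(2) t23_swap23
          ev_l[unfolded sLam_eq] l23 sm L23 gm se_q[unfolded sR_def] relR_swap23 good_q])
qed

end

section \<open>Series of morphisms between different objects\<close>

context cochain2
begin

text \<open>The terms of the axiom pass through different orders of the three objects. Written as
  evaluated series between permutation isomorphisms, they compose by cancelling inner isomorphisms,
  and their series can be multiplied.\<close>

definition sandwich :: "'m \<Rightarrow> 'm fps \<Rightarrow> 'm \<Rightarrow> 'm fps" where
  "sandwich g A h = Abs_fps (\<lambda>n. g \<cdot> fps_nth A n \<cdot> h)"

lemma sandwich_nth: "fps_nth (sandwich g A h) n = g \<cdot> fps_nth A n \<cdot> h"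
  by (simp add: sandwich_def)

lemma sandwich_SHom: "g \<in> Hom C 0 B D \<Longrightarrow> A \<in> SHom C n U B \<Longrightarrow> h \<in> Hom C 0 V U \<Longrightarrow> sandwich g A h \<in> SHom C n V D"
  by (intro SHomI) (simp only: sandwich_nth, rule comp0'[OF comp0[OF _ SHomD]])

lemma gev_cj:
  fixes T :: "'a::finite list \<Rightarrow> 'm"
  assumes "g \<in> Hom C 0 B D" "\<And>w. T w \<in> Hom C n A B" "h \<in> Hom C 0 U A"
  shows "gev (cj g T h) f = sandwich g (gev T f) h"
  by (rule fps_ext) (simp add: gev_cj_nth[OF assms] sandwich_nth)

lemma conj_sum:
  assumes g: "g \<in> Hom C 0 B D" and h: "h \<in> Hom C 0 V U" and f: "\<And>i. i \<in> I \<Longrightarrow> f i \<in> Hom C n U B"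
  shows "g \<cdot> (\<Sum>i\<in>I. f i) \<cdot> h = (\<Sum>i\<in>I. g \<cdot> f i \<cdot> h)"
proof -
  have "g \<cdot> sum f I = (\<Sum>i\<in>I. g \<cdot> f i)"
    by (rule linear_on_Hom(4)[OF comp_linear_right[OF g] f])
  moreover have "(\<Sum>i\<in>I. g \<cdot> f i) \<cdot> h = (\<Sum>i\<in>I. g \<cdot> f i \<cdot> h)"
    by (rule linear_on_Hom(4)[OF comp_linear_left[OF h] comp0[OF g f]])
  ultimately show ?thesis by simp
qed

lemma
  assumes g: "g \<in> Hom C 0 B D" and h: "h \<in> Hom C 0 V U"
  shows sandwich_add: "A \<in> SHom C n U B \<Longrightarrow> A' \<in> SHom C n U B \<Longrightarrow> sandwich g (A + A') h = sandwich g A h + sandwich g A' h"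
    and sandwich_diff: "A \<in> SHom C n U B \<Longrightarrow> A' \<in> SHom C n U B \<Longrightarrow> sandwich g (A - A') h = sandwich g A h - sandwich g A' h"
    and sandwich_scale: "A \<in> SHom C n U B \<Longrightarrow> sandwich g (c *\<^sub>s A) h = c *\<^sub>s sandwich g A h"
    and sandwich_sum: "(\<And>i. i \<in> I \<Longrightarrow> F i \<in> SHom C n U B) \<Longrightarrow> sandwich g (sum F I) h = (\<Sum>i\<in>I. sandwich g (F i) h)"
    and sandwich_ssum: "(\<And>i. G i \<in> SHom C n U B) \<Longrightarrow> sandwich g (ssum G) h = ssum (\<lambda>i. sandwich g (G i) h)"
proof -
  note gr = comp_linear_right[OF g] and hl = comp_linear_left[OF h]
  note sum = conj_sum[OF g h]
  show "sandwich g (A + A') h = sandwich g A h + sandwich g A' h" if A: "A \<in> SHom C n U B" "A' \<in> SHom C n U B"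
    by (rule fps_ext) (simp add: sandwich_nth linear_onD(1)[OF gr A[THEN SHomD]]
        linear_onD(1)[OF hl comp0[OF g SHomD[OF A(1)]] comp0[OF g SHomD[OF A(2)]]])
  show "sandwich g (A - A') h = sandwich g A h - sandwich g A' h" if A: "A \<in> SHom C n U B" "A' \<in> SHom C n U B"
    by (rule fps_ext) (simp add: sandwich_nth linear_on_Hom(3)[OF gr A[THEN SHomD]]
        linear_on_Hom(3)[OF hl comp0[OF g SHomD[OF A(1)]] comp0[OF g SHomD[OF A(2)]]])
  show "sandwich g (c *\<^sub>s A) h = c *\<^sub>s sandwich g A h" if A: "A \<in> SHom C n U B"
    by (rule fps_ext) (simp add: sandwich_nth sscale_nth linear_onD(2)[OF gr SHomD[OF A]]
        linear_onD(2)[OF hl comp0[OF g SHomD[OF A]]])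
  show "sandwich g (sum F I) h = (\<Sum>i\<in>I. sandwich g (F i) h)" if "\<And>i. i \<in> I \<Longrightarrow> F i \<in> SHom C n U B"
    by (rule fps_ext) (simp add: sandwich_nth fps_nth_sum sum[OF SHomD[OF that]])
  show "sandwich g (ssum G) h = ssum (\<lambda>i. sandwich g (G i) h)" if "\<And>i. G i \<in> SHom C n U B"
    by (rule fps_ext) (simp add: sandwich_nth ssum_nth sum[OF SHomD[OF that]])
qed

lemma sandwich_mult:
  assumes g: "iso g g' Y Z" and h: "h \<in> Hom C 0 B D" and k: "k \<in> Hom C 0 V A"
    and M: "M \<in> SHom C m Y B" and N: "N \<in> SHom C n A Y"
  shows "sandwich h M g' \<odot> sandwich g N k = sandwich h (M \<odot> N) k"
proof (rule fps_ext)
  fix j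
  note G = isoD[OF g] and MH = SHomD[OF M] and NH = SHomD[OF N]
  have MN: "fps_nth M i \<cdot> fps_nth N i' \<in> Hom C (m + n) A B" for i i' by (rule comp_Hom[OF MH NH])
  have "h \<cdot> (\<Sum>i\<le>j. fps_nth M i \<cdot> fps_nth N (j - i)) \<cdot> k = (\<Sum>i\<le>j. h \<cdot> (fps_nth M i \<cdot> fps_nth N (j - i)) \<cdot> k)"
    by (rule conj_sum[OF h k MN])
  then show "fps_nth (sandwich h M g' \<odot> sandwich g N k) j = fps_nth (sandwich h (M \<odot> N) k) j"
    by (simp add: scomp_nth sandwich_nth iso_middle[OF g h k MH NH])
qed

lemma const_scomp: "a \<in> Hom C 0 V W \<Longrightarrow> A \<in> SHom C n U V \<Longrightarrow> fps_nth (fps_const a \<odot> A) j = a \<cdot> fps_nth A j"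
proof -
  assume "a \<in> Hom C 0 V W" "A \<in> SHom C n U V"
  then have "(\<Sum>i\<le>j. fps_nth (fps_const a) i \<cdot> fps_nth A (j - i)) = (\<Sum>i\<in>{0}. fps_nth (fps_const a) i \<cdot> fps_nth A (j - i))"
    by (intro sum.mono_neutral_right) (auto simp: comp_zero(1)[OF SHomD])
  then show ?thesis by (simp add: scomp_nth)
qed

lemma scomp_const: "a \<in> Hom C 0 U V \<Longrightarrow> A \<in> SHom C n V W \<Longrightarrow> fps_nth (A \<odot> fps_const a) j = fps_nth A j \<cdot> a"
proof -
  assume "a \<in> Hom C 0 U V" "A \<in> SHom C n V W"
  then have "(\<Sum>i\<le>j. fps_nth A i \<cdot> fps_nth (fps_const a) (j - i)) = (\<Sum>i\<in>{j}. fps_nth A i \<cdot> fps_nth (fps_const a) (j - i))"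
    by (intro sum.mono_neutral_right) (auto simp: comp_zero(2)[OF SHomD])
  then show ?thesis by (simp add: scomp_nth)
qed

lemma const_sandwich:
  assumes "a \<in> Hom C 0 D W" "g \<in> Hom C 0 B D" "A \<in> SHom C n U B" "h \<in> Hom C 0 V U"
  shows "fps_const a \<odot> sandwich g A h = sandwich (a \<cdot> g) A h"
  by (rule fps_ext) (simp add: const_scomp[OF assms(1) sandwich_SHom[OF assms(2-4)]] sandwich_nth
      comp_assoc[OF assms(1) comp0[OF assms(2) SHomD[OF assms(3)]] assms(4)] comp_assoc[OF assms(1,2) SHomD[OF assms(3)]])

lemma sandwich_const:
  assumes "a \<in> Hom C 0 W V" "g \<in> Hom C 0 B D" "A \<in> SHom C n U B" "h \<in> Hom C 0 V U"
  shows "sandwich g A h \<odot> fps_const a = sandwich g A (h \<cdot> a)"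
  by (rule fps_ext) (simp add: scomp_const[OF assms(1) sandwich_SHom[OF assms(2-4)]] sandwich_nth
      comp_assoc[OF comp0[OF assms(2) SHomD[OF assms(3)]] assms(4,1)])

lemma sandwich_id: "A \<in> SHom C n U V \<Longrightarrow> sandwich (idm C V) A (idm C U) = A"
  by (rule fps_ext) (simp add: sandwich_nth idm_left[OF SHomD] idm_right[OF SHomD])

lemma sandwich_one: "iso g g' X Y \<Longrightarrow> sandwich g (\<one> X) g' = \<one> Y"
  by (rule fps_ext) (simp add: sandwich_nth sid_nth idm_right[OF isoD(1)] isoD(4) comp_zero(2)[OF isoD(1)] comp_zero(1)[OF isoD(2)])

lemma const_SHom: "g \<in> Hom C 0 U V \<Longrightarrow> fps_const g \<in> SHom C 0 U V"
  by (intro SHomI) (auto simp: Hom_closed)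

lemma sinv_eqI:
  assumes A: "A \<in> SHom C 0 X Y" and B: "B \<in> SHom C 0 Y X" and inv: "B \<odot> A = \<one> X" "A \<odot> B = \<one> Y"
  shows "sinv C X Y A = B"
  unfolding sinv_def
proof (rule the_equality)
  show "B' = B" if B': "B' \<in> SHom C 0 Y X \<and> B' \<odot> A = \<one> X \<and> A \<odot> B' = \<one> Y" for B'
    using scomp_assoc[OF B'[THEN conjunct1] A B] B' inv scomp_id_left[OF B] scomp_id_right[of B' 0 Y X] by simp
qed (simp add: B inv)

lemma sinv_const:
  assumes "iso g g' X Y"
  shows "sinv C X Y (fps_const g) = fps_const g'"
proof (rule sinv_eqI[OF const_SHom[OF isoD(1)[OF assms]] const_SHom[OF isoD(2)[OF assms]]])
  note G = isoD[OF assms]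
  show "fps_const g' \<odot> fps_const g = \<one> X"
    by (rule fps_ext) (simp add: const_scomp[OF G(2) const_SHom[OF G(1)]] G(3) sid_nth comp_zero(2)[OF G(2)])
  show "fps_const g \<odot> fps_const g' = \<one> Y"
    by (rule fps_ext) (simp add: const_scomp[OF G(1) const_SHom[OF G(2)]] G(4) sid_nth comp_zero(2)[OF G(1)])
qed

fun mpow :: "'o \<Rightarrow> 'm \<Rightarrow> nat \<Rightarrow> 'm" where
  "mpow X x 0 = idm C X"
| "mpow X x (Suc n) = x \<cdot> mpow X x n"

lemma mpow_Hom: "x \<in> Hom C 0 X X \<Longrightarrow> mpow X x n \<in> Hom C 0 X X"
  by (induction n) (simp_all add: idm_Hom comp0)

lemma hpow_nth: "fps_nth (hpow k (x :: 'm)) n = (if n = k then x else 0)"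
  by (simp add: hpow_def)

lemma hpow_scomp:
  assumes x: "x \<in> Hom C m V W" and y: "y \<in> Hom C n U V"
  shows "hpow j x \<odot> hpow k y = hpow (j + k) (x \<cdot> y)"
proof (rule fps_ext)
  fix i
  have "(\<Sum>r\<le>i. fps_nth (hpow j x) r \<cdot> fps_nth (hpow k y) (i - r)) = (\<Sum>r\<in>{..i} \<inter> {j}. fps_nth (hpow j x) r \<cdot> fps_nth (hpow k y) (i - r))"
    by (intro sum.mono_neutral_right) (auto simp: hpow_nth comp_zero(1)[OF y] comp_zero(1)[OF Hom_closed(1)])
  also have "\<dots> = fps_nth (hpow (j + k) (x \<cdot> y)) i"
    by (cases "j \<le> i") (auto simp: hpow_nth comp_zero(2)[OF x])
  finally show "fps_nth (hpow j x \<odot> hpow k y) i = fps_nth (hpow (j + k) (x \<cdot> y)) i" by (simp add: scomp_nth)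
qed

lemma sscale_one: "1 *\<^sub>s A = A"
  by (rule fps_ext) (simp add: sscale_nth)

lemma spow_hpow:
  assumes x: "x \<in> Hom C 0 X X"
  shows "spow C X (c *\<^sub>s hpow 1 x) n = (c ^ n) *\<^sub>s hpow n (mpow X x n)"
proof (induction n)
  case 0
  show ?case by (rule fps_ext) (simp add: sid_nth sscale_nth hpow_nth)
next
  case (Suc n)
  have s: "d *\<^sub>s hpow k y = hpow k (cs d y)" for d k y by (rule fps_ext) (simp add: sscale_nth hpow_nth)
  have "cs c x \<cdot> cs (c ^ n) (mpow X x n) = cs (c ^ Suc n) (mpow X x (Suc n))"
    using comp_sum_sum[of "{()}" "\<lambda>_. x" 0 X X "{()}" "\<lambda>_. mpow X x n" 0 X "\<lambda>_. c" "\<lambda>_. c ^ n"] x mpow_Hom[OF x]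
    by simp
  with Suc hpow_scomp[OF Hom_closed(5)[OF x] Hom_closed(5)[OF mpow_Hom[OF x]], of 1 c n "c ^ n"] show ?case
    by (simp only: s spow.simps) simp
qed

lemma sexp_hpow:
  assumes x: "x \<in> Hom C 0 X X"
  shows "fps_nth (sexp C X (c *\<^sub>s hpow 1 x)) n = cs (c ^ n / fact n) (mpow X x n)"
proof -
  have "(\<Sum>m\<le>n. fps_nth ((1 / fact m) *\<^sub>s spow C X (c *\<^sub>s hpow 1 x) m) n) =
      (\<Sum>m\<in>{n}. fps_nth ((1 / fact m) *\<^sub>s spow C X (c *\<^sub>s hpow 1 x) m) n)"
    by (intro sum.mono_neutral_right) (auto simp: spow_hpow[OF x] sscale_nth hpow_nth simp del: One_nat_def)
  then show ?thesis by (simp add: sexp_def ssum_nth spow_hpow[OF x] sscale_nth hpow_nth del: One_nat_def)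
qed

end

section \<open>Homotopy components of exponentials\<close>

context evaluation
begin

lemma
  assumes g: "iso g g' X Y" and h: "h \<in> Hom C 0 X B" and k: "k \<in> Hom C 0 A X"
  shows sandwich_ev_ev: "sandwich h (ev a) g' \<odot> sandwich g (ev b) k = sandwich h (ev (a * b)) k"
    and sandwich_ev_se: "good b \<Longrightarrow> sandwich h (ev a) g' \<odot> sandwich g (se b) k = sandwich h (se (a * b)) k"
    and sandwich_se_ev: "good a \<Longrightarrow> sandwich h (se a) g' \<odot> sandwich g (ev b) k = sandwich h (se (a * b)) k"
  by (simp_all add: sandwich_mult[OF g h k ev_SHom ev_SHom] sandwich_mult[OF g h k ev_SHom se_SHom]
      sandwich_mult[OF g h k se_SHom ev_SHom] ev_mult se_mult_left se_mult_right)

lemma spow_sandwich: "iso g g' X Y \<Longrightarrow> spow C Y (sandwich g (ev B) g') n = sandwich g (ev (B ^ n)) g'"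
proof (induction n)
  case (Suc n)
  then show ?case by (simp add: sandwich_ev_ev[OF Suc.prems isoD(1,2)[OF Suc.prems]])
qed (simp add: ev_1 sandwich_one)

text \<open>In \<open>exp_hty\<close> the powers on the left of the homotopy component live at the
  target and those on the right at the source. Conjugation by \<open>k\<close> makes both powers of
  the same \<open>B\<close>, so the sum becomes a commutator with one exponential.\<close>

lemma exp_hty_sandwich:
  assumes k: "iso k k' X Y" and B: "coef B [] = 0" and good: "good (F * B - B * F)"
    and x: "fst x \<otimes> snd x = X" "hpow 1 (cmp t x) = ev B"
    and x': "fst x' \<otimes> snd x' = Y" "hpow 1 (cmp t x') = sandwich k (ev B) k'"
    and H: "hty_series t x x' P Q = sandwich k (se (F * B - B * F)) (idm C X)"
  shows "exp_hty C t x x' P Q = sandwich k (se (F * nexp (\<i> * of_real pi) B - nexp (\<i> * of_real pi) B * F)) (idm C X)"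
proof -
  note K = isoD[OF k] and i = iso_sym[OF k]
  have id: "iso (idm C X) (idm C X) X X" by (simp add: iso_def idm_Hom idm_left[OF idm_Hom])
  have pw: "spow C X (ev B) m = sandwich (idm C X) (ev (B ^ m)) (idm C X)" for m
    by (simp add: ev_power sandwich_id[OF ev_SHom])
  define G where "G m j = B ^ j * (F * B - B * F) * B ^ (m - 1 - j)" for m j :: nat
  have G: "sandwich k (ev (B ^ j)) k' \<odot> sandwich k (se (F * B - B * F)) (idm C X) \<odot> sandwich (idm C X) (ev (B ^ (m - 1 - j))) (idm C X)
     = sandwich k (se (G m j)) (idm C X)" for m j
    unfolding G_def
    by (simp only: sandwich_ev_se[OF k K(1) idm_Hom good] sandwich_se_ev[OF id K(1) idm_Hom good_mult_left[OF good]])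
  have SG: "se (\<Sum>j<m. G m j) \<in> SHom C (-1) X X" for m by (rule se_SHom)
  have SG': "c *\<^sub>s se (\<Sum>j<m. G m j) \<in> SHom C (-1) X X" for c m
    using SG by (simp add: SHom_def sscale_nth Hom_closed)
  have "exp_hty C t x x' P Q = ssum (\<lambda>m. ((\<i> * of_real pi) ^ m / fact m) *\<^sub>s (\<Sum>j<m. sandwich k (se (G m j)) (idm C X)))"
    unfolding exp_hty_def x x' H spow_sandwich[OF k] pw G ..
  also have "\<dots> = ssum (\<lambda>m. sandwich k (((\<i> * of_real pi) ^ m / fact m) *\<^sub>s se (\<Sum>j<m. G m j)) (idm C X))"
    by (simp only: sandwich_sum[OF K(1) idm_Hom se_SHom, symmetric] gev_sum[symmetric] sandwich_scale[OF K(1) idm_Hom SG])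
  also have "\<dots> = sandwich k (ssum (\<lambda>m. ((\<i> * of_real pi) ^ m / fact m) *\<^sub>s se (\<Sum>j<m. G m j))) (idm C X)"
    by (rule sandwich_ssum[OF K(1) idm_Hom SG', symmetric])
  also have "ssum (\<lambda>m. ((\<i> * of_real pi) ^ m / fact m) *\<^sub>s se (\<Sum>j<m. G m j)) = se (F * nexp (\<i> * of_real pi) B - nexp (\<i> * of_real pi) B * F)"
    unfolding se_commutator_nexp_right[OF B good] G_def gev_sum se_mult[OF good] ev_power ..
  finally show ?thesis .
qed

text \<open>The recursion assumed for \<open>H\<close> is the composition rule for homotopy
  components at powers of \<open>x\<close>; the commutators with \<open>q ^ n\<close> obey the same
  recursion.\<close>

lemma se_commutator_power:
  assumes x: "ev q = hpow 1 x" "x \<in> Hom C 0 X X" and good: "good (q * B - B * q)"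
    and r: "se (q * B - B * q) = hpow 2 r" "r \<in> Hom C (-1) X X"
    and H: "H 0 = 0" "\<And>n. H (Suc n) = r \<cdot> mpow X x n + x \<cdot> H n" "\<And>n. H n \<in> Hom C (-1) X X"
  shows "se (q ^ n * B - B * q ^ n) = hpow (Suc n) (H n)"
proof (induction n)
  case 0
  show ?case by (rule fps_ext) (simp add: H hpow_nth)
next
  case (Suc n)
  have ev_pow: "ev (q ^ n) = hpow n (mpow X x n)"
    using spow_hpow[OF x(2), of 1 n] unfolding power_one sscale_one x(1)[symmetric] ev_power .
  have gn: "good (q ^ n * B - B * q ^ n)"
    using good_commutator_power[OF good, of n 1] by simp
  have "q ^ Suc n * B - B * q ^ Suc n = q * (q ^ n * B - B * q ^ n) + (q * B - B * q) * q ^ n"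
    by (simp add: algebra_simps)
  then have "se (q ^ Suc n * B - B * q ^ Suc n) = hpow 1 x \<odot> hpow (Suc n) (H n) + hpow 2 r \<odot> hpow n (mpow X x n)"
    by (simp only: gev_add se_mult_left[OF gn] se_mult_right[OF good] Suc r(1) x(1) ev_pow)
  also have "\<dots> = hpow (Suc (Suc n)) (H (Suc n))"
    unfolding hpow_scomp[OF x(2) H(3)] hpow_scomp[OF r(2) mpow_Hom[OF x(2)]] by (simp add: hpow_add H(2) add.commute)
  finally show ?case .
qed

lemma nexp_commutator_coef:
  assumes q: "coef q [] = 0" and w: "length w = n"
  shows "coef (nexp v q * B - B * nexp v q) w = coef (\<Sum>m\<le>n. (v ^ m / fact m) *\<^sub>n (q ^ m * B - B * q ^ m)) w"
proof -
  have "coef (nexp v q * B - B * nexp v q) w = - coef (B * nexp v q - nexp v q * B) w" by simp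
  also have "\<dots> = coef (- (\<Sum>m\<le>n. (v ^ m / fact m) *\<^sub>n (B * q ^ m - q ^ m * B))) w"
    by (simp only: commutator_nexp_right_coef[OF q w] coef_simps(4))
  also have "- (\<Sum>m\<le>n. (v ^ m / fact m) *\<^sub>n (B * q ^ m - q ^ m * B)) = (\<Sum>m\<le>n. (v ^ m / fact m) *\<^sub>n (q ^ m * B - B * q ^ m))"
    unfolding sum_negf[symmetric] by (intro sum.cong refl ncs_eqI) (simp add: algebra_simps)
  finally show ?thesis .
qed

lemma good_nexp_commutator:
  assumes q: "coef q [] = 0" and good: "good (q * B - B * q)"
  shows "good (nexp v q * B - B * nexp v q)"
proof (rule good_coefs, intro exI conjI ballI)
  fix n and w :: "'a list" assume "w \<in> words n"
  then show "coef (nexp v q * B - B * nexp v q) w = coef (\<Sum>m\<le>n. (v ^ m / fact m) *\<^sub>n (q ^ m * B - B * q ^ m)) w"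
    by (intro nexp_commutator_coef q) simp
qed (intro good_sum good_scale good_commutator_power[OF good, of _ 1, unfolded power_one_right])

text \<open>The index shift is the single \<hbar> carried by the homotopy component, which
  \<open>hty_series\<close> inserts in the same way.\<close>

lemma se_nexp_commutator_nth:
  assumes q: "coef q [] = 0" and H: "\<And>n. se (q ^ n * B - B * q ^ n) = hpow (Suc n) (H n)"
  shows "fps_nth (se (nexp v q * B - B * nexp v q)) n = (case n of 0 \<Rightarrow> 0 | Suc k \<Rightarrow> cs (v ^ k / fact k) (H k))"
proof -
  have "fps_nth (se (nexp v q * B - B * nexp v q)) n = (\<Sum>m\<le>n. cs (v ^ m / fact m) (fps_nth (hpow (Suc m) (H m)) n))"
    using gev_nth_cong[where T = S, OF nexp_commutator_coef[OF q]] by (simp only: gev_sum gev_scale H fps_nth_sum sscale_nth)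
  also have "\<dots> = (case n of 0 \<Rightarrow> 0 | Suc k \<Rightarrow> cs (v ^ k / fact k) (H k))"
  proof (cases n)
    case (Suc k)
    have "(\<Sum>m\<le>n. cs (v ^ m / fact m) (fps_nth (hpow (Suc m) (H m)) n)) = (\<Sum>m\<in>{k}. cs (v ^ m / fact m) (fps_nth (hpow (Suc m) (H m)) n))"
      by (intro sum.mono_neutral_right) (auto simp: hpow_nth Suc)
    then show ?thesis by (simp add: Suc hpow_nth)
  qed (simp add: hpow_nth)
  finally show ?thesis .
qed

end

section \<open>Permutation identities and the braiding series\<close>

context braided
begin

lemma iso_unique:
  assumes g: "iso g h A B" and g': "iso g' h A B"
  shows "g = g'"
proof -
  have "g \<cdot> h \<cdot> g' = g \<cdot> (h \<cdot> g')" by (rule comp_assoc[OF isoD(1,2)[OF g] isoD(1)[OF g']])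
  then show ?thesis
    by (simp add: isoD(4)[OF g] isoD(3)[OF g'] idm_left[OF isoD(1)[OF g']] idm_right[OF isoD(1)[OF g]])
qed

text \<open>The hexagon for the other variable: both sides have the same inverse.\<close>

lemma hexagon_left: "\<gamma> (U \<otimes> V) W = (\<gamma> U W \<boxtimes> idm C V) \<cdot> (idm C U \<boxtimes> \<gamma> V W)"
proof (rule iso_unique)
  show "iso (\<gamma> (U \<otimes> V) W) (\<gamma> W (U \<otimes> V)) (U \<otimes> V \<otimes> W) (W \<otimes> U \<otimes> V)"
    using iso_gamma[of "U \<otimes> V" W] by (simp only: ob_assoc)
  show "iso ((\<gamma> U W \<boxtimes> idm C V) \<cdot> (idm C U \<boxtimes> \<gamma> V W)) (\<gamma> W (U \<otimes> V)) (U \<otimes> V \<otimes> W) (W \<otimes> U \<otimes> V)"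
    unfolding hexagon by (rule iso_comp[OF iso_23 iso_12])
qed

definition reversal :: "'o \<Rightarrow> 'o \<Rightarrow> 'o \<Rightarrow> 'm" where
  "reversal U V W = (\<gamma> V W \<boxtimes> idm C U) \<cdot> \<gamma> U (V \<otimes> W)"

lemma gamma_swap_right: "\<gamma> U (W \<otimes> V) \<cdot> (idm C U \<boxtimes> \<gamma> V W) = reversal U V W"
  unfolding reversal_def by (rule gamma_nat[OF idm_Hom gamma_Hom])

lemma gamma_swap_left: "\<gamma> (V \<otimes> U) W \<cdot> (\<gamma> U V \<boxtimes> idm C W) = (idm C W \<boxtimes> \<gamma> U V) \<cdot> \<gamma> (U \<otimes> V) W"
  by (rule gamma_nat[OF gamma_Hom idm_Hom])

text \<open>The two reduced words for the permutation reversing three factors, compared through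
  naturality and the hexagon.\<close>

lemma yang_baxter: "(idm C W \<boxtimes> \<gamma> U V) \<cdot> \<gamma> (U \<otimes> V) W = reversal U V W"
  unfolding gamma_swap_left[symmetric] hexagon_left[of V U W] reversal_def hexagon[of U V W]
  by (rule comp_assoc[OF isoD(1)[OF iso_12] isoD(1)[OF iso_23] isoD(1)[OF iso_12]])

lemma iso_gamma_right: "iso (\<gamma> U (V \<otimes> W)) (\<gamma> (V \<otimes> W) U) (U \<otimes> V \<otimes> W) (V \<otimes> W \<otimes> U)"
  and iso_gamma_left: "iso (\<gamma> (U \<otimes> V) W) (\<gamma> W (U \<otimes> V)) (U \<otimes> V \<otimes> W) (W \<otimes> U \<otimes> V)"
  using iso_gamma[of U "V \<otimes> W"] iso_gamma[of "U \<otimes> V" W] by (simp_all only: ob_assoc)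

lemma iso_reversal: "iso (reversal U V W) (\<gamma> (V \<otimes> W) U \<cdot> (\<gamma> W V \<boxtimes> idm C U)) (U \<otimes> V \<otimes> W) (W \<otimes> V \<otimes> U)"
  unfolding reversal_def by (rule iso_comp[OF iso_gamma_right iso_12])

lemma tens_linear_left: "g \<in> Hom C n V V' \<Longrightarrow> linear_on C (Hom C m U U') (\<lambda>f. f \<boxtimes> g)"
  and tens_linear_right: "f \<in> Hom C m U U' \<Longrightarrow> linear_on C (Hom C n V V') (\<lambda>g. f \<boxtimes> g)"
  using tens_bilinear by (simp_all add: bilinear_on_def)

lemma hty_linear_left: "g \<in> Hom C 0 V V' \<Longrightarrow> linear_on C (Hom C 0 U U') (\<lambda>f. hty t (U, V) (U', V') (f, g))"
  and hty_linear_right: "f \<in> Hom C 0 U U' \<Longrightarrow> linear_on C (Hom C 0 V V') (\<lambda>g. hty t (U, V) (U', V') (f, g))"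
  using hty_bilinear by (simp_all add: bilinear_on_def)

lemma stens_one_nth: "A \<in> SHom C 0 U V \<Longrightarrow> fps_nth (A \<boxdot> \<one> W) n = fps_nth A n \<boxtimes> idm C W"
proof -
  assume A: "A \<in> SHom C 0 U V"
  have "(\<Sum>i\<le>n. fps_nth A i \<boxtimes> fps_nth (\<one> W) (n - i)) = (\<Sum>i\<in>{n}. fps_nth A i \<boxtimes> fps_nth (\<one> W) (n - i))"
    using linear_on_Hom(1)[OF tens_linear_right[OF SHomD[OF A]]] by (intro sum.mono_neutral_right) (auto simp: sid_nth)
  then show ?thesis by (simp add: stens_def sid_nth)
qed

lemma one_stens_nth: "A \<in> SHom C 0 U V \<Longrightarrow> fps_nth (\<one> W \<boxdot> A) n = idm C W \<boxtimes> fps_nth A n"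
proof -
  assume A: "A \<in> SHom C 0 U V"
  have "(\<Sum>i\<le>n. fps_nth (\<one> W) i \<boxtimes> fps_nth A (n - i)) = (\<Sum>i\<in>{0}. fps_nth (\<one> W) i \<boxtimes> fps_nth A (n - i))"
    using linear_on_Hom(1)[OF tens_linear_left[OF SHomD[OF A]]] by (intro sum.mono_neutral_right) (auto simp: sid_nth)
  then show ?thesis by (simp add: stens_def sid_nth)
qed

lemma revperm_eq: "revperm C U V W = fps_const (reversal U V W)"
proof (rule fps_ext)
  fix n
  have 1: "fps_const (\<gamma> V W) \<boxdot> \<one> U = fps_const (\<gamma> V W \<boxtimes> idm C U)"
    by (rule fps_ext) (simp add: stens_one_nth[OF const_SHom[OF gamma_Hom]] linear_on_Hom(1)[OF tens_linear_left[OF idm_Hom]])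
  show "fps_nth (revperm C U V W) n = fps_nth (fps_const (reversal U V W)) n"
    unfolding revperm_def ssym_def 1 reversal_def
    by (simp add: const_scomp[OF isoD(1)[OF iso_12] const_SHom[OF isoD(1)[OF iso_gamma_right]]] comp_zero(2)[OF isoD(1)[OF iso_12]])
qed

lemma braid_nth: "fps_nth (braid C t U V) n = cs ((\<i> * of_real pi) ^ n / fact n) (\<gamma> U V \<cdot> mpow (U \<otimes> V) (cmp t (U, V)) n)"
  and braid_SHom: "braid C t U V \<in> SHom C 0 (U \<otimes> V) (V \<otimes> U)"
proof -
  have e: "sexp C (U \<otimes> V) ((\<i> * of_real pi) *\<^sub>s hpow 1 (cmp t (U, V))) \<in> SHom C 0 (U \<otimes> V) (U \<otimes> V)"
    by (intro SHomI) (simp only: sexp_hpow[OF t_Hom] Hom_closed mpow_Hom[OF t_Hom])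
  show *: "fps_nth (braid C t U V) n = cs ((\<i> * of_real pi) ^ n / fact n) (\<gamma> U V \<cdot> mpow (U \<otimes> V) (cmp t (U, V)) n)" for n
    unfolding braid_def ssym_def
    by (simp only: const_scomp[OF gamma_Hom e] sexp_hpow[OF t_Hom] linear_onD(2)[OF comp_linear_right[OF gamma_Hom] mpow_Hom[OF t_Hom]])
  show "braid C t U V \<in> SHom C 0 (U \<otimes> V) (V \<otimes> U)"
    by (intro SHomI) (simp only: * Hom_closed comp0[OF gamma_Hom mpow_Hom[OF t_Hom]])
qed

lemma mpow_tens_left: "x \<in> Hom C 0 U U \<Longrightarrow> mpow (U \<otimes> W) (x \<boxtimes> idm C W) n = mpow U x n \<boxtimes> idm C W"
  and mpow_tens_right: "x \<in> Hom C 0 U U \<Longrightarrow> mpow (W \<otimes> U) (idm C W \<boxtimes> x) n = idm C W \<boxtimes> mpow U x n"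
  by (induction n) (simp_all add: tens_id tens_comp_left[OF mpow_Hom] tens_comp_right[OF mpow_Hom])

lemma hty_mpow_left:
  assumes x: "x \<in> Hom C 0 U U"
  shows "hty t (U, W) (U, W) (mpow U x (Suc n), idm C W) =
    hty t (U, W) (U, W) (x, idm C W) \<cdot> mpow (U \<otimes> W) (x \<boxtimes> idm C W) n + (x \<boxtimes> idm C W) \<cdot> hty t (U, W) (U, W) (mpow U x n, idm C W)"
  using hty_comp[OF mpow_Hom[OF x, of n] idm_Hom[of W] x idm_Hom[of W]]
  by (simp add: mpow_tens_left[OF x] idm_left[OF idm_Hom])

lemma hty_mpow_right:
  assumes x: "x \<in> Hom C 0 W W"
  shows "hty t (U, W) (U, W) (idm C U, mpow W x (Suc n)) =
    hty t (U, W) (U, W) (idm C U, x) \<cdot> mpow (U \<otimes> W) (idm C U \<boxtimes> x) n + (idm C U \<boxtimes> x) \<cdot> hty t (U, W) (U, W) (idm C U, mpow W x n)"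
  using hty_comp[OF idm_Hom[of U] mpow_Hom[OF x, of n] idm_Hom[of U] x]
  by (simp add: mpow_tens_right[OF x] idm_left[OF idm_Hom])

lemma hty_idm: "hty t (U, W) (U, W) (idm C U, idm C W) = 0"
proof -
  have "hty t (U, W) (U, W) (idm C U, idm C W) \<in> Hom C (-1) (U \<otimes> W) (U \<otimes> W)" by (rule hty_Hom[OF idm_Hom idm_Hom])
  then show ?thesis
    using hty_comp[OF idm_Hom idm_Hom idm_Hom idm_Hom, of U W] by (simp add: idm_left[OF idm_Hom] tens_id idm_left idm_right)
qed

text \<open>Only the constant coefficient of the identity series contributes, and the symmetry in
  the braiding can be pulled out because its own homotopy component is zero.\<close>

lemma hty_series_braid_right:
  "fps_nth (hty_series t (U, V \<otimes> W) (U, W \<otimes> V) (\<one> U) (braid C t V W)) n = (case n of 0 \<Rightarrow> 0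
    | Suc k \<Rightarrow> cs ((\<i> * of_real pi) ^ k / fact k) ((idm C U \<boxtimes> \<gamma> V W) \<cdot> hty t (U, V \<otimes> W) (U, V \<otimes> W) (idm C U, mpow (V \<otimes> W) (cmp t (V, W)) k)))"
proof (cases n)
  case (Suc k)
  have "(\<Sum>i\<le>k. hty t (U, V \<otimes> W) (U, W \<otimes> V) (fps_nth (\<one> U) i, fps_nth (braid C t V W) (k - i))) =
     (\<Sum>i\<in>{0}. hty t (U, V \<otimes> W) (U, W \<otimes> V) (fps_nth (\<one> U) i, fps_nth (braid C t V W) (k - i)))"
    using linear_on_Hom(1)[OF hty_linear_left[OF SHomD[OF braid_SHom]]] by (intro sum.mono_neutral_right) (auto simp: sid_nth)
  then show ?thesis
    by (simp add: hty_series_def Suc sid_nth braid_nth hty_post_right[OF mpow_Hom[OF t_Hom]]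
        linear_onD(2)[OF hty_linear_right[OF idm_Hom] comp0[OF gamma_Hom mpow_Hom[OF t_Hom]]])
qed (simp add: hty_series_def)

lemma hty_series_braid_left:
  "fps_nth (hty_series t (U \<otimes> V, W) (V \<otimes> U, W) (braid C t U V) (\<one> W)) n = (case n of 0 \<Rightarrow> 0
    | Suc k \<Rightarrow> cs ((\<i> * of_real pi) ^ k / fact k) ((\<gamma> U V \<boxtimes> idm C W) \<cdot> hty t (U \<otimes> V, W) (U \<otimes> V, W) (mpow (U \<otimes> V) (cmp t (U, V)) k, idm C W)))"
proof (cases n)
  case (Suc k)
  have "(\<Sum>i\<le>k. hty t (U \<otimes> V, W) (V \<otimes> U, W) (fps_nth (braid C t U V) i, fps_nth (\<one> W) (k - i))) =
     (\<Sum>i\<in>{k}. hty t (U \<otimes> V, W) (V \<otimes> U, W) (fps_nth (braid C t U V) i, fps_nth (\<one> W) (k - i)))"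
    using linear_on_Hom(1)[OF hty_linear_right[OF SHomD[OF braid_SHom]]] by (intro sum.mono_neutral_right) (auto simp: sid_nth)
  then show ?thesis
    by (simp add: hty_series_def Suc sid_nth braid_nth hty_post[OF mpow_Hom[OF t_Hom]]
        linear_onD(2)[OF hty_linear_left[OF idm_Hom] comp0[OF gamma_Hom mpow_Hom[OF t_Hom]]])
qed (simp add: hty_series_def)

end

locale hexagon_objects = braided C t + hexagon_data C X E S t U V W p q l
  for C :: "('r::comm_ring_1, 'o, 'm::ab_group_add) smc2cat" (structure)
    and t :: "('o, 'm) trans2" and X :: 'o and E S :: "'a::finite list \<Rightarrow> 'm" and U V W :: 'o and p q l :: "'a ncs"
begin

text \<open>
  \<open>placed g g' A B D p' q'\<close>: the isomorphism \<open>g\<close> onto \<open>A \<otimes> B \<otimes> D\<close> turns \<open>p'\<close> and \<open>q'\<close> into \<open>t\<^sub>1\<^sub>2\<close> and \<open>t\<^sub>2\<^sub>3\<close>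
  at \<open>(A, B, D)\<close>.
\<close>

definition placed :: "'m \<Rightarrow> 'm \<Rightarrow> 'o \<Rightarrow> 'o \<Rightarrow> 'o \<Rightarrow> 'a ncs \<Rightarrow> 'a ncs \<Rightarrow> bool" where
  "placed g g' A B D p' q' \<longleftrightarrow> iso g g' X (A \<otimes> B \<otimes> D) \<and> hexagon_data C (A \<otimes> B \<otimes> D) (cj g E g') (cj g S g') t A B D p' q' l"

lemma placedD:
  assumes "placed g g' A B D p' q'"
  shows "iso g g' X (A \<otimes> B \<otimes> D)" "hexagon_data C (A \<otimes> B \<otimes> D) (cj g E g') (cj g S g') t A B D p' q' l"
  using assms by (simp_all add: placed_def)

lemma cj_cj:
  assumes g: "iso g g' X Y" and h: "iso h h' Y Z" and T: "\<And>w. T w \<in> Hom C n X X"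
  shows "cj h (cj g T g') h' = cj (h \<cdot> g) T (g' \<cdot> h')"
proof
  fix w
  note G = isoD[OF g] and H = isoD[OF h]
  have "h \<cdot> (g \<cdot> T w \<cdot> g') = h \<cdot> g \<cdot> T w \<cdot> g'"
    using comp_assoc[OF H(1) comp0[OF G(1) T] G(2)] comp_assoc[OF H(1) G(1) T] by simp
  then show "cj h (cj g T g') h' w = cj (h \<cdot> g) T (g' \<cdot> h') w"
    unfolding cj_def using comp_assoc[OF comp0[OF comp0[OF H(1) G(1)] T] G(2) H(2)] by simp
qed

lemma cj_id: "(\<And>w. T w \<in> Hom C n X X) \<Longrightarrow> cj (idm C X) T (idm C X) = T"
  using idm_left[of _ n X X] idm_right[of _ n X X] by (intro ext) (simp add: cj_def)

lemma iso_id: "iso (idm C X) (idm C X) X X"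
  by (simp add: iso_def idm_Hom idm_left[OF idm_Hom])

lemma placed_base: "placed (idm C X) (idm C X) U V W p q"
  using hexagon_data_axioms iso_id unfolding placed_def cj_id[OF E_Hom] cj_id[OF S_Hom] X[symmetric] by simp

lemma placed_swap12:
  assumes "placed g g' A B D p' q'"
  shows "placed ((\<gamma> A B \<boxtimes> idm C D) \<cdot> g) (g' \<cdot> (\<gamma> B A \<boxtimes> idm C D)) B A D p' (l - p' - q')"
  using hexagon_data_swap(1)[OF placedD(2)[OF assms]] iso_comp[OF placedD(1)[OF assms] iso_12]
  unfolding placed_def cj_cj[OF placedD(1)[OF assms] iso_12 E_Hom] cj_cj[OF placedD(1)[OF assms] iso_12 S_Hom] by simp

lemma placed_swap23:
  assumes "placed g g' A B D p' q'"
  shows "placed ((idm C A \<boxtimes> \<gamma> B D) \<cdot> g) (g' \<cdot> (idm C A \<boxtimes> \<gamma> D B)) A D B (l - p' - q') q'"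
  using hexagon_data_swap(2)[OF placedD(2)[OF assms]] iso_comp[OF placedD(1)[OF assms] iso_23]
  unfolding placed_def cj_cj[OF placedD(1)[OF assms] iso_23 E_Hom] cj_cj[OF placedD(1)[OF assms] iso_23 S_Hom] by simp

context
  fixes g g' :: 'm and A B D :: 'o and p' q' :: "'a ncs"
  assumes placed: "placed g g' A B D p' q'"
begin

lemmas iso_g = placedD(1)[OF placed]
lemmas data = placedD(2)[OF placed]

lemma placed_linear: "linear_ncs p'" "linear_ncs q'"
  by (rule hexagon_data.lin[OF data])+

lemma gev_placed: "gev (cj g E g') f = sandwich g (ev f) g'" "gev (cj g S g') f = sandwich g (se f) g'"
  by (rule gev_cj[OF isoD(1)[OF iso_g] E_Hom isoD(2)[OF iso_g]] gev_cj[OF isoD(1)[OF iso_g] S_Hom isoD(2)[OF iso_g]])+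

lemma placed_assoc: "assoc C t A B D = sandwich g (ev (kz_assoc p' q')) g'"
  using hexagon_data.assoc_eq[OF data] unfolding gev_placed .

text \<open>Exchanging the two arguments of the associator inverts it on both sides.\<close>

lemma placed_assoc_inv: "assoc_inv C t A B D = sandwich g (ev (kz_assoc q' p')) g'"
proof -
  note G = isoD[OF iso_g]
  have "sandwich g (ev (kz_assoc a b)) g' \<in> SHom C 0 (A \<otimes> B \<otimes> D) (A \<otimes> B \<otimes> D)" for a b
    by (rule sandwich_SHom[OF G(1) ev_SHom G(2)])
  moreover have "sandwich g (ev (kz_assoc a b)) g' \<odot> sandwich g (ev (kz_assoc b a)) g' = \<one> (A \<otimes> B \<otimes> D)" for a b
    by (simp only: sandwich_ev_ev[OF iso_g G(1,2)] kz_assoc_inverse ev_1 sandwich_one[OF iso_g])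
  ultimately show ?thesis
    unfolding assoc_inv_def placed_assoc by (intro sinv_eqI)
qed

lemma placed_prehexR:
  assumes "a \<noteq> 0"
  shows "prehexR C t A B D a = sandwich g (se (nc_hexagon p' q' (l - p' - q'))) g'" "good (nc_hexagon p' q' (l - p' - q'))"
proof -
  note inv = iso_sym[OF iso_g]
  show "prehexR C t A B D a = sandwich g (se (nc_hexagon p' q' (l - p' - q'))) g'"
    using hexagon_data.prehexR_eq(1)[OF data assms] unfolding gev_placed .
  \<comment> \<open>Goodness is known for the conjugated evaluation; conjugating by the inverse
    returns to the original one.\<close>
  have "cj g' (cj g E g') g = E" "cj g' (cj g S g') g = S"
    unfolding cj_cj[OF iso_g inv E_Hom] cj_cj[OF iso_g inv S_Hom] isoD(3)[OF iso_g] by (rule cj_id[OF E_Hom] cj_id[OF S_Hom])+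
  moreover have "evaluation C (A \<otimes> B \<otimes> D) (cj g E g') (cj g S g')" by (rule evaluation_conj[OF iso_g])
  ultimately show "good (nc_hexagon p' q' (l - p' - q'))"
    using evaluation.good_conj[OF _ inv hexagon_data.prehexR_eq(2)[OF data assms]] by simp
qed

lemma placed_nexp12: "g \<cdot> fps_nth (ev (nexp c p')) n \<cdot> g' = cs (c ^ n / fact n) (mpow (A \<otimes> B) (cmp t (A, B)) n \<boxtimes> idm C D)"
proof -
  have "sandwich g (ev (nexp c p')) g' = sexp C (A \<otimes> B \<otimes> D) (c *\<^sub>s hpow 1 (cmp (t12 C t) (A, B, D)))"
    unfolding gev_placed[symmetric] s12_def[symmetric] hexagon_data.ev_p[OF data, symmetric]
    by (rule evaluation.sexp_ev[OF evaluation_conj[OF iso_g], symmetric]) (simp add: placed_linear)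
  then have "g \<cdot> fps_nth (ev (nexp c p')) n \<cdot> g' = cs (c ^ n / fact n) (mpow (A \<otimes> B \<otimes> D) (cmp (t12 C t) (A, B, D)) n)"
    by (simp only: sandwich_nth[symmetric] sexp_hpow[OF t12_Hom])
  then show ?thesis
    using mpow_tens_left[OF t_Hom, of A B D n] by (simp add: t12_def ob_assoc)
qed

lemma placed_nexp23: "g \<cdot> fps_nth (ev (nexp c q')) n \<cdot> g' = cs (c ^ n / fact n) (idm C A \<boxtimes> mpow (B \<otimes> D) (cmp t (B, D)) n)"
proof -
  have "sandwich g (ev (nexp c q')) g' = sexp C (A \<otimes> B \<otimes> D) (c *\<^sub>s hpow 1 (cmp (t23 C t) (A, B, D)))"
    unfolding gev_placed[symmetric] s23_def[symmetric] hexagon_data.ev_q[OF data, symmetric]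
    by (rule evaluation.sexp_ev[OF evaluation_conj[OF iso_g], symmetric]) (simp add: placed_linear)
  then have "g \<cdot> fps_nth (ev (nexp c q')) n \<cdot> g' = cs (c ^ n / fact n) (mpow (A \<otimes> B \<otimes> D) (cmp (t23 C t) (A, B, D)) n)"
    by (simp only: sandwich_nth[symmetric] sexp_hpow[OF t23_Hom])
  then show ?thesis
    using mpow_tens_right[OF t_Hom, of A B D n] by (simp add: t23_def)
qed

lemma placed_braid12: "braid C t A B \<boxdot> \<one> D = sandwich ((\<gamma> A B \<boxtimes> idm C D) \<cdot> g) (ev (nexp (\<i> * of_real pi) p')) g'"
proof (rule fps_ext)
  fix n
  note G = isoD[OF iso_g] and i = isoD(1)[OF iso_12] and M = mpow_Hom[OF t_Hom[of A B], of n]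
  have e: "fps_nth (ev f) n \<in> Hom C 0 X X" for f by (rule SHomD[OF ev_SHom])
  have assoc: "(\<gamma> A B \<boxtimes> idm C D) \<cdot> g \<cdot> N \<cdot> g' = (\<gamma> A B \<boxtimes> idm C D) \<cdot> (g \<cdot> N \<cdot> g')" if "N \<in> Hom C 0 X X" for N
    using comp_assoc[OF i G(1) that] comp_assoc[OF i comp0[OF G(1) that] G(2)] by simp
  have MT: "mpow (A \<otimes> B) (cmp t (A, B)) n \<boxtimes> idm C D \<in> Hom C 0 (A \<otimes> B \<otimes> D) (A \<otimes> B \<otimes> D)"
    using tens_left[OF M, of D] by (simp only: ob_assoc)
  show "fps_nth (braid C t A B \<boxdot> \<one> D) n = fps_nth (sandwich ((\<gamma> A B \<boxtimes> idm C D) \<cdot> g) (ev (nexp (\<i> * of_real pi) p')) g') n"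
    by (simp only: stens_one_nth[OF braid_SHom] braid_nth sandwich_nth assoc[OF e] placed_nexp12
        linear_onD(2)[OF tens_linear_left[OF idm_Hom] comp0[OF gamma_Hom M]] tens_comp_left[OF M gamma_Hom]
        linear_onD(2)[OF comp_linear_right[OF i] MT])
qed

lemma placed_braid23: "\<one> A \<boxdot> braid C t B D = sandwich ((idm C A \<boxtimes> \<gamma> B D) \<cdot> g) (ev (nexp (\<i> * of_real pi) q')) g'"
proof (rule fps_ext)
  fix n
  note G = isoD[OF iso_g] and i = isoD(1)[OF iso_23] and M = mpow_Hom[OF t_Hom[of B D], of n]
  have e: "fps_nth (ev f) n \<in> Hom C 0 X X" for f by (rule SHomD[OF ev_SHom])
  have assoc: "(idm C A \<boxtimes> \<gamma> B D) \<cdot> g \<cdot> N \<cdot> g' = (idm C A \<boxtimes> \<gamma> B D) \<cdot> (g \<cdot> N \<cdot> g')" if "N \<in> Hom C 0 X X" for N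
    using comp_assoc[OF i G(1) that] comp_assoc[OF i comp0[OF G(1) that] G(2)] by simp
  have MT: "idm C A \<boxtimes> mpow (B \<otimes> D) (cmp t (B, D)) n \<in> Hom C 0 (A \<otimes> B \<otimes> D) (A \<otimes> B \<otimes> D)"
    by (rule tens_right[OF M])
  show "fps_nth (\<one> A \<boxdot> braid C t B D) n = fps_nth (sandwich ((idm C A \<boxtimes> \<gamma> B D) \<cdot> g) (ev (nexp (\<i> * of_real pi) q')) g') n"
    by (simp only: one_stens_nth[OF braid_SHom] braid_nth sandwich_nth assoc[OF e] placed_nexp23
        linear_onD(2)[OF tens_linear_right[OF idm_Hom] comp0[OF gamma_Hom M]] tens_comp_right[OF M gamma_Hom]
        linear_onD(2)[OF comp_linear_right[OF i] MT])
qed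

end

end

section \<open>The Breen polytope axiom\<close>

context braided
begin

lemma sandwich_hpow: "g \<in> Hom C 0 B D \<Longrightarrow> h \<in> Hom C 0 U A \<Longrightarrow> sandwich g (hpow n x) h = hpow n (g \<cdot> x \<cdot> h)"
  by (rule fps_ext) (simp add: sandwich_nth hpow_nth comp_zero(2) comp_zero(1))

lemma t_natural:
  assumes g: "iso g g' (A \<otimes> B) (A' \<otimes> B')" and f: "f \<in> Hom C 0 A A'" "h \<in> Hom C 0 B B'" "g = f \<boxtimes> h"
    and zero: "hty t (A, B) (A', B') (f, h) = 0"
  shows "cmp t (A', B') = g \<cdot> cmp t (A, B) \<cdot> g'"
proof -
  have "g \<cdot> cmp t (A, B) = cmp t (A', B') \<cdot> g"
    using hty_diff[OF f(1,2)] by (simp add: zero f(3) linear_on_Hom(1)[OF diff_linear])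
  then show ?thesis by (simp add: iso_cancel(2)[OF g t_Hom])
qed

text \<open>The reversal in the definition of the left pre-hexagonator is absorbed into the
  placement: conjugating a series placed at \<open>(W, V, U)\<close> by it gives the same series
  placed at \<open>(U, V, W)\<close>.\<close>

lemma hexL_eq:
  assumes prehexR: "prehexR C t W V U a = sandwich h F h'" and F: "F \<in> SHom C (-1) X X" and h: "iso h h' X (W \<otimes> V \<otimes> U)"
    and k: "iso k k' X (U \<otimes> V \<otimes> W)" and eq: "h = reversal U V W \<cdot> k"
  shows "hexL C t a U V W = sandwich (\<gamma> U (V \<otimes> W) \<cdot> k) F k'"
proof -
  note H = isoD[OF h] and K = isoD[OF k] and r = iso_reversal[of U V W] and R = isoD[OF iso_reversal[of U V W]]
  define r' where "r' = \<gamma> (V \<otimes> W) U \<cdot> (\<gamma> W V \<boxtimes> idm C U)"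
  note r = r[folded r'_def] and R = R[folded r'_def]
  have 1: "r' \<cdot> h = k" unfolding eq by (rule iso_cancel(1)[OF r K(1)])
  have "h' \<cdot> reversal U V W = h' \<cdot> (reversal U V W \<cdot> (k \<cdot> k'))"
    by (simp add: K(4) idm_right[OF R(1)])
  also have "\<dots> = h' \<cdot> h \<cdot> k'"
    unfolding eq using comp_assoc[OF R(1) K(1,2)] comp_assoc[OF H(2) comp0[OF R(1) K(1)] K(2)] by simp
  finally have 2: "h' \<cdot> reversal U V W = k'" by (simp add: H(3) idm_left[OF K(2)])
  have "prehexL C t a U V W = sandwich k F k'"
    unfolding prehexL_def revperm_eq sinv_const[OF r] prehexR
    by (simp only: const_sandwich[OF R(2) H(1) F H(2)] 1 sandwich_const[OF R(1) K(1) F H(2)] 2)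
  then show ?thesis
    unfolding hexL_def ssym_def by (simp only: const_sandwich[OF isoD(1)[OF iso_gamma_right] K(1) F K(2)])
qed

end

context hexagon_objects
begin

lemma ev_l_minus: "ev (l - q) = hpow 1 (cmp t (U, V \<otimes> W))" "ev (l - p) = hpow 1 (cmp t (U \<otimes> V, W))"
proof -
  have "ev (p + (l - p - q)) = hpow 1 (cmp t (U, V \<otimes> W))" "ev (q + (l - p - q)) = hpow 1 (cmp t (U \<otimes> V, W))"
    unfolding gev_add ev_p ev_m ev_q s12_def s13_def s23_def hpow_add strict_eqs[symmetric] by (simp_all add: t1_23_def t12_3_def)
  moreover have "p + (l - p - q) = l - q" "q + (l - p - q) = l - p" by simp_all
  ultimately show "ev (l - q) = hpow 1 (cmp t (U, V \<otimes> W))" "ev (l - p) = hpow 1 (cmp t (U \<otimes> V, W))" by simp_all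
qed

lemma good_exchange: "good (q * (l - q) - (l - q) * q)" "good (p * (l - p) - (l - p) * p)"
  and se_exchange: "se (q * (l - q) - (l - q) * q) = sR C t U V W" "se (p * (l - p) - (l - p) * p) = sL C t U V W"
proof -
  have "q * (l - q) - (l - q) * q = q * l - l * q" "p * (l - p) - (l - p) * p = p * l - l * p"
    by (simp_all add: algebra_simps)
  then show "good (q * (l - q) - (l - q) * q)" "good (p * (l - p) - (l - p) * p)"
    "se (q * (l - q) - (l - q) * q) = sR C t U V W" "se (p * (l - p) - (l - p) * p) = sL C t U V W"
    using good_p good_q se_p se_q by simp_all
qed

lemma coef_Nil: "coef p [] = 0" "coef q [] = 0" "coef (l - p) [] = 0" "coef (l - q) [] = 0"
  by (simp_all add: lin)

text \<open>The commutator is built up in two stages. The homotopy components of \<open>t\<close> at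
  powers of \<open>t\<close> give the exponential of \<open>q\<close> against \<open>l - q\<close>,
  and the exponential series of the outer braiding then turns \<open>l - q\<close> into its
  exponential.\<close>

lemma braid_hty_right:
  "braid_hty C t (U, V \<otimes> W) (U, W \<otimes> V) (\<one> U) (braid C t V W) = sandwich (reversal U V W)
     (se (nexp (\<i> * of_real pi) q * nexp (\<i> * of_real pi) (l - q) - nexp (\<i> * of_real pi) (l - q) * nexp (\<i> * of_real pi) q)) (idm C X)"
proof -
  note k = iso_23[of U V W, folded X]
  note K = isoD[OF k]
  define H where "H n = hty t (U, V \<otimes> W) (U, V \<otimes> W) (idm C U, mpow (V \<otimes> W) (cmp t (V, W)) n)" for n
  have Hom: "idm C U \<boxtimes> cmp t (V, W) \<in> Hom C 0 X X" "relR C t U V W \<in> Hom C (-1) X X" "H n \<in> Hom C (-1) X X" for n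
    unfolding X H_def by (rule tens_right[OF t_Hom] relR_Hom hty_Hom[OF idm_Hom mpow_Hom[OF t_Hom]])+
  have H: "se (q ^ n * (l - q) - (l - q) * q ^ n) = hpow (Suc n) (H n)" for n
  proof (rule se_commutator_power[OF _ Hom(1) good_exchange(1) _ Hom(2)])
    show "ev q = hpow 1 (idm C U \<boxtimes> cmp t (V, W))" by (simp add: ev_q s23_def t23_def)
    show "se (q * (l - q) - (l - q) * q) = hpow 2 (relR C t U V W)" by (simp add: se_exchange sR_def)
    show "H 0 = 0" by (simp add: H_def hty_idm)
    show "H (Suc n) = relR C t U V W \<cdot> mpow X (idm C U \<boxtimes> cmp t (V, W)) n + (idm C U \<boxtimes> cmp t (V, W)) \<cdot> H n" for n
      unfolding H_def relR_def X by (rule hty_mpow_right[OF t_Hom])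
  qed (rule Hom)
  have "exp_hty C t (U, V \<otimes> W) (U, W \<otimes> V) (\<one> U) (braid C t V W) = sandwich (idm C U \<boxtimes> \<gamma> V W)
     (se (nexp (\<i> * of_real pi) q * nexp (\<i> * of_real pi) (l - q) - nexp (\<i> * of_real pi) (l - q) * nexp (\<i> * of_real pi) q)) (idm C X)"
  proof (rule exp_hty_sandwich[OF k coef_Nil(4) good_nexp_commutator[OF coef_Nil(2) good_exchange(1)]])
    \<comment> \<open>The vanishing homotopy component makes \<open>t\<close> strictly natural at
      this symmetry.\<close>
    show "hpow 1 (cmp t (U, W \<otimes> V)) = sandwich (idm C U \<boxtimes> \<gamma> V W) (ev (l - q)) (idm C U \<boxtimes> \<gamma> W V)"
      unfolding ev_l_minus sandwich_hpow[OF K(1,2)]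
      by (subst t_natural[OF iso_23 idm_Hom gamma_Hom refl hty_gamma_right]) (rule refl)
    show "hty_series t (U, V \<otimes> W) (U, W \<otimes> V) (\<one> U) (braid C t V W) =
        sandwich (idm C U \<boxtimes> \<gamma> V W) (se (nexp (\<i> * of_real pi) q * (l - q) - (l - q) * nexp (\<i> * of_real pi) q)) (idm C X)"
    proof (rule fps_ext)
      fix n
      show "fps_nth (hty_series t (U, V \<otimes> W) (U, W \<otimes> V) (\<one> U) (braid C t V W)) n =
        fps_nth (sandwich (idm C U \<boxtimes> \<gamma> V W) (se (nexp (\<i> * of_real pi) q * (l - q) - (l - q) * nexp (\<i> * of_real pi) q)) (idm C X)) n"
        unfolding hty_series_braid_right sandwich_nth se_nexp_commutator_nth[OF coef_Nil(2) H] H_def[symmetric]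
        by (cases n) (simp_all add: comp_zero(2)[OF K(1)] comp_zero(1)[OF idm_Hom] linear_onD(2)[OF comp_linear_right[OF K(1)] Hom(3)]
            idm_right[OF Hom_closed(5)[OF comp0[OF K(1) Hom(3)]]])
    qed
  qed (simp_all add: X ev_l_minus)
  then show ?thesis
    unfolding braid_hty_def ssym_def
    by (simp only: fst_conv snd_conv const_sandwich[OF isoD(1)[OF iso_gamma_right] K(1)[unfolded X] se_SHom[unfolded X] idm_Hom] X gamma_swap_right)
qed

lemma braid_hty_left:
  "braid_hty C t (U \<otimes> V, W) (V \<otimes> U, W) (braid C t U V) (\<one> W) = sandwich (reversal U V W)
     (se (nexp (\<i> * of_real pi) p * nexp (\<i> * of_real pi) (l - p) - nexp (\<i> * of_real pi) (l - p) * nexp (\<i> * of_real pi) p)) (idm C X)"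
proof -
  note k = iso_12[of U V W, folded X]
  note K = isoD[OF k]
  define H where "H n = hty t (U \<otimes> V, W) (U \<otimes> V, W) (mpow (U \<otimes> V) (cmp t (U, V)) n, idm C W)" for n
  have X': "X = (U \<otimes> V) \<otimes> W" by (simp only: X ob_assoc)
  have Hom: "cmp t (U, V) \<boxtimes> idm C W \<in> Hom C 0 X X" "H n \<in> Hom C (-1) X X" for n
    unfolding X' H_def by (rule tens_left[OF t_Hom] hty_Hom[OF mpow_Hom[OF t_Hom] idm_Hom])+
  have L: "relL C t U V W \<in> Hom C (-1) X X" unfolding X by (rule relL_Hom)
  have H: "se (p ^ n * (l - p) - (l - p) * p ^ n) = hpow (Suc n) (H n)" for n
  proof (rule se_commutator_power[OF _ Hom(1) good_exchange(2) _ L])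
    show "ev p = hpow 1 (cmp t (U, V) \<boxtimes> idm C W)" by (simp add: ev_p s12_def t12_def)
    show "se (p * (l - p) - (l - p) * p) = hpow 2 (relL C t U V W)" by (simp add: se_exchange sL_def)
    show "H 0 = 0" by (simp add: H_def hty_idm)
    show "H (Suc n) = relL C t U V W \<cdot> mpow X (cmp t (U, V) \<boxtimes> idm C W) n + (cmp t (U, V) \<boxtimes> idm C W) \<cdot> H n" for n
      unfolding H_def relL_def X' by (rule hty_mpow_left[OF t_Hom])
  qed (rule Hom)
  have "exp_hty C t (U \<otimes> V, W) (V \<otimes> U, W) (braid C t U V) (\<one> W) = sandwich (\<gamma> U V \<boxtimes> idm C W)
     (se (nexp (\<i> * of_real pi) p * nexp (\<i> * of_real pi) (l - p) - nexp (\<i> * of_real pi) (l - p) * nexp (\<i> * of_real pi) p)) (idm C X)"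
  proof (rule exp_hty_sandwich[OF k coef_Nil(3) good_nexp_commutator[OF coef_Nil(1) good_exchange(2)]])
    show "hpow 1 (cmp t (V \<otimes> U, W)) = sandwich (\<gamma> U V \<boxtimes> idm C W) (ev (l - p)) (\<gamma> V U \<boxtimes> idm C W)"
      unfolding ev_l_minus sandwich_hpow[OF K(1,2)]
      by (subst t_natural[OF iso_tens_left[OF iso_gamma] gamma_Hom idm_Hom refl hty_gamma_left]) (rule refl)
    show "hty_series t (U \<otimes> V, W) (V \<otimes> U, W) (braid C t U V) (\<one> W) =
        sandwich (\<gamma> U V \<boxtimes> idm C W) (se (nexp (\<i> * of_real pi) p * (l - p) - (l - p) * nexp (\<i> * of_real pi) p)) (idm C X)"
    proof (rule fps_ext)
      fix n
      show "fps_nth (hty_series t (U \<otimes> V, W) (V \<otimes> U, W) (braid C t U V) (\<one> W)) n =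
        fps_nth (sandwich (\<gamma> U V \<boxtimes> idm C W) (se (nexp (\<i> * of_real pi) p * (l - p) - (l - p) * nexp (\<i> * of_real pi) p)) (idm C X)) n"
        unfolding hty_series_braid_left sandwich_nth se_nexp_commutator_nth[OF coef_Nil(1) H] H_def[symmetric]
        by (cases n) (simp_all add: comp_zero(2)[OF K(1)] comp_zero(1)[OF idm_Hom] linear_onD(2)[OF comp_linear_right[OF K(1)] Hom(2)]
            idm_right[OF Hom_closed(5)[OF comp0[OF K(1) Hom(2)]]])
    qed
  qed (simp_all add: X ob_assoc ev_l_minus)
  moreover have "\<gamma> (V \<otimes> U) W \<in> Hom C 0 (V \<otimes> U \<otimes> W) (W \<otimes> V \<otimes> U)" by (rule isoD(1)[OF iso_gamma_left])
  ultimately show ?thesis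
    unfolding braid_hty_def ssym_def
    by (simp only: fst_conv snd_conv const_sandwich[OF _ K(1) se_SHom idm_Hom] gamma_swap_left yang_baxter)
qed

lemma breen:
  assumes a: "a \<noteq> 0"
  shows "hexL C t a U W V \<odot> assoc_inv C t U W V \<odot> (\<one> U \<boxdot> braid C t V W) \<odot> assoc C t U V W
     + assoc C t W V U \<odot> braid_hty C t (U, V \<otimes> W) (U, W \<otimes> V) (\<one> U) (braid C t V W)
         \<odot> assoc C t U V W
     - assoc C t W V U \<odot> (braid C t V W \<boxdot> \<one> U) \<odot> assoc_inv C t V W U \<odot> hexL C t a U V W
     = (\<one> W \<boxdot> braid C t U V) \<odot> assoc C t W U V \<odot> hexR C t a U V W \<odot> assoc C t U V W
     - braid_hty C t (U \<otimes> V, W) (V \<otimes> U, W) (braid C t U V) (\<one> W)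
     - assoc C t W V U \<odot> hexR C t a V U W \<odot> assoc C t V U W \<odot> (braid C t U V \<boxdot> \<one> W)"
proof -
  define m where "m = l - p - q"
  define id where "id = idm C X"
  have lm: "l - p - q = m" "l - p - m = q" "l - m - q = p" "l - q - m = p" "l - m - p = q" "l - q - p = m"
    by (simp_all add: m_def)
  have lm': "l - q = p + m" "l - p = m + q"
    by (simp_all add: m_def)
  define j where "j = \<gamma> U V \<boxtimes> idm C W"
  define k where "k = idm C U \<boxtimes> \<gamma> V W"
  define g where "g = \<gamma> U (V \<otimes> W)"
  define s where "s = \<gamma> (U \<otimes> V) W"
  define \<tau> where "\<tau> = reversal U V W"
  have Hom_id: "id \<in> Hom C 0 X X" by (simp add: id_def idm_Hom)
  have jX: "j \<in> Hom C 0 X (V \<otimes> U \<otimes> W)" and kX: "k \<in> Hom C 0 X (U \<otimes> W \<otimes> V)"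
    unfolding j_def k_def X by (rule isoD(1)[OF iso_12] isoD(1)[OF iso_23])+
  have gX: "g \<in> Hom C 0 X (V \<otimes> W \<otimes> U)" and sX: "s \<in> Hom C 0 X (W \<otimes> U \<otimes> V)"
    unfolding g_def s_def X by (rule isoD(1)[OF iso_gamma_right] isoD(1)[OF iso_gamma_left])+
  have right: "j \<cdot> id = j" "k \<cdot> id = k" "g \<cdot> id = g" "s \<cdot> id = s"
    unfolding id_def by (rule idm_right[OF jX] idm_right[OF kX] idm_right[OF gX] idm_right[OF sX])+
  note P0 = placed_base[folded id_def]
  \<comment> \<open>All six orders of the objects are reached from the given one by adjacent
    transpositions, each permuting \<open>p\<close>, \<open>q\<close> and \<open>m\<close>
    accordingly. Hexagon and Yang-Baxter identities bring the composite isomorphisms into the form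
    in which the axiom contains them.\<close>
  obtain j' where P1: "placed j j' V U W p m"
    using placed_swap12[OF P0, folded j_def, unfolded right lm] by (rule that)
  obtain k' where P2: "placed k k' U W V m q"
    using placed_swap23[OF P0, folded k_def, unfolded right lm] by (rule that)
  obtain g' where P3: "placed g g' V W U q m"
    using placed_swap23[OF P1, unfolded j_def hexagon[symmetric] lm, folded g_def] by (rule that)
  obtain \<tau>' where P4: "placed \<tau> \<tau>' W V U q p"
    using placed_swap12[OF P3, unfolded g_def reversal_def[symmetric] lm, folded \<tau>_def] by (rule that)
  obtain s' where P5: "placed s s' W U V m p"
    using placed_swap12[OF P2, unfolded k_def hexagon_left[symmetric] lm, folded s_def] by (rule that)
  note i0 = placedD(1)[OF P0] and i1 = placedD(1)[OF P1] and i2 = placedD(1)[OF P2]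
    and i3 = placedD(1)[OF P3] and i4 = placedD(1)[OF P4] and i5 = placedD(1)[OF P5]
  note iX = i0[folded X]
  note h1 = isoD(2)[OF i1] and h2 = isoD(2)[OF i2] and h3 = isoD(2)[OF i3] and h4 = isoD[OF i4] and h5 = isoD(2)[OF i5]
  note \<tau> = isoD(1)[OF i4]
  note R0 = placed_prehexR[OF P0 a, unfolded lm] and R1 = placed_prehexR[OF P1 a, unfolded lm]
    and R3 = placed_prehexR[OF P3 a, unfolded lm] and R4 = placed_prehexR[OF P4 a, unfolded lm]
  \<comment> \<open>Every term of the axiom leads from the order \<open>(U, V, W)\<close> to the
    reversed one; in each, the last isomorphism collapses to the same \<tau>.\<close>
  have \<tau>_eqs: "\<gamma> U (W \<otimes> V) \<cdot> k = \<tau>" "(idm C W \<boxtimes> \<gamma> U V) \<cdot> s = \<tau>" "\<gamma> (V \<otimes> U) W \<cdot> j = \<tau>" "(\<gamma> V W \<boxtimes> idm C U) \<cdot> g = \<tau>"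
    unfolding j_def k_def s_def g_def \<tau>_def gamma_swap_right gamma_swap_left yang_baxter reversal_def[symmetric] by (rule refl)+
  have gk: "g = reversal U W V \<cdot> k"
  proof -
    have "reversal U W V \<cdot> k = (\<gamma> W V \<boxtimes> idm C U) \<cdot> (\<gamma> U (W \<otimes> V) \<cdot> k)"
      unfolding reversal_def by (rule comp_assoc[OF isoD(1)[OF iso_12] isoD(1)[OF iso_gamma_right] isoD(1)[OF i2]])
    also have "\<dots> = (\<gamma> W V \<boxtimes> idm C U) \<cdot> ((\<gamma> V W \<boxtimes> idm C U) \<cdot> g)" unfolding \<tau>_eqs ..
    also have "\<dots> = g" by (rule iso_cancel(1)[OF iso_12 isoD(1)[OF i3]])
    finally show ?thesis ..
  qed
  have \<tau>id: "\<tau> = reversal U V W \<cdot> id"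
    unfolding \<tau>_def[symmetric] id_def by (rule idm_right[OF \<tau>, symmetric])
  note hexL1 = hexL_eq[OF R3(1) se_SHom i3 i2 gk, unfolded \<tau>_eqs]
  note hexL2 = hexL_eq[OF R4(1) se_SHom i4 i0 \<tau>id, folded g_def, unfolded right]
  have hexR1: "hexR C t a U V W = sandwich s (se (nc_hexagon p q m)) id"
    unfolding hexR_def ssym_def R0(1) s_def[symmetric] const_sandwich[OF sX Hom_id se_SHom Hom_id] right ..
  have hexR2: "hexR C t a V U W = sandwich \<tau> (se (nc_hexagon p m q)) j'"
    unfolding hexR_def ssym_def R1(1) const_sandwich[OF isoD(1)[OF iso_gamma_left] isoD(1)[OF i1] se_SHom h1] \<tau>_eqs ..
  note A0 = placed_assoc[OF P0] and A1 = placed_assoc[OF P1] and A4 = placed_assoc[OF P4] and A5 = placed_assoc[OF P5]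
    and A2 = placed_assoc_inv[OF P2] and A3 = placed_assoc_inv[OF P3]
  note B1 = placed_braid23[OF P0, folded k_def, unfolded right] and B2 = placed_braid12[OF P3, unfolded \<tau>_eqs]
    and B3 = placed_braid23[OF P5, unfolded \<tau>_eqs] and B4 = placed_braid12[OF P0, folded j_def, unfolded right]
  let ?e = "nexp (\<i> * of_real pi)" and ?\<Phi> = kz_assoc and ?\<rho> = nc_hexagon
  have G1: "good (?e q * ?e (l - q) - ?e (l - q) * ?e q)" and G2: "good (?e p * ?e (l - p) - ?e (l - p) * ?e p)"
    by (rule good_commutator_nexp[OF coef_Nil(2,4) good_exchange(1)] good_commutator_nexp[OF coef_Nil(1,3) good_exchange(2)])+
  have T1: "hexL C t a U W V \<odot> assoc_inv C t U W V \<odot> (\<one> U \<boxdot> braid C t V W) \<odot> assoc C t U V W =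
      sandwich \<tau> (se (?\<rho> q m p * ?\<Phi> q m * ?e q * ?\<Phi> p q)) id"
    unfolding hexL1 A2 B1 A0 sandwich_se_ev[OF i2 \<tau> h2 R3(2)] sandwich_se_ev[OF i2 \<tau> Hom_id good_mult_right[OF R3(2)]]
    by (rule sandwich_se_ev[OF iX \<tau> Hom_id good_mult_right[OF good_mult_right[OF R3(2)]]])
  have T2: "assoc C t W V U \<odot> braid_hty C t (U, V \<otimes> W) (U, W \<otimes> V) (\<one> U) (braid C t V W) \<odot> assoc C t U V W =
      sandwich \<tau> (se (?\<Phi> q p * (?e q * ?e (l - q) - ?e (l - q) * ?e q) * ?\<Phi> p q)) id"
    unfolding A4 A0 braid_hty_right \<tau>_def[symmetric] id_def[symmetric] sandwich_ev_se[OF i4 \<tau> Hom_id G1]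
    by (rule sandwich_se_ev[OF iX \<tau> Hom_id good_mult_left[OF G1]])
  have T3: "assoc C t W V U \<odot> (braid C t V W \<boxdot> \<one> U) \<odot> assoc_inv C t V W U \<odot> hexL C t a U V W =
      sandwich \<tau> (se (?\<Phi> q p * ?e q * ?\<Phi> m q * ?\<rho> q p m)) id"
    unfolding hexL2 A3 B2 A4 sandwich_ev_ev[OF i4 \<tau> h3] sandwich_ev_ev[OF i3 \<tau> h3]
    by (rule sandwich_ev_se[OF i3 \<tau> Hom_id R4(2)])
  have T4: "(\<one> W \<boxdot> braid C t U V) \<odot> assoc C t W U V \<odot> hexR C t a U V W \<odot> assoc C t U V W =
      sandwich \<tau> (se (?e p * ?\<Phi> m p * ?\<rho> p q m * ?\<Phi> p q)) id"
    unfolding hexR1 A5 B3 A0 sandwich_ev_ev[OF i5 \<tau> h5] sandwich_ev_se[OF i5 \<tau> Hom_id R0(2)]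
    by (rule sandwich_se_ev[OF iX \<tau> Hom_id good_mult_left[OF R0(2)]])
  have T6: "assoc C t W V U \<odot> hexR C t a V U W \<odot> assoc C t V U W \<odot> (braid C t U V \<boxdot> \<one> W) =
      sandwich \<tau> (se (?\<Phi> q p * ?\<rho> p m q * ?\<Phi> p m * ?e p)) id"
    unfolding hexR2 A4 A1 B4 sandwich_ev_se[OF i4 \<tau> h1 R1(2)] sandwich_se_ev[OF i1 \<tau> h1 good_mult_left[OF R1(2)]]
    by (rule sandwich_se_ev[OF i1 \<tau> Hom_id good_mult_right[OF good_mult_left[OF R1(2)]]])
  have cancel: "?\<Phi> A B * (?\<Phi> B A * Y) = Y" for A B Y :: "'a ncs"
    using arg_cong[OF kz_assoc_inverse[of A B], of "\<lambda>Z. Z * Y"] by (simp add: mult.assoc)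
  \<comment> \<open>After expanding the hexagons, the exponentials of sums cancel against the
    commutators. Both sides become
    \<open>?\<Phi> q p * ?e q * ?\<Phi> m q * ?e m * ?\<Phi> p m * ?e p\<close> minus
    \<open>?e p * ?\<Phi> m p * ?e m * ?\<Phi> q m * ?e q * ?\<Phi> p q\<close>, the difference of
    the two sides of the Yang-Baxter equation for the braiding.\<close>
  have "?\<rho> q m p * ?\<Phi> q m * ?e q * ?\<Phi> p q + ?\<Phi> q p * (?e q * ?e (l - q) - ?e (l - q) * ?e q) * ?\<Phi> p q
      - ?\<Phi> q p * ?e q * ?\<Phi> m q * ?\<rho> q p m =
      ?e p * ?\<Phi> m p * ?\<rho> p q m * ?\<Phi> p q - (?e p * ?e (l - p) - ?e (l - p) * ?e p) - ?\<Phi> q p * ?\<rho> p m q * ?\<Phi> p m * ?e p"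
    unfolding nc_hexagon_def lm lm'
    by (simp add: distrib_left distrib_right left_diff_distrib right_diff_distrib mult.assoc cancel kz_assoc_inverse add.commute)
  then show ?thesis
    unfolding T1 T2 T3 T4 T6 braid_hty_left \<tau>_def[symmetric] id_def[symmetric]
      sandwich_add[OF \<tau> Hom_id se_SHom se_SHom, symmetric] sandwich_diff[OF \<tau> Hom_id se_SHom se_SHom, symmetric]
      gev_add[symmetric] gev_diff[symmetric] by (rule arg_cong)
qed

end

theorem mainTheorem2:
  fixes C :: "('r::comm_ring_1, 'o, 'm::ab_group_add) smc2cat" (structure)
    and t :: "('o, 'm) trans2"
    and a :: complex
    and U V W :: 'o
  assumes "symmetric_strict_monoidal C"
    and "infinitesimal_2braiding C t"
    and "strict C t"
    and "totally_symmetric C t"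
    and "coherent C t"
    and "a \<noteq> 0"
  shows
    "hexL C t a U W V \<odot> assoc_inv C t U W V \<odot> (\<one> U \<boxdot> braid C t V W) \<odot> assoc C t U V W
     + assoc C t W V U \<odot> braid_hty C t (U, V \<otimes> W) (U, W \<otimes> V) (\<one> U) (braid C t V W)
         \<odot> assoc C t U V W
     - assoc C t W V U \<odot> (braid C t V W \<boxdot> \<one> U) \<odot> assoc_inv C t V W U \<odot> hexL C t a U V W
     = (\<one> W \<boxdot> braid C t U V) \<odot> assoc C t W U V \<odot> hexR C t a U V W \<odot> assoc C t U V W
     - braid_hty C t (U \<otimes> V, W) (V \<otimes> U, W) (braid C t U V) (\<one> W)
     - assoc C t W V U \<odot> hexR C t a V U W \<odot> assoc C t V U W \<odot> (braid C t U V \<boxdot> \<one> W)"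
proof -
  interpret braided C t
    using assms(1-5) by unfold_locales (simp_all add: symmetric_strict_monoidal_def)
  obtain E S :: "letter list \<Rightarrow> 'm" and p q l where "hexagon_data C (U \<otimes> V \<otimes> W) E S t U V W p q l"
    by (rule hexagon_data_base)
  then interpret hexagon_objects C t "U \<otimes> V \<otimes> W" E S U V W p q l
    by (rule hexagon_objects.intro[OF braided_axioms])
  show ?thesis by (rule breen[OF assms(6)])
qed

end
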